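(* Assume that $\liminf_{n\to\infty}S_n=-\infty$ a.s. and $\limsup_{n\to\infty}S_n'=+\infty$ a.s., and let $\alpha=1$. Then the measure $$\pi(dx):=\Big[\big[\mathbb P(D\le x)-\mathbb P(D+A'\le x)\big]\mathbf 1(x<0)+\big[\mathbb P(A'>x)-\mathbb P(D+A'>x)\big]\mathbf 1(x\ge0)\Big]\lambda(dx)$$ is the unique (up to a constant factor) locally finite Borel measure on $\mathcal Z$ that is invariant for the chain $Y^{\updownarrow}$ of overshoots at crossings of zero by $Y$. Likewise, $\pi_1^+(dx):=\mathbf 1(x\ge0)\,\pi(dx)$ is the unique (up to a constant factor) locally finite Borel measure on $\mathcal Z$ that is invariant for the chain $Y^{\uparrow}$ of overshoots at up-crossings of zero by $Y$.
   Context: Setting. $X_1,X_1'$ are real random variables, neither a.s. equal to $0$. $(X_n)_{n\ge1}$ and $(X_n')_{n\ge1}$ are sequences of i.i.d. random variables, jointly independent; $S_n:=X_1+\dots+X_n$, $S_n':=X_1'+\dots+X_n'$. With $\alpha=1$, the switching random walk $Y=(Y_n)_{n\ge0}$ is the time-homogeneous Markov chain with transition kernel $P(x,dy)=\mathbb P(x+X_1\in dy)$ if $x\ge0$ and $P(x,dy)=\mathbb P(x+X_1'\in dy)$ if $x<0$. State space. $\mathcal Z_0:=\mathbb R$, $\mathcal Z_u:=u\mathbb Z$ for $u>0$; $d:=\max\{u\ge0:\mathbb P(X_1\in\mathcal Z_u)\,\mathbb P(X_1'\in\mathcal Z_u)=1\}$; $\mathcal Z:=\mathcal Z_d$ is the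 state space of $Y$. $\lambda$ is the Haar measure on $\mathcal Z$ normalized so that $\lambda([0,x)\cap\mathcal Z)=x$ for positive $x\in\mathcal Z$ (Lebesgue measure if $d=0$, $d$ times counting measure if $d>0$). A measure is locally finite if every point has an open neighbourhood of finite measure. $D:=S_{\gamma_-}$ with $\gamma_-:=\inf\{k\ge1:S_k\le0\}$ is the first weak descending ladder height of $S$, and $A':=S'_{\gamma_+'}$ with $\gamma_+':=\inf\{k\ge1:S_k'\ge0\}$ is the first weak ascending ladder height of $S'$; $D$ and $A'$ are independent. $Y^{\uparrow}=(Y_n^{\uparrow})_{n\ge1}$ is obtained by sampling $Y$ at the consecutive moments $k\ge1$ such that $Y_{k-1}<0$ and $Y_k\ge0$. $Y^{\updownarrow}=(Y_n^{\updownarrow})_{n\ge1}$ is obtained by sampling $Y$ at the consecutive moments $k\ge1$ such that either $Y_{k-1}<0,\ Y_k\ge0$ or $Y_{k-1}\ge0,\ Y_k<0$. These are Markov chains with transition kernels on $\mathcal Z$ given by $(x,B)\mapsto\mathbb P(Y_1^{\uparrow}\in B\mid Y_0=x)$ and $(x,B)\mapsto\mathbb P(Y_1^{\updownarrow}\in B\mid Y_0=x)$, respectively. *)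

theory Defs
  imports "HOL-Probability.Probability"
begin

definition walk :: "(nat \<Rightarrow> 'a \<Rightarrow> real) \<Rightarrow> nat \<Rightarrow> 'a \<Rightarrow> real" where
  "walk X n \<omega> = (\<Sum>k=1..n. X k \<omega>)"

text \<open>\<open>Inf {} = 0\<close> on \<^typ>\<open>nat\<close>, so the ladder heights below are \<open>0\<close> on the event that the
  ladder time is infinite.\<close>

definition weak_descending_ladder_height :: "(nat \<Rightarrow> 'a \<Rightarrow> real) \<Rightarrow> 'a \<Rightarrow> real" where
  "weak_descending_ladder_height X \<omega> = walk X (Inf {k. k \<ge> 1 \<and> walk X k \<omega> \<le> 0}) \<omega>"

definition weak_ascending_ladder_height :: "(nat \<Rightarrow> 'a \<Rightarrow> real) \<Rightarrow> 'a \<Rightarrow> real" where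
  "weak_ascending_ladder_height X \<omega> = walk X (Inf {k. k \<ge> 1 \<and> walk X k \<omega> \<ge> 0}) \<omega>"

definition lattice_set :: "real \<Rightarrow> real set" where
  "lattice_set u = (if u = 0 then UNIV else range (\<lambda>k::int. u * of_int k))"

definition lattice_span :: "'a measure \<Rightarrow> ('a \<Rightarrow> real) \<Rightarrow> ('a \<Rightarrow> real) \<Rightarrow> real" where
  "lattice_span M U U' =
     (GREATEST u. u \<ge> 0 \<and>
        \<P>(\<omega> in M. U \<omega> \<in> lattice_set u) * \<P>(\<omega> in M. U' \<omega> \<in> lattice_set u) = 1)"

definition haar :: "real \<Rightarrow> real measure" where
  "haar d = (if d = 0 then lborel else scale_measure (ennreal d) (count_space (lattice_set d)))"

definition natural_filtration :: "'b measure \<Rightarrow> (nat \<Rightarrow> 'b \<Rightarrow> real) \<Rightarrow> nat \<Rightarrow> 'b measure" where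
  "natural_filtration N Y n =
     sigma (space N) (\<Union>i\<in>{..n}. {Y i -` B \<inter> space N | B. B \<in> sets borel})"

definition markov_chain_from ::
    "real \<Rightarrow> (real \<Rightarrow> real measure) \<Rightarrow> 'b measure \<Rightarrow> (nat \<Rightarrow> 'b \<Rightarrow> real) \<Rightarrow> bool" where
  "markov_chain_from x P N Y \<longleftrightarrow>
     prob_space N \<and> (\<forall>n. Y n \<in> borel_measurable N) \<and> (AE \<omega> in N. Y 0 \<omega> = x) \<and>
     (\<forall>n. \<forall>B\<in>sets borel. AE \<omega> in N.
        real_cond_exp N (natural_filtration N Y n) (indicator {\<omega> \<in> space N. Y (Suc n) \<omega> \<in> B}) \<omega>
          = measure (P (Y n \<omega>)) B)"

definition switching_kernel ::
    "'a measure \<Rightarrow> ('a \<Rightarrow> real) \<Rightarrow> ('a \<Rightarrow> real) \<Rightarrow> real \<Rightarrow> real measure" where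
  "switching_kernel M U U' x =
     (if x \<ge> 0 then distr M borel (\<lambda>\<omega>. x + U \<omega>) else distr M borel (\<lambda>\<omega>. x + U' \<omega>))"

definition up_crossing :: "(nat \<Rightarrow> real) \<Rightarrow> nat \<Rightarrow> bool" where
  "up_crossing y k \<longleftrightarrow> k \<ge> 1 \<and> y (k - 1) < 0 \<and> y k \<ge> 0"

definition down_crossing :: "(nat \<Rightarrow> real) \<Rightarrow> nat \<Rightarrow> bool" where
  "down_crossing y k \<longleftrightarrow> k \<ge> 1 \<and> y (k - 1) \<ge> 0 \<and> y k < 0"

definition zero_crossing :: "(nat \<Rightarrow> real) \<Rightarrow> nat \<Rightarrow> bool" where
  "zero_crossing y k \<longleftrightarrow> up_crossing y k \<or> down_crossing y k"

text \<open>\<open>overshoot C y n\<close> is the value of the path \<open>y\<close> at its \<open>n\<close>-th time of type \<open>C\<close>, where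
  \<open>n \<ge> 1\<close>; it is meaningful if there are at least \<open>n\<close> such times.\<close>

definition overshoot :: "((nat \<Rightarrow> real) \<Rightarrow> nat \<Rightarrow> bool) \<Rightarrow> (nat \<Rightarrow> real) \<Rightarrow> nat \<Rightarrow> real" where
  "overshoot C y n = y (enumerate {k. C y k} (n - 1))"

text \<open>The transition kernel of the chain of overshoots, \<open>Pr x\<close> being the law under which the
  underlying chain \<open>Y\<close> starts at \<open>x\<close>. Paths without any time of type \<open>C\<close> do not contribute.\<close>

definition overshoot_kernel ::
    "((nat \<Rightarrow> real) \<Rightarrow> nat \<Rightarrow> bool) \<Rightarrow> (real \<Rightarrow> 'b measure) \<Rightarrow> (nat \<Rightarrow> 'b \<Rightarrow> real) \<Rightarrow>
     real \<Rightarrow> real set \<Rightarrow> ennreal" where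
  "overshoot_kernel C Pr Y x B =
     emeasure (Pr x) {\<omega> \<in> space (Pr x).
       (\<exists>k. C (\<lambda>n. Y n \<omega>) k) \<and> overshoot C (\<lambda>n. Y n \<omega>) 1 \<in> B}"

definition locally_finite_borel_measure_on :: "real set \<Rightarrow> real measure \<Rightarrow> bool" where
  "locally_finite_borel_measure_on Z \<nu> \<longleftrightarrow>
     sets \<nu> = sets (restrict_space borel Z) \<and>
     (\<forall>x\<in>Z. \<exists>U. openin (top_of_set Z) U \<and> x \<in> U \<and> emeasure \<nu> U < \<infinity>)"

definition invariant_measure :: "(real \<Rightarrow> real set \<Rightarrow> ennreal) \<Rightarrow> real measure \<Rightarrow> bool" where
  "invariant_measure K \<nu> \<longleftrightarrow> (\<forall>B\<in>sets \<nu>. emeasure \<nu> B = (\<integral>\<^sup>+x. K x B \<partial>\<nu>))"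

definition unique_locally_finite_invariant_measure ::
    "real set \<Rightarrow> (real \<Rightarrow> real set \<Rightarrow> ennreal) \<Rightarrow> real measure \<Rightarrow> bool" where
  "unique_locally_finite_invariant_measure Z K \<pi> \<longleftrightarrow>
     locally_finite_borel_measure_on Z \<pi> \<and> invariant_measure K \<pi> \<and>
     emeasure \<pi> (space \<pi>) \<noteq> 0 \<and>
     (\<forall>\<nu>. locally_finite_borel_measure_on Z \<nu> \<and> invariant_measure K \<nu> \<longrightarrow>
        (\<exists>c\<ge>0. \<nu> = scale_measure (ennreal c) \<pi>))"

definition overshoot_density ::
    "'a measure \<Rightarrow> ('a \<Rightarrow> real) \<Rightarrow> ('a \<Rightarrow> real) \<Rightarrow> real \<Rightarrow> real" where
  "overshoot_density M D A' x =
     (\<P>(\<omega> in M. D \<omega> \<le> x) - \<P>(\<omega> in M. D \<omega> + A' \<omega> \<le> x)) * indicator {..<0} x +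
     (\<P>(\<omega> in M. A' \<omega> > x) - \<P>(\<omega> in M. D \<omega> + A' \<omega> > x)) * indicator {0..} x"

definition overshoot_measure ::
    "'a measure \<Rightarrow> (nat \<Rightarrow> 'a \<Rightarrow> real) \<Rightarrow> (nat \<Rightarrow> 'a \<Rightarrow> real) \<Rightarrow> real measure" where
  "overshoot_measure M X X' =
     density (haar (lattice_span M (X 1) (X' 1)))
       (\<lambda>x. ennreal (overshoot_density M
          (weak_descending_ladder_height X) (weak_ascending_ladder_height X') x))"

end

theory Submission
  imports Defs
begin

text \<open>
  By the strong Markov property, an overshoot of \<open>Y\<close> depends only on the ladder heights: from \<open>x \<ge> 0\<close> the chain
  enters the negative half-line as the renewal process with step law \<open>\<delta>\<close> of \<open>D\<close> does, and from \<open>x < 0\<close> it returns as the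
  renewal process with step law \<open>\<alpha>\<close> of \<open>A'\<close>.

  Existence: let \<open>m\<^sub>+\<close> and \<open>m\<^sub>-\<close> have the densities \<open>P(A' > x)\<close> on \<open>x \<ge> 0\<close> and \<open>P(D \<le> x)\<close> on \<open>x < 0\<close>. The positive part
  \<open>\<pi>\<^sub>+\<close> of \<open>\<pi>\<close> is \<open>m\<^sub>+\<close> minus the image of \<open>m\<^sub>+\<close> under a \<open>\<delta>\<close>-step killed on the negative half-line, so \<open>m\<^sub>+\<close> is the occupation
  measure of the \<open>\<delta>\<close>-process started from \<open>\<pi>\<^sub>+\<close> and killed there; the part of \<open>m\<^sub>+\<close> that the next step throws below zero is
  \<open>\<pi>\<^sub>-\<close>. The other direction is symmetric.

  Uniqueness: given an invariant measure \<open>\<nu>\<close> on the nonnegative half-line, follow the \<open>\<delta>\<close>-process from \<open>\<nu>\<close> until it becomes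
  negative, the \<open>\<alpha>\<close>-process from there until it returns, and apply to the two occupation measures the renewal operators
  of \<open>\<alpha>\<close> and \<open>\<delta>\<close>. The sum \<open>M\<close> is a measure with \<open>M * \<delta> = M = M * \<alpha>\<close>, finite on bounded sets. By a one-sided Choquet--Deny
  theorem \<open>M\<close> is invariant under almost all translations by \<open>D\<close> and \<open>A'\<close>, hence, by maximality of the span \<open>d\<close>, a multiple
  of the Haar measure, and \<open>\<nu>\<close> is determined by \<open>M\<close>.
\<close>

section \<open>Taboo operators of a Markov kernel\<close>

text \<open>So identities are written additively, inequalities come from minimality of potentials,
  and each cancellation needs a finite term; hence the tests on functions of bounded support and the
  effort to show that the occupation measures are finite on bounded sets. \<open>M\<close> has its
  form for an algebraic reason. The upper occupation measure exceeds its image under a \<delta>-step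
  by \<nu> - \<nu> \<open>Kd\<close>. The steps commute, so applying \<open>Va\<close> leaves the
  defect \<nu> \<open>Va\<close> - \<nu> \<open>Kd\<close> \<open>Va\<close>. Splitting
  \<open>Va\<close> = \<open>Um\<close> + \<open>Ku\<close> \<open>Va\<close> at the return and
  using \<nu> = \<nu> \<open>Kd\<close> \<open>Ku\<close>, this is minus the lower occupation
  measure. The lower summand carries \<open>Vd\<close>, so its defect is plus that measure, and the
  sum has none. An \<alpha>-step is treated in the same way. One-sidedness removes the exponentials
  of the general Choquet--Deny theorem: for a nondegenerate law on a half-line, exp(s y) has mean 1
  only if s = 0. The proof works by excluding exponential growth.\<close>

abbreviation BM :: "(real \<Rightarrow> ennreal) set" where
  "BM \<equiv> borel_measurable borel"

text \<open>Finite additivity follows, by padding with zero functions.\<close>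

definition linop :: "((real \<Rightarrow> ennreal) \<Rightarrow> real \<Rightarrow> ennreal) \<Rightarrow> bool" where
  "linop \<Phi> \<longleftrightarrow> (\<forall>f\<in>BM. \<Phi> f \<in> BM) \<and>
     (\<forall>F x. (\<forall>i::nat. F i \<in> BM) \<longrightarrow> \<Phi> (\<lambda>y. \<Sum>i. F i y) x = (\<Sum>i. \<Phi> (F i) x)) \<and>
     (\<forall>c x. \<forall>f\<in>BM. \<Phi> (\<lambda>y. c * f y) x = c * \<Phi> f x)"

lemma suminf_Suc_ennreal: "(\<Sum>n. f n) = f 0 + (\<Sum>n. f (Suc n) :: ennreal)"
proof -
  have "(\<lambda>n. f (Suc n)) sums (\<Sum>n. f (Suc n))" by (rule summable_sums) simp
  then have "f sums ((\<Sum>n. f (Suc n)) + f 0)" by (rule sums_Suc)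
  then show ?thesis by (simp add: sums_iff add.commute)
qed

lemma suminf_add_ennreal: "(\<Sum>n. f n + g n) = (\<Sum>n. f n) + (\<Sum>n. g n :: ennreal)"
  by (rule suminf_add[symmetric]) auto

lemma suminf_swap_ennreal: "(\<Sum>i. \<Sum>j. f i j) = (\<Sum>j. \<Sum>i. f i j :: ennreal)"
proof -
  have "(\<Sum>i. \<Sum>j. f i j) = (\<integral>\<^sup>+i. (\<Sum>j. f i j) \<partial>count_space UNIV)"
    by (simp add: nn_integral_count_space_nat)
  also have "\<dots> = (\<Sum>j. \<integral>\<^sup>+i. f i j \<partial>count_space UNIV)"
    by (rule nn_integral_suminf) simp
  finally show ?thesis by (simp add: nn_integral_count_space_nat)
qed

lemma linop_measurable: "linop \<Phi> \<Longrightarrow> f \<in> BM \<Longrightarrow> \<Phi> f \<in> BM"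
  and linop_suminf: "linop \<Phi> \<Longrightarrow> (\<And>i. F i \<in> BM) \<Longrightarrow> \<Phi> (\<lambda>y. \<Sum>i. F i y) x = (\<Sum>i. \<Phi> (F i) x)"
  and linop_cmult: "linop \<Phi> \<Longrightarrow> f \<in> BM \<Longrightarrow> \<Phi> (\<lambda>y. c * f y) x = c * \<Phi> f x"
  by (auto simp: linop_def)

lemma linop_zero: "linop \<Phi> \<Longrightarrow> \<Phi> (\<lambda>_. 0) x = 0"
  using linop_cmult[of \<Phi> "\<lambda>_. 0" 0] by simp

lemma linop_add:
  assumes "linop \<Phi>" "f \<in> BM" "g \<in> BM"
  shows "\<Phi> (\<lambda>y. f y + g y) x = \<Phi> f x + \<Phi> g x"
proof -
  define F where "F i = (if i = 0 then f else if i = Suc 0 then g else (\<lambda>_. 0))" for i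
  have F: "F i \<in> BM" for i using assms by (auto simp: F_def)
  have "(\<Sum>i. F i y) = f y + g y" for y
    by (subst suminf_finite[of "{0, Suc 0}"]) (auto simp: F_def)
  moreover have "(\<Sum>i. \<Phi> (F i) x) = \<Phi> f x + \<Phi> g x"
    by (subst suminf_finite[of "{0, Suc 0}"]) (auto simp: F_def linop_zero[OF assms(1)])
  ultimately show ?thesis using linop_suminf[of \<Phi> F x] assms(1) F by simp
qed

lemma linop_mono:
  assumes "linop \<Phi>" "f \<in> BM" "g \<in> BM" "\<And>y. f y \<le> g y"
  shows "\<Phi> f x \<le> \<Phi> g x"
proof -
  have "\<Phi> g x = \<Phi> (\<lambda>y. f y + (g y - f y)) x"
    using assms(4) by (simp add: add_diff_inverse_ennreal)
  also have "\<dots> = \<Phi> f x + \<Phi> (\<lambda>y. g y - f y) x"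
    using assms by (intro linop_add) auto
  finally show ?thesis by simp
qed

lemma linop_sum:
  assumes "linop \<Phi>" "\<And>i::nat. F i \<in> BM"
  shows "\<Phi> (\<lambda>y. \<Sum>i<n. F i y) x = (\<Sum>i<n. \<Phi> (F i) x)"
proof (induction n)
  case (Suc n)
  have "(\<lambda>y. \<Sum>i<n. F i y) \<in> BM" using assms(2) by auto
  then show ?case using Suc assms linop_add[of \<Phi> "\<lambda>y. \<Sum>i<n. F i y" "F n" x] by simp
qed (simp add: linop_zero[OF assms(1)])

lemma linop_comp:
  assumes "linop \<Phi>" "linop \<Psi>"
  shows "linop (\<lambda>f. \<Phi> (\<Psi> f))"
  unfolding linop_def
proof (intro conjI ballI allI impI)
  show "f \<in> BM \<Longrightarrow> \<Phi> (\<Psi> f) \<in> BM" for f using assms by (simp add: linop_measurable)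
  show "\<Phi> (\<Psi> (\<lambda>y. c * f y)) x = c * \<Phi> (\<Psi> f) x" if f: "f \<in> BM" for f c x
  proof -
    have "\<Psi> (\<lambda>y. c * f y) = (\<lambda>y. c * \<Psi> f y)" using linop_cmult[OF assms(2) f] by auto
    then show ?thesis using linop_cmult[OF assms(1) linop_measurable[OF assms(2) f]] by simp
  qed
  show "\<Phi> (\<Psi> (\<lambda>y. \<Sum>i. F i y)) x = (\<Sum>i. \<Phi> (\<Psi> (F i)) x)" if "\<forall>i::nat. F i \<in> BM" for F x
  proof -
    have F: "F i \<in> BM" for i using that by simp
    have "\<Psi> (\<lambda>y. \<Sum>i. F i y) = (\<lambda>y. \<Sum>i. \<Psi> (F i) y)" using linop_suminf[OF assms(2) F] by auto
    then show ?thesis using linop_suminf[OF assms(1) linop_measurable[OF assms(2) F]] by simp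
  qed
qed

lemma linop_plus:
  assumes "linop \<Phi>" "linop \<Psi>"
  shows "linop (\<lambda>f x. \<Phi> f x + \<Psi> f x)"
  unfolding linop_def
proof (intro conjI ballI allI impI)
  show "f \<in> BM \<Longrightarrow> (\<lambda>x. \<Phi> f x + \<Psi> f x) \<in> BM" for f
    by (rule borel_measurable_add[OF linop_measurable[OF assms(1)] linop_measurable[OF assms(2)]])
  show "f \<in> BM \<Longrightarrow> \<Phi> (\<lambda>y. c * f y) x + \<Psi> (\<lambda>y. c * f y) x = c * (\<Phi> f x + \<Psi> f x)" for f c x
    by (simp add: linop_cmult assms distrib_left)
  show "\<forall>i. F i \<in> BM \<Longrightarrow> \<Phi> (\<lambda>y. \<Sum>i. F i y) x + \<Psi> (\<lambda>y. \<Sum>i. F i y) x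
      = (\<Sum>i. \<Phi> (F i) x + \<Psi> (F i) x)" for F :: "nat \<Rightarrow> real \<Rightarrow> ennreal" and x
    by (simp add: linop_suminf assms suminf_add_ennreal)
qed

lemma linop_funpow: "linop \<Phi> \<Longrightarrow> linop (\<Phi> ^^ n)"
proof (induction n)
  case (Suc n)
  then show ?case using linop_comp[of \<Phi> "\<Phi> ^^ n"] by (simp add: comp_def)
qed (simp add: linop_def)

lemma linop_potential:
  assumes "linop \<Phi>"
  shows "linop (\<lambda>f x. \<Sum>n. (\<Phi> ^^ n) f x)"
proof -
  have L: "linop (\<Phi> ^^ n)" for n using assms by (rule linop_funpow)
  show ?thesis
    unfolding linop_def
  proof (intro conjI ballI allI impI)
    fix f assume "f \<in> BM"
    then show "(\<lambda>x. \<Sum>n. (\<Phi> ^^ n) f x) \<in> BM"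
      by (intro borel_measurable_suminf_order linop_measurable[OF L])
  next
    fix F x assume "\<forall>i::nat. F i \<in> BM"
    then have "(\<Sum>n. (\<Phi> ^^ n) (\<lambda>y. \<Sum>i. F i y) x) = (\<Sum>n. \<Sum>i. (\<Phi> ^^ n) (F i) x)"
      using L by (simp add: linop_suminf)
    then show "(\<Sum>n. (\<Phi> ^^ n) (\<lambda>y. \<Sum>i. F i y) x) = (\<Sum>i. \<Sum>n. (\<Phi> ^^ n) (F i) x)"
      by (simp add: suminf_swap_ennreal[of "\<lambda>n i. (\<Phi> ^^ n) (F i) x"])
  next
    fix c x f assume "f \<in> BM"
    then show "(\<Sum>n. (\<Phi> ^^ n) (\<lambda>y. c * f y) x) = c * (\<Sum>n. (\<Phi> ^^ n) f x)"
      using L by (simp add: linop_cmult)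
  qed
qed

text \<open>Operators act on functions; this is the dual action on measures, characterised by
  \<open>nn_integral_act\<close>. It upgrades an identity tested on a small class of functions to an
  equality of measures, hence to all measurable functions.\<close>

definition act :: "real measure \<Rightarrow> ((real \<Rightarrow> ennreal) \<Rightarrow> real \<Rightarrow> ennreal) \<Rightarrow> real measure" where
  "act \<nu> \<Phi> = measure_of UNIV (sets borel) (\<lambda>B. \<integral>\<^sup>+x. \<Phi> (indicator B) x \<partial>\<nu>)"

lemma sets_act [simp, measurable_cong]: "sets (act \<nu> \<Phi>) = sets borel"
  and space_act [simp]: "space (act \<nu> \<Phi>) = UNIV"
  using sets.sigma_sets_eq[of "borel :: real measure"] by (auto simp: act_def)

lemma measurable_borel_sets: "sets \<nu> = sets borel \<Longrightarrow> f \<in> BM \<Longrightarrow> f \<in> borel_measurable \<nu>"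
  by (simp cong: measurable_cong_sets)

lemma emeasure_act:
  assumes L: "linop \<Phi>" and \<nu>: "sets \<nu> = sets borel" and B: "B \<in> sets borel"
  shows "emeasure (act \<nu> \<Phi>) B = (\<integral>\<^sup>+x. \<Phi> (indicator B) x \<partial>\<nu>)"
  unfolding act_def
proof (rule emeasure_measure_of_sigma)
  show "sigma_algebra UNIV (sets (borel::real measure))"
    using sets.sigma_algebra_axioms[of "borel::real measure"] by simp
  show "positive (sets borel) (\<lambda>B. \<integral>\<^sup>+x. \<Phi> (indicator B) x \<partial>\<nu>)"
  proof -
    have "\<Phi> (indicator {}) = (\<lambda>_. 0)" using linop_zero[OF L] by (auto simp: indicator_def[abs_def])
    then show ?thesis by (simp add: positive_def)
  qed
  show "countably_additive (sets borel) (\<lambda>B. \<integral>\<^sup>+x. \<Phi> (indicator B) x \<partial>\<nu>)"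
    unfolding countably_additive_def
  proof (intro allI impI)
    fix A :: "nat \<Rightarrow> real set"
    assume A: "range A \<subseteq> sets borel" "disjoint_family A"
    have A': "(indicator (A i) :: real \<Rightarrow> ennreal) \<in> BM" for i using A by auto
    have "(\<Sum>i. \<integral>\<^sup>+x. \<Phi> (indicator (A i)) x \<partial>\<nu>) = (\<integral>\<^sup>+x. (\<Sum>i. \<Phi> (indicator (A i)) x) \<partial>\<nu>)"
      by (intro nn_integral_suminf[symmetric] measurable_borel_sets[OF \<nu>] linop_measurable[OF L] A')
    also have "\<dots> = (\<integral>\<^sup>+x. \<Phi> (\<lambda>y. \<Sum>i. indicator (A i) y) x \<partial>\<nu>)"
      using linop_suminf[OF L A'] by simp
    also have "(\<lambda>y. \<Sum>i. indicator (A i) y :: ennreal) = indicator (\<Union>i. A i)"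
      using suminf_indicator[OF A(2)] by (auto simp: fun_eq_iff)
    finally show "(\<Sum>i. \<integral>\<^sup>+x. \<Phi> (indicator (A i)) x \<partial>\<nu>) = (\<integral>\<^sup>+x. \<Phi> (indicator (\<Union>i. A i)) x \<partial>\<nu>)" .
  qed
qed (use B in simp)

text \<open>Countable additivity is already monotone continuity: an increasing sequence consists of
  the partial sums of its increments.\<close>

lemma linop_SUP:
  assumes L: "linop \<Phi>" and U: "\<And>i. U i \<in> BM" "incseq U" "\<And>i x. U i x < top"
  shows "\<Phi> (\<lambda>y. SUP i. U i y) x = (SUP i. \<Phi> (U i) x)"
proof -
  define V where "V i = (\<lambda>y. if i = 0 then U 0 y else U i y - U (i - 1) y)" for i
  have V: "V i \<in> BM" for i using U(1) unfolding V_def by auto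
  have UV: "(\<Sum>i<Suc n. V i y) = U n y" for n y
  proof (induction n)
    case (Suc n)
    have "U n y \<le> U (Suc n) y" using U(2) by (auto simp: incseq_Suc_iff le_fun_def)
    then show ?case using Suc by (simp add: V_def add_diff_inverse_ennreal)
  qed (simp add: V_def)
  have S: "(SUP n. (\<Sum>i<n. g i)) = (SUP n. (\<Sum>i<Suc n. g i))" for g :: "nat \<Rightarrow> ennreal"
  proof (rule antisym)
    show "(SUP n. (\<Sum>i<n. g i)) \<le> (SUP n. (\<Sum>i<Suc n. g i))"
      by (intro SUP_mono) (rule_tac x = n in bexI, auto)
    show "(SUP n. (\<Sum>i<Suc n. g i)) \<le> (SUP n. (\<Sum>i<n. g i))"
      by (intro SUP_least SUP_upper) simp
  qed
  have "(SUP i. U i y) = (\<Sum>i. V i y)" for y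
    unfolding suminf_eq_SUP S by (simp only: UV)
  then have "\<Phi> (\<lambda>y. SUP i. U i y) x = (\<Sum>i. \<Phi> (V i) x)"
    using linop_suminf[OF L V] by simp
  also have "\<dots> = (SUP n. \<Phi> (\<lambda>y. \<Sum>i<Suc n. V i y) x)"
    unfolding suminf_eq_SUP S by (simp only: linop_sum[OF L V])
  finally show ?thesis by (simp only: UV)
qed

lemma nn_integral_act:
  assumes L: "linop \<Phi>" and \<nu>: "sets \<nu> = sets borel" and f: "f \<in> BM"
  shows "(\<integral>\<^sup>+x. f x \<partial>act \<nu> \<Phi>) = (\<integral>\<^sup>+x. \<Phi> f x \<partial>\<nu>)"
  using f
proof (induction rule: borel_measurable_induct)
  case (cong f g)
  then have "f = g" by auto
  then show ?case using cong by simp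
next
  case (set A)
  then show ?case using emeasure_act[OF L \<nu> set] by simp
next
  case (mult u c)
  then have "(\<integral>\<^sup>+x. c * u x \<partial>act \<nu> \<Phi>) = c * (\<integral>\<^sup>+x. u x \<partial>act \<nu> \<Phi>)"
    by (intro nn_integral_cmult) simp
  also have "\<dots> = c * (\<integral>\<^sup>+x. \<Phi> u x \<partial>\<nu>)" using mult by (simp only:)
  also have "\<dots> = (\<integral>\<^sup>+x. c * \<Phi> u x \<partial>\<nu>)"
    by (intro nn_integral_cmult[symmetric] measurable_borel_sets[OF \<nu>] linop_measurable[OF L]
        \<open>u \<in> BM\<close>)
  finally show ?case using linop_cmult[OF L mult(2)] by simp
next
  case (add u v)
  then have "(\<integral>\<^sup>+x. v x + u x \<partial>act \<nu> \<Phi>) = (\<integral>\<^sup>+x. v x \<partial>act \<nu> \<Phi>) + (\<integral>\<^sup>+x. u x \<partial>act \<nu> \<Phi>)"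
    by (intro nn_integral_add) simp_all
  also have "\<dots> = (\<integral>\<^sup>+x. \<Phi> v x \<partial>\<nu>) + (\<integral>\<^sup>+x. \<Phi> u x \<partial>\<nu>)"
    using add by (simp only:)
  also have "\<dots> = (\<integral>\<^sup>+x. \<Phi> v x + \<Phi> u x \<partial>\<nu>)"
    by (intro nn_integral_add[symmetric] measurable_borel_sets[OF \<nu>] linop_measurable[OF L]
        \<open>u \<in> BM\<close> \<open>v \<in> BM\<close>)
  finally show ?case using linop_add[OF L \<open>v \<in> BM\<close> \<open>u \<in> BM\<close>] by simp
next
  case (seq U)
  have U: "U i \<in> BM" "U i x < top" for i x using seq(1,2) by auto
  have U3: "incseq U" by (rule seq)
  have "(\<integral>\<^sup>+x. (SUP i. U i) x \<partial>act \<nu> \<Phi>) = (\<integral>\<^sup>+x. (SUP i. U i x) \<partial>act \<nu> \<Phi>)"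
    by (simp add: image_comp)
  also have "\<dots> = (SUP i. \<integral>\<^sup>+x. U i x \<partial>act \<nu> \<Phi>)"
    by (intro nn_integral_monotone_convergence_SUP U U3 measurable_borel_sets) simp
  also have "\<dots> = (SUP i. \<integral>\<^sup>+x. \<Phi> (U i) x \<partial>\<nu>)" by (intro SUP_cong refl seq)
  also have "\<dots> = (\<integral>\<^sup>+x. (SUP i. \<Phi> (U i) x) \<partial>\<nu>)"
  proof (rule nn_integral_monotone_convergence_SUP[symmetric])
    show "incseq (\<lambda>i. \<Phi> (U i))"
    proof (intro incseq_SucI le_funI linop_mono[OF L] U)
      show "U i y \<le> U (Suc i) y" for i y using U3 by (simp add: incseq_Suc_iff le_fun_def)
    qed
    show "\<Phi> (U i) \<in> borel_measurable \<nu>" for i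
      by (intro measurable_borel_sets[OF \<nu>] linop_measurable[OF L] U)
  qed
  also have "\<dots> = (\<integral>\<^sup>+x. \<Phi> (\<lambda>y. SUP i. U i y) x \<partial>\<nu>)"
    by (simp only: linop_SUP[OF L U(1) U3 U(2)])
  also have "(\<lambda>y. SUP i. U i y) = (SUP i. U i)" by (auto simp: image_comp)
  finally show ?case .
qed

section \<open>Killed kernels: one-step, potential and exit operators\<close>

definition kern :: "(real \<Rightarrow> real measure) \<Rightarrow> bool" where
  "kern \<kappa> \<longleftrightarrow> (\<forall>x. sets (\<kappa> x) = sets borel) \<and> (\<forall>f\<in>BM. (\<lambda>x. \<integral>\<^sup>+y. f y \<partial>\<kappa> x) \<in> BM)"

text \<open>One step of a chain killed on leaving \<open>S\<close>: the landing point is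
  constrained, the starting point is not inspected. With \<open>- S\<close> in place of
  \<open>S\<close> the same operator records the step that leaves \<open>S\<close>.\<close>

definition taboo ::
    "(real \<Rightarrow> real measure) \<Rightarrow> real set \<Rightarrow> (real \<Rightarrow> ennreal) \<Rightarrow> real \<Rightarrow> ennreal" where
  "taboo \<kappa> S f x = (\<integral>\<^sup>+y. f y * indicator S y \<partial>\<kappa> x)"

text \<open>The Green operator of the killed chain. Time 0 is counted, so \<open>f x\<close>
  contributes even if \<open>x\<close> is outside \<open>S\<close>.\<close>

definition pot ::
    "(real \<Rightarrow> real measure) \<Rightarrow> real set \<Rightarrow> (real \<Rightarrow> ennreal) \<Rightarrow> real \<Rightarrow> ennreal" where
  "pot \<kappa> S f x = (\<Sum>n. (taboo \<kappa> S ^^ n) f x)"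

text \<open>The expectation of \<open>f\<close> at the first position outside \<open>S\<close> at a
  time at least 1; paths that never leave contribute 0. Summing over the last time before the exit
  gives a potential followed by the exit step, so no stopping times are needed.\<close>

definition exitop ::
    "(real \<Rightarrow> real measure) \<Rightarrow> real set \<Rightarrow> (real \<Rightarrow> ennreal) \<Rightarrow> real \<Rightarrow> ennreal" where
  "exitop \<kappa> S f = pot \<kappa> S (taboo \<kappa> (- S) f)"

lemma kern_sets: "kern \<kappa> \<Longrightarrow> sets (\<kappa> x) = sets borel"
  by (simp add: kern_def)

lemma linop_taboo:
  assumes "kern \<kappa>" "S \<in> sets borel"
  shows "linop (taboo \<kappa> S)"
  unfolding linop_def
proof (intro conjI ballI allI impI)
  have m: "g \<in> BM \<Longrightarrow> g \<in> borel_measurable (\<kappa> x)" for g x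
    by (rule measurable_borel_sets[OF kern_sets[OF assms(1)]])
  fix f assume f: "f \<in> BM"
  then have f': "(\<lambda>y. f y * indicator S y) \<in> BM" using assms(2) by auto
  then show "taboo \<kappa> S f \<in> BM" unfolding taboo_def using assms(1) by (simp add: kern_def)
  show "taboo \<kappa> S (\<lambda>y. c * f y) x = c * taboo \<kappa> S f x" for c x
    unfolding taboo_def using nn_integral_cmult[OF m[OF f'], where c = c] by (simp add: mult.assoc)
next
  have m: "g \<in> BM \<Longrightarrow> g \<in> borel_measurable (\<kappa> x)" for g x
    by (rule measurable_borel_sets[OF kern_sets[OF assms(1)]])
  fix F x assume "\<forall>i::nat. F i \<in> BM"
  then have "F i \<in> BM" for i by simp
  then have "(\<lambda>y. F i y * indicator S y) \<in> BM" for i using assms(2) by auto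
  then show "taboo \<kappa> S (\<lambda>y. \<Sum>i. F i y) x = (\<Sum>i. taboo \<kappa> S (F i) x)"
    unfolding taboo_def by (subst nn_integral_suminf[symmetric]) (auto intro: m)
qed

lemma taboo_cong: "(\<And>y. y \<in> S \<Longrightarrow> f y = g y) \<Longrightarrow> taboo \<kappa> S f = taboo \<kappa> S g"
  unfolding taboo_def fun_eq_iff
  by (intro allI nn_integral_cong) (auto simp: indicator_def)

lemma taboo_split:
  assumes "kern \<kappa>" "S \<in> sets borel" "T \<in> sets borel" "f \<in> BM" "S \<subseteq> T"
  shows "taboo \<kappa> T f x = taboo \<kappa> S f x + taboo \<kappa> (T - S) f x"
proof -
  have "(\<lambda>y. f y * indicator S y) \<in> borel_measurable (\<kappa> x)"
    "(\<lambda>y. f y * indicator (T - S) y) \<in> borel_measurable (\<kappa> x)"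
    using assms by (auto intro!: measurable_borel_sets[OF kern_sets[OF assms(1)]])
  then have "taboo \<kappa> S f x + taboo \<kappa> (T - S) f x
      = (\<integral>\<^sup>+y. f y * indicator S y + f y * indicator (T - S) y \<partial>\<kappa> x)"
    unfolding taboo_def by (rule nn_integral_add[symmetric])
  also have "\<dots> = taboo \<kappa> T f x"
    unfolding taboo_def using assms(5) by (intro nn_integral_cong) (auto simp: indicator_def)
  finally show ?thesis by simp
qed

lemma linop_pot: "kern \<kappa> \<Longrightarrow> S \<in> sets borel \<Longrightarrow> linop (pot \<kappa> S)"
  unfolding pot_def[abs_def] by (intro linop_potential linop_taboo)

lemma linop_exitop: "kern \<kappa> \<Longrightarrow> S \<in> sets borel \<Longrightarrow> linop (exitop \<kappa> S)"
  unfolding exitop_def[abs_def]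
  by (rule linop_comp[OF linop_pot linop_taboo]) auto

lemma taboo_funpow_measurable:
  "kern \<kappa> \<Longrightarrow> S \<in> sets borel \<Longrightarrow> f \<in> BM \<Longrightarrow> (taboo \<kappa> S ^^ n) f \<in> BM"
  by (rule linop_measurable[OF linop_funpow[OF linop_taboo]])

definition psum where
  "psum \<kappa> S N f x = (\<Sum>n<N. (taboo \<kappa> S ^^ n) f x)"

lemma psum_measurable: "kern \<kappa> \<Longrightarrow> S \<in> sets borel \<Longrightarrow> f \<in> BM \<Longrightarrow> psum \<kappa> S N f \<in> BM"
  unfolding psum_def[abs_def]
  by (rule borel_measurable_sum) (rule taboo_funpow_measurable)

lemma psum_0 [simp]: "psum \<kappa> S 0 f x = 0"
  by (simp add: psum_def)

lemma psum_Suc: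
  assumes "kern \<kappa>" "S \<in> sets borel" "f \<in> BM"
  shows "psum \<kappa> S (Suc N) f x = f x + taboo \<kappa> S (psum \<kappa> S N f) x"
proof -
  have "taboo \<kappa> S (psum \<kappa> S N f) x = (\<Sum>n<N. taboo \<kappa> S ((taboo \<kappa> S ^^ n) f) x)"
    unfolding psum_def[abs_def]
    by (rule linop_sum[OF linop_taboo]) (rule assms taboo_funpow_measurable)+
  then show ?thesis by (simp add: psum_def sum.lessThan_Suc_shift del: sum.lessThan_Suc)
qed

lemma pot_SUP: "pot \<kappa> S f x = (SUP N. psum \<kappa> S N f x)"
  by (simp add: pot_def psum_def suminf_eq_SUP)

lemma psum_le_pot: "psum \<kappa> S N f x \<le> pot \<kappa> S f x"
  unfolding pot_SUP by (rule SUP_upper) simp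

lemma pot_leI: "(\<And>N. psum \<kappa> S N f x \<le> c) \<Longrightarrow> pot \<kappa> S f x \<le> c"
  unfolding pot_SUP by (rule SUP_least) simp

lemma pot_unfold:
  assumes "kern \<kappa>" "S \<in> sets borel" "f \<in> BM"
  shows "pot \<kappa> S f x = f x + taboo \<kappa> S (pot \<kappa> S f) x"
proof -
  have "taboo \<kappa> S (pot \<kappa> S f) x = (\<Sum>n. taboo \<kappa> S ((taboo \<kappa> S ^^ n) f) x)"
    unfolding pot_def[abs_def]
    by (rule linop_suminf[OF linop_taboo]) (rule assms taboo_funpow_measurable)+
  then show ?thesis by (simp add: pot_def suminf_Suc_ennreal[of "\<lambda>n. (taboo \<kappa> S ^^ n) f x"])
qed

lemma pot_unfold_right:
  assumes "kern \<kappa>" "S \<in> sets borel" "f \<in> BM"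
  shows "pot \<kappa> S f x = f x + pot \<kappa> S (taboo \<kappa> S f) x"
proof -
  have "(taboo \<kappa> S ^^ Suc n) f x = (taboo \<kappa> S ^^ n) (taboo \<kappa> S f) x" for n
    by (simp add: funpow_swap1)
  then show ?thesis
    unfolding pot_def by (subst suminf_Suc_ennreal) simp
qed

text \<open>Potentials are the least nonnegative solutions of g = f + (killed step of g), and this
  replaces subtraction throughout. The inequality is required only on a set \<open>T\<close>
  containing \<open>S\<close>, since a killed step sees only values on \<open>S\<close>.\<close>

lemma psum_least:
  assumes \<kappa>: "kern \<kappa>" "S \<in> sets borel" "f \<in> BM" and g: "g \<in> BM" and "S \<subseteq> T"
    and le: "\<And>x. x \<in> T \<Longrightarrow> f x + taboo \<kappa> S g x \<le> g x"
  shows "x \<in> T \<Longrightarrow> psum \<kappa> S N f x \<le> g x"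
proof (induction N arbitrary: x)
  case (Suc N)
  have "taboo \<kappa> S (psum \<kappa> S N f) x \<le> taboo \<kappa> S g x"
    unfolding taboo_def using Suc(1) \<open>S \<subseteq> T\<close>
    by (intro nn_integral_mono) (auto simp: indicator_def)
  then have "psum \<kappa> S (Suc N) f x \<le> f x + taboo \<kappa> S g x"
    by (simp add: psum_Suc[OF \<kappa>])
  also have "\<dots> \<le> g x" by (rule le[OF Suc(2)])
  finally show ?case .
qed simp

lemma pot_least:
  assumes "kern \<kappa>" "S \<in> sets borel" "f \<in> BM" "g \<in> BM" "S \<subseteq> T"
    and "\<And>x. x \<in> T \<Longrightarrow> f x + taboo \<kappa> S g x \<le> g x" and "x \<in> T"
  shows "pot \<kappa> S f x \<le> g x"
  by (rule pot_leI, rule psum_least[OF assms])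

lemma exitop_unfold:
  assumes "kern \<kappa>" "S \<in> sets borel" "f \<in> BM"
  shows "exitop \<kappa> S f x = taboo \<kappa> (- S) f x + taboo \<kappa> S (exitop \<kappa> S f) x"
  unfolding exitop_def
  by (rule pot_unfold[OF assms(1,2) linop_measurable[OF linop_taboo[OF assms(1)] assms(3)]])
     (use assms(2) in auto)

text \<open>The strong Markov property at the first exit from \<open>S\<close>: total occupation is
  that before the exit plus that of the chain restarted there. Both sides may be infinite, so both
  inequalities come from minimality: the unrestricted potential solves the equation of the potential
  in \<open>S\<close> with source f + h, and the truncated unrestricted sums stay below that
  potential.\<close>

lemma pot_exitop:
  assumes \<kappa>: "kern \<kappa>" and S: "S \<in> sets borel" and f: "f \<in> BM"
  shows "pot \<kappa> UNIV f x = pot \<kappa> S f x + exitop \<kappa> S (pot \<kappa> UNIV f) x"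
proof -
  define V where "V = pot \<kappa> UNIV f"
  have V: "V \<in> BM" unfolding V_def by (rule linop_measurable[OF linop_pot[OF \<kappa>] f]) simp
  define h where "h = taboo \<kappa> (- S) V"
  have h: "h \<in> BM" unfolding h_def by (rule linop_measurable[OF linop_taboo[OF \<kappa>] V]) (use S in simp)
  have UNIV_split: "g \<in> BM \<Longrightarrow> taboo \<kappa> UNIV g y = taboo \<kappa> S g y + taboo \<kappa> (- S) g y" for g y
    using taboo_split[OF \<kappa> S, of UNIV g y] by (simp add: Compl_eq_Diff_UNIV)
  have fh: "(\<lambda>y. f y + h y) \<in> BM" using f h by simp
  define W where "W = pot \<kappa> S (\<lambda>y. f y + h y)"
  have W: "W \<in> BM" unfolding W_def by (rule linop_measurable[OF linop_pot[OF \<kappa> S] fh])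
  have W_eq: "W y = f y + h y + taboo \<kappa> S W y" for y
    unfolding W_def by (rule pot_unfold[OF \<kappa> S fh])
  have "W x \<le> V x"
    unfolding W_def
  proof (rule pot_least[OF \<kappa> S fh V, of UNIV])
    fix y
    have "V y = f y + taboo \<kappa> UNIV V y" unfolding V_def by (rule pot_unfold[OF \<kappa> _ f]) simp
    then show "f y + h y + taboo \<kappa> S V y \<le> V y"
      using UNIV_split[OF V, of y] by (simp add: h_def ac_simps)
  qed auto
  moreover have "psum \<kappa> UNIV N f y \<le> W y" for N y
  proof (induction N arbitrary: y)
    case (Suc N)
    have m: "psum \<kappa> UNIV N f \<in> BM" using \<kappa> f by (intro psum_measurable) auto
    have "taboo \<kappa> S (psum \<kappa> UNIV N f) y \<le> taboo \<kappa> S W y"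
      by (rule linop_mono[OF linop_taboo[OF \<kappa> S] m W Suc])
    moreover have "taboo \<kappa> (- S) (psum \<kappa> UNIV N f) y \<le> h y"
      unfolding h_def using S by (intro linop_mono[OF linop_taboo[OF \<kappa>] m V]) (auto simp: V_def psum_le_pot)
    ultimately have "taboo \<kappa> S (psum \<kappa> UNIV N f) y + taboo \<kappa> (- S) (psum \<kappa> UNIV N f) y
        \<le> taboo \<kappa> S W y + h y" by (rule add_mono)
    then show ?case
      using f \<kappa> by (simp add: psum_Suc UNIV_split[OF m] W_eq[of y] add.assoc)
        (simp add: add.commute add_left_mono)
  qed simp
  then have "V x \<le> W x" unfolding V_def by (rule pot_leI)
  ultimately have "V x = W x" by (rule antisym[rotated])
  also have "W x = pot \<kappa> S f x + pot \<kappa> S h x"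
    unfolding W_def by (rule linop_add[OF linop_pot[OF \<kappa> S] f h])
  finally show ?thesis unfolding V_def h_def exitop_def .
qed

text \<open>Landing in S - S' is an exit from \<open>S'\<close> that collects \<open>h\<close>, and
  also a step inside \<open>S\<close> weighted with \<open>h\<close>; only there do the two sides
  classify the landing point differently.\<close>

lemma taboo_patch:
  assumes \<kappa>: "kern \<kappa>" and S: "S \<in> sets borel" "S' \<in> sets borel" "S' \<subseteq> S"
    and g: "g \<in> BM" "h \<in> BM"
  shows "taboo \<kappa> (- S') (\<lambda>y. g y * indicator (- S) y + h y * indicator S y) x + taboo \<kappa> S' h x
    = taboo \<kappa> (- S) g x + taboo \<kappa> S h x"
proof -
  let ?G = "\<lambda>y. g y * indicator (- S) y + h y * indicator S y :: ennreal"
  have G: "?G \<in> BM" using g S by auto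
  have "taboo \<kappa> (- S') ?G x = taboo \<kappa> (- S) ?G x + taboo \<kappa> (- S' - (- S)) ?G x"
    by (rule taboo_split[OF \<kappa> _ _ G]) (use S in auto)
  also have "taboo \<kappa> (- S) ?G = taboo \<kappa> (- S) g"
    by (rule taboo_cong) auto
  also have "- S' - (- S) = S - S'" using S(3) by auto
  also have "taboo \<kappa> (S - S') ?G = taboo \<kappa> (S - S') h"
    by (rule taboo_cong) auto
  finally show ?thesis using taboo_split[OF \<kappa> S(2,1) g(2) S(3), of x] by (simp add: ac_simps)
qed

lemma exitop_measurable: "kern \<kappa> \<Longrightarrow> S \<in> sets borel \<Longrightarrow> g \<in> BM \<Longrightarrow> exitop \<kappa> S g \<in> BM"
  by (rule linop_measurable[OF linop_exitop])

lemma taboo_measurable: "kern \<kappa> \<Longrightarrow> S \<in> sets borel \<Longrightarrow> g \<in> BM \<Longrightarrow> taboo \<kappa> S g \<in> BM"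
  by (rule linop_measurable[OF linop_taboo])

text \<open>Strong Markov property for nested sets: leaving \<open>S\<close> requires leaving the
  smaller \<open>S'\<close>; there the chain is either outside \<open>S\<close> and collects
  \<open>g\<close>, or goes on from a point of \<open>S\<close>. The converse is stated separately
  because it is needed for truncated sums.\<close>

lemma exitop_strong_ge:
  assumes \<kappa>: "kern \<kappa>" and S: "S \<in> sets borel" "S' \<in> sets borel" "S' \<subseteq> S" and g: "g \<in> BM"
  shows "exitop \<kappa> S' (\<lambda>y. g y * indicator (- S) y + exitop \<kappa> S g y * indicator S y) x
    \<le> exitop \<kappa> S g x"
proof -
  have E: "exitop \<kappa> S g \<in> BM" by (rule exitop_measurable[OF \<kappa> S(1) g])
  have G: "(\<lambda>y. g y * indicator (- S) y + exitop \<kappa> S g y * indicator S y) \<in> BM"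
    using g E S by auto
  show ?thesis
    unfolding exitop_def[of _ S']
  proof (rule pot_least[OF \<kappa> S(2) taboo_measurable[OF \<kappa> _ G] E subset_UNIV])
    fix y
    show "taboo \<kappa> (- S') (\<lambda>y. g y * indicator (- S) y + exitop \<kappa> S g y * indicator S y) y
        + taboo \<kappa> S' (exitop \<kappa> S g) y \<le> exitop \<kappa> S g y"
      unfolding taboo_patch[OF \<kappa> S g E] exitop_unfold[OF \<kappa> S(1) g, of y] by simp
  qed (use S in auto)
qed

text \<open>Leaving \<open>S'\<close> uses up at least one step, so at most \<open>N\<close> of the
  N + 1 steps remain. This loss of one step drives the induction in \<open>exitop_ladder\<close>,
  where \<open>S'\<close> changes with the current point.\<close>

lemma exitop_strong_le:
  assumes \<kappa>: "kern \<kappa>" and S: "S \<in> sets borel" "S' \<in> sets borel" "S' \<subseteq> S" and g: "g \<in> BM"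
  shows "psum \<kappa> S (Suc N) (taboo \<kappa> (- S) g) x
    \<le> exitop \<kappa> S' (\<lambda>y. g y * indicator (- S) y
        + psum \<kappa> S N (taboo \<kappa> (- S) g) y * indicator S y) x"
proof -
  define h where "h = taboo \<kappa> (- S) g"
  have h: "h \<in> BM" unfolding h_def by (rule taboo_measurable[OF \<kappa> _ g]) (use S in auto)
  define G where "G N = (\<lambda>y. g y * indicator (- S) y + psum \<kappa> S N h y * indicator S y)" for N
  have p: "psum \<kappa> S N h \<in> BM" for N by (rule psum_measurable[OF \<kappa> S(1) h])
  have G: "G N \<in> BM" for N using p g S unfolding G_def by auto
  have mono: "psum \<kappa> S N h y \<le> psum \<kappa> S (Suc N) h y" for N y by (simp add: psum_def)
  have "psum \<kappa> S (Suc N) h x \<le> exitop \<kappa> S' (G N) x"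
  proof (induction N arbitrary: x)
    case 0
    have "psum \<kappa> S (Suc 0) h x = taboo \<kappa> (- S) g x + taboo \<kappa> S (psum \<kappa> S 0 h) x"
      using psum_Suc[OF \<kappa> S(1) h, of 0 x] by (simp add: h_def)
    also have "\<dots> = taboo \<kappa> (- S') (G 0) x + taboo \<kappa> S' (psum \<kappa> S 0 h) x"
      unfolding G_def by (rule taboo_patch[OF \<kappa> S g p, symmetric])
    also have "\<dots> \<le> taboo \<kappa> (- S') (G 0) x + taboo \<kappa> S' (exitop \<kappa> S' (G 0)) x"
      by (intro add_left_mono linop_mono[OF linop_taboo[OF \<kappa> S(2)]] p exitop_measurable \<kappa> S G) simp
    finally show ?case by (simp add: exitop_unfold[OF \<kappa> S(2) G])
  next
    case (Suc N)
    have "psum \<kappa> S (Suc (Suc N)) h x = taboo \<kappa> (- S) g x + taboo \<kappa> S (psum \<kappa> S (Suc N) h) x"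
      using psum_Suc[OF \<kappa> S(1) h, of "Suc N" x] by (simp add: h_def)
    also have "\<dots> = taboo \<kappa> (- S') (G (Suc N)) x + taboo \<kappa> S' (psum \<kappa> S (Suc N) h) x"
      unfolding G_def by (rule taboo_patch[OF \<kappa> S g p, symmetric])
    also have "\<dots> \<le> taboo \<kappa> (- S') (G (Suc N)) x + taboo \<kappa> S' (exitop \<kappa> S' (G (Suc N))) x"
    proof (intro add_left_mono linop_mono[OF linop_taboo[OF \<kappa> S(2)]] p exitop_measurable \<kappa> S G)
      fix y
      have "psum \<kappa> S (Suc N) h y \<le> exitop \<kappa> S' (G N) y" by (rule Suc)
      also have "\<dots> \<le> exitop \<kappa> S' (G (Suc N)) y"
        by (rule linop_mono[OF linop_exitop[OF \<kappa> S(2)] G G])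
           (auto simp: G_def indicator_def mono)
      finally show "psum \<kappa> S (Suc N) h y \<le> exitop \<kappa> S' (G (Suc N)) y" .
    qed
    finally show ?case by (simp add: exitop_unfold[OF \<kappa> S(2) G])
  qed
  then show ?thesis by (simp add: G_def h_def)
qed

lemma taboo_kern_cong:
  "\<kappa> x = \<kappa>' x \<Longrightarrow> taboo \<kappa> S f x = taboo \<kappa>' S f x"
  by (simp add: taboo_def)

lemma pot_kern_cong:
  assumes "\<And>x. x \<in> S \<Longrightarrow> \<kappa> x = \<kappa>' x" "\<And>x. x \<in> S \<Longrightarrow> f x = f' x" "x \<in> S"
  shows "pot \<kappa> S f x = pot \<kappa>' S f' x"
proof -
  have "(taboo \<kappa> S ^^ n) f y = (taboo \<kappa>' S ^^ n) f' y" if "y \<in> S" for n y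
    using that
  proof (induction n arbitrary: y)
    case (Suc n)
    have "taboo \<kappa> S ((taboo \<kappa> S ^^ n) f) = taboo \<kappa> S ((taboo \<kappa>' S ^^ n) f')"
      by (rule taboo_cong) (rule Suc)
    then show ?case using assms(1)[OF Suc(2)] by (simp add: taboo_kern_cong[of \<kappa> y \<kappa>'])
  qed (use assms in simp)
  then show ?thesis using assms(3) by (simp add: pot_def)
qed

lemma exitop_kern_cong:
  assumes "\<And>x. x \<in> S \<Longrightarrow> \<kappa> x = \<kappa>' x" "x \<in> S"
  shows "exitop \<kappa> S f x = exitop \<kappa>' S f x"
  unfolding exitop_def
  by (rule pot_kern_cong[OF assms(1) _ assms(2)]) (auto simp: assms(1) taboo_def)

lemma taboo_cong_on:
  assumes "AE y in \<kappa> x. y \<in> Z" "\<And>y. y \<in> Z \<Longrightarrow> y \<in> S \<Longrightarrow> f y = g y"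
  shows "taboo \<kappa> S f x = taboo \<kappa> S g x"
  unfolding taboo_def
proof (rule nn_integral_cong_AE)
  show "AE y in \<kappa> x. f y * indicator S y = g y * indicator S y"
    using assms(1) by eventually_elim (auto simp: indicator_def assms(2))
qed

text \<open>\<open>Z\<close> is absorbing, so the chain started in \<open>Z\<close> never reads a
  value elsewhere. Applied with \<open>Z\<close> a lattice, or a half-line that a monotone walk
  cannot leave.\<close>

lemma pot_cong_on:
  assumes "\<And>x. x \<in> Z \<Longrightarrow> AE y in \<kappa> x. y \<in> Z" "\<And>x. x \<in> Z \<Longrightarrow> f x = g x" "x \<in> Z"
  shows "pot \<kappa> S f x = pot \<kappa> S g x"
proof -
  have "(taboo \<kappa> S ^^ n) f y = (taboo \<kappa> S ^^ n) g y" if "y \<in> Z" for n y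
    using that
  proof (induction n arbitrary: y)
    case (Suc n)
    have "taboo \<kappa> S ((taboo \<kappa> S ^^ n) f) y = taboo \<kappa> S ((taboo \<kappa> S ^^ n) g) y"
      by (rule taboo_cong_on[where Z = Z]) (auto intro: assms(1) Suc)
    then show ?case by simp
  qed (use assms in simp)
  then show ?thesis using assms(3) by (simp add: pot_def)
qed

lemma exitop_cong_on:
  assumes "\<And>x. x \<in> Z \<Longrightarrow> AE y in \<kappa> x. y \<in> Z" "\<And>x. x \<in> Z \<Longrightarrow> x \<notin> S \<Longrightarrow> f x = g x" "x \<in> Z"
  shows "exitop \<kappa> S f x = exitop \<kappa> S g x"
  unfolding exitop_def
  by (rule pot_cong_on[OF assms(1) _ assms(3)])
     (auto intro!: taboo_cong_on assms)

lemma pot_zero_fun: "pot \<kappa> S (\<lambda>_. 0) x = 0"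
proof -
  have "(taboo \<kappa> S ^^ n) (\<lambda>_. 0) = (\<lambda>_. 0)" for n
    by (induction n) (auto simp: taboo_def)
  then show ?thesis by (simp add: pot_def)
qed

lemma pot_cong: "(\<And>y. y \<in> S \<Longrightarrow> f y = g y) \<Longrightarrow> x \<in> S \<Longrightarrow> pot \<kappa> S f x = pot \<kappa> S g x"
  by (rule pot_kern_cong) auto

lemma exitop_cong: "(\<And>y. y \<notin> S \<Longrightarrow> f y = g y) \<Longrightarrow> exitop \<kappa> S f = exitop \<kappa> S g"
  unfolding exitop_def by (subst taboo_cong[of "- S" f g]) auto

lemma exitop_mono:
  assumes "kern \<kappa>" "S \<in> sets borel" "f \<in> BM" "g \<in> BM" "\<And>y. y \<notin> S \<Longrightarrow> f y \<le> g y"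
  shows "exitop \<kappa> S f x \<le> exitop \<kappa> S g x"
proof -
  have "exitop \<kappa> S (\<lambda>y. f y * indicator (- S) y) x \<le> exitop \<kappa> S (\<lambda>y. g y * indicator (- S) y) x"
    using assms by (intro linop_mono[OF linop_exitop]) (auto simp: indicator_def)
  moreover have "exitop \<kappa> S (\<lambda>y. f y * indicator (- S) y) = exitop \<kappa> S f"
    "exitop \<kappa> S (\<lambda>y. g y * indicator (- S) y) = exitop \<kappa> S g"
    by (rule exitop_cong; simp)+
  ultimately show ?thesis by simp
qed

section \<open>Kernels of random walks\<close>

definition conv :: "real measure \<Rightarrow> real \<Rightarrow> real measure" where
  "conv p x = distr p borel (\<lambda>y. x + y)"

lemma nn_integral_conv:
  "sets p = sets borel \<Longrightarrow> f \<in> BM \<Longrightarrow> (\<integral>\<^sup>+y. f y \<partial>conv p x) = (\<integral>\<^sup>+y. f (x + y) \<partial>p)"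
  unfolding conv_def by (subst nn_integral_distr) (auto cong: measurable_cong_sets)

lemma kern_conv:
  assumes "prob_space p" "sets p = sets borel"
  shows "kern (conv p)"
  unfolding kern_def
proof (intro conjI allI ballI)
  interpret prob_space p by fact
  show "sets (conv p x) = sets borel" for x by (simp add: conv_def)
  fix f assume f: "f \<in> BM"
  have "(\<lambda>(x, y). f (x + y)) \<in> borel_measurable (borel \<Otimes>\<^sub>M p)"
    using f assms(2) by (simp add: split_beta' cong: measurable_cong_sets)
  then have "(\<lambda>x. \<integral>\<^sup>+y. f (x + y) \<partial>p) \<in> BM"
    by (rule borel_measurable_nn_integral)
  then show "(\<lambda>x. \<integral>\<^sup>+y. f y \<partial>conv p x) \<in> BM"
    using nn_integral_conv[OF assms(2) f] by simp
qed

lemma taboo_conv: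
  assumes "sets p = sets borel" "f \<in> BM" "S \<in> sets borel"
  shows "taboo (conv p) S f x = (\<integral>\<^sup>+y. f (x + y) * indicator S (x + y) \<partial>p)"
  unfolding taboo_def by (rule nn_integral_conv) (use assms in auto)

lemma AE_conv:
  assumes "sets p = sets borel" "Z \<in> sets borel"
  shows "(AE y in conv p x. y \<in> Z) \<longleftrightarrow> (AE y in p. x + y \<in> Z)"
  unfolding conv_def using assms
  by (subst AE_distr_iff) (auto cong: measurable_cong_sets)

lemma pot_conv_shift:
  assumes p: "prob_space p" "sets p = sets borel" and S: "S \<in> sets borel" and f: "f \<in> BM"
  shows "pot (conv p) {z. z - a \<in> S} f (a + x) = pot (conv p) S (\<lambda>z. f (a + z)) x"
proof -
  note k = kern_conv[OF p]
  let ?T = "{z. z - a \<in> S}"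
  have T: "?T \<in> sets borel" using S measurable_sets[of "\<lambda>z. z - a" borel borel S]
    by (simp add: vimage_def)
  have f': "(\<lambda>z. f (a + z)) \<in> BM" using f by simp
  have "(taboo (conv p) ?T ^^ n) f (a + x) = (taboo (conv p) S ^^ n) (\<lambda>z. f (a + z)) x" for n
  proof (induction n arbitrary: x)
    case (Suc n)
    show ?case
      using Suc
      by (simp add: taboo_conv[OF p(2) taboo_funpow_measurable[OF k T f] T]
          taboo_conv[OF p(2) taboo_funpow_measurable[OF k S f'] S] indicator_def add.assoc
          cong: if_cong)
  qed simp
  then show ?thesis by (simp add: pot_def)
qed

lemma exitop_conv_shift:
  assumes p: "prob_space p" "sets p = sets borel" and S: "S \<in> sets borel" and f: "f \<in> BM"
  shows "exitop (conv p) {z. z - a \<in> S} f (a + x) = exitop (conv p) S (\<lambda>z. f (a + z)) x"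
proof -
  let ?T = "{z. z - a \<in> S}"
  have T: "?T \<in> sets borel" using S measurable_sets[of "\<lambda>z. z - a" borel borel S]
    by (simp add: vimage_def)
  have f': "(\<lambda>z. f (a + z)) \<in> BM" using f by simp
  have m: "taboo (conv p) (- ?T) f \<in> BM"
    by (rule taboo_measurable[OF kern_conv[OF p] _ f]) (use T in auto)
  have "taboo (conv p) (- ?T) f (a + z) = taboo (conv p) (- S) (\<lambda>z. f (a + z)) z" for z
    using T S by (simp add: taboo_conv[OF p(2) f] taboo_conv[OF p(2) f'] indicator_def add.assoc)
  then show ?thesis
    unfolding exitop_def pot_conv_shift[OF p S m] by simp
qed

text \<open>Both sides are the law of the exit position from \<open>S\<close>: a walk can only leave \<open>S\<close> while it leaves a
  translate of \<open>S0\<close>, that is, at a ladder epoch.\<close>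

lemma exitop_ladder:
  assumes p: "prob_space p" "sets p = sets borel" and q: "prob_space q" "sets q = sets borel"
    and S0: "S0 \<in> sets borel" and S: "S \<in> sets borel"
    and q_law: "\<And>f. f \<in> BM \<Longrightarrow> (\<integral>\<^sup>+y. f y \<partial>q) = exitop (conv p) S0 f 0"
    and sub: "\<And>x. x \<in> S \<Longrightarrow> {z. z - x \<in> S0} \<subseteq> S"
    and g: "g \<in> BM" and x: "x \<in> S"
  shows "exitop (conv p) S g x = exitop (conv q) S g x"
proof -
  note kp = kern_conv[OF p] and kq = kern_conv[OF q]
  define E where "E = exitop (conv p) S g"
  define F where "F = exitop (conv q) S g"
  have E: "E \<in> BM" unfolding E_def by (rule exitop_measurable[OF kp S g])
  have F: "F \<in> BM" unfolding F_def by (rule exitop_measurable[OF kq S g])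
  define patch where "patch h = (\<lambda>y. g y * indicator (- S) y + h y * indicator S y)"
    for h :: "real \<Rightarrow> ennreal"
  have patch: "patch h \<in> BM" if "h \<in> BM" for h
    using that g S unfolding patch_def by auto
  have T: "{z. z - x \<in> S0} \<in> sets borel" for x
    using S0 measurable_sets[of "\<lambda>z. z - x" borel borel S0] by (simp add: vimage_def)
  \<comment> \<open>A \<open>q\<close>-step is an exit of the \<open>p\<close>-walk from a translate
    of \<open>S0\<close>, so one step of the \<open>q\<close>-walk collects the patched function at
    that exit.\<close>
  have step: "taboo (conv q) (- S) g x + taboo (conv q) S h x
      = exitop (conv p) {z. z - x \<in> S0} (patch h) x" if h: "h \<in> BM" for h x
  proof -
    have "taboo (conv q) (- S) g x + taboo (conv q) S h x = taboo (conv q) UNIV (patch h) x"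
      using taboo_patch[OF kq S _ _ g h, of "{}" x] by (simp add: patch_def) (simp add: taboo_def)
    also have "\<dots> = (\<integral>\<^sup>+y. patch h (x + y) \<partial>q)"
      by (simp add: taboo_conv[OF q(2) patch[OF h]])
    also have "\<dots> = exitop (conv p) S0 (\<lambda>y. patch h (x + y)) 0"
      by (rule q_law) (use patch[OF h] in simp)
    also have "\<dots> = exitop (conv p) {z. z - x \<in> S0} (patch h) x"
      using exitop_conv_shift[OF p S0 patch[OF h], of x 0] by simp
    finally show ?thesis .
  qed
  have "F x \<le> E x"
    unfolding F_def exitop_def[of "conv q"]
  proof (rule pot_least[OF kq S taboo_measurable[OF kq _ g] E order_refl _ x])
    fix y assume "y \<in> S"
    then show "taboo (conv q) (- S) g y + taboo (conv q) S E y \<le> E y"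
      unfolding step[OF E] unfolding patch_def E_def
      by (intro exitop_strong_ge[OF kp S T sub g])
  qed (use S in auto)
  \<comment> \<open>Induction on the number of \<open>p\<close>-steps: one \<open>q\<close>-step
    consumes at least one of them, so \<open>N\<close> are left.\<close>
  moreover have "psum (conv p) S N (taboo (conv p) (- S) g) y \<le> F y" if "y \<in> S" for N y
    using that
  proof (induction N arbitrary: y)
    case (Suc N)
    let ?h = "psum (conv p) S N (taboo (conv p) (- S) g)"
    have h: "?h \<in> BM"
      by (rule psum_measurable[OF kp S taboo_measurable[OF kp _ g]]) (use S in auto)
    have "psum (conv p) S (Suc N) (taboo (conv p) (- S) g) y
        \<le> exitop (conv p) {z. z - y \<in> S0} (patch ?h) y"
      unfolding patch_def by (rule exitop_strong_le[OF kp S T sub[OF Suc(2)] g])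
    also have "\<dots> = taboo (conv q) (- S) g y + taboo (conv q) S ?h y"
      by (rule step[OF h, symmetric])
    also have "taboo (conv q) S ?h y \<le> taboo (conv q) S F y"
      unfolding taboo_def[of "conv q"] using Suc(1)
      by (intro nn_integral_mono) (auto simp: indicator_def simp del: of_bool_eq_iff)
    finally show ?case
      unfolding F_def exitop_unfold[OF kq S g, of y] by (simp add: add_left_mono)
  qed simp
  then have "E x \<le> F x"
    unfolding E_def exitop_def[of "conv p"] using x by (intro pot_leI)
  ultimately show ?thesis unfolding E_def F_def by simp
qed

section \<open>A one-sided Choquet--Deny theorem\<close>

text \<open>Extremal argument. Let \<open>C\<close> be the best constant with f(x + h) \<le> C f(x),
  and suppose C > 1. At a nearly extremal point the defect u(x) = C f(x) - f(x + h) is small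
  relative to \<open>f\<close>. It is harmonic too, so it stays small along a chain of jumps close
  to \<open>h\<close>, and \<open>f\<close> grows there like C' powr (k / h) with C' > 1. Averaging
  this exponential against \<open>p\<close> yields a factor q > 1 per use of harmonicity, and n uses
  give f(x) > f(x). The growth hypothesis controls \<open>f\<close> between the jump points.\<close>

lemma one_sided_harmonic_step:
  fixes f :: "real \<Rightarrow> real"
  assumes p: "prob_space p" "sets p = sets borel"
    and nonneg: "AE y in p. 0 \<le> y"
    and f0: "\<And>x. 0 \<le> f x" and fm: "f \<in> borel_measurable borel" and s: "0 \<le> s"
    and growth: "\<And>x t. 0 \<le> t \<Longrightarrow> f (x + t) \<le> exp (s * t) * f x"
    and harm: "\<And>x. (\<integral>\<^sup>+y. ennreal (f (x + y)) \<partial>p) = ennreal (f x)"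
    and h: "0 < h" and supp: "\<And>\<epsilon>. 0 < \<epsilon> \<Longrightarrow> 0 < measure p {h - \<epsilon><..h}"
  shows "f (x + h) \<le> f x"
proof (rule ccontr)
  interpret prob_space p by fact
  have sp: "space p = UNIV" using sets_eq_imp_space_eq[OF p(2)] by simp
  have mI: "g \<in> borel_measurable borel \<Longrightarrow> g \<in> borel_measurable p" for g :: "real \<Rightarrow> ennreal"
    using p(2) by (simp cong: measurable_cong_sets)
  assume "\<not> f (x + h) \<le> f x"
  then have x0: "f x < f (x + h)" by simp
  define x0 where "x0 = x"
  note x0 = x0[folded x0_def]
  define R where "R = {c. 0 \<le> c \<and> (\<forall>x. f (x + h) \<le> c * f x)}"
  define C where "C = Inf R"
  have R_ne: "exp (s * h) \<in> R" using growth[of h] h by (auto simp: R_def)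
  have R_bdd: "bdd_below R" by (auto simp: R_def intro!: bdd_belowI[of _ 0])
  have C0: "0 \<le> C"    unfolding C_def
  proof (rule cInf_greatest)
    show "R \<noteq> {}" using R_ne by blast
  qed (simp add: R_def)
  have C: "f (x + h) \<le> C * f x" for x
  proof (cases "f x = 0")
    case True
    then show ?thesis using R_ne growth[of h x] h by simp
  next
    case False
    then have "0 < f x" using f0[of x] by simp
    then have "f (x + h) / f x \<le> C"
      unfolding C_def
    proof (intro cInf_greatest)
      show "R \<noteq> {}" using R_ne by blast
      show "f (x + h) / f x \<le> c" if "c \<in> R" for c
        using that \<open>0 < f x\<close> by (simp add: R_def pos_divide_le_eq)
    qed
    then show ?thesis using \<open>0 < f x\<close> by (simp add: field_simps)
  qed
  have C1: "1 < C"
  proof (rule ccontr)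
    assume "\<not> 1 < C"
    then have "C * f x0 \<le> f x0" using f0[of x0] C0 by (intro mult_left_le_one_le) auto
    then show False using C[of x0] x0 by simp
  qed
  have near: "\<exists>x. 0 < f x \<and> C * f x - f (x + h) < e * f x" if e: "0 < e" "e \<le> C" for e
  proof -
    have "C - e \<notin> R"
      using cInf_lower[OF _ R_bdd, of "C - e"] e unfolding C_def[symmetric] by auto
    then obtain x where "f (x + h) > (C - e) * f x" using e by (auto simp: R_def not_le)
    moreover from this have "f x \<noteq> 0"
      using C[of x] f0[of "x + h"] by auto
    ultimately show ?thesis using f0[of x] by (intro exI[of _ x]) (auto simp: algebra_simps)
  qed
  \<comment> \<open>The defect of extremality: nonnegative by the choice of \<open>C\<close>, and
    harmonic because f and its translate are.\<close>
  define u where "u x = C * f x - f (x + h)" for x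
  have u0: "0 \<le> u x" for x using C[of x] by (simp add: u_def)
  have um: "u \<in> borel_measurable borel" unfolding u_def[abs_def] using fm by simp
  have u_harm: "(\<integral>\<^sup>+y. ennreal (u (x + y)) \<partial>p) = ennreal (u x)" for x
  proof -
    have "(\<integral>\<^sup>+y. ennreal (u (x + y)) \<partial>p) + ennreal (f (x + h))
        = (\<integral>\<^sup>+y. ennreal (u (x + y)) \<partial>p) + (\<integral>\<^sup>+y. ennreal (f (x + h + y)) \<partial>p)"
      by (simp add: harm)
    also have "\<dots> = (\<integral>\<^sup>+y. ennreal (u (x + y)) + ennreal (f (x + h + y)) \<partial>p)"
      using um fm by (intro nn_integral_add[symmetric] mI) simp_all
    also have "\<dots> = (\<integral>\<^sup>+y. ennreal C * ennreal (f (x + y)) \<partial>p)"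
    proof (rule nn_integral_cong)
      fix y
      show "ennreal (u (x + y)) + ennreal (f (x + h + y)) = ennreal C * ennreal (f (x + y))"
        using u0[of "x + y"] f0 C0
        by (simp add: ennreal_plus[symmetric] ennreal_mult[symmetric] del: ennreal_plus)
           (simp add: u_def add_ac)
    qed
    also have "\<dots> = ennreal C * ennreal (f x)"
      using fm by (subst nn_integral_cmult) (auto intro!: mI simp: harm)
    also have "\<dots> = ennreal (u x) + ennreal (f (x + h))"
      using u0[of x] f0 C0
      by (simp add: ennreal_plus[symmetric] ennreal_mult[symmetric] del: ennreal_plus)
         (simp add: u_def)
    finally show ?thesis by simp
  qed
  \<comment> \<open>C - \<eta> = (3 C + 1) / 4 still exceeds C' = (C + 1) / 2, and \<open>r\<close>
    is the quotient C' / (C - \<eta>) < 1. Then \<epsilon> is chosen so small that a jump missing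
    \<open>h\<close> by at most \<epsilon> costs a factor no smaller than \<open>r\<close>.\<close>
  define \<eta> where "\<eta> = (C - 1) / 4"
  have \<eta>: "0 < \<eta>" "\<eta> \<le> C" using C1 by (auto simp: \<eta>_def)
  define C' where "C' = (C + 1) / 2"
  have C': "1 < C'" using C1 by (simp add: C'_def)
  define r where "r = (2 * C + 2) / (3 * C + 1)"
  have r: "0 < r" "r < 1" using C1 by (auto simp: r_def field_simps)
  define \<epsilon> where "\<epsilon> = min (h / 2) (- ln r / (s + 1))"
  have "0 < - ln r / (s + 1)" using r s by (intro divide_pos_pos) auto
  then have \<epsilon>: "0 < \<epsilon>" "\<epsilon> < h" using h by (auto simp: \<epsilon>_def)
  have "s * \<epsilon> \<le> - ln r"
  proof -
    have "s * \<epsilon> \<le> (s + 1) * (- ln r / (s + 1))"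
      using s \<epsilon>(1) by (intro mult_mono) (auto simp: \<epsilon>_def)
    then show ?thesis using s by simp
  qed
  then have "exp (ln r) \<le> exp (- (s * \<epsilon>))" by (intro exp_le_cancel_iff[THEN iffD2]) linarith
  then have "r \<le> exp (- (s * \<epsilon>))" using r(1) by simp
  then have "r * (C - \<eta>) \<le> exp (- (s * \<epsilon>)) * (C - \<eta>)"
    using C1 by (intro mult_right_mono) (auto simp: \<eta>_def)
  moreover have "r * (C - \<eta>) = C'" using C1 by (simp add: r_def \<eta>_def C'_def field_simps)
  ultimately have C'_le: "C' \<le> exp (- (s * \<epsilon>)) * (C - \<eta>)" by simp
  define \<pi> where "\<pi> = measure p {h - \<epsilon><..h}"
  have \<pi>: "0 < \<pi>" "\<pi> \<le> 1" using supp[OF \<epsilon>(1)] prob_le_1 by (auto simp: \<pi>_def)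
  \<comment> \<open>If \<open>u\<close> exceeded u(x) / \<pi> on all of (x + h - \<epsilon>, x + h],
    the jumps into that window alone would give \<open>u\<close> a mean above u(x).\<close>
  have jump: "\<exists>k. h - \<epsilon> < k \<and> k \<le> h \<and> u (x + k) * \<pi> \<le> u x" for x
  proof (rule ccontr)
    assume "\<not> ?thesis"
    then have less: "u x < u (x + k) * \<pi>" if "k \<in> {h - \<epsilon><..h}" for k
      using that by force
    have I: "{h - \<epsilon><..h} \<in> sets p" using p(2) by simp
    define c where "c = u x / \<pi>"
    have "(\<integral>\<^sup>+y. ennreal c * indicator {h - \<epsilon><..h} y \<partial>p) < (\<integral>\<^sup>+y. ennreal (u (x + y)) \<partial>p)"
    proof (rule nn_integral_less)
      show "(\<integral>\<^sup>+y. ennreal c * indicator {h - \<epsilon><..h} y \<partial>p) \<noteq> \<infinity>"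
        using I by (simp add: nn_integral_cmult_indicator ennreal_mult_eq_top_iff)
      show "AE y in p. ennreal c * indicator {h - \<epsilon><..h} y \<le> ennreal (u (x + y))"
      proof (rule AE_I2)
        fix y
        have "c \<le> u (x + y)" if "y \<in> {h - \<epsilon><..h}"
          using less[OF that] \<pi> by (simp add: c_def pos_divide_le_eq)
        then show "ennreal c * indicator {h - \<epsilon><..h} y \<le> ennreal (u (x + y))"
          by (auto simp: indicator_def intro: ennreal_leI)
      qed
      show "\<not> (AE y in p. ennreal (u (x + y)) \<le> ennreal c * indicator {h - \<epsilon><..h} y)"
      proof
        assume "AE y in p. ennreal (u (x + y)) \<le> ennreal c * indicator {h - \<epsilon><..h} y"
        then have "AE y in p. y \<notin> {h - \<epsilon><..h}"
        proof eventually_elim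
          case (elim y)
          show ?case
          proof
            assume y: "y \<in> {h - \<epsilon><..h}"
            then have "u (x + y) \<le> c" using elim u0 \<pi> by (simp add: c_def)
            then show False using less[OF y] \<pi> by (simp add: c_def field_simps)
          qed
        qed
        then have "prob {h - \<epsilon><..h} = 0"
          using I by (subst prob_eq_0) auto
        then show False using \<pi> by (simp add: \<pi>_def)
      qed
      show "(\<lambda>y. ennreal (u (x + y))) \<in> borel_measurable p" using um by (intro mI) simp
      show "(\<lambda>y. ennreal c * indicator {h - \<epsilon><..h} y) \<in> borel_measurable p" by (intro mI) simp
    qed
    moreover have "(\<integral>\<^sup>+y. ennreal c * indicator {h - \<epsilon><..h} y \<partial>p) = ennreal (u x)"
      using I \<pi> u0[of x]
      by (simp add: nn_integral_cmult_indicator emeasure_eq_measure ennreal_mult[symmetric] c_def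
          \<pi>_def[symmetric])
    ultimately show False using u_harm by simp
  qed
  \<comment> \<open>Each jump may enlarge \<open>u\<close> by the factor 1 / \<pi>, hence the
    allowance \<pi> ^ I for \<open>I\<close> jumps, which cover a distance of at least I (h -
    \<epsilon>). The factor \<open>exp (- (s * h))\<close> pays for stopping between two jump
    points.\<close>
  have chain: "exp (- (s * h)) * C' powr (k / h) * f x \<le> f (x + k)"
    if "0 < f x" "u x \<le> \<eta> * \<pi> ^ I * f x" "0 \<le> k" "k \<le> real I * (h - \<epsilon>)" for I x k
    using that
  proof (induction I arbitrary: x k)
    case 0
    then have "k = 0" by simp
    moreover have "exp (- (s * h)) * f x \<le> f x"
      using f0[of x] s h by (intro mult_left_le_one_le) auto
    ultimately show ?case using C' by simp
  next
    case (Suc I)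
    obtain k1 where k1: "h - \<epsilon> < k1" "k1 \<le> h" "u (x + k1) * \<pi> \<le> u x" using jump by blast
    have "\<eta> * \<pi> ^ Suc I * f x \<le> \<eta> * 1 * f x"
      using \<pi> \<eta> Suc(2) by (intro mult_right_mono mult_left_mono power_le_one) auto
    then have "(C - \<eta>) * f x \<le> f (x + h)"
      using Suc(3) by (simp add: u_def algebra_simps)
    also have "f (x + h) \<le> exp (s * \<epsilon>) * f (x + k1)"
    proof -
      have "f (x + k1 + (h - k1)) \<le> exp (s * (h - k1)) * f (x + k1)" using k1 by (intro growth) simp
      also have "\<dots> \<le> exp (s * \<epsilon>) * f (x + k1)"
        using k1 s f0 by (intro mult_right_mono) (auto intro!: mult_left_mono)
      finally show ?thesis by simp
    qed
    finally have "exp (- (s * \<epsilon>)) * ((C - \<eta>) * f x) \<le> f (x + k1)"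
      by (simp add: exp_minus field_simps)
    moreover have "C' * f x \<le> exp (- (s * \<epsilon>)) * ((C - \<eta>) * f x)"
      using C'_le Suc(2) by (simp add: mult.assoc[symmetric])
    ultimately have big: "C' * f x \<le> f (x + k1)" by simp
    have "1 * f x \<le> C' * f x" using C' Suc(2) by (intro mult_right_mono) auto
    then have big1: "f x \<le> f (x + k1)" using big by linarith
    show ?case
    proof (cases "k1 \<le> k")
      case True
      have "u (x + k1) * \<pi> \<le> \<eta> * \<pi> ^ Suc I * f x" using k1(3) Suc(3) by simp
      then have "u (x + k1) \<le> \<eta> * \<pi> ^ I * f x" using \<pi> by (simp add: field_simps)
      also have "\<dots> \<le> \<eta> * \<pi> ^ I * f (x + k1)"
        using big1 \<eta> \<pi> by (intro mult_left_mono) auto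
      finally have u1: "u (x + k1) \<le> \<eta> * \<pi> ^ I * f (x + k1)" .
      have "k - k1 \<le> real I * (h - \<epsilon>)" using Suc(5) k1(1) by (simp add: algebra_simps)
      then have "exp (- (s * h)) * C' powr ((k - k1) / h) * f (x + k1) \<le> f (x + k1 + (k - k1))"
        using True u1 big1 Suc(2) by (intro Suc.IH) auto
      moreover have "exp (- (s * h)) * C' powr (k / h) * f x
          \<le> exp (- (s * h)) * C' powr ((k - k1) / h) * f (x + k1)"
      proof -
        have "C' powr (k / h) \<le> C' powr ((k - k1) / h + 1)"
          using C' k1 h by (intro powr_mono) (auto simp: field_simps)
        also have "\<dots> = C' powr ((k - k1) / h) * C'" using C' by (simp add: powr_add)
        finally have "C' powr (k / h) * f x \<le> C' powr ((k - k1) / h) * C' * f x"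
          using f0 by (intro mult_right_mono) auto
        also have "\<dots> \<le> C' powr ((k - k1) / h) * f (x + k1)"
          unfolding mult.assoc by (intro mult_left_mono big) simp
        finally have "exp (- (s * h)) * (C' powr (k / h) * f x)
            \<le> exp (- (s * h)) * (C' powr ((k - k1) / h) * f (x + k1))"
          by (rule mult_left_mono) simp
        then show ?thesis by (simp only: mult.assoc)
      qed
      ultimately have "exp (- (s * h)) * C' powr (k / h) * f x \<le> f (x + k1 + (k - k1))"
        by (rule order_trans[rotated])
      moreover have "x + k1 + (k - k1) = x + k" by simp
      ultimately show ?thesis by (simp only:)
    next
      case False
      have "f (x + k + (k1 - k)) \<le> exp (s * (k1 - k)) * f (x + k)"
        using False by (intro growth) simp
      also have "\<dots> \<le> exp (s * h) * f (x + k)"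
        using False k1 s f0 Suc(4) by (intro mult_right_mono) (auto intro!: mult_left_mono)
      finally have "exp (- (s * h)) * f (x + k1) \<le> f (x + k)"
        by (simp add: exp_minus field_simps)
      moreover have "C' powr (k / h) \<le> C' powr 1"
        using C' False k1 h by (intro powr_mono) (auto simp: field_simps)
      then have "C' powr (k / h) * f x \<le> f (x + k1)"
        using big C' f0[of x] by (intro order_trans[OF mult_right_mono big]) auto
      then have "exp (- (s * h)) * (C' powr (k / h) * f x) \<le> exp (- (s * h)) * f (x + k1)"
        by (intro mult_left_mono) auto
      ultimately show ?thesis unfolding mult.assoc by linarith
    qed
  qed
  \<comment> \<open>As C' > 1 and \<open>p\<close> charges (0, h], this multiplicative function has
    mean above 1; cutting it off at a finite \<open>L\<close> preserves that and bounds the range of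
    the steps.\<close>
  define \<phi> where "\<phi> y = C' powr (y / h)" for y
  have \<phi>m: "\<phi> \<in> borel_measurable borel" unfolding \<phi>_def[abs_def] by simp
  have \<phi>1: "1 \<le> \<phi> y" if "0 \<le> y" for y
    using C' that h unfolding \<phi>_def by (intro ge_one_powr_ge_zero) auto
  have \<phi>0: "0 < \<phi> y" for y using C' by (simp add: \<phi>_def)
  have \<phi>_add: "\<phi> (y + z) = \<phi> y * \<phi> z" for y z
    by (simp add: \<phi>_def add_divide_distrib powr_add)
  have "(\<integral>\<^sup>+y. 1 \<partial>p) < (\<integral>\<^sup>+y. ennreal (\<phi> y) \<partial>p)"
  proof (rule nn_integral_less)
    show "(\<integral>\<^sup>+y. 1 \<partial>p) \<noteq> \<infinity>" by (simp add: emeasure_space_1)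
    show "AE y in p. 1 \<le> ennreal (\<phi> y)" using nonneg by eventually_elim (simp add: \<phi>1)
    show "\<not> (AE y in p. ennreal (\<phi> y) \<le> 1)"
    proof
      assume "AE y in p. ennreal (\<phi> y) \<le> 1"
      then have "AE y in p. y \<notin> {h - h<..h}"
      proof eventually_elim
        case (elim y)
        then have "\<phi> y \<le> 1" using \<phi>0[of y] by simp
        then have "C' powr (y / h) \<le> C' powr 0" using C' by (simp add: \<phi>_def)
        then have "y / h \<le> 0" using C' by (subst (asm) powr_le_cancel_iff) auto
        then show ?case using h by (simp add: divide_le_0_iff)
      qed
      then have "prob {h - h<..h} = 0" using p(2) by (subst prob_eq_0) auto
      then show False using supp[OF h] by simp
    qed
  qed (use \<phi>m in \<open>auto intro!: mI\<close>)
  also have "(\<integral>\<^sup>+y. ennreal (\<phi> y) \<partial>p) = (\<integral>\<^sup>+y. (SUP n. ennreal (\<phi> y) * indicator {0..real n} y) \<partial>p)"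
  proof (rule nn_integral_cong_AE)
    show "AE y in p. ennreal (\<phi> y) = (SUP n. ennreal (\<phi> y) * indicator {0..real n} y)"
      using nonneg
    proof eventually_elim
      case (elim y)
      obtain n where "y \<le> real n" using real_arch_simple by blast
      then have "ennreal (\<phi> y) \<le> (SUP n. ennreal (\<phi> y) * indicator {0..real n} y)"
        using elim by (intro SUP_upper2[of n]) auto
      moreover have "(SUP n. ennreal (\<phi> y) * indicator {0..real n} y) \<le> ennreal (\<phi> y)"
        by (rule SUP_least) (simp add: indicator_def)
      ultimately show ?case by (rule antisym)
    qed
  qed
  also have "\<dots> = (SUP n. \<integral>\<^sup>+y. ennreal (\<phi> y) * indicator {0..real n} y \<partial>p)"
    using \<phi>m by (intro nn_integral_monotone_convergence_SUP mI)
      (auto simp: incseq_def le_fun_def indicator_def)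
  finally obtain L :: nat where "1 < (\<integral>\<^sup>+y. ennreal (\<phi> y) * indicator {0..real L} y \<partial>p)"
    by (auto simp: emeasure_space_1 less_SUP_iff)
  then obtain q' where q': "1 < q'" "q' < (\<integral>\<^sup>+y. ennreal (\<phi> y) * indicator {0..real L} y \<partial>p)"
    using dense by blast
  have "q' \<noteq> top" using q'(2) by auto
  then obtain q where q_q': "q' = ennreal q" and "0 \<le> q" by (cases q') auto
  then have "ennreal 1 < ennreal q" using q'(1) by simp
  then have q: "1 < q" "ennreal q = q'"
    using q_q' by (simp_all add: ennreal_less_iff del: ennreal_1)
  define c where "c = exp (- (s * h))"
  have c: "0 < c" by (simp add: c_def)
  obtain n where n: "1 < c * q ^ n"
  proof -
    obtain n where "1 / c < q ^ n" using real_arch_pow[OF q(1)] by blast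
    then show ?thesis using c that by (simp add: field_simps)
  qed
  \<comment> \<open>\<open>n\<close> steps of length at most \<open>L\<close> stay within distance
    \<open>K\<close>, and \<open>I\<close> jumps of the chain reach that far. Only now is the nearly
    extremal point chosen, with the tolerance that \<open>I\<close> jumps require.\<close>
  define K where "K = real n * real L"
  obtain I :: nat where I: "K \<le> real I * (h - \<epsilon>)"
  proof -
    obtain I :: nat where "K / (h - \<epsilon>) \<le> real I" using real_arch_simple by blast
    then show ?thesis using \<epsilon> that by (simp add: pos_divide_le_eq)
  qed
  have "\<eta> * \<pi> ^ I \<le> \<eta> * 1" using \<eta> \<pi> by (intro mult_left_mono power_le_one) auto
  then have "\<eta> * \<pi> ^ I \<le> C" using \<eta> by linarith
  moreover have "0 < \<eta> * \<pi> ^ I" using \<eta> \<pi> by simp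
  ultimately obtain x where x: "0 < f x" "u x < \<eta> * \<pi> ^ I * f x"
    using near[of "\<eta> * \<pi> ^ I"] unfolding u_def by blast
  have lower: "c * \<phi> k * f x \<le> f (x + k)" if "0 \<le> k" "k \<le> K" for k
    using chain[OF x(1) less_imp_le[OF x(2)] that(1)] that(2) I unfolding c_def \<phi>_def by simp
  have "c * q ^ j * \<phi> k * f x \<le> f (x + k)" if "0 \<le> k" "k + real j * real L \<le> K" for j k
    using that
  proof (induction j arbitrary: k)
    case (Suc j)
    define b where "b = c * q ^ j * \<phi> k * f x"
    have b: "0 \<le> b" using c q(1) \<phi>0[of k] x(1) by (simp add: b_def)
    have "ennreal (b * q) \<le> ennreal b * (\<integral>\<^sup>+y. ennreal (\<phi> y) * indicator {0..real L} y \<partial>p)"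
    proof -
      have "ennreal (b * q) = ennreal b * ennreal q" using q b by (intro ennreal_mult) auto
      moreover have "ennreal q \<le> (\<integral>\<^sup>+y. ennreal (\<phi> y) * indicator {0..real L} y \<partial>p)"
        using q'(2) q(2) by simp
      ultimately show ?thesis by (simp add: mult_left_mono)
    qed
    also have "\<dots> = (\<integral>\<^sup>+y. ennreal b * (ennreal (\<phi> y) * indicator {0..real L} y) \<partial>p)"
      using \<phi>m by (intro nn_integral_cmult[symmetric] mI) simp
    also have "\<dots> \<le> (\<integral>\<^sup>+y. ennreal (f (x + k + y)) \<partial>p)"
    proof (intro nn_integral_mono)
      fix y
      show "ennreal b * (ennreal (\<phi> y) * indicator {0..real L} y) \<le> ennreal (f (x + k + y))"
      proof (cases "y \<in> {0..real L}")
        case True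
        have "c * q ^ j * \<phi> (k + y) * f x \<le> f (x + (k + y))"
          using True Suc(2,3) by (intro Suc.IH) (auto simp: algebra_simps)
        then have "b * \<phi> y \<le> f (x + k + y)" by (simp add: b_def \<phi>_add ac_simps)
        then show ?thesis using True b \<phi>0[of y] by (simp add: ennreal_mult[symmetric] ennreal_leI)
      qed simp
    qed
    also have "\<dots> = ennreal (f (x + k))" by (rule harm)
    finally have "b * q \<le> f (x + k)" using f0 by simp
    then show ?case by (simp add: b_def ac_simps)
  qed (use lower in simp)
  from this[of 0 n] have "c * q ^ n * \<phi> 0 * f x \<le> f x" by (simp add: K_def)
  moreover have "\<phi> 0 = 1" using C' by (simp add: \<phi>_def)
  ultimately have "c * q ^ n * f x \<le> f x" by simp
  moreover have "1 * f x < c * q ^ n * f x" using n x(1) by (intro mult_strict_right_mono)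
  ultimately show False by simp
qed

definition bdd_finite :: "real measure \<Rightarrow> bool" where
  "bdd_finite M \<longleftrightarrow> sets M = sets borel \<and> (\<forall>a b. emeasure M {a..b} < top)"

lemma bdd_finite_sigma_finite:
  assumes "bdd_finite M"
  shows "sigma_finite_measure M"
proof
  have s: "space M = UNIV" using sets_eq_imp_space_eq[of M borel] assms by (simp add: bdd_finite_def)
  have "\<exists>n::nat. x \<in> {- real n..real n}" for x :: real
  proof -
    obtain n where "\<bar>x\<bar> \<le> real n" using real_arch_simple by blast
    then show ?thesis by (intro exI[of _ n]) auto
  qed
  then have "(\<Union>n::nat. {- real n..real n}) = UNIV" by blast
  then show "\<exists>A::real set set. countable A \<and> A \<subseteq> sets M \<and> \<Union> A = space M \<and> (\<forall>a\<in>A. emeasure M a \<noteq> \<infinity>)"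
    using assms s
    by (intro exI[of _ "range (\<lambda>n::nat. {- real n..real n})"]) (auto simp: bdd_finite_def less_top[symmetric])
qed

text \<open>For fixed q, the points h > q with no mass in (q, h] form an interval starting at q. It
  is null because it has a largest point, or else because countably many uncharged intervals with
  rational right end cover it. A point with an uncharged left neighbourhood lies in such a set for
  some rational q.\<close>

lemma AE_left_support:
  fixes p :: "real measure"
  assumes p: "prob_space p" "sets p = sets borel"
  shows "AE h in p. \<forall>\<epsilon>>0. 0 < measure p {h - \<epsilon><..h}"
proof -
  interpret prob_space p by fact
  define B where "B q = {h. q < h \<and> measure p {q<..h} = 0}" for q
  have null: "{q<..h} \<in> null_sets p" if "h \<in> B q" for q h
    using that p(2) by (auto simp: B_def null_sets_def emeasure_eq_measure)
  have "\<exists>N\<in>null_sets p. B q \<subseteq> N" for q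
  proof -
    define A where "A = (\<Union>r\<in>{r\<in>\<rat>. r \<in> B q}. {q<..r})"
    have A: "A \<in> null_sets p"
      unfolding A_def using countable_rat by (intro null_sets_UN') (auto intro: null countable_subset)
    show ?thesis
    proof (cases "\<exists>m\<in>B q. \<forall>h\<in>B q. h \<le> m")
      case True
      then obtain m where m: "m \<in> B q" "\<forall>h\<in>B q. h \<le> m" by blast
      then have "B q \<subseteq> {q<..m}" by (auto simp: B_def)
      then show ?thesis using null[OF m(1)] by blast
    next
      case False
      have "h \<in> A" if h: "h \<in> B q" for h
      proof -
        obtain h' where h': "h' \<in> B q" "h < h'" using False h by force
        obtain r where r: "r \<in> \<rat>" "h < r" "r < h'" using Rats_dense_in_real[OF h'(2)] by blast
        have "measure p {q<..r} \<le> measure p {q<..h'}"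
          using r p(2) by (intro finite_measure_mono) auto
        then have "r \<in> B q" using h h' r by (auto simp: B_def measure_le_0_iff)
        then show ?thesis using r h unfolding A_def by (auto simp: B_def intro!: bexI[of _ r])
      qed
      then show ?thesis using A by blast
    qed
  qed
  then have "\<forall>q. \<exists>N. N \<in> null_sets p \<and> B q \<subseteq> N" by blast
  then obtain N where N: "\<And>q. N q \<in> null_sets p" "\<And>q. B q \<subseteq> N q" by metis
  have "(\<Union>q\<in>\<rat>. N q) \<in> null_sets p"
    using countable_rat by (intro null_sets_UN' N)
  then have "AE h in p. h \<notin> (\<Union>q\<in>\<rat>. N q)" by (rule AE_not_in)
  then show ?thesis
  proof eventually_elim
    case (elim h)
    show ?case
    proof (intro allI impI)
      fix \<epsilon> :: real assume "0 < \<epsilon>"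
      then obtain q where q: "q \<in> \<rat>" "h - \<epsilon> < q" "q < h" using Rats_dense_in_real[of "h - \<epsilon>" h] by auto
      have "h \<notin> B q" using elim q(1) N(2) by blast
      then have "0 < measure p {q<..h}" using q by (auto simp: B_def zero_less_measure_iff)
      also have "\<dots> \<le> measure p {h - \<epsilon><..h}" using q p(2) by (intro finite_measure_mono) auto
      finally show "0 < measure p {h - \<epsilon><..h}" .
    qed
  qed
qed

text \<open>\<open>one_sided_harmonic_step\<close> gives f(x + h) \<le> f(x) for almost every step
  h, while the mean of f(x + h) is f(x); so equality holds almost surely.\<close>

lemma one_sided_harmonic:
  fixes f :: "real \<Rightarrow> real"
  assumes p: "prob_space p" "sets p = sets borel" and nonneg: "AE y in p. 0 \<le> y"
    and f0: "\<And>x. 0 \<le> f x" and fm: "f \<in> borel_measurable borel" and s: "0 \<le> s"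
    and growth: "\<And>x t. 0 \<le> t \<Longrightarrow> f (x + t) \<le> exp (s * t) * f x"
    and harm: "\<And>x. (\<integral>\<^sup>+y. ennreal (f (x + y)) \<partial>p) = ennreal (f x)"
  shows "AE h in p. f (x + h) = f x"
proof -
  interpret prob_space p by fact
  have mI: "g \<in> borel_measurable borel \<Longrightarrow> g \<in> borel_measurable p" for g :: "real \<Rightarrow> ennreal"
    using p(2) by (simp cong: measurable_cong_sets)
  have le: "AE h in p. f (x + h) \<le> f x"
    using AE_left_support[OF p] nonneg
  proof eventually_elim
    case (elim h)
    show ?case
    proof (cases "h = 0")
      case False
      then show ?thesis using elim
        by (intro one_sided_harmonic_step[OF p nonneg f0 fm s _ harm]) (auto intro: growth)
    qed simp
  qed
  show ?thesis
  proof (rule ccontr)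
    assume neg: "\<not> (AE h in p. f (x + h) = f x)"
    have "(\<integral>\<^sup>+h. ennreal (f (x + h)) \<partial>p) < (\<integral>\<^sup>+h. ennreal (f x) \<partial>p)"
    proof (rule nn_integral_less)
      show "(\<integral>\<^sup>+h. ennreal (f (x + h)) \<partial>p) \<noteq> \<infinity>" by (simp add: harm)
      show "AE h in p. ennreal (f (x + h)) \<le> ennreal (f x)"
        using le by eventually_elim (simp add: ennreal_leI)
      show "\<not> (AE h in p. ennreal (f x) \<le> ennreal (f (x + h)))"
      proof
        assume "AE h in p. ennreal (f x) \<le> ennreal (f (x + h))"
        with le have "AE h in p. f (x + h) = f x"
          by eventually_elim (simp add: f0)
        then show False using neg by simp
      qed
    qed (use fm in \<open>auto intro!: mI\<close>)
    then show False by (simp add: harm emeasure_space_1)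
  qed
qed

text \<open>Mass can pile up towards minus infinity at most exponentially: a fraction \<pi> of the
  mass of [x - a, x) is carried by jumps in [a, b] into [x, x + b), and invariance bounds the
  arriving mass. So lengthening a window by \<open>a\<close> multiplies its mass by at most K = 1 +
  1 / \<pi>.\<close>

lemma bdd_finite_exp_growth:
  assumes M: "bdd_finite M" and p: "prob_space p" "sets p = sets borel" and nonneg: "AE y in p. 0 \<le> y"
    and inv: "\<And>g. g \<in> borel_measurable borel \<Longrightarrow> (\<integral>\<^sup>+z. (\<integral>\<^sup>+y. g (z + y) \<partial>p) \<partial>M) = (\<integral>\<^sup>+z. g z \<partial>M)"
    and nontriv: "\<not> (AE y in p. y = 0)"
  shows "\<exists>s\<ge>0. \<forall>c. (\<integral>\<^sup>+z. ennreal (exp (s * (z - c))) * indicator {..c} z \<partial>M) < top"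
proof -
  interpret prob_space p by fact
  have sM: "sets M = sets borel" and fin: "emeasure M {a..b} < top" for a b
    using M by (auto simp: bdd_finite_def)
  have spM: "space M = UNIV" using sets_eq_imp_space_eq[OF sM] by simp
  have "\<exists>n::nat. prob {1 / Suc n..Suc n} \<noteq> 0"
  proof (rule ccontr)
    assume "\<not> ?thesis"
    then have "{1 / Suc n..Suc n} \<in> null_sets p" for n :: nat
      using p(2) by (auto simp: null_sets_def emeasure_eq_measure)
    then have "(\<Union>n::nat. {1 / Suc n..real (Suc n)}) \<in> null_sets p" by auto
    then have "AE y in p. y \<notin> (\<Union>n::nat. {1 / Suc n..real (Suc n)})" by (rule AE_not_in)
    with nonneg have "AE y in p. y = 0"
    proof eventually_elim
      case (elim y)
      show ?case
      proof (rule ccontr)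
        assume "y \<noteq> 0"
        then have "0 < y" using elim by simp
        obtain n1 where n1: "y \<le> real n1" using real_arch_simple by blast
        obtain n2 where n2: "1 / y \<le> real n2" using real_arch_simple by blast
        let ?n = "max n1 n2"
        have "1 / y \<le> real (Suc ?n)" "y \<le> real (Suc ?n)" using n1 n2 by auto
        then have "1 / real (Suc ?n) \<le> y" using \<open>0 < y\<close> by (simp add: field_simps)
        then have "y \<in> {1 / real (Suc ?n)..real (Suc ?n)}" using \<open>y \<le> real (Suc ?n)\<close> by simp
        then show False using elim(2) by blast
      qed
    qed
    then show False using nontriv by simp
  qed
  then obtain n :: nat where n: "0 < prob {1 / Suc n..Suc n}" by (auto simp: zero_less_measure_iff)
  define a b :: real where "a = 1 / Suc n" and "b = Suc n"
  define \<pi> where "\<pi> = prob {a..b}"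
  have ab: "0 < a" "a \<le> b" and \<pi>: "0 < \<pi>" using n by (auto simp: a_def b_def \<pi>_def field_simps)
  define K where "K = 1 + 1 / \<pi>"
  have K: "1 < K" using \<pi> by (simp add: K_def)
  have step: "emeasure M {x - a..<x} * ennreal \<pi> \<le> emeasure M {x..<x + b}" for x
  proof -
    have "emeasure M {x - a..<x} * ennreal \<pi>
        = (\<integral>\<^sup>+z. ennreal \<pi> * indicator {x - a..<x} z \<partial>M)"
      using sM by (simp add: nn_integral_cmult_indicator mult.commute)
    also have "\<dots> \<le> (\<integral>\<^sup>+z. (\<integral>\<^sup>+y. indicator {x..<x + b} (z + y) \<partial>p) \<partial>M)"
    proof (rule nn_integral_mono)
      fix z
      show "ennreal \<pi> * indicator {x - a..<x} z \<le> (\<integral>\<^sup>+y. indicator {x..<x + b} (z + y) \<partial>p)"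
      proof (cases "z \<in> {x - a..<x}")
        case True
        have "ennreal \<pi> = (\<integral>\<^sup>+y. indicator {a..b} y \<partial>p)"
          using p(2) by (simp add: \<pi>_def emeasure_eq_measure)
        also have "\<dots> \<le> (\<integral>\<^sup>+y. indicator {x..<x + b} (z + y) \<partial>p)"
          using True by (intro nn_integral_mono) (auto simp: indicator_def)
        finally show ?thesis using True by simp
      qed simp
    qed
    also have "\<dots> = emeasure M {x..<x + b}"
      using sM by (subst inv) auto
    finally show ?thesis .
  qed
  have "\<exists>s\<ge>0. \<forall>c. (\<integral>\<^sup>+z. ennreal (exp (s * (z - c))) * indicator {..c} z \<partial>M) < top"
  proof (intro exI conjI allI)
    \<comment> \<open>Decay by 2 K against growth by \<open>K\<close> per length \<open>a\<close>
      leaves a geometric series of ratio 1 / 2.\<close>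
    show "0 \<le> ln (2 * K) / a" using K ab by simp
    fix c
    define s where "s = ln (2 * K) / a"
    have s: "0 \<le> s" "s * a = ln (2 * K)" using K ab by (auto simp: s_def)
    define G where "G x = emeasure M {x..c}" for x
    have G: "G (x - a) \<le> ennreal K * G x" if "x \<le> c - b" for x
    proof -
      have "emeasure M {x - a..<x} * ennreal \<pi> \<le> G x"
        using step[of x] that by (intro order_trans[OF step]) (auto simp: G_def sM intro!: emeasure_mono)
      then have "emeasure M {x - a..<x} * ennreal \<pi> * ennreal (1 / \<pi>) \<le> G x * ennreal (1 / \<pi>)"
        by (rule mult_right_mono) simp
      then have "emeasure M {x - a..<x} \<le> G x * ennreal (1 / \<pi>)"
        using \<pi> by (simp add: mult.assoc ennreal_mult[symmetric])
      moreover have "G (x - a) = emeasure M {x - a..<x} + G x"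
        unfolding G_def using ab that
        by (subst plus_emeasure) (auto simp: sM intro!: arg_cong[of _ _ "emeasure M"])
      ultimately have "G (x - a) \<le> G x * ennreal (1 / \<pi>) + G x" by (simp add: add_right_mono)
      also have "\<dots> = ennreal K * G x"
      proof -
        have "ennreal K = ennreal (1 / \<pi>) + 1"
          using \<pi> by (simp add: K_def add.commute)
        then show ?thesis by (simp add: distrib_left mult.commute)
      qed
      finally show ?thesis .
    qed
    have Gn: "G (c - b - real n * a) \<le> ennreal (K ^ n) * G (c - b)" for n
    proof (induction n)
      case (Suc n)
      have "G (c - b - real (Suc n) * a) = G (c - b - real n * a - a)" by (simp add: algebra_simps)
      also have "\<dots> \<le> ennreal K * G (c - b - real n * a)" using ab by (intro G) simp
      also have "\<dots> \<le> ennreal K * (ennreal (K ^ n) * G (c - b))" by (intro mult_left_mono Suc) simp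
      finally show ?case using K by (simp add: ennreal_mult mult.assoc)
    qed simp
    \<comment> \<open>The \<open>n\<close>-th term serves the points about n a below c - b.
      Enlarging their layer to a window ending in \<open>c\<close> only increases the bound, and
      such windows are what \<open>Gn\<close> controls.\<close>
    have pw: "ennreal (exp (s * (z - c))) * indicator {..c} z
        \<le> (\<Sum>n. ennreal ((1 / (2 * K)) ^ n) * indicator {c - b - real (Suc n) * a..c} z)" for z
    proof (cases "z \<le> c")
      case True
      define n where "n = nat \<lfloor>(c - b - z) / a\<rfloor>"
      have n1: "(c - b - z) / a \<le> real (Suc n)" unfolding n_def by linarith
      then have n1: "c - b - z \<le> real (Suc n) * a" using ab by (simp add: field_simps)
      have n2: "z - c \<le> - (real n * a)"
      proof (cases "0 \<le> (c - b - z) / a")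
        case True
        then have "real n \<le> (c - b - z) / a" by (simp add: n_def)
        then have "real n * a \<le> c - b - z" using ab by (simp add: field_simps)
        then show ?thesis using ab by simp
      next
        case False
        then have "n = 0" by (simp add: n_def)
        then show ?thesis using \<open>z \<le> c\<close> by simp
      qed
      have "exp (s * (z - c)) \<le> exp (- (real n * ln (2 * K)))"
      proof -
        have "s * (z - c) \<le> s * (- (real n * a))" by (rule mult_left_mono[OF n2 s(1)])
        also have "\<dots> = - (real n * (s * a))" by simp
        finally show ?thesis by (simp add: s(2))
      qed
      also have "\<dots> = (1 / (2 * K)) ^ n"
        using K by (simp add: exp_minus exp_of_nat_mult power_divide inverse_eq_divide)
      finally have "ennreal (exp (s * (z - c))) * indicator {..c} z
          \<le> ennreal ((1 / (2 * K)) ^ n) * indicator {c - b - real (Suc n) * a..c} z"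
        using True n1 by (simp add: ennreal_leI)
      also have "\<dots> \<le> (\<Sum>n. ennreal ((1 / (2 * K)) ^ n) * indicator {c - b - real (Suc n) * a..c} z)"
      proof -
        have "t n \<le> (\<Sum>n. t n)" for t :: "nat \<Rightarrow> ennreal"
          using sum_le_suminf[of t "{n}"] by simp
        then show ?thesis .
      qed
      finally show ?thesis .
    qed simp
    have "(\<integral>\<^sup>+z. ennreal (exp (s * (z - c))) * indicator {..c} z \<partial>M)
        \<le> (\<integral>\<^sup>+z. (\<Sum>n. ennreal ((1 / (2 * K)) ^ n) * indicator {c - b - real (Suc n) * a..c} z) \<partial>M)"
      by (rule nn_integral_mono) (rule pw)
    also have "\<dots> = (\<Sum>n. \<integral>\<^sup>+z. ennreal ((1 / (2 * K)) ^ n) * indicator {c - b - real (Suc n) * a..c} z \<partial>M)"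
      by (rule nn_integral_suminf) (simp add: sM cong: measurable_cong_sets)
    also have "\<dots> = (\<Sum>n. ennreal ((1 / (2 * K)) ^ n) * G (c - b - real (Suc n) * a))"
      using sM by (simp add: nn_integral_cmult_indicator G_def)
    also have "\<dots> \<le> (\<Sum>n. ennreal ((1 / 2) ^ n) * (ennreal K * G (c - b)))"
    proof (rule suminf_le)
      fix n
      have "ennreal ((1 / (2 * K)) ^ n) * G (c - b - real (Suc n) * a)
          \<le> ennreal ((1 / (2 * K)) ^ n) * (ennreal (K ^ Suc n) * G (c - b))"
        by (intro mult_left_mono Gn) simp
      also have "\<dots> = ennreal ((1 / (2 * K)) ^ n * K ^ Suc n) * G (c - b)"
        using K by (simp only: mult.assoc[symmetric]) (simp add: ennreal_mult)
      also have "(1 / (2 * K)) ^ n * K ^ Suc n = (1 / 2) ^ n * K"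
        using K by (simp add: power_divide power_mult_distrib field_simps)
      also have "ennreal ((1 / 2) ^ n * K) * G (c - b) = ennreal ((1 / 2) ^ n) * (ennreal K * G (c - b))"
        using K by (simp add: ennreal_mult mult.assoc)
      finally show "ennreal ((1 / (2 * K)) ^ n) * G (c - b - real (Suc n) * a)
          \<le> ennreal ((1 / 2) ^ n) * (ennreal K * G (c - b))" .
    qed auto
    also have "\<dots> = (\<Sum>n. ennreal ((1 / 2) ^ n)) * (ennreal K * G (c - b))" by simp
    also have "(\<Sum>n. ennreal ((1 / 2) ^ n)) = ennreal 2"
      using suminf_geometric[of "1 / 2 :: real"]
      by (subst suminf_ennreal2) (auto intro!: summable_geometric)
    also have "ennreal 2 * (ennreal K * G (c - b)) < top"
      using fin by (simp add: G_def ennreal_mult_less_top)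
    finally show "(\<integral>\<^sup>+z. ennreal (exp (ln (2 * K) / a * (z - c))) * indicator {..c} z \<partial>M) < top"
      by (simp add: s_def)
  qed
  then show ?thesis .
qed

text \<open>Rational end points, because the equalities will hold almost surely for one end point at
  a time, and countably many null sets may be discarded together.\<close>

lemma measure_eqI_atMost_rat:
  fixes A B :: "real measure"
  assumes sets: "sets A = sets borel" "sets B = sets borel"
    and fin: "\<And>r. emeasure A {..real_of_rat r} < top"
    and eq: "\<And>r. emeasure A {..real_of_rat r} = emeasure B {..real_of_rat r}"
  shows "A = B"
proof (rule measure_eqI_generator_eq_countable)
  let ?E = "range (\<lambda>r. {..real_of_rat r})"
  show "Int_stable ?E"
  proof (rule Int_stableI_image)
    fix i j show "\<exists>k\<in>UNIV. {..real_of_rat i} \<inter> {..real_of_rat j} = {..real_of_rat k}"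
      by (intro bexI[of _ "min i j"]) (auto simp: min_def of_rat_less_eq)
  qed
  have "sigma_sets UNIV ?E = sets borel"
  proof
    show "sigma_sets UNIV ?E \<subseteq> sets borel"
    proof -
      have "?E \<subseteq> sets borel" by auto
      then show ?thesis using sets.sigma_sets_subset[of ?E "borel::real measure"] by simp
    qed
    interpret sigma_algebra UNIV "sigma_sets UNIV ?E" by (rule sigma_algebra_sigma_sets) simp
    have "{..x} \<in> sigma_sets UNIV ?E" for x
    proof -
      have "{..x} = (\<Inter>r\<in>{r. x < real_of_rat r}. {..real_of_rat r})"
      proof (intro equalityI subsetI)
        fix y assume y: "y \<in> (\<Inter>r\<in>{r. x < real_of_rat r}. {..real_of_rat r})"
        show "y \<in> {..x}"
        proof (rule ccontr)
          assume "y \<notin> {..x}"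
          then obtain r where r: "x < of_rat r" "of_rat r < y" using of_rat_dense[of x y] by auto
          then show False using y by auto
        qed
      qed auto
      moreover
      have "(\<Inter>r\<in>{r. x < real_of_rat r}. {..real_of_rat r}) \<in> sigma_sets UNIV ?E"
        by (intro countable_INT'') (auto intro: sigma_sets_top)
      ultimately show ?thesis by simp
    qed
    then have "sigma_sets UNIV (range (\<lambda>x. {..x::real})) \<subseteq> sigma_sets UNIV ?E"
      by (intro sigma_sets_mono) auto
    then show "sets borel \<subseteq> sigma_sets UNIV ?E"
      unfolding borel_eq_atMost by simp
  qed
  then show "sets A = sigma_sets UNIV ?E" "sets B = sigma_sets UNIV ?E" using sets by auto
  show "\<Union> ?E = UNIV"
  proof -
    have "x \<in> \<Union> ?E" for x
    proof -
      obtain r where "x < real_of_rat r" using of_rat_dense[of x "x + 1"] by auto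
      then show ?thesis by (intro UnionI[of "{..real_of_rat r}"]) auto
    qed
    then show ?thesis by (intro UNIV_eq_I[symmetric])
  qed
qed (use fin eq sets in \<open>auto simp: less_top[symmetric]\<close>)

text \<open>Integrating \<open>M\<close> against an exponential weight on a half-line yields a harmonic function of at most exponential
  growth, to which \<open>one_sided_harmonic\<close> applies.\<close>

lemma one_sided_choquet_deny:
  assumes M: "bdd_finite M" and p: "prob_space p" "sets p = sets borel" and nonneg: "AE y in p. 0 \<le> y"
    and inv: "\<And>g. g \<in> borel_measurable borel \<Longrightarrow> (\<integral>\<^sup>+z. (\<integral>\<^sup>+y. g (z + y) \<partial>p) \<partial>M) = (\<integral>\<^sup>+z. g z \<partial>M)"
  shows "AE h in p. distr M borel (\<lambda>z. z + h) = M"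
proof (cases "AE y in p. y = 0")
  case True
  have sM: "sets M = sets borel" using M by (auto simp: bdd_finite_def)
  have "distr M borel (\<lambda>z. z) = M" using distr_id2[OF sM[symmetric]] .
  then show ?thesis using True by (auto elim: eventually_mono)
next
  case False
  interpret p: prob_space p by fact
  interpret M: sigma_finite_measure M by (rule bdd_finite_sigma_finite[OF M])
  interpret pM: pair_sigma_finite p M ..
  have sM [measurable_cong]: "sets M = sets borel" using M by (auto simp: bdd_finite_def)
  have sp [measurable_cong]: "sets p = sets borel" by fact
  have spM: "space M = UNIV" using sets_eq_imp_space_eq[OF sM] by simp
  obtain s where s: "0 \<le> s"
    "\<And>c. (\<integral>\<^sup>+z. ennreal (exp (s * (z - c))) * indicator {..c} z \<partial>M) < top"
    using bdd_finite_exp_growth[OF M p nonneg inv False] by blast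
  \<comment> \<open>The weight makes left half-lines integrable under \<open>M\<close>; moving the
    end point with \<open>x\<close> turns invariance of \<open>M\<close> into harmonicity of
    \<open>F\<close>, with growth rate \<open>s\<close> built in.\<close>
  define w where "w t = ennreal (exp (s * t)) * indicator {..0} t" for t :: real
  have [measurable]: "w \<in> borel_measurable borel" unfolding w_def[abs_def] by measurable
  define F where "F x = (\<integral>\<^sup>+z. w (z + x) \<partial>M)" for x
  have F: "F x < top" for x
  proof -
    have "F x = (\<integral>\<^sup>+z. ennreal (exp (s * (z - (- x)))) * indicator {..- x} z \<partial>M)"
      unfolding F_def w_def by (intro nn_integral_cong) (auto simp: indicator_def)
    then show ?thesis using s(2)[of "- x"] by simp
  qed
  have Fm: "F \<in> borel_measurable borel" unfolding F_def[abs_def] by measurable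
  have growth: "F (x + t) \<le> ennreal (exp (s * t)) * F x" if "0 \<le> t" for x t
  proof -
    have "F (x + t) \<le> (\<integral>\<^sup>+z. ennreal (exp (s * t)) * w (z + x) \<partial>M)"
      unfolding F_def
    proof (rule nn_integral_mono)
      fix z
      show "w (z + (x + t)) \<le> ennreal (exp (s * t)) * w (z + x)"
        using that unfolding w_def
        by (auto simp: indicator_def ennreal_mult[symmetric] exp_add[symmetric] algebra_simps)
    qed
    also have "\<dots> = ennreal (exp (s * t)) * F x"
      unfolding F_def by (rule nn_integral_cmult) measurable
    finally show ?thesis .
  qed
  have harm: "(\<integral>\<^sup>+y. F (x + y) \<partial>p) = F x" for x
  proof -
    have "(\<integral>\<^sup>+y. F (x + y) \<partial>p) = (\<integral>\<^sup>+z. (\<integral>\<^sup>+y. w (z + (x + y)) \<partial>p) \<partial>M)"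
      unfolding F_def by (rule pM.Fubini'[symmetric]) measurable
    also have "\<dots> = (\<integral>\<^sup>+z. (\<integral>\<^sup>+y. w (z + y + x) \<partial>p) \<partial>M)" by (simp add: ac_simps)
    also have "\<dots> = F x" unfolding F_def by (rule inv) measurable
    finally show ?thesis .
  qed
  define f where "f x = enn2real (F x)" for x
  have fF: "ennreal (f x) = F x" for x unfolding f_def using F by simp
  have "AE h in p. \<forall>r. f (real_of_rat r + h) = f (real_of_rat r)"
  proof (subst AE_all_countable, rule allI)
    fix r
    show "AE h in p. f (real_of_rat r + h) = f (real_of_rat r)"
    proof (rule one_sided_harmonic[OF p nonneg])
      show "0 \<le> f x" for x by (simp add: f_def)
      show "f \<in> borel_measurable borel" unfolding f_def[abs_def] using Fm by measurable
      show "0 \<le> s" by (rule s)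
      show "(\<integral>\<^sup>+y. ennreal (f (x + y)) \<partial>p) = ennreal (f x)" for x by (simp add: fF harm)
      show "f (x + t) \<le> exp (s * t) * f x" if "0 \<le> t" for x t
      proof -
        have "ennreal (f (x + t)) \<le> ennreal (exp (s * t) * f x)"
          using growth[OF that, of x] by (simp add: fF ennreal_mult f_def) (simp add: f_def[symmetric] fF)
        then show ?thesis by (simp add: f_def)
      qed
    qed
  qed
  then show ?thesis
  proof eventually_elim
    case (elim h)
    define Mh where "Mh = distr M borel (\<lambda>z. z + h)"
    have [measurable_cong]: "sets Mh = sets borel" by (simp add: Mh_def)
    define e where "e z = ennreal (exp (s * z))" for z
    have [measurable]: "e \<in> borel_measurable borel" unfolding e_def[abs_def] by measurable
    \<comment> \<open>Up to an explicit factor, \<open>F\<close> is the distribution function of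
      \<open>M\<close> weighted by \<open>e\<close>. Equal values of \<open>F\<close> at rational
      points thus identify the weighted versions of \<open>M\<close> and of its translate.\<close>
    have val: "emeasure (density M e) {..- x} = ennreal (exp (- (s * x))) * F x" for x
    proof -
      have "emeasure (density M e) {..- x} = (\<integral>\<^sup>+z. ennreal (exp (- (s * x))) * w (z + x) \<partial>M)"
        by (subst emeasure_density, measurable, rule nn_integral_cong)
           (auto simp: indicator_def w_def e_def ennreal_mult[symmetric] exp_add[symmetric] algebra_simps)
      also have "\<dots> = ennreal (exp (- (s * x))) * F x"
        unfolding F_def by (rule nn_integral_cmult) measurable
      finally show ?thesis .
    qed
    have val_h: "emeasure (density Mh e) {..- x} = ennreal (exp (- (s * x))) * F (x + h)" for x
    proof -
      have "emeasure (density Mh e) {..- x} = (\<integral>\<^sup>+z. e z * indicator {..- x} z \<partial>Mh)"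
        by (subst emeasure_density) measurable
      also have "\<dots> = (\<integral>\<^sup>+z. e (z + h) * indicator {..- x} (z + h) \<partial>M)"
        unfolding Mh_def by (subst nn_integral_distr) measurable
      also have "\<dots> = (\<integral>\<^sup>+z. ennreal (exp (- (s * x))) * w (z + (x + h)) \<partial>M)"
        by (rule nn_integral_cong)
           (auto simp: indicator_def w_def e_def ennreal_mult[symmetric] exp_add[symmetric] algebra_simps)
      also have "\<dots> = ennreal (exp (- (s * x))) * F (x + h)"
        unfolding F_def by (rule nn_integral_cmult) measurable
      finally show ?thesis .
    qed
    have "density M e = density Mh e"
    proof (rule measure_eqI_atMost_rat)
      fix r
      have "F (real_of_rat (- r) + h) = F (real_of_rat (- r))"
        using elim fF by metis
      then show "emeasure (density M e) {..real_of_rat r} = emeasure (density Mh e) {..real_of_rat r}"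
        using val[of "real_of_rat (- r)"] val_h[of "real_of_rat (- r)"] by (simp add: of_rat_minus)
      show "emeasure (density M e) {..real_of_rat r} < top"
        using val[of "real_of_rat (- r)"] F by (simp add: of_rat_minus ennreal_mult_less_top)
    qed (simp_all add: sM \<open>sets Mh = sets borel\<close>)
    then have eq: "(\<integral>\<^sup>+z. g z \<partial>density M e) = (\<integral>\<^sup>+z. g z \<partial>density Mh e)" for g by simp
    show "distr M borel (\<lambda>z. z + h) = M"
      unfolding Mh_def[symmetric]
    proof (rule measure_eqI)
      show "sets Mh = sets M" by (simp add: sM \<open>sets Mh = sets borel\<close>)
      fix B assume "B \<in> sets Mh"
      then have B [measurable]: "B \<in> sets borel" by (simp add: \<open>sets Mh = sets borel\<close>)
      \<comment> \<open>Dividing by the positive weight \<open>e\<close> recovers the measures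
        themselves.\<close>
      have "emeasure N B = (\<integral>\<^sup>+z. ennreal (exp (- (s * z))) * indicator B z \<partial>density N e)"
        if [measurable_cong]: "sets N = sets borel" for N
      proof -
        have "emeasure N B = (\<integral>\<^sup>+z. indicator B z \<partial>N)" using that by simp
        also have "\<dots> = (\<integral>\<^sup>+z. e z * (ennreal (exp (- (s * z))) * indicator B z) \<partial>N)"
          by (rule nn_integral_cong)
             (auto simp: e_def indicator_def ennreal_mult[symmetric] exp_add[symmetric])
        also have "\<dots> = (\<integral>\<^sup>+z. ennreal (exp (- (s * z))) * indicator B z \<partial>density N e)"
          by (subst nn_integral_density) measurable
        finally show ?thesis .
      qed
      then show "emeasure Mh B = emeasure M B"
        using eq sM \<open>sets Mh = sets borel\<close> by metis
    qed
  qed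
qed

section \<open>Bounds for renewal operators\<close>

lemma pot_le_UNIV:
  "kern \<kappa> \<Longrightarrow> S \<in> sets borel \<Longrightarrow> f \<in> BM \<Longrightarrow> pot \<kappa> S f x \<le> pot \<kappa> UNIV f x"
  by (simp add: pot_exitop[of \<kappa> S f])

definition prob_kern :: "(real \<Rightarrow> real measure) \<Rightarrow> bool" where
  "prob_kern \<kappa> \<longleftrightarrow> kern \<kappa> \<and> (\<forall>x. prob_space (\<kappa> x))"

lemma prob_kern_conv: "prob_space p \<Longrightarrow> sets p = sets borel \<Longrightarrow> prob_kern (conv p)"
  unfolding prob_kern_def conv_def using kern_conv[of p]
  by (auto simp: conv_def[abs_def] intro!: prob_space.prob_space_distr cong: measurable_cong_sets)

lemma taboo_UNIV_le_const:
  assumes "prob_kern \<kappa>" "\<And>y. f y \<le> c" "S \<in> sets borel"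
  shows "taboo \<kappa> S f x \<le> c"
proof -
  have "taboo \<kappa> S f x \<le> (\<integral>\<^sup>+y. c \<partial>\<kappa> x)"
    unfolding taboo_def using assms(2) by (intro nn_integral_mono) (auto simp: indicator_def)
  also have "\<dots> = c"
    using assms(1) prob_space.emeasure_space_1[of "\<kappa> x"] by (simp add: prob_kern_def)
  finally show ?thesis .
qed

text \<open>Conservation of mass: the potential of 1 is its own tail plus the exit probability, and
  also its own tail plus 1. The tail cancels when it is finite.\<close>

lemma exitop_one:
  assumes \<kappa>: "prob_kern \<kappa>" and S: "S \<in> sets borel" and fin: "pot \<kappa> S (\<lambda>_. 1) x < top"
  shows "exitop \<kappa> S (\<lambda>_. 1) x = 1"
proof -
  have k: "kern \<kappa>" using \<kappa> by (simp add: prob_kern_def)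
  have m: "(\<lambda>_. 1 :: ennreal) \<in> BM" by simp
  have mS: "taboo \<kappa> S (\<lambda>_. 1) \<in> BM" "taboo \<kappa> (- S) (\<lambda>_. 1) \<in> BM"
    using S by (auto intro!: taboo_measurable[OF k])
  have "taboo \<kappa> S (\<lambda>_. 1) y + taboo \<kappa> (- S) (\<lambda>_. 1) y = 1" for y
  proof -
    have "taboo \<kappa> UNIV (\<lambda>_. 1) y = 1"
      using \<kappa> prob_space.emeasure_space_1[of "\<kappa> y"] by (simp add: prob_kern_def taboo_def)
    then show ?thesis
      using taboo_split[OF k S, of UNIV "\<lambda>_. 1" y] by (simp add: Compl_eq_Diff_UNIV)
  qed
  then have "pot \<kappa> S (\<lambda>_. 1) x = pot \<kappa> S (taboo \<kappa> S (\<lambda>_. 1)) x + exitop \<kappa> S (\<lambda>_. 1) x"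
    using linop_add[OF linop_pot[OF k S] mS, of x] by (simp add: exitop_def)
  moreover have *: "pot \<kappa> S (\<lambda>_. 1) x = 1 + pot \<kappa> S (taboo \<kappa> S (\<lambda>_. 1)) x"
    by (rule pot_unfold_right[OF k S m])
  moreover have "pot \<kappa> S (taboo \<kappa> S (\<lambda>_. 1)) x < top"
    using fin * by (simp add: add.commute less_top[symmetric])
  ultimately show ?thesis by (auto simp: add.commute[of 1] ennreal_add_left_cancel)
qed

text \<open>Each visit to \<open>I\<close> is followed with probability at least \<open>c\<close> by
  absorption in \<open>J\<close>, so the number of visits is dominated by a geometric variable of
  mean 1 / c; in the induction this is 1 + (1 - c) / c = 1 / c.\<close>

lemma pot_visit_bound:
  assumes \<kappa>: "prob_kern \<kappa>" and I: "I \<in> sets borel" and J: "J \<in> sets borel" and IJ: "I \<inter> J = {}"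
    and c: "0 < c" and jump: "\<And>x. x \<in> I \<Longrightarrow> ennreal c \<le> emeasure (\<kappa> x) J"
    and abs: "\<And>x. x \<in> J \<Longrightarrow> AE y in \<kappa> x. y \<in> J"
  shows "pot \<kappa> UNIV (indicator I) x \<le> ennreal (1 / c)"
proof (rule pot_leI)
  have k: "kern \<kappa>" and pk: "\<And>x. prob_space (\<kappa> x)" using \<kappa> by (auto simp: prob_kern_def)
  have m: "(indicator I :: real \<Rightarrow> ennreal) \<in> BM" using I by simp
  have zero: "pot \<kappa> UNIV (indicator I) x = 0" if "x \<in> J" for x
  proof -
    have "pot \<kappa> UNIV (indicator I) x = pot \<kappa> UNIV (\<lambda>_. 0) x"
      by (rule pot_cong_on[where Z = J]) (use abs IJ that in \<open>auto simp: indicator_def\<close>)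
    then show ?thesis by (simp add: pot_zero_fun)
  qed
  then have zeroN: "psum \<kappa> UNIV N (indicator I) x = 0" if "x \<in> J" for x N
    using that psum_le_pot[of \<kappa> UNIV N "indicator I" x] by simp
  fix N
  show "psum \<kappa> UNIV N (indicator I) x \<le> ennreal (1 / c)"
  proof (induction N arbitrary: x)
    case (Suc N)
    define g where "g = psum \<kappa> UNIV N (indicator I)"
    have g_le: "g y \<le> ennreal (1 / c)" and g_zero: "y \<in> J \<Longrightarrow> g y = 0" for y
      unfolding g_def by (rule Suc, rule zeroN)
    have eq: "psum \<kappa> UNIV (Suc N) (indicator I) x = indicator I x + taboo \<kappa> UNIV g x"
      unfolding g_def by (rule psum_Suc[OF k _ m]) simp
    show ?case
    proof (cases "x \<in> I")
      case False
      then show ?thesis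
        using eq taboo_UNIV_le_const[OF \<kappa> g_le, where S = UNIV and x = x] by simp
    next
      case True
      interpret prob_space "\<kappa> x" by (rule pk)
      have sx: "sets (\<kappa> x) = sets borel" using k by (simp add: kern_def)
      then have spx: "space (\<kappa> x) = UNIV" using sets_eq_imp_space_eq by fastforce
      have c1: "c \<le> prob J" using jump[OF True] by (simp add: emeasure_eq_measure)
      have "taboo \<kappa> UNIV g x \<le> (\<integral>\<^sup>+y. ennreal (1 / c) * indicator (- J) y \<partial>\<kappa> x)"
        unfolding taboo_def using g_le g_zero by (intro nn_integral_mono) (auto simp: indicator_def)
      also have "\<dots> = ennreal (1 / c) * emeasure (\<kappa> x) (- J)"
        using J sx by (simp add: nn_integral_cmult_indicator)
      also have "emeasure (\<kappa> x) (- J) = ennreal (1 - prob J)"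
        using prob_compl[of J] J sx spx by (simp add: emeasure_eq_measure Compl_eq_Diff_UNIV)
      also have "ennreal (1 / c) * ennreal (1 - prob J) = ennreal ((1 - prob J) / c)"
        using c by (simp add: ennreal_mult[symmetric])
      also have "\<dots> \<le> ennreal ((1 - c) / c)"
        using c c1 by (intro ennreal_leI divide_right_mono) auto
      finally have "psum \<kappa> UNIV (Suc N) (indicator I) x \<le> 1 + ennreal ((1 - c) / c)"
        using True eq by (simp add: add_left_mono)
      also have "\<dots> = ennreal (1 / c)"
      proof -
        have "1 / c = 1 + (1 - c) / c" using c by (simp add: field_simps)
        moreover have "0 \<le> (1 - c) / c" using c c1 prob_le_1[of J] by (intro divide_nonneg_nonneg) linarith+
        ultimately show ?thesis by (simp only: ennreal_plus[OF zero_le_one]) simp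
      qed
      finally show ?thesis .
    qed
  qed simp
qed

lemma AE_conv_monotone:
  fixes t :: real
  assumes "sets p = sets borel" "AE y in p. 0 \<le> t * y"
  shows "AE y in conv p x. t * x \<le> t * y"
proof -
  have "{y. t * x \<le> t * y} \<in> sets borel" by measurable
  then have "(AE y in conv p x. y \<in> {y. t * x \<le> t * y}) \<longleftrightarrow> (AE y in p. x + y \<in> {y. t * x \<le> t * y})"
    by (rule AE_conv[OF assms(1)])
  then show ?thesis using assms(2) by (simp add: distrib_left)
qed

text \<open>Divide the line into cells of length \<epsilon>. A jump of at least \<epsilon> in
  direction \<open>t\<close> leaves the current cell for good, which bounds the visits to one cell
  uniformly, and {a..b} meets finitely many cells. The sign \<open>t\<close> treats increasing and
  decreasing walks at once.\<close>

lemma renewal_bound: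
  fixes t :: real
  assumes p: "prob_space p" "sets p = sets borel" and t: "t = 1 \<or> t = - 1"
    and dir: "AE y in p. 0 \<le> t * y" and nontriv: "\<not> (AE y in p. y = 0)"
  shows "\<exists>C\<ge>0. \<forall>x. pot (conv p) UNIV (indicator {a..b}) x \<le> ennreal C"
proof -
  interpret prob_space p by fact
  note k = kern_conv[OF p] and pk = prob_kern_conv[OF p]
  have "\<exists>n::nat. prob {y. 1 / Suc n \<le> t * y} \<noteq> 0"
  proof (rule ccontr)
    assume "\<not> ?thesis"
    then have "{y. 1 / Suc n \<le> t * y} \<in> null_sets p" for n :: nat
      using p(2) by (auto simp: null_sets_def emeasure_eq_measure)
    then have "(\<Union>n::nat. {y. 1 / Suc n \<le> t * y}) \<in> null_sets p" by auto
    then have "AE y in p. y \<notin> (\<Union>n::nat. {y. 1 / Suc n \<le> t * y})" by (rule AE_not_in)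
    with dir have "AE y in p. y = 0"
    proof eventually_elim
      case (elim y)
      show ?case
      proof (rule ccontr)
        assume "y \<noteq> 0"
        then have "0 < t * y" using elim t by auto
        then obtain n where "1 / Suc n < t * y" using nat_approx_posE by blast
        then show False using elim(2) by (auto intro: less_imp_le)
      qed
    qed
    then show False using nontriv by simp
  qed
  then obtain n :: nat where n: "0 < prob {y. 1 / Suc n \<le> t * y}" by (auto simp: zero_less_measure_iff)
  define \<epsilon> :: real where "\<epsilon> = 1 / Suc n"
  define c where "c = prob {y. \<epsilon> \<le> t * y}"
  have \<epsilon>: "0 < \<epsilon>" and c: "0 < c" using n by (auto simp: \<epsilon>_def c_def)
  define I where "I i = {z. of_int i * \<epsilon> \<le> t * z \<and> t * z < of_int (i + 1) * \<epsilon>}" for i :: int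
  have I: "I i \<in> sets borel" for i unfolding I_def by measurable
  have bound: "pot (conv p) UNIV (indicator (I i)) x \<le> ennreal (1 / c)" for i x
  proof (rule pot_visit_bound[OF pk I _ _ c])
    let ?J = "{z. of_int (i + 1) * \<epsilon> \<le> t * z}"
    show J: "?J \<in> sets borel" by measurable
    show "I i \<inter> ?J = {}" by (auto simp: I_def)
    show "ennreal c \<le> emeasure (conv p x) ?J" if "x \<in> I i" for x
    proof -
      have "emeasure (conv p x) ?J = emeasure p ((\<lambda>y. x + y) -` ?J \<inter> space p)"
        unfolding conv_def using J p(2) by (intro emeasure_distr) (auto cong: measurable_cong_sets)
      moreover have "{y. \<epsilon> \<le> t * y} \<subseteq> (\<lambda>y. x + y) -` ?J \<inter> space p"
        using that sets_eq_imp_space_eq[OF p(2)] by (auto simp: I_def algebra_simps)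
      moreover have "(\<lambda>y. x + y) -` ?J \<inter> space p \<in> sets p"
        using J p(2) by (intro measurable_sets[of _ p borel]) (auto cong: measurable_cong_sets)
      ultimately show ?thesis
        unfolding c_def emeasure_eq_measure[symmetric] by (simp add: emeasure_mono)
    qed
    show "AE y in conv p x. y \<in> ?J" if "x \<in> ?J" for x
      using AE_conv_monotone[OF p(2) dir, of x] by eventually_elim (use that in auto)
  qed
  \<comment> \<open>The indices of the cells met by {a..b} lie between - (m - 1) and m - 1; adding
    \<open>m\<close> makes them natural numbers below N = 2 m.\<close>
  define m where "m = \<lceil>max \<bar>a\<bar> \<bar>b\<bar> / \<epsilon>\<rceil> + 1"
  have m: "max \<bar>a\<bar> \<bar>b\<bar> \<le> of_int (m - 1) * \<epsilon>"
  proof -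
    have "max \<bar>a\<bar> \<bar>b\<bar> / \<epsilon> \<le> of_int (m - 1)" unfolding m_def by (simp add: le_of_int_ceiling)
    then show ?thesis using \<epsilon> by (simp only: pos_divide_le_eq)
  qed
  define N where "N = nat (2 * m)"
  have "0 \<le> max \<bar>a\<bar> \<bar>b\<bar> / \<epsilon>" using \<epsilon> by simp
  then have m0: "0 < m" unfolding m_def by linarith
  have cover: "indicator {a..b} z \<le> (\<Sum>j<N. indicator (I (int j - m)) z :: ennreal)" for z
  proof (cases "z \<in> {a..b}")
    case True
    then have "\<bar>t * z\<bar> \<le> max \<bar>a\<bar> \<bar>b\<bar>" using t by auto
    then have tz: "- (of_int (m - 1) * \<epsilon>) \<le> t * z" "t * z \<le> of_int (m - 1) * \<epsilon>" using m by auto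
    define i where "i = \<lfloor>t * z / \<epsilon>\<rfloor>"
    have i: "of_int i \<le> t * z / \<epsilon>" "t * z / \<epsilon> < of_int i + 1" unfolding i_def by linarith+
    have "z \<in> I i" using i \<epsilon> by (auto simp: I_def field_simps)
    have "- of_int (m - 1) \<le> t * z / \<epsilon>" "t * z / \<epsilon> \<le> of_int (m - 1)"
      using tz \<epsilon> by (simp_all add: field_simps)
    then have "- (m - 1) \<le> i" "i \<le> m - 1"
      unfolding i_def by (simp_all add: le_floor_iff) linarith
    then have j: "nat (i + m) < N" "int (nat (i + m)) - m = i"
      using m0 by (auto simp: N_def)
    have "indicator {a..b} z = (indicator (I (int (nat (i + m)) - m)) z :: ennreal)"
      using True \<open>z \<in> I i\<close> j(2) by simp
    also have "\<dots> \<le> (\<Sum>j<N. indicator (I (int j - m)) z)"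
      by (rule member_le_sum) (use j in auto)
    finally show ?thesis .
  qed simp
  have "pot (conv p) UNIV (indicator {a..b}) x \<le> ennreal (real N * (1 / c))" for x
  proof -
    have mI: "indicator (I (int j - m)) \<in> BM" for j using I by simp
    have "pot (conv p) UNIV (indicator {a..b}) x
        \<le> pot (conv p) UNIV (\<lambda>z. \<Sum>j<N. indicator (I (int j - m)) z) x"
      using mI by (intro linop_mono[OF linop_pot[OF k]] cover) auto
    also have "\<dots> = (\<Sum>j<N. pot (conv p) UNIV (indicator (I (int j - m))) x)"
      by (rule linop_sum[OF linop_pot[OF k]]) (use mI in auto)
    also have "\<dots> \<le> (\<Sum>j<N. ennreal (1 / c))" by (intro sum_mono bound)
    also have "\<dots> = ennreal (real N * (1 / c))"
      using c by (simp add: ennreal_of_nat_eq_real_of_nat ennreal_mult[symmetric])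
    finally show ?thesis .
  qed
  then show ?thesis using c by (intro exI[of _ "real N * (1 / c)"]) auto
qed

text \<open>A walk in direction \<open>t\<close> started at t x \<ge> - a can visit \<open>S\<close>
  only where t z lies in [- a, 0], so the renewal bound for one bounded interval suffices.\<close>

lemma pot_one_bound:
  fixes t :: real
  assumes p: "prob_space p" "sets p = sets borel" and t: "t = 1 \<or> t = - 1"
    and dir: "AE y in p. 0 \<le> t * y" and nontriv: "\<not> (AE y in p. y = 0)"
    and S: "S \<in> sets borel" "\<And>z. z \<in> S \<Longrightarrow> t * z \<le> 0"
  shows "\<exists>C\<ge>0. \<forall>x\<in>S. - a \<le> t * x \<longrightarrow> pot (conv p) S (\<lambda>_. 1) x \<le> ennreal C"
proof -
  note k = kern_conv[OF p]
  obtain C where C: "0 \<le> C" "\<And>x. pot (conv p) UNIV (indicator {- \<bar>a\<bar>..\<bar>a\<bar>}) x \<le> ennreal C"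
    using renewal_bound[OF p t dir nontriv] by blast
  have "pot (conv p) S (\<lambda>_. 1) x \<le> ennreal C" if x: "x \<in> S" "- a \<le> t * x" for x
  proof -
    have "pot (conv p) S (\<lambda>_. 1) x = pot (conv p) S (indicator S) x"
      by (rule pot_cong) (use x in auto)
    also have "\<dots> = pot (conv p) S (indicator {- \<bar>a\<bar>..\<bar>a\<bar>}) x"
    proof -
      have "pot (conv p) S (indicator S) x = pot (conv p) S (indicator (S \<inter> {- \<bar>a\<bar>..\<bar>a\<bar>})) x"
      proof (rule pot_cong_on[where Z = "{z. t * x \<le> t * z}"])
        show "AE y in conv p y'. y \<in> {z. t * x \<le> t * z}" if "y' \<in> {z. t * x \<le> t * z}" for y'
          using AE_conv_monotone[OF p(2) dir, of y'] by eventually_elim (use that in auto)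
        show "indicator S z = (indicator (S \<inter> {- \<bar>a\<bar>..\<bar>a\<bar>}) z :: ennreal)" if "z \<in> {z. t * x \<le> t * z}" for z
          using that x t S(2)[of z] by (auto simp: indicator_def)
      qed auto
      also have "\<dots> = pot (conv p) S (indicator {- \<bar>a\<bar>..\<bar>a\<bar>}) x"
        by (rule pot_cong) (use x in \<open>auto simp: indicator_def\<close>)
      finally show ?thesis .
    qed
    also have "\<dots> \<le> pot (conv p) UNIV (indicator {- \<bar>a\<bar>..\<bar>a\<bar>}) x"
      by (rule pot_le_UNIV[OF k S(1)]) simp
    also have "\<dots> \<le> ennreal C" by (rule C)
    finally show ?thesis .
  qed
  then show ?thesis using C(1) by blast
qed

text \<open>Tightness of the overshoot, uniformly over starting points of bounded depth: landing
  beyond \<open>n\<close> takes a single jump exceeding \<open>n\<close>, and on average at most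
  \<open>C\<close> jumps are tried before the exit. A jump probability below 1 / (2 (C + 1)) leaves
  at most 1/2 for long overshoots.\<close>

lemma exit_one_sided:
  fixes t :: real
  assumes p: "prob_space p" "sets p = sets borel" and t: "t = 1 \<or> t = - 1"
    and dir: "AE y in p. 0 \<le> t * y" and nontriv: "\<not> (AE y in p. y = 0)"
    and S: "S \<in> sets borel" "\<And>z. z \<in> S \<Longrightarrow> t * z \<le> 0"
  shows "\<exists>b. \<forall>x\<in>S. - a \<le> t * x \<longrightarrow> ennreal (1 / 2) \<le> exitop (conv p) S (indicator {z. t * z \<le> b}) x"
proof -
  interpret prob_space p by fact
  note k = kern_conv[OF p] and pk = prob_kern_conv[OF p]
  obtain C where C: "0 \<le> C" "\<And>x. x \<in> S \<Longrightarrow> - a \<le> t * x \<Longrightarrow> pot (conv p) S (\<lambda>_. 1) x \<le> ennreal C"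
    using pot_one_bound[OF p t dir nontriv S] by blast
  define B where "B n = {y. real n < t * y}" for n :: nat
  have B: "B n \<in> sets p" for n unfolding B_def p(2) by measurable
  have "(\<lambda>n. prob (B n)) \<longlonglongrightarrow> prob (\<Inter>n. B n)"
  proof (rule finite_Lim_measure_decseq)
    show "range B \<subseteq> events" using B by auto
    show "decseq B" by (auto simp: B_def decseq_def)
  qed
  moreover have "(\<Inter>n. B n) = {}"
  proof -
    have "\<exists>n. y \<notin> B n" for y
      using real_arch_simple[of "t * y"] by (auto simp: B_def not_less)
    then show ?thesis by blast
  qed
  ultimately have "(\<lambda>n. prob (B n)) \<longlonglongrightarrow> 0" by simp
  then have "eventually (\<lambda>n. prob (B n) < 1 / (2 * (C + 1))) sequentially"
    using C(1) by (intro order_tendstoD(2)) auto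
  then obtain n where n: "prob (B n) < 1 / (2 * (C + 1))" by (auto simp: eventually_sequentially)
  have "ennreal (1 / 2) \<le> exitop (conv p) S (indicator {z. t * z \<le> real n}) x"
    if x: "x \<in> S" "- a \<le> t * x" for x
  proof -
    let ?A = "{z. t * z \<le> real n}"
    have A: "?A \<in> sets borel" "- ?A \<in> sets borel" by auto
    have "exitop (conv p) S (indicator (- ?A)) x \<le> pot (conv p) S (\<lambda>_. ennreal (prob (B n)) * 1) x"
    proof -
      have le: "taboo (conv p) (- S) (indicator (- ?A)) z \<le> ennreal (prob (B n))" if "z \<in> S" for z
      proof -
        have "taboo (conv p) (- S) (indicator (- ?A)) z \<le> (\<integral>\<^sup>+y. indicator (B n) y \<partial>p)"
          using S(2)[OF that] S(1) A unfolding B_def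
          by (subst taboo_conv[OF p(2)]) (auto intro!: nn_integral_mono simp: indicator_def distrib_left)
        then show ?thesis using B by (simp add: emeasure_eq_measure)
      qed
      have "exitop (conv p) S (indicator (- ?A)) x
          = pot (conv p) S (\<lambda>z. taboo (conv p) (- S) (indicator (- ?A)) z * indicator S z) x"
        unfolding exitop_def by (rule pot_cong) (use x in auto)
      also have "\<dots> \<le> pot (conv p) S (\<lambda>_. ennreal (prob (B n)) * 1) x"
        using S A le by (intro linop_mono[OF linop_pot[OF k]] borel_measurable_times_ennreal
            taboo_measurable[OF k]) (auto simp: indicator_def)
      finally show ?thesis .
    qed
    also have "\<dots> = ennreal (prob (B n)) * pot (conv p) S (\<lambda>_. 1) x"
      by (rule linop_cmult[OF linop_pot[OF k S(1)]]) simp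
    also have "\<dots> \<le> ennreal (1 / (2 * (C + 1))) * ennreal C"
      using n C x by (intro mult_mono ennreal_leI) auto
    also have "\<dots> = ennreal (C / (2 * (C + 1)))" using C by (simp add: ennreal_mult[symmetric])
    also have "\<dots> \<le> ennreal (1 / 2)" using C(1) by (intro ennreal_leI) (simp add: field_simps)
    finally have small: "exitop (conv p) S (indicator (- ?A)) x \<le> ennreal (1 / 2)" .
    have "pot (conv p) S (\<lambda>_. 1) x < top"
      using C(2)[OF x] by (rule le_less_trans) simp
    then have "1 = exitop (conv p) S (\<lambda>_. 1) x" by (rule exitop_one[OF pk S(1), symmetric])
    also have "\<dots> = exitop (conv p) S (\<lambda>z. indicator ?A z + indicator (- ?A) z) x"
      by (rule arg_cong[of _ _ "\<lambda>f. exitop (conv p) S f x"]) (auto simp: indicator_def)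
    also have "exitop (conv p) S (\<lambda>z. indicator ?A z + indicator (- ?A) z) x
        = exitop (conv p) S (indicator ?A) x + exitop (conv p) S (indicator (- ?A)) x"
      by (rule linop_add[OF linop_exitop[OF k S(1)]]) (use A in auto)
    also have "\<dots> \<le> exitop (conv p) S (indicator ?A) x + ennreal (1 / 2)"
      by (intro add_left_mono small)
    finally have "1 \<le> ennreal (1 / 2) + exitop (conv p) S (indicator ?A) x"
      by (simp only: add.commute)
    moreover have "ennreal (1 / 2) + ennreal (1 / 2) = 1"
      by (subst ennreal_plus[symmetric]) auto
    ultimately have "ennreal (1 / 2) + ennreal (1 / 2) \<le> ennreal (1 / 2) + exitop (conv p) S (indicator ?A) x"
      by (simp only:)
    then show ?thesis unfolding ennreal_add_left_cancel_le by simp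
  qed
  then show ?thesis by blast
qed

text \<open>The maximum principle: an excessive function that dominates a potential on the support
  of its charge dominates it everywhere, because off the support a truncated potential is just a
  killed average of its predecessor.\<close>

lemma pot_max_principle:
  assumes \<kappa>: "kern \<kappa>" and S: "S \<in> sets borel" and I: "I \<in> sets borel" and \<phi>: "\<phi> \<in> BM"
    and sup: "\<And>x. x \<in> S \<Longrightarrow> taboo \<kappa> S \<phi> x \<le> \<phi> x"
    and bd: "\<And>x. x \<in> S \<Longrightarrow> x \<in> I \<Longrightarrow> pot \<kappa> S (indicator I) x \<le> \<phi> x" and x: "x \<in> S"
  shows "pot \<kappa> S (indicator I) x \<le> \<phi> x"
proof -
  have m: "(indicator I :: real \<Rightarrow> ennreal) \<in> BM" using I by simp
  have "psum \<kappa> S N (indicator I) x \<le> \<phi> x" if "x \<in> S" for N x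
    using that
  proof (induction N arbitrary: x)
    case (Suc N)
    show ?case
    proof (cases "x \<in> I")
      case True
      then show ?thesis using bd[OF Suc(2)] psum_le_pot[of \<kappa> S "Suc N" "indicator I" x] by simp
    next
      case False
      define g where "g = psum \<kappa> S N (indicator I)"
      have "g y \<le> \<phi> y" if "y \<in> S" for y unfolding g_def by (rule Suc(1)[OF that])
      then have "taboo \<kappa> S (psum \<kappa> S N (indicator I)) x \<le> taboo \<kappa> S \<phi> x"
        unfolding taboo_def g_def[symmetric] by (intro nn_integral_mono) (auto simp: indicator_def)
      then show ?thesis using False sup[OF Suc(2)] by (simp add: psum_Suc[OF \<kappa> S m])
    qed
  qed simp
  then show ?thesis using x by (intro pot_leI)
qed

section \<open>Two ladder laws and an invariant measure of the alternating walk\<close>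

text \<open>Test functions below the indicator of a bounded interval are those whose potentials will
  have finite integrals, so identities that require cancellation are checked on them only.\<close>

lemma measure_eqI_bounded_fun:
  assumes A: "sets A = sets borel" and B: "sets B = sets borel"
    and eq: "\<And>f b. f \<in> BM \<Longrightarrow> 0 \<le> b \<Longrightarrow> (\<And>x. f x \<le> indicator {- b..b} x) \<Longrightarrow>
      (\<integral>\<^sup>+x. f x \<partial>A) = (\<integral>\<^sup>+x. f x \<partial>B)"
  shows "A = B"
proof (rule measure_eqI)
  show "sets A = sets B" using A B by simp
  fix X assume "X \<in> sets A"
  then have X: "X \<in> sets borel" using A by simp
  define Xn where "Xn n = X \<inter> {- real n..real n}" for n :: nat
  have Xn: "Xn n \<in> sets borel" for n using X by (auto simp: Xn_def)
  have U: "(\<Union>n. Xn n) = X"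
  proof -
    have "\<exists>n::nat. x \<in> {- real n..real n}" for x :: real
    proof -
      obtain n where "\<bar>x\<bar> \<le> real n" using real_arch_simple by blast
      then show ?thesis by (intro exI[of _ n]) auto
    qed
    then show ?thesis by (auto simp: Xn_def)
  qed
  have inc: "incseq Xn" by (auto simp: Xn_def incseq_def)
  have *: "emeasure C X = (SUP n. emeasure C (Xn n))" if "sets C = sets borel" for C
  proof -
    have "range Xn \<subseteq> sets C" using Xn that by auto
    from SUP_emeasure_incseq[OF this inc] show ?thesis by (simp add: U)
  qed
  have "emeasure A (Xn n) = emeasure B (Xn n)" for n
  proof -
    have "(\<integral>\<^sup>+x. indicator (Xn n) x \<partial>A) = (\<integral>\<^sup>+x. indicator (Xn n) x \<partial>B)"
    proof (rule eq)
      show "(indicator (Xn n) :: real \<Rightarrow> ennreal) \<in> BM" using Xn by simp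
      show "indicator (Xn n) x \<le> (indicator {- real n..real n} x :: ennreal)" for x
        by (auto simp: Xn_def indicator_def)
    qed simp
    then show ?thesis using Xn A B by simp
  qed
  then show "emeasure A X = emeasure B X" by (simp add: *[OF A] *[OF B])
qed

lemma taboo_conv_commute:
  assumes p: "prob_space p" "sets p = sets borel" and q: "prob_space q" "sets q = sets borel"
    and f: "f \<in> BM"
  shows "taboo (conv p) UNIV (taboo (conv q) UNIV f) = taboo (conv q) UNIV (taboo (conv p) UNIV f)"
proof
  fix x
  interpret p: prob_space p by fact
  interpret q: prob_space q by fact
  interpret pq: pair_sigma_finite p q ..
  note [measurable_cong] = p(2) q(2)
  note [measurable] = f
  have m: "taboo (conv p) UNIV f \<in> BM" "taboo (conv q) UNIV f \<in> BM"
    by (auto intro!: taboo_measurable kern_conv p q f)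
  have "(\<integral>\<^sup>+y. (\<integral>\<^sup>+z. f (x + y + z) \<partial>q) \<partial>p) = (\<integral>\<^sup>+z. (\<integral>\<^sup>+y. f (x + y + z) \<partial>p) \<partial>q)"
    by (rule pq.Fubini'[symmetric]) measurable
  also have "\<dots> = (\<integral>\<^sup>+z. (\<integral>\<^sup>+y. f (x + z + y) \<partial>p) \<partial>q)" by (simp add: ac_simps)
  finally show "taboo (conv p) UNIV (taboo (conv q) UNIV f) x = taboo (conv q) UNIV (taboo (conv p) UNIV f) x"
    using m by (simp add: taboo_conv p q f)
qed

lemma pot_commute:
  assumes \<kappa>: "kern \<kappa>" and S: "S \<in> sets borel" and \<Phi>: "linop \<Phi>"
    and comm: "\<And>g. g \<in> BM \<Longrightarrow> taboo \<kappa> S (\<Phi> g) = \<Phi> (taboo \<kappa> S g)" and f: "f \<in> BM"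
  shows "pot \<kappa> S (\<Phi> f) x = \<Phi> (pot \<kappa> S f) x"
proof -
  have m: "(taboo \<kappa> S ^^ n) f \<in> BM" for n by (rule taboo_funpow_measurable[OF \<kappa> S f])
  have "(taboo \<kappa> S ^^ n) (\<Phi> f) = \<Phi> ((taboo \<kappa> S ^^ n) f)" for n
    by (induction n) (auto simp: comm m)
  then show ?thesis
    unfolding pot_def[abs_def] using linop_suminf[OF \<Phi> m] by simp
qed

text \<open>The balance \<open>pot\<close> (I - R) = I - \<open>exitop\<close> for the free step R,
  in additive form.\<close>

lemma pot_taboo_compl:
  assumes \<kappa>: "kern \<kappa>" and S: "S \<in> sets borel" and g: "g \<in> BM"
  shows "pot \<kappa> S (taboo \<kappa> UNIV g) x + g x = pot \<kappa> S g x + exitop \<kappa> S g x"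
proof -
  have "taboo \<kappa> UNIV g = (\<lambda>y. taboo \<kappa> S g y + taboo \<kappa> (- S) g y)"
    using taboo_split[OF \<kappa> S _ g, of UNIV] by (auto simp: Compl_eq_Diff_UNIV)
  then have "pot \<kappa> S (taboo \<kappa> UNIV g) x = pot \<kappa> S (taboo \<kappa> S g) x + exitop \<kappa> S g x"
    unfolding exitop_def using S
    by (simp add: linop_add[OF linop_pot[OF \<kappa> S]] taboo_measurable[OF \<kappa> _ g])
  then show ?thesis
    using pot_unfold_right[OF \<kappa> S g, of x] by (simp add: ac_simps)
qed

text \<open>A constant, so that the simplifier keeps \<open>- Hp\<close> instead of turning it into a ray.\<close>

definition Hp :: "real set" where
  "Hp = {0..}"

lemma Hp_iff [simp]: "x \<in> Hp \<longleftrightarrow> 0 \<le> x"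
  by (simp add: Hp_def)

lemma Hp_sets [simp, measurable]: "Hp \<in> sets borel"
  by (simp add: Hp_def)

text \<open>\<delta> and \<alpha> stand for the laws of D and A'; the original walks are absent
  until the last sections. In the abbreviations, R is a free step, V a free renewal operator, U the
  occupation operator of a half-line and K its exit operator. The second letter names the step law
  for R and V, the half-line (plus, minus) for U, the direction of the crossing for K.\<close>

locale two_sided =
  fixes \<delta> \<alpha> :: "real measure"
  assumes \<delta>: "prob_space \<delta>" "sets \<delta> = sets borel" and \<alpha>: "prob_space \<alpha>" "sets \<alpha> = sets borel"
    and \<delta>_le: "AE y in \<delta>. y \<le> 0" and \<alpha>_ge: "AE y in \<alpha>. 0 \<le> y"
    and \<delta>_nontriv: "\<not> (AE y in \<delta>. y = 0)" and \<alpha>_nontriv: "\<not> (AE y in \<alpha>. y = 0)"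
begin

abbreviation "S \<equiv> Hp"
abbreviation "Rd \<equiv> taboo (conv \<delta>) UNIV"
abbreviation "Ra \<equiv> taboo (conv \<alpha>) UNIV"
abbreviation "Vd \<equiv> pot (conv \<delta>) UNIV"
abbreviation "Va \<equiv> pot (conv \<alpha>) UNIV"
abbreviation "Up \<equiv> pot (conv \<delta>) S"
abbreviation "Um \<equiv> pot (conv \<alpha>) (- S)"
abbreviation "Kd \<equiv> exitop (conv \<delta>) S"
abbreviation "Ku \<equiv> exitop (conv \<alpha>) (- S)"

lemma kern_\<delta>: "kern (conv \<delta>)" and kern_\<alpha>: "kern (conv \<alpha>)"
  by (rule kern_conv[OF \<delta>], rule kern_conv[OF \<alpha>])

lemma UNIV_in_borel: "UNIV \<in> sets (borel :: real measure)" by simp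

lemma half_line_sets: "S \<in> sets borel" "- S \<in> sets borel" by auto

text \<open>Positions referred to below: 1 \<open>Up\<close>, 2 \<open>Um\<close>, 3
  \<open>Vd\<close>, 4 \<open>Va\<close>, 5 \<open>Kd\<close>, 6 \<open>Ku\<close>, 7
  \<open>Rd\<close>, 8 \<open>Ra\<close>; the same for \<open>operators_measurable\<close>.\<close>

lemmas operators_linop = linop_pot[OF kern_\<delta> half_line_sets(1)] linop_pot[OF kern_\<alpha> half_line_sets(2)] linop_pot[OF kern_\<delta> UNIV_in_borel]
  linop_pot[OF kern_\<alpha> UNIV_in_borel] linop_exitop[OF kern_\<delta> half_line_sets(1)] linop_exitop[OF kern_\<alpha> half_line_sets(2)]
  linop_taboo[OF kern_\<delta> UNIV_in_borel] linop_taboo[OF kern_\<alpha> UNIV_in_borel]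

lemmas operators_measurable = operators_linop[THEN linop_measurable]

lemma dir_d: "AE y in \<delta>. 0 \<le> - 1 * y" and dir_a: "AE y in \<alpha>. 0 \<le> 1 * y"
  using \<delta>_le \<alpha>_ge by auto

lemma AE_a: "c \<le> x \<Longrightarrow> AE y in conv \<alpha> x. c \<le> y"
  using AE_conv_monotone[OF \<alpha>(2) dir_a, of x] by (auto elim!: eventually_mono)

lemma AE_d': "x < c \<Longrightarrow> AE y in conv \<delta> x. y < c"
  using AE_conv_monotone[OF \<delta>(2) dir_d, of x] by (auto elim!: eventually_mono)

lemma AE_a': "c < x \<Longrightarrow> AE y in conv \<alpha> x. c < y"
  using AE_conv_monotone[OF \<alpha>(2) dir_a, of x] by (auto elim!: eventually_mono)

text \<open>The renewal bound, sharpened by monotonicity: from above \<open>b\<close> the ascending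
  walk never reaches the interval. This cutoff is what makes the function integrable against
  \<nu>.\<close>

lemma Va_bound: "\<exists>C\<ge>0. \<forall>x. Va (indicator {- b..b}) x \<le> ennreal C * indicator {..b} x"
proof -
  obtain C where C: "0 \<le> C" "\<And>x. Va (indicator {- b..b}) x \<le> ennreal C"
    using renewal_bound[OF \<alpha> _ dir_a \<alpha>_nontriv] by blast
  have "Va (indicator {- b..b}) x = 0" if "b < x" for x
  proof -
    have "Va (indicator {- b..b}) x = Va (\<lambda>_. 0) x"
      by (rule pot_cong_on[where Z = "{b<..}"]) (use that AE_a' in auto)
    then show ?thesis by (simp add: pot_zero_fun)
  qed
  then show ?thesis using C by (intro exI[of _ C]) (auto simp: indicator_def not_le)
qed

lemma Vd_bound: "\<exists>C\<ge>0. \<forall>x. Vd (indicator {- b..b}) x \<le> ennreal C * indicator {- b..} x"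
proof -
  obtain C where C: "0 \<le> C" "\<And>x. Vd (indicator {- b..b}) x \<le> ennreal C"
    using renewal_bound[OF \<delta> _ dir_d \<delta>_nontriv] by blast
  have "Vd (indicator {- b..b}) x = 0" if "x < - b" for x
  proof -
    have "Vd (indicator {- b..b}) x = Vd (\<lambda>_. 0) x"
      by (rule pot_cong_on[where Z = "{..< - b}"]) (use that AE_d' in auto)
    then show ?thesis by (simp add: pot_zero_fun)
  qed
  then show ?thesis using C by (intro exI[of _ C]) (auto simp: indicator_def not_le)
qed

lemma Va_nonneg: "x \<in> S \<Longrightarrow> (\<And>y. y \<in> S \<Longrightarrow> f y = g y) \<Longrightarrow> Va f x = Va g x"
  by (rule pot_cong_on[where Z = S]) (use AE_a in auto)

lemma Vd_neg: "x \<notin> S \<Longrightarrow> (\<And>y. y \<notin> S \<Longrightarrow> f y = g y) \<Longrightarrow> Vd f x = Vd g x"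
  by (rule pot_cong_on[where Z = "- S"]) (use AE_d' in \<open>auto simp: not_le\<close>)

end

section \<open>Occupation measures of an invariant measure\<close>

locale two_sided_inv = two_sided +
  fixes \<nu> :: "real measure"
  assumes sets_\<nu>: "sets \<nu> = sets borel" and \<nu>_S: "AE x in \<nu>. x \<in> S"
    and \<nu>_fin: "\<And>b. emeasure \<nu> {..b} < top"
    and \<nu>_inv: "\<And>f. f \<in> BM \<Longrightarrow> (\<integral>\<^sup>+x. Kd (Ku f) x \<partial>\<nu>) = (\<integral>\<^sup>+x. f x \<partial>\<nu>)"
begin

lemma I_add: "f \<in> BM \<Longrightarrow> g \<in> BM \<Longrightarrow> (\<integral>\<^sup>+x. f x + g x \<partial>\<nu>) = (\<integral>\<^sup>+x. f x \<partial>\<nu>) + (\<integral>\<^sup>+x. g x \<partial>\<nu>)"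
  by (intro nn_integral_add measurable_borel_sets[OF sets_\<nu>])

lemma I_cmult: "f \<in> BM \<Longrightarrow> (\<integral>\<^sup>+x. c * f x \<partial>\<nu>) = c * (\<integral>\<^sup>+x. f x \<partial>\<nu>)"
  by (intro nn_integral_cmult measurable_borel_sets[OF sets_\<nu>])

lemma \<nu>_indicator: "(\<integral>\<^sup>+x. indicator {..b} x \<partial>\<nu>) = emeasure \<nu> {..b}"
  using sets_\<nu> by simp

lemma Ku_half: "\<exists>b. \<forall>y. y \<notin> S \<longrightarrow> - a \<le> y \<longrightarrow> ennreal (1 / 2) \<le> Ku (indicator {..b}) y"
proof -
  obtain b where "\<forall>x\<in>- S. - a \<le> 1 * x \<longrightarrow> ennreal (1 / 2) \<le> Ku (indicator {z. 1 * z \<le> b}) x"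
    using exit_one_sided[OF \<alpha> _ dir_a \<alpha>_nontriv half_line_sets(2)] by auto
  moreover have "{z. 1 * z \<le> b} = {..b}" by auto
  ultimately have "\<forall>x\<in>- S. - a \<le> x \<longrightarrow> ennreal (1 / 2) \<le> Ku (indicator {..b}) x" by simp
  then show ?thesis by (intro exI[of _ b]) blast
qed

text \<open>On [- a, 0) the occupation is at most \<open>C\<close>, while the return lands in {..b}
  with probability at least 1/2; so by the maximum principle the occupation is everywhere at most 2
  C times that return probability. Integrating, invariance turns the bound into 2 C times the mass
  of {..b} under \<nu>.\<close>

lemma mm_fin: "(\<integral>\<^sup>+x. Kd (Um (indicator {- a..})) x \<partial>\<nu>) < top"
proof -
  obtain C where C: "0 \<le> C" "\<And>x. x \<notin> S \<Longrightarrow> - a \<le> x \<Longrightarrow> Um (\<lambda>_. 1) x \<le> ennreal C"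
    using pot_one_bound[OF \<alpha> _ dir_a \<alpha>_nontriv half_line_sets(2), of a] by auto
  obtain b where b: "\<And>y. y \<notin> S \<Longrightarrow> - a \<le> y \<Longrightarrow> ennreal (1 / 2) \<le> Ku (indicator {..b}) y"
    using Ku_half by blast
  define \<psi> where "\<psi> = Ku (indicator {..b})"
  have ib: "(indicator {..b} :: real \<Rightarrow> ennreal) \<in> BM" "(indicator {- a..} :: real \<Rightarrow> ennreal) \<in> BM" by auto
  have \<psi>: "\<psi> \<in> BM" unfolding \<psi>_def by (intro operators_measurable ib)
  have \<psi>2: "(\<lambda>x. ennreal (2 * C) * \<psi> x) \<in> BM" using \<psi> by simp
  have le: "Um (indicator {- a..}) x \<le> ennreal (2 * C) * \<psi> x" if "x \<in> - S" for x
  proof (rule pot_max_principle[OF kern_\<alpha> half_line_sets(2) _ \<psi>2 _ _ that])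
    fix x
    have "taboo (conv \<alpha>) (- S) \<psi> x \<le> \<psi> x"
      unfolding \<psi>_def using exitop_unfold[OF kern_\<alpha> half_line_sets(2) ib(1), of x] by simp
    then show "taboo (conv \<alpha>) (- S) (\<lambda>x. ennreal (2 * C) * \<psi> x) x \<le> ennreal (2 * C) * \<psi> x"
      by (simp add: linop_cmult[OF linop_taboo[OF kern_\<alpha> half_line_sets(2)] \<psi>] mult_left_mono)
  next
    fix x assume x: "x \<in> - S" "x \<in> {- a..}"
    have "Um (indicator {- a..}) x \<le> Um (\<lambda>_. 1) x"
      by (rule linop_mono[OF operators_linop(2) ib(2)]) (auto simp: indicator_def)
    also have "\<dots> \<le> ennreal C" using C x by auto
    also have "\<dots> = ennreal (2 * C) * ennreal (1 / 2)"
      using C(1) by (subst ennreal_mult[symmetric]) auto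
    also have "\<dots> \<le> ennreal (2 * C) * \<psi> x"
      unfolding \<psi>_def using b x by (intro mult_left_mono) auto
    finally show "Um (indicator {- a..}) x \<le> ennreal (2 * C) * \<psi> x" .
  qed auto
  have "(\<integral>\<^sup>+x. Kd (Um (indicator {- a..})) x \<partial>\<nu>) \<le> (\<integral>\<^sup>+x. ennreal (2 * C) * Kd \<psi> x \<partial>\<nu>)"
  proof (rule nn_integral_mono)
    fix x
    have "Kd (Um (indicator {- a..})) x \<le> Kd (\<lambda>x. ennreal (2 * C) * \<psi> x) x"
      by (rule exitop_mono[OF kern_\<delta> half_line_sets(1) operators_measurable(2)[OF ib(2)] \<psi>2]) (use le in auto)
    then show "Kd (Um (indicator {- a..})) x \<le> ennreal (2 * C) * Kd \<psi> x"
      by (simp add: linop_cmult[OF operators_linop(5) \<psi>])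
  qed
  also have "\<dots> = ennreal (2 * C) * emeasure \<nu> {..b}"
    unfolding I_cmult[OF operators_measurable(5)[OF \<psi>]] unfolding \<psi>_def \<nu>_inv[OF ib(1)] \<nu>_indicator ..
  also have "\<dots> < top" using \<nu>_fin by (simp add: ennreal_mult_less_top)
  finally show ?thesis .
qed

text \<open>As for \<open>mm_fin\<close>, one crossing earlier: from [0, b] the walk lands at or
  above - b1 with probability at least 1/2, and from there returns to {..b2} with probability at
  least 1/2, whence the constant 4 C.\<close>

lemma mp_fin: "(\<integral>\<^sup>+x. Up (indicator {..b}) x \<partial>\<nu>) < top"
proof -
  obtain C where C: "0 \<le> C" "\<And>x. x \<in> S \<Longrightarrow> x \<le> b \<Longrightarrow> Up (\<lambda>_. 1) x \<le> ennreal C"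
    using pot_one_bound[OF \<delta> _ dir_d \<delta>_nontriv half_line_sets(1), of b] by auto
  obtain b1 where b1: "\<And>x. x \<in> S \<Longrightarrow> x \<le> b \<Longrightarrow> ennreal (1 / 2) \<le> Kd (indicator {z. - 1 * z \<le> b1}) x"
  proof -
    obtain b1 where "\<forall>x\<in>S. - b \<le> - 1 * x \<longrightarrow> ennreal (1 / 2) \<le> Kd (indicator {z. - 1 * z \<le> b1}) x"
      using exit_one_sided[OF \<delta> _ dir_d \<delta>_nontriv half_line_sets(1), of b] by auto
    then show ?thesis by (intro that[of b1]) (auto simp del: Hp_iff)
  qed
  obtain b2 where b2: "\<And>y. y \<notin> S \<Longrightarrow> - b1 \<le> y \<Longrightarrow> ennreal (1 / 2) \<le> Ku (indicator {..b2}) y"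
    using Ku_half by blast
  define \<psi> where "\<psi> = Ku (indicator {..b2})"
  have ib: "(indicator {..b2} :: real \<Rightarrow> ennreal) \<in> BM" "(indicator {..b} :: real \<Rightarrow> ennreal) \<in> BM"
    "(indicator {z. - 1 * z \<le> b1} :: real \<Rightarrow> ennreal) \<in> BM" by auto
  have \<psi>: "\<psi> \<in> BM" unfolding \<psi>_def by (intro operators_measurable ib)
  have K: "Kd \<psi> \<in> BM" by (intro operators_measurable \<psi>)
  have K2: "(\<lambda>x. ennreal (4 * C) * Kd \<psi> x) \<in> BM" using K by simp
  have le: "Up (indicator {..b}) x \<le> ennreal (4 * C) * Kd \<psi> x" if "x \<in> S" for x
  proof (rule pot_max_principle[OF kern_\<delta> half_line_sets(1) _ K2 _ _ that])
    fix x
    have "taboo (conv \<delta>) S (Kd \<psi>) x \<le> Kd \<psi> x"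
      using exitop_unfold[OF kern_\<delta> half_line_sets(1) \<psi>, of x] by simp
    then show "taboo (conv \<delta>) S (\<lambda>x. ennreal (4 * C) * Kd \<psi> x) x \<le> ennreal (4 * C) * Kd \<psi> x"
      by (simp add: linop_cmult[OF linop_taboo[OF kern_\<delta> half_line_sets(1)] K] mult_left_mono)
  next
    fix x assume x: "x \<in> S" "x \<in> {..b}"
    have "Up (indicator {..b}) x \<le> Up (\<lambda>_. 1) x"
      by (rule linop_mono[OF operators_linop(1) ib(2)]) (auto simp: indicator_def)
    also have "\<dots> \<le> ennreal C" using C x by auto
    also have "\<dots> = ennreal (4 * C) * (ennreal (1 / 2) * ennreal (1 / 2))"
      using C(1) by (simp only: ennreal_mult[symmetric]) (auto simp: ennreal_mult[symmetric] simp del: inverse_eq_divide)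
    also have "\<dots> \<le> ennreal (4 * C) * Kd \<psi> x"
    proof (rule mult_left_mono)
      have "ennreal (1 / 2) * ennreal (1 / 2) \<le> ennreal (1 / 2) * Kd (indicator {z. - 1 * z \<le> b1}) x"
        using b1 x by (intro mult_left_mono) auto
      also have "\<dots> = Kd (\<lambda>z. ennreal (1 / 2) * indicator {z. - 1 * z \<le> b1} z) x"
        by (rule linop_cmult[OF operators_linop(5) ib(3), symmetric])
      also have "\<dots> \<le> Kd \<psi> x"
        by (rule exitop_mono[OF kern_\<delta> half_line_sets(1) _ \<psi>]) (use ib b2 in \<open>auto simp: \<psi>_def indicator_def\<close>)
      finally show "ennreal (1 / 2) * ennreal (1 / 2) \<le> Kd \<psi> x" .
    qed simp
    finally show "Up (indicator {..b}) x \<le> ennreal (4 * C) * Kd \<psi> x" .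
  qed auto
  have "(\<integral>\<^sup>+x. Up (indicator {..b}) x \<partial>\<nu>) \<le> (\<integral>\<^sup>+x. ennreal (4 * C) * Kd \<psi> x \<partial>\<nu>)"
    by (rule nn_integral_mono_AE) (use \<nu>_S in eventually_elim, rule le)
  also have "\<dots> = ennreal (4 * C) * emeasure \<nu> {..b2}"
    unfolding I_cmult[OF operators_measurable(5)[OF \<psi>]] unfolding \<psi>_def \<nu>_inv[OF ib(1)] \<nu>_indicator ..
  also have "\<dots> < top" using \<nu>_fin by (simp add: ennreal_mult_less_top)
  finally show ?thesis .
qed

text \<open>Duality with the renewal operators turns an invariant measure \<open>\<nu>\<close> of the overshoots into a measure \<open>M\<close> that is
  invariant under both renewal steps. If \<open>\<nu>\<close> is the measure of the theorem, then \<open>M\<close> is the Haar measure.\<close>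

definition \<Phi> where "\<Phi> f x = Up (Va f) x + Kd (Um (Vd f)) x"

definition M where "M = act \<nu> \<Phi>"

lemma linop_\<Phi>: "linop \<Phi>"
proof -
  have "linop (\<lambda>f. Up (Va f))" by (rule linop_comp[OF operators_linop(1,4)])
  moreover have "linop (\<lambda>f. Kd (Um (Vd f)))"
    by (rule linop_comp[OF operators_linop(5) linop_comp[OF operators_linop(2,3)]])
  ultimately have "linop (\<lambda>f x. Up (Va f) x + Kd (Um (Vd f)) x)" by (rule linop_plus)
  then show ?thesis by (simp add: \<Phi>_def[abs_def])
qed

lemma sets_M: "sets M = sets borel" by (simp add: M_def)

lemma nn_integral_M:
  assumes "f \<in> BM"
  shows "(\<integral>\<^sup>+x. f x \<partial>M) = (\<integral>\<^sup>+x. Up (Va f) x \<partial>\<nu>) + (\<integral>\<^sup>+x. Kd (Um (Vd f)) x \<partial>\<nu>)"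
  unfolding M_def nn_integral_act[OF linop_\<Phi> sets_\<nu> assms] unfolding \<Phi>_def
  by (intro I_add operators_measurable assms)

lemma Va_\<nu>_fin: "b \<ge> 0 \<Longrightarrow> f \<in> BM \<Longrightarrow> (\<And>x. f x \<le> indicator {- b..b} x) \<Longrightarrow> (\<integral>\<^sup>+x. Va f x \<partial>\<nu>) < top"
proof -
  assume f: "f \<in> BM" "\<And>x. f x \<le> indicator {- b..b} x"
  obtain C where C: "0 \<le> C" "\<And>x. Va (indicator {- b..b}) x \<le> ennreal C * indicator {..b} x"
    using Va_bound by blast
  have "(\<integral>\<^sup>+x. Va f x \<partial>\<nu>) \<le> (\<integral>\<^sup>+x. ennreal C * indicator {..b} x \<partial>\<nu>)"
    by (intro nn_integral_mono order_trans[OF linop_mono[OF operators_linop(4) f(1) _ f(2)] C(2)]) simp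
  also have "\<dots> = ennreal C * emeasure \<nu> {..b}" by (simp add: I_cmult \<nu>_indicator)
  also have "\<dots> < top" using \<nu>_fin by (simp add: ennreal_mult_less_top)
  finally show ?thesis .
qed

lemma Kd_Vd_fin: "b \<ge> 0 \<Longrightarrow> f \<in> BM \<Longrightarrow> (\<And>x. f x \<le> indicator {- b..b} x) \<Longrightarrow> (\<integral>\<^sup>+x. Kd (Vd f) x \<partial>\<nu>) < top"
proof -
  assume f: "f \<in> BM" "\<And>x. f x \<le> indicator {- b..b} x"
  obtain C where C: "0 \<le> C" "\<And>x. Vd (indicator {- b..b}) x \<le> ennreal C * indicator {- b..} x"
    using Vd_bound by blast
  have ib: "(indicator {- b..} :: real \<Rightarrow> ennreal) \<in> BM" by simp
  have "(\<integral>\<^sup>+x. Kd (Vd f) x \<partial>\<nu>) \<le> (\<integral>\<^sup>+x. ennreal C * Kd (Um (indicator {- b..})) x \<partial>\<nu>)"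
  proof (rule nn_integral_mono)
    fix x
    have "Kd (Vd f) x \<le> Kd (\<lambda>x. ennreal C * Um (indicator {- b..}) x) x"
    proof (rule linop_mono[OF operators_linop(5)])
      fix y
      have "Vd f y \<le> Vd (indicator {- b..b}) y" by (rule linop_mono[OF operators_linop(3) f(1) _ f(2)]) simp
      also have "\<dots> \<le> ennreal C * indicator {- b..} y" by (rule C)
      \<comment> \<open>Time 0 counts in the occupation, so \<open>Um\<close> dominates the identity
        and \<open>mm_fin\<close> becomes applicable.\<close>
      also have "\<dots> \<le> ennreal C * Um (indicator {- b..}) y"
        by (rule mult_left_mono) (simp_all add: pot_unfold[OF kern_\<alpha> half_line_sets(2) ib])
      finally show "Vd f y \<le> ennreal C * Um (indicator {- b..}) y" .
    qed (use operators_measurable(2)[OF ib] in \<open>auto intro: operators_measurable(3) f\<close>)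
    then show "Kd (Vd f) x \<le> ennreal C * Kd (Um (indicator {- b..})) x"
      by (simp add: linop_cmult[OF operators_linop(5) operators_measurable(2)[OF ib]])
  qed
  also have "\<dots> = ennreal C * (\<integral>\<^sup>+x. Kd (Um (indicator {- b..})) x \<partial>\<nu>)"
    by (rule I_cmult) (intro operators_measurable ib)
  also have "\<dots> < top" using mm_fin by (simp add: ennreal_mult_less_top)
  finally show ?thesis .
qed

lemma bdd_finite_M: "bdd_finite M"
  unfolding bdd_finite_def
proof (intro conjI allI)
  show "sets M = sets borel" by (rule sets_M)
  fix a b :: real
  define c where "c = max \<bar>a\<bar> \<bar>b\<bar>"
  obtain C where C: "0 \<le> C" "\<And>x. Va (indicator {- c..c}) x \<le> ennreal C * indicator {..c} x"
    using Va_bound by blast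
  obtain D where D: "0 \<le> D" "\<And>x. Vd (indicator {- c..c}) x \<le> ennreal D * indicator {- c..} x"
    using Vd_bound by blast
  have ib: "(indicator {..c} :: real \<Rightarrow> ennreal) \<in> BM" "(indicator {- c..} :: real \<Rightarrow> ennreal) \<in> BM"
    "(indicator {- c..c} :: real \<Rightarrow> ennreal) \<in> BM" by auto
  have "emeasure M {a..b} \<le> emeasure M {- c..c}"
    using sets_M by (intro emeasure_mono) (auto simp: c_def)
  also have "\<dots> = (\<integral>\<^sup>+x. indicator {- c..c} x \<partial>M)" using sets_M by simp
  also have "\<dots> = (\<integral>\<^sup>+x. Up (Va (indicator {- c..c})) x \<partial>\<nu>) + (\<integral>\<^sup>+x. Kd (Um (Vd (indicator {- c..c}))) x \<partial>\<nu>)"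
    by (rule nn_integral_M) simp
  also have "\<dots> \<le> (\<integral>\<^sup>+x. ennreal C * Up (indicator {..c}) x \<partial>\<nu>) + (\<integral>\<^sup>+x. ennreal D * Kd (Um (indicator {- c..})) x \<partial>\<nu>)"
  proof (intro add_mono nn_integral_mono)
    fix x
    show "Up (Va (indicator {- c..c})) x \<le> ennreal C * Up (indicator {..c}) x"
      unfolding linop_cmult[OF operators_linop(1) ib(1), symmetric]
      by (rule linop_mono[OF operators_linop(1) operators_measurable(4)[OF ib(3)] _ C(2)]) simp
    have "Um (Vd (indicator {- c..c})) y \<le> ennreal D * Um (indicator {- c..}) y" for y
      unfolding linop_cmult[OF operators_linop(2) ib(2), symmetric]
      by (rule linop_mono[OF operators_linop(2) operators_measurable(3)[OF ib(3)] _ D(2)]) simp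
    then show "Kd (Um (Vd (indicator {- c..c}))) x \<le> ennreal D * Kd (Um (indicator {- c..})) x"
      unfolding linop_cmult[OF operators_linop(5) operators_measurable(2)[OF ib(2)], symmetric]
      by (intro linop_mono[OF operators_linop(5) operators_measurable(2)[OF operators_measurable(3)[OF ib(3)]]])
         (use operators_measurable(2)[OF ib(2)] in auto)
  qed
  also have "\<dots> = ennreal C * (\<integral>\<^sup>+x. Up (indicator {..c}) x \<partial>\<nu>) + ennreal D * (\<integral>\<^sup>+x. Kd (Um (indicator {- c..})) x \<partial>\<nu>)"
    by (simp add: I_cmult[OF operators_measurable(1)[OF ib(1)]] I_cmult[OF operators_measurable(5)[OF operators_measurable(2)[OF ib(2)]]])
  also have "\<dots> < top" using mp_fin mm_fin by (simp add: ennreal_mult_less_top)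
  finally show "emeasure M {a..b} < top" .
qed

lemma Va_Rd: "f \<in> BM \<Longrightarrow> Va (Rd f) = Rd (Va f)"
  and Vd_Ra: "f \<in> BM \<Longrightarrow> Vd (Ra f) = Ra (Vd f)"
  by (intro ext pot_commute kern_\<alpha> kern_\<delta> UNIV_in_borel operators_linop taboo_conv_commute \<delta> \<alpha>; assumption)+

text \<open>Steps of the two laws commute, so \<open>Rd\<close> can be moved next to
  \<open>Up\<close>, where the balance at the exit from \<open>S\<close> applies;
  \<open>Kd (Va f)\<close> is then split at the return to \<open>S\<close>. Invariance of \<nu> will
  cancel the last summand against \<open>Va f\<close>.\<close>

lemma Up_Va_Rd:
  assumes f: "f \<in> BM"
  shows "Up (Va (Rd f)) x + Va f x = Up (Va f) x + Kd (Um f) x + Kd (Ku (Va f)) x"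
proof -
  have "Up (Va (Rd f)) x + Va f x = Up (Va f) x + Kd (Va f) x"
    unfolding Va_Rd[OF f] by (rule pot_taboo_compl[OF kern_\<delta> half_line_sets(1) operators_measurable(4)[OF f]])
  also have "Va f = (\<lambda>y. Um f y + Ku (Va f) y)"
    using pot_exitop[OF kern_\<alpha> half_line_sets(2) f] by auto
  then have "Kd (Va f) x = Kd (Um f) x + Kd (Ku (Va f)) x"
    using linop_add[OF operators_linop(5) operators_measurable(2)[OF f] operators_measurable(6)[OF operators_measurable(4)[OF f]]] by metis
  finally show ?thesis by (simp add: add.assoc)
qed

lemma mp_Rd:
  assumes f: "f \<in> BM" and b: "0 \<le> b" "\<And>x. f x \<le> indicator {- b..b} x"
  shows "(\<integral>\<^sup>+x. Up (Va (Rd f)) x \<partial>\<nu>) = (\<integral>\<^sup>+x. Up (Va f) x \<partial>\<nu>) + (\<integral>\<^sup>+x. Kd (Um f) x \<partial>\<nu>)"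
proof -
  have "(\<integral>\<^sup>+x. Up (Va (Rd f)) x \<partial>\<nu>) + (\<integral>\<^sup>+x. Va f x \<partial>\<nu>)
      = (\<integral>\<^sup>+x. Up (Va f) x + Kd (Um f) x + Kd (Ku (Va f)) x \<partial>\<nu>)"
    using Up_Va_Rd[OF f] by (subst I_add[symmetric]) (auto intro: operators_measurable f)
  also have "\<dots> = (\<integral>\<^sup>+x. Up (Va f) x \<partial>\<nu>) + (\<integral>\<^sup>+x. Kd (Um f) x \<partial>\<nu>) + (\<integral>\<^sup>+x. Va f x \<partial>\<nu>)"
    by (subst I_add, intro borel_measurable_add operators_measurable f, intro operators_measurable f, subst I_add, intro operators_measurable f, intro operators_measurable f)
       (simp add: \<nu>_inv operators_measurable f)
  finally show ?thesis
    using Va_\<nu>_fin[OF b(1) f b(2)] by (auto simp: add.commute[of _ "\<integral>\<^sup>+x. Va f x \<partial>\<nu>"] ennreal_add_left_cancel)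
qed

text \<open>Under a \<delta>-step the upper summand of \<open>M\<close> gains the integral of
  \<open>Kd (Um f)\<close>, by \<open>mp_Rd\<close>; the lower one loses the same amount, as Vd f =
  f + Vd (Rd f).\<close>

lemma M_Rd_bounded:
  assumes f: "f \<in> BM" and b: "0 \<le> b" "\<And>x. f x \<le> indicator {- b..b} x"
  shows "(\<integral>\<^sup>+x. Rd f x \<partial>M) = (\<integral>\<^sup>+x. f x \<partial>M)"
proof -
  have "Vd f = (\<lambda>y. f y + Vd (Rd f) y)" using pot_unfold_right[OF kern_\<delta> UNIV_in_borel f] by auto
  then have "Um (Vd f) = (\<lambda>y. Um f y + Um (Vd (Rd f)) y)"
    using linop_add[OF operators_linop(2) f operators_measurable(3)[OF operators_measurable(7)[OF f]]] by metis
  then have "Kd (Um (Vd f)) x = Kd (Um f) x + Kd (Um (Vd (Rd f))) x" for x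
    using linop_add[OF operators_linop(5) operators_measurable(2)[OF f] operators_measurable(2)[OF operators_measurable(3)[OF operators_measurable(7)[OF f]]]] by metis
  then have "(\<integral>\<^sup>+x. Kd (Um (Vd f)) x \<partial>\<nu>) = (\<integral>\<^sup>+x. Kd (Um f) x \<partial>\<nu>) + (\<integral>\<^sup>+x. Kd (Um (Vd (Rd f))) x \<partial>\<nu>)"
    by (simp add: I_add operators_measurable f)
  then show ?thesis
    by (simp add: nn_integral_M f operators_measurable mp_Rd[OF f b] add.assoc)
qed

text \<open>Mirror image: the upper summand loses the integral of \<open>Up f\<close> and the lower
  one gains it. Here invariance is applied to \<open>Vd f\<close>, which is split at the exit from
  \<open>S\<close>, and \<open>Kd_Vd_fin\<close> permits the cancellation.\<close>

lemma M_Ra_bounded: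
  assumes f: "f \<in> BM" and b: "0 \<le> b" "\<And>x. f x \<le> indicator {- b..b} x"
  shows "(\<integral>\<^sup>+x. Ra f x \<partial>M) = (\<integral>\<^sup>+x. f x \<partial>M)"
proof -
  let ?g = "Vd f"
  have g: "?g \<in> BM" by (intro operators_measurable f)
  have "Va f = (\<lambda>y. f y + Va (Ra f) y)" using pot_unfold_right[OF kern_\<alpha> UNIV_in_borel f] by auto
  then have "Up (Va f) x = Up f x + Up (Va (Ra f)) x" for x
    using linop_add[OF operators_linop(1) f operators_measurable(4)[OF operators_measurable(8)[OF f]]] by metis
  then have 1: "(\<integral>\<^sup>+x. Up (Va f) x \<partial>\<nu>) = (\<integral>\<^sup>+x. Up f x \<partial>\<nu>) + (\<integral>\<^sup>+x. Up (Va (Ra f)) x \<partial>\<nu>)"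
    by (simp add: I_add operators_measurable f)
  have "(\<lambda>y. Um (Ra ?g) y + ?g y) = (\<lambda>y. Um ?g y + Ku ?g y)"
    using pot_taboo_compl[OF kern_\<alpha> half_line_sets(2) g] by auto
  then have "Kd (Um (Ra ?g)) x + Kd ?g x = Kd (Um ?g) x + Kd (Ku ?g) x" for x
    using linop_add[OF operators_linop(5) operators_measurable(2)[OF operators_measurable(8)[OF g]] g] linop_add[OF operators_linop(5) operators_measurable(2)[OF g] operators_measurable(6)[OF g]]
    by metis
  then have "(\<integral>\<^sup>+x. Kd (Um (Ra ?g)) x \<partial>\<nu>) + (\<integral>\<^sup>+x. Kd ?g x \<partial>\<nu>) = (\<integral>\<^sup>+x. Kd (Um ?g) x \<partial>\<nu>) + (\<integral>\<^sup>+x. Kd (Ku ?g) x \<partial>\<nu>)"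
    by (subst (1 2) I_add[symmetric]) (auto intro: operators_measurable g)
  also have "(\<integral>\<^sup>+x. Kd (Ku ?g) x \<partial>\<nu>) = (\<integral>\<^sup>+x. ?g x \<partial>\<nu>)" by (rule \<nu>_inv[OF g])
  also have "\<dots> = (\<integral>\<^sup>+x. Up f x \<partial>\<nu>) + (\<integral>\<^sup>+x. Kd ?g x \<partial>\<nu>)"
    using I_add[OF operators_measurable(1)[OF f] operators_measurable(5)[OF g]] by (simp add: pot_exitop[OF kern_\<delta> half_line_sets(1) f, symmetric])
  finally have "(\<integral>\<^sup>+x. Kd (Um (Ra ?g)) x \<partial>\<nu>) = (\<integral>\<^sup>+x. Kd (Um ?g) x \<partial>\<nu>) + (\<integral>\<^sup>+x. Up f x \<partial>\<nu>)"
    using less_imp_neq[OF Kd_Vd_fin[OF b(1) f b(2)]]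
    by (simp add: add.commute[of _ "\<integral>\<^sup>+x. Kd ?g x \<partial>\<nu>"] add.assoc[symmetric] ennreal_add_left_cancel)
  then show ?thesis
    by (simp add: nn_integral_M f operators_measurable Vd_Ra 1 ac_simps)
qed

lemma M_Rd: "f \<in> BM \<Longrightarrow> (\<integral>\<^sup>+x. Rd f x \<partial>M) = (\<integral>\<^sup>+x. f x \<partial>M)"
proof -
  have "act M Rd = M"
    by (rule measure_eqI_bounded_fun)
       (simp_all add: sets_M nn_integral_act[OF operators_linop(7) sets_M] M_Rd_bounded)
  then show "f \<in> BM \<Longrightarrow> (\<integral>\<^sup>+x. Rd f x \<partial>M) = (\<integral>\<^sup>+x. f x \<partial>M)"
    using nn_integral_act[OF operators_linop(7) sets_M, of f] by simp
qed

lemma M_Ra: "f \<in> BM \<Longrightarrow> (\<integral>\<^sup>+x. Ra f x \<partial>M) = (\<integral>\<^sup>+x. f x \<partial>M)"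
proof -
  have "act M Ra = M"
    by (rule measure_eqI_bounded_fun)
       (simp_all add: sets_M nn_integral_act[OF operators_linop(8) sets_M] M_Ra_bounded)
  then show "f \<in> BM \<Longrightarrow> (\<integral>\<^sup>+x. Ra f x \<partial>M) = (\<integral>\<^sup>+x. f x \<partial>M)"
    using nn_integral_act[OF operators_linop(8) sets_M, of f] by simp
qed

end

lemma linop_mult:
  assumes "linop \<Phi>" "g \<in> BM"
  shows "linop (\<lambda>f x. g x * \<Phi> f x)"
  unfolding linop_def
proof (intro conjI ballI allI impI)
  show "f \<in> BM \<Longrightarrow> (\<lambda>x. g x * \<Phi> f x) \<in> BM" for f
    by (rule borel_measurable_times_ennreal[OF assms(2) linop_measurable[OF assms(1)]])
  show "f \<in> BM \<Longrightarrow> g x * \<Phi> (\<lambda>y. c * f y) x = c * (g x * \<Phi> f x)" for f c x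
    by (simp add: linop_cmult[OF assms(1)] ac_simps)
  show "\<forall>i. F i \<in> BM \<Longrightarrow> g x * \<Phi> (\<lambda>y. \<Sum>i. F i y) x = (\<Sum>i. g x * \<Phi> (F i) x)"
    for F :: "nat \<Rightarrow> real \<Rightarrow> ennreal" and x
    by (simp add: linop_suminf[OF assms(1)])
qed

lemma one_sided_choquet_deny_neg:
  assumes M: "bdd_finite M" and p: "prob_space p" "sets p = sets borel" and nonpos: "AE y in p. y \<le> 0"
    and inv: "\<And>g. g \<in> BM \<Longrightarrow> (\<integral>\<^sup>+z. (\<integral>\<^sup>+y. g (z + y) \<partial>p) \<partial>M) = (\<integral>\<^sup>+z. g z \<partial>M)"
  shows "AE h in p. distr M borel (\<lambda>z. z + h) = M"
proof -
  have sM [measurable_cong]: "sets M = sets borel" using M by (auto simp: bdd_finite_def)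
  note [measurable_cong] = p(2)
  interpret prob_space p by fact
  interpret sigma_finite_measure M by (rule bdd_finite_sigma_finite[OF M])
  define M' where "M' = distr M borel uminus"
  define p' where "p' = distr p borel uminus"
  have "AE h in p'. distr M' borel (\<lambda>z. z + h) = M'"
  proof (rule one_sided_choquet_deny)
    show "bdd_finite M'"
      unfolding bdd_finite_def
    proof (intro conjI allI)
      show "sets M' = sets borel" by (simp add: M'_def)
      fix a b
      have "emeasure M' {a..b} = emeasure M {- b..- a}"
        unfolding M'_def using sets_eq_imp_space_eq[OF sM]
        by (subst emeasure_distr) (auto intro!: arg_cong[of _ _ "emeasure M"])
      then show "emeasure M' {a..b} < top" using M by (simp add: bdd_finite_def)
    qed
    show "prob_space p'" unfolding p'_def by (rule prob_space_distr) measurable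
    show "sets p' = sets borel" by (simp add: p'_def)
    show "AE y in p'. 0 \<le> y"
      unfolding p'_def using nonpos by (subst AE_distr_iff) auto
    fix g :: "real \<Rightarrow> ennreal" assume g [measurable]: "g \<in> BM"
    have "(\<integral>\<^sup>+z. (\<integral>\<^sup>+y. g (z + y) \<partial>p') \<partial>M') = (\<integral>\<^sup>+z. (\<integral>\<^sup>+y. g (- (z + y)) \<partial>p) \<partial>M)"
    proof -
      have *: "(\<integral>\<^sup>+y. g (z + y) \<partial>p') = (\<integral>\<^sup>+y. g (z - y) \<partial>p)" for z
        unfolding p'_def by (subst nn_integral_distr) auto
      have "(\<lambda>z. \<integral>\<^sup>+y. g (z - y) \<partial>p) \<in> BM" by measurable
      then show ?thesis
        unfolding * M'_def by (subst nn_integral_distr) (auto simp: add.commute)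
    qed
    also have "\<dots> = (\<integral>\<^sup>+z. g (- z) \<partial>M)" by (rule inv) measurable
    also have "\<dots> = (\<integral>\<^sup>+z. g z \<partial>M')"
      unfolding M'_def by (subst nn_integral_distr) auto
    finally show "(\<integral>\<^sup>+z. (\<integral>\<^sup>+y. g (z + y) \<partial>p') \<partial>M') = (\<integral>\<^sup>+z. g z \<partial>M')" .
  qed
  then have "AE h in p. distr M' borel (\<lambda>z. z + - h) = M'"
    unfolding p'_def by (rule AE_distrD[rotated]) measurable
  then show ?thesis
  proof eventually_elim
    case (elim h)
    have M_M': "M = distr M' borel uminus"
    proof -
      have "distr M' borel uminus = distr M borel (\<lambda>z. z)"
        unfolding M'_def by (subst distr_distr) (auto simp: comp_def)
      also have "\<dots> = M" by (rule distr_id2[OF sM[symmetric]])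
      finally show ?thesis ..
    qed
    have "distr M borel (\<lambda>z. z + h) = distr M borel (\<lambda>z. - (- z + - h))"
      by (simp add: add.commute)
    also have "\<dots> = distr (distr M' borel (\<lambda>z. z + - h)) borel uminus"
      unfolding M'_def by (subst distr_distr) (auto simp: comp_def distr_distr)
    also have "\<dots> = M" unfolding elim by (rule M_M'[symmetric])
    finally show ?case .
  qed
qed

context two_sided_inv
begin

lemma Kd_zero: "Kd (\<lambda>_. 0) x = 0"
  by (rule linop_zero[OF operators_linop(5)])

text \<open>On \<open>S\<close> only the upper summand of \<open>M\<close> lives, since a descending
  walk started below zero never enters \<open>S\<close>; and that summand does not charge the
  negative half-line, which an ascending walk from \<open>S\<close> never enters. So
  \<open>mp_Rd\<close>, applied to the part of \<open>f\<close> below zero, says that the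
  \<delta>-flow of \<open>M\<close> out of \<open>S\<close> is the lower occupation measure.\<close>

lemma Kd_Um_eq:
  assumes f: "f \<in> BM" and b: "0 \<le> b" "\<And>x. f x \<le> indicator {- b..b} x"
  shows "(\<integral>\<^sup>+x. Kd (Um f) x \<partial>\<nu>) = (\<integral>\<^sup>+x. indicator S x * taboo (conv \<delta>) (- S) f x \<partial>M)"
proof -
  define f' where "f' = (\<lambda>x. f x * indicator (- S) x)"
  have f': "f' \<in> BM" unfolding f'_def using f by simp
  have f'b: "f' x \<le> indicator {- b..b} x" for x using b(2)[of x] by (auto simp: f'_def indicator_def)
  have Rd: "taboo (conv \<delta>) (- S) f = Rd f'"
    unfolding f'_def by (auto simp: taboo_def fun_eq_iff)
  define g where "g = (\<lambda>x. indicator S x * Rd f' x)"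
  have g: "g \<in> BM" unfolding g_def using operators_measurable(7)[OF f'] by simp
  have "Kd (Um f) = Kd (Um f')"
    by (rule exitop_cong, rule pot_cong) (auto simp: f'_def)
  then have 1: "(\<integral>\<^sup>+x. Kd (Um f) x \<partial>\<nu>) = (\<integral>\<^sup>+x. Kd (Um f') x \<partial>\<nu>)" by simp
  have "Up (Va f') x = 0" if "x \<in> S" for x
  proof -
    have "Up (Va f') x = Up (\<lambda>_. 0) x"
    proof (rule pot_cong[OF _ that])
      fix y assume "y \<in> S"
      then have "Va f' y = Va (\<lambda>_. 0) y" by (rule Va_nonneg) (simp add: f'_def)
      then show "Va f' y = 0" by (simp add: pot_zero_fun)
    qed
    then show ?thesis by (simp add: pot_zero_fun)
  qed
  then have 2: "(\<integral>\<^sup>+x. Up (Va f') x \<partial>\<nu>) = 0"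
    using \<nu>_S by (subst nn_integral_0_iff_AE) (auto intro!: measurable_borel_sets[OF sets_\<nu>] operators_measurable f' elim!: eventually_mono)
  have "Kd (Um (Vd g)) = Kd (\<lambda>_. 0)"
  proof (rule exitop_cong)
    fix y assume "y \<notin> S"
    then have "Um (Vd g) y = Um (\<lambda>_. 0) y"
    proof (intro pot_cong)
      fix z assume "z \<in> - S"
      then have "Vd g z = Vd (\<lambda>_. 0) z" by (intro Vd_neg) (auto simp: g_def)
      then show "Vd g z = 0" by (simp add: pot_zero_fun)
    qed auto
    then show "Um (Vd g) y = 0" by (simp add: pot_zero_fun)
  qed
  then have 3: "(\<integral>\<^sup>+x. Kd (Um (Vd g)) x \<partial>\<nu>) = 0" by (simp add: Kd_zero)
  have "Up (Va g) x = Up (Va (Rd f')) x" if "x \<in> S" for x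
    by (rule pot_cong[OF _ that], rule Va_nonneg) (auto simp: g_def)
  then have "(\<integral>\<^sup>+x. Up (Va g) x \<partial>\<nu>) = (\<integral>\<^sup>+x. Up (Va (Rd f')) x \<partial>\<nu>)"
    using \<nu>_S by (intro nn_integral_cong_AE) (auto elim!: eventually_mono)
  then have "(\<integral>\<^sup>+x. g x \<partial>M) = (\<integral>\<^sup>+x. Kd (Um f') x \<partial>\<nu>)"
    by (simp add: nn_integral_M[OF g] 3 mp_Rd[OF f' b(1) f'b] 2)
  then show ?thesis unfolding 1 Rd g_def by simp
qed

text \<open>Recovers \<open>\<nu>\<close> from \<open>M\<close>: \<open>\<nu>\<close> is the flow through zero, down and up again, of the measure \<open>M\<close> on \<open>S\<close>.\<close>

lemma \<nu>_flow:
  assumes f: "f \<in> BM"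
  shows "(\<integral>\<^sup>+x. f x \<partial>\<nu>) = (\<integral>\<^sup>+x. indicator S x * taboo (conv \<delta>) (- S) (taboo (conv \<alpha>) S f) x \<partial>M)"
proof -
  have L1: "linop (\<lambda>f. Kd (Um f))" by (rule linop_comp[OF operators_linop(5,2)])
  have L2: "linop (\<lambda>f x. indicator S x * taboo (conv \<delta>) (- S) f x)"
    by (intro linop_mult linop_taboo kern_\<delta>) simp_all
  have eq: "act \<nu> (\<lambda>f. Kd (Um f)) = act M (\<lambda>f x. indicator S x * taboo (conv \<delta>) (- S) f x)"
    by (rule measure_eqI_bounded_fun)
       (simp_all add: nn_integral_act[OF L1 sets_\<nu>] nn_integral_act[OF L2 sets_M] Kd_Um_eq)
  have m: "taboo (conv \<alpha>) S f \<in> BM" by (intro taboo_measurable kern_\<alpha> f) simp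
  have "(\<integral>\<^sup>+x. f x \<partial>\<nu>) = (\<integral>\<^sup>+x. Kd (Ku f) x \<partial>\<nu>)" by (rule \<nu>_inv[OF f, symmetric])
  also have "Ku f = Um (taboo (conv \<alpha>) S f)" by (simp add: exitop_def)
  also have "(\<integral>\<^sup>+x. Kd (Um (taboo (conv \<alpha>) S f)) x \<partial>\<nu>) = (\<integral>\<^sup>+x. taboo (conv \<alpha>) S f x \<partial>act \<nu> (\<lambda>f. Kd (Um f)))"
    by (rule nn_integral_act[OF L1 sets_\<nu> m, symmetric])
  also have "\<dots> = (\<integral>\<^sup>+x. indicator S x * taboo (conv \<delta>) (- S) (taboo (conv \<alpha>) S f) x \<partial>M)"
    unfolding eq by (rule nn_integral_act[OF L2 sets_M m])
  finally show ?thesis .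
qed

lemma M_supp:
  assumes Z: "Z \<in> sets borel" "AE x in \<nu>. x \<in> Z"
    and d: "\<And>x. x \<in> Z \<Longrightarrow> AE y in \<delta>. x + y \<in> Z" and a: "\<And>x. x \<in> Z \<Longrightarrow> AE y in \<alpha>. x + y \<in> Z"
  shows "AE x in M. x \<in> Z"
proof -
  have cd: "x \<in> Z \<Longrightarrow> AE y in conv \<delta> x. y \<in> Z" and ca: "x \<in> Z \<Longrightarrow> AE y in conv \<alpha> x. y \<in> Z" for x
    using AE_conv[OF \<delta>(2) Z(1)] AE_conv[OF \<alpha>(2) Z(1)] d a by auto
  let ?f = "indicator (- Z) :: real \<Rightarrow> ennreal"
  have f: "?f \<in> BM" using Z by simp
  have V: "Va ?f x = 0" "Vd ?f x = 0" if "x \<in> Z" for x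
    using pot_cong_on[where Z = Z and f = ?f and g = "\<lambda>_. 0" and S = UNIV and x = x, OF ca]
      pot_cong_on[where Z = Z and f = ?f and g = "\<lambda>_. 0" and S = UNIV and x = x, OF cd] that
    by (auto simp: pot_zero_fun)
  have "Um (Vd ?f) x = 0" if "x \<in> Z" for x
    using pot_cong_on[where Z = Z and f = "Vd ?f" and g = "\<lambda>_. 0" and S = "- S" and x = x, OF ca] that V by (simp add: pot_zero_fun)
  then have "Kd (Um (Vd ?f)) x = 0" if "x \<in> Z" for x
    using exitop_cong_on[where Z = Z and f = "Um (Vd ?f)" and g = "\<lambda>_. 0" and S = S and x = x, OF cd] that by (simp add: Kd_zero)
  moreover have "Up (Va ?f) x = 0" if "x \<in> Z" for x
    using pot_cong_on[where Z = Z and f = "Va ?f" and g = "\<lambda>_. 0" and S = S and x = x, OF cd] that V by (simp add: pot_zero_fun)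
  ultimately have "(\<integral>\<^sup>+x. Up (Va ?f) x \<partial>\<nu>) = 0" "(\<integral>\<^sup>+x. Kd (Um (Vd ?f)) x \<partial>\<nu>) = 0"
    using Z(2) by (auto simp: nn_integral_0_iff_AE measurable_borel_sets[OF sets_\<nu>] operators_measurable f elim!: eventually_mono)
  then have "(\<integral>\<^sup>+x. ?f x \<partial>M) = 0" by (simp add: nn_integral_M[OF f])
  then have "AE x in M. ?f x = 0"
    using f by (subst (asm) nn_integral_0_iff_AE) (auto intro: measurable_borel_sets[OF sets_M])
  then show ?thesis by (auto simp: indicator_def elim!: eventually_mono split: if_splits)
qed

lemma M_period_a: "AE h in \<alpha>. distr M borel (\<lambda>z. z + h) = M"
  by (rule one_sided_choquet_deny[OF bdd_finite_M \<alpha> \<alpha>_ge])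
     (use M_Ra in \<open>simp add: taboo_conv[OF \<alpha>(2)]\<close>)

lemma M_period_d: "AE h in \<delta>. distr M borel (\<lambda>z. z + h) = M"
  by (rule one_sided_choquet_deny_neg[OF bdd_finite_M \<delta> \<delta>_le])
     (use M_Rd in \<open>simp add: taboo_conv[OF \<delta>(2)]\<close>)

end

section \<open>Periods and Haar measure\<close>

lemma lattice_set_0 [simp]: "lattice_set 0 = UNIV"
  by (simp add: lattice_set_def)

lemma lattice_set_pos: "u \<noteq> 0 \<Longrightarrow> lattice_set u = range (\<lambda>k::int. u * of_int k)"
  by (simp add: lattice_set_def)

lemma lattice_set_diff: "x \<in> lattice_set u \<Longrightarrow> y \<in> lattice_set u \<Longrightarrow> x - y \<in> lattice_set u"
proof (cases "u = 0")
  case False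
  assume "x \<in> lattice_set u" "y \<in> lattice_set u"
  then obtain k l :: int where "x = u * of_int k" "y = u * of_int l"
    using False by (auto simp: lattice_set_pos)
  then have "x - y = u * of_int (k - l)" by (simp add: algebra_simps)
  then show ?thesis
    unfolding lattice_set_pos[OF False] by (intro image_eqI[of _ _ "k - l"]) simp_all
qed simp

lemma lattice_set_zero [simp]: "0 \<in> lattice_set u"
  by (cases "u = 0") (auto simp: lattice_set_pos intro: rev_image_eqI[of 0])

lemma lattice_set_minus: "x \<in> lattice_set u \<Longrightarrow> - x \<in> lattice_set u"
  using lattice_set_diff[of 0 u x] by simp

lemma lattice_set_add: "x \<in> lattice_set u \<Longrightarrow> y \<in> lattice_set u \<Longrightarrow> x + y \<in> lattice_set u"
  using lattice_set_diff[of x u "- y"] lattice_set_minus[of y u] by simp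

lemma countable_lattice: "u \<noteq> 0 \<Longrightarrow> countable (lattice_set u)"
  by (simp add: lattice_set_pos)

lemma lattice_sets_borel [measurable, simp]: "lattice_set u \<in> sets borel"
proof (cases "u = 0")
  case False
  have "range (\<lambda>k::int. {u * of_int k}) \<subseteq> sets borel" by auto
  then have "(\<Union>k::int. {u * of_int k}) \<in> sets borel" by (intro sets.countable_UN) auto
  moreover have "(\<Union>k::int. {u * of_int k}) = lattice_set u" using False by (auto simp: lattice_set_pos)
  ultimately show ?thesis by simp
qed simp

text \<open>If the positive elements stay away from 0, taking differences forces their infimum to be
  attained, and division with remainder makes it a generator.\<close>

lemma subgroup_real_cases:
  fixes H :: "real set"
  assumes zero: "0 \<in> H" and diff: "\<And>x y. x \<in> H \<Longrightarrow> y \<in> H \<Longrightarrow> x - y \<in> H"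
  shows "(\<forall>\<epsilon>>0. \<exists>h\<in>H. 0 < h \<and> h < \<epsilon>) \<or> H = {0} \<or> (\<exists>g>0. H = lattice_set g)"
proof (intro disjCI)
  assume "\<not> (H = {0} \<or> (\<exists>g>0. H = lattice_set g))"
  then have ne: "H \<noteq> {0}" and not_lattice: "\<And>g. 0 < g \<Longrightarrow> H \<noteq> lattice_set g" by auto
  show "\<forall>\<epsilon>>0. \<exists>h\<in>H. 0 < h \<and> h < \<epsilon>"
  proof (rule ccontr)
    assume "\<not> (\<forall>\<epsilon>>0. \<exists>h\<in>H. 0 < h \<and> h < \<epsilon>)"
    then obtain \<epsilon> where \<epsilon>: "0 < \<epsilon>" "\<And>h. h \<in> H \<Longrightarrow> 0 < h \<Longrightarrow> \<epsilon> \<le> h" by force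
    have neg: "- x \<in> H" if "x \<in> H" for x using diff[OF zero that] by simp
    have add: "x + y \<in> H" if "x \<in> H" "y \<in> H" for x y using diff[OF that(1) neg[OF that(2)]] by simp
    define P where "P = {h \<in> H. 0 < h}"
    obtain h0 where "h0 \<in> H" "h0 \<noteq> 0" using ne zero by blast
    then have "\<bar>h0\<bar> \<in> P" using neg by (auto simp: P_def abs_if)
    then have P: "P \<noteq> {}" "bdd_below P" by (auto simp: P_def intro!: bdd_belowI[of _ 0])
    define g where "g = Inf P"
    have g_le: "g \<le> h" if "h \<in> P" for h unfolding g_def by (rule cInf_lower[OF that P(2)])
    obtain p where p: "p \<in> P" "p < g + \<epsilon>" using cInf_lessD[OF P(1), of "g + \<epsilon>"] \<epsilon>(1) by (auto simp: g_def)
    have "p = g"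
    proof (rule ccontr)
      assume "p \<noteq> g"
      then have "Inf P < p" using g_le[OF p(1)] by (simp add: g_def)
      then obtain p' where p': "p' \<in> P" "p' < p" using cInf_lessD[OF P(1)] by blast
      have "\<epsilon> \<le> p - p'" using p p' by (intro \<epsilon>(2) diff) (auto simp: P_def)
      then show False using g_le[OF p'(1)] p(2) by simp
    qed
    then have g: "g \<in> H" "0 < g" using p(1) by (auto simp: P_def)
    have nat_mult: "g * real n \<in> H" for n
    proof (induction n)
      case (Suc n)
      then show ?case using add[OF g(1) Suc] by (simp add: distrib_left)
    qed (use zero in simp)
    have int_mult: "g * of_int k \<in> H" for k :: int
      using nat_mult[of "nat k"] neg[OF nat_mult[of "nat (- k)"]] by (cases "0 \<le> k") auto
    have "x \<in> lattice_set g" if x: "x \<in> H" for x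
    proof -
      define k where "k = \<lfloor>x / g\<rfloor>"
      have k: "of_int k \<le> x / g" "x / g < of_int k + 1" unfolding k_def by linarith+
      have "x - g * of_int k \<in> H" by (rule diff[OF x int_mult])
      moreover have "0 \<le> x - g * of_int k" "x - g * of_int k < g" using k g(2) by (auto simp: field_simps)
      moreover have "g \<le> x - g * of_int k" if "0 < x - g * of_int k" "x - g * of_int k \<in> H"
        using that by (intro g_le) (simp add: P_def)
      ultimately have "x = g * of_int k" by force
      then show ?thesis using g(2) by (auto simp: lattice_set_pos)
    qed
    then have "H = lattice_set g" using int_mult g(2) by (auto simp: lattice_set_pos)
    then show False using not_lattice[OF g(2)] by simp
  qed
qed

text \<open>Let E(x) be the probability that the exit from the half-line, started at x, lands off
  the lattice; so E(0) = 0. Steps with s z \<le> 0 are exits themselves, hence on the lattice almost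
  surely, and steps with s z > 0 must have E(z) = 0. But from an off-lattice point of the half-line,
  finitely many lattice steps with s z \<le> - \<epsilon> lead out of it, still off the lattice,
  with positive probability. So z is on the lattice.\<close>

lemma ladder_lattice:
  fixes s g :: real
  assumes p: "prob_space p" "sets p = sets borel" and neg: "measure p {z. s * z < 0} \<noteq> 0"
    and hit: "exitop (conv p) {x. 0 < s * x} (indicator (- lattice_set g)) 0 = 0"
  shows "AE z in p. z \<in> lattice_set g"
proof -
  interpret prob_space p by fact
  let ?S = "{x. 0 < s * x}" and ?L = "lattice_set g"
  note k = kern_conv[OF p]
  have S: "?S \<in> sets borel" "- ?S \<in> sets borel" by measurable
  have L: "(indicator (- ?L) :: real \<Rightarrow> ennreal) \<in> BM" by simp
  define E where "E = exitop (conv p) ?S (indicator (- ?L))"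
  have E: "E \<in> BM" unfolding E_def by (rule exitop_measurable[OF k S(1) L])
  have E_eq: "E x = (\<integral>\<^sup>+z. indicator (- ?L) (x + z) * indicator (- ?S) (x + z) \<partial>p)
      + (\<integral>\<^sup>+z. E (x + z) * indicator ?S (x + z) \<partial>p)" for x
    unfolding E_def exitop_unfold[OF k S(1) L, of x] unfolding E_def[symmetric]
    using taboo_conv[OF p(2) L S(2)] taboo_conv[OF p(2) E S(1)] by simp
  have mp: "f \<in> BM \<Longrightarrow> f \<in> borel_measurable p" for f by (rule measurable_borel_sets[OF p(2)])
  have "E 0 = 0" using hit by (simp add: E_def)
  then have "(\<integral>\<^sup>+z. indicator (- ?L) z * indicator (- ?S) z \<partial>p) = 0" "(\<integral>\<^sup>+z. E z * indicator ?S z \<partial>p) = 0"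
    using trans[OF E_eq[of 0, symmetric] \<open>E 0 = 0\<close>]
    by (simp_all only: add_0 add_eq_0_iff_both_eq_0)
  moreover have "(\<lambda>z. indicator (- ?L) z * indicator (- ?S) z :: ennreal) \<in> BM" "(\<lambda>z. E z * indicator ?S z) \<in> BM"
    using L E S by (auto intro!: borel_measurable_times_ennreal)
  ultimately have AE0: "AE z in p. (indicator (- ?L) z * indicator (- ?S) z :: ennreal) = 0"
      "AE z in p. E z * indicator ?S z = 0"
    using nn_integral_0_iff_AE[OF mp] by blast+
  have AE1: "AE z in p. s * z \<le> 0 \<longrightarrow> z \<in> ?L" using AE0(1) by eventually_elim (auto simp: indicator_def split: if_splits)
  have AE2: "AE z in p. 0 < s * z \<longrightarrow> E z = 0" using AE0(2) by eventually_elim (auto simp: indicator_def)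
  obtain n :: nat where n: "prob {z. s * z \<le> - (1 / Suc n)} \<noteq> 0"
  proof (rule ccontr)
    assume "\<not> thesis"
    then have "{z. s * z \<le> - (1 / Suc n)} \<in> null_sets p" for n :: nat
      using that p(2) by (auto simp: null_sets_def emeasure_eq_measure)
    then have "(\<Union>n::nat. {z. s * z \<le> - (1 / Suc n)}) \<in> null_sets p" by auto
    moreover have "(\<Union>n::nat. {z. s * z \<le> - (1 / Suc n)}) = {z. s * z < 0}"
    proof (intro equalityI subsetI)
      fix z assume "z \<in> {z. s * z < 0}"
      then obtain n where "1 / Suc n < - (s * z)" using nat_approx_posE[of "- (s * z)"] by auto
      then show "z \<in> (\<Union>n::nat. {z. s * z \<le> - (1 / Suc n)})" by (auto intro!: exI[of _ n])
    next
      fix z assume "z \<in> (\<Union>n::nat. {z. s * z \<le> - (1 / Suc n)})"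
      then obtain n :: nat where "s * z \<le> - (1 / Suc n)" by auto
      moreover have "0 < 1 / real (Suc n)" by simp
      ultimately have "s * z < 0" by linarith
      then show "z \<in> {z. s * z < 0}" by simp
    qed
    ultimately show False using neg by (simp add: null_sets_def emeasure_eq_measure)
  qed
  define \<epsilon> :: real where "\<epsilon> = 1 / Suc n"
  define q where "q = prob {z. s * z \<le> - \<epsilon>}"
  have q: "0 < q" using n by (simp add: q_def \<epsilon>_def zero_less_measure_iff)
  have lower: "ennreal (q ^ k) \<le> E y" if "y \<notin> ?L" "0 < s * y" "s * y \<le> real k * \<epsilon>" for k y
    using that
  proof (induction k arbitrary: y)
    case (Suc k)
    have "ennreal (q ^ Suc k) = ennreal (q ^ k) * emeasure p {z. s * z \<le> - \<epsilon>}"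
    proof -
      have "emeasure p {z. s * z \<le> - \<epsilon>} = ennreal q" by (simp add: q_def emeasure_eq_measure)
      then show ?thesis using q by (simp add: ennreal_mult[symmetric] mult.commute)
    qed
    also have "\<dots> = (\<integral>\<^sup>+z. ennreal (q ^ k) * indicator {z. s * z \<le> - \<epsilon>} z \<partial>p)"
      using p(2) by (subst nn_integral_cmult_indicator) auto
    also have "\<dots> \<le> (\<integral>\<^sup>+z. indicator (- ?L) (y + z) * indicator (- ?S) (y + z)
        + E (y + z) * indicator ?S (y + z) \<partial>p)"
    proof (rule nn_integral_mono_AE)
      show "AE z in p. ennreal (q ^ k) * indicator {z. s * z \<le> - \<epsilon>} z
          \<le> indicator (- ?L) (y + z) * indicator (- ?S) (y + z) + E (y + z) * indicator ?S (y + z)"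
        using AE1
      proof eventually_elim
        case (elim z)
        show ?case
        proof (cases "s * z \<le> - \<epsilon>")
          case True
          have "z \<in> ?L" using elim True by (auto simp: \<epsilon>_def intro: order_trans)
          then have yz: "y + z \<notin> ?L" using Suc(2) lattice_set_diff[of "y + z" g z] by auto
          show ?thesis
          proof (cases "0 < s * (y + z)")
            case pos: True
            have "s * (y + z) \<le> real k * \<epsilon>" using Suc(4) True by (simp add: algebra_simps)
            from Suc.IH[OF yz pos this] show ?thesis using True pos by (simp add: indicator_def)
          next
            case False
            have "q ^ k \<le> 1" using q prob_le_1 by (intro power_le_one) (auto simp: q_def)
            then show ?thesis using True False yz by (simp add: indicator_def)
          qed
        qed simp
      qed
    qed
    also have "\<dots> = E y"
      unfolding E_eq[of y] using E S by (intro nn_integral_add mp) auto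
    finally show ?case .
  qed simp
  show ?thesis
    using AE1 AE2
  proof eventually_elim
    case (elim z)
    show ?case
    proof (rule ccontr)
      assume z: "z \<notin> ?L"
      then have "0 < s * z" "E z = 0" using elim by auto
      obtain k where "s * z / \<epsilon> \<le> real k" using real_arch_simple by blast
      then have "s * z \<le> real k * \<epsilon>" by (simp add: \<epsilon>_def field_simps)
      from lower[OF z \<open>0 < s * z\<close> this] show False using \<open>E z = 0\<close> q by simp
    qed
  qed
qed

text \<open>For d > 0, \<open>haar d\<close> lives on the lattice with all subsets measurable,
  whereas the operators act on Borel functions of the line; this is the same measure carried to the
  line.\<close>

definition haar_borel :: "real \<Rightarrow> real measure" where
  "haar_borel d = distr (haar d) borel (\<lambda>x. x)"

lemma sets_haar_borel [simp, measurable_cong]: "sets (haar_borel d) = sets borel"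
  by (simp add: haar_borel_def)

lemma haar_measurable: "f \<in> borel \<rightarrow>\<^sub>M N \<Longrightarrow> f \<in> haar d \<rightarrow>\<^sub>M N"
proof (cases "d = 0")
  case False
  assume f: "f \<in> borel \<rightarrow>\<^sub>M N"
  have "sets (haar d) = Pow (lattice_set d)" "space (haar d) = lattice_set d"
    using False by (auto simp: haar_def space_scale_measure)
  then show ?thesis using f by (auto simp: measurable_def)
qed (simp add: haar_def)

lemma id_haar_measurable: "(\<lambda>x. x) \<in> haar d \<rightarrow>\<^sub>M borel"
  by (rule haar_measurable) simp

lemma nn_integral_haar_borel: "f \<in> BM \<Longrightarrow> (\<integral>\<^sup>+x. f x \<partial>haar_borel d) = (\<integral>\<^sup>+x. f x \<partial>haar d)"
  unfolding haar_borel_def by (rule nn_integral_distr[OF id_haar_measurable]) simp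

lemma haar_borel_0: "haar_borel 0 = lborel"
  unfolding haar_borel_def haar_def by (simp add: distr_id2)

lemma nn_integral_haar_borel_pos:
  assumes "0 < d" "f \<in> BM"
  shows "(\<integral>\<^sup>+x. f x \<partial>haar_borel d) = ennreal d * (\<integral>\<^sup>+k. f (d * of_int k) \<partial>count_space (UNIV :: int set))"
proof -
  have "(\<integral>\<^sup>+x. f x \<partial>haar_borel d) = ennreal d * (\<integral>\<^sup>+x. f x \<partial>count_space (lattice_set d))"
    using assms by (simp add: nn_integral_haar_borel haar_def nn_integral_scale_measure)
  also have "(\<integral>\<^sup>+x. f x \<partial>count_space (lattice_set d)) = (\<integral>\<^sup>+k. f (d * of_int k) \<partial>count_space (UNIV :: int set))"
  proof (rule nn_integral_bij_count_space[symmetric])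
    show "bij_betw (\<lambda>k::int. d * of_int k) UNIV (lattice_set d)"
      using assms(1) by (auto simp: bij_betw_def lattice_set_pos inj_def)
  qed
  finally show ?thesis .
qed

lemma haar_borel_translate:
  assumes d: "0 \<le> d" and f: "f \<in> BM" and y: "y \<in> lattice_set d"
  shows "(\<integral>\<^sup>+x. f (x + y) \<partial>haar_borel d) = (\<integral>\<^sup>+x. f x \<partial>haar_borel d)"
proof (cases "d = 0")
  case True
  then show ?thesis
    using nn_integral_real_affine[of f 1 y] f by (simp add: haar_borel_0 add.commute)
next
  case False
  then have d: "0 < d" using d by simp
  then obtain l :: int where l: "y = d * of_int l" using y by (auto simp: lattice_set_pos)
  have "(\<integral>\<^sup>+k. f (d * of_int k + y) \<partial>count_space (UNIV :: int set))
      = (\<integral>\<^sup>+k. f (d * of_int (k + l)) \<partial>count_space (UNIV :: int set))"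
    by (simp add: l distrib_left)
  also have "\<dots> = (\<integral>\<^sup>+k. f (d * of_int k) \<partial>count_space (UNIV :: int set))"
    by (rule nn_integral_bij_count_space) (auto simp: bij_betw_def inj_def intro!: surjI[of _ "\<lambda>k. k - l"])
  finally show ?thesis
    using d f by (simp add: nn_integral_haar_borel_pos)
qed

lemma haar_borel_reflect:
  assumes d: "0 \<le> d" and f: "f \<in> BM"
  shows "(\<integral>\<^sup>+x. f (- x) \<partial>haar_borel d) = (\<integral>\<^sup>+x. f x \<partial>haar_borel d)"
proof (cases "d = 0")
  case True
  then show ?thesis
    using nn_integral_real_affine[of f "- 1" 0] f by (simp add: haar_borel_0)
next
  case False
  then have d: "0 < d" using d by simp
  have "(\<integral>\<^sup>+k. f (- (d * of_int k)) \<partial>count_space (UNIV :: int set))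
      = (\<integral>\<^sup>+k. f (d * of_int (- k)) \<partial>count_space (UNIV :: int set))" by simp
  also have "\<dots> = (\<integral>\<^sup>+k. f (d * of_int k) \<partial>count_space (UNIV :: int set))"
    by (rule nn_integral_bij_count_space) (auto simp: bij_betw_def inj_def intro!: surjI[of _ uminus])
  finally show ?thesis
    using d f by (simp add: nn_integral_haar_borel_pos)
qed

lemma haar_borel_supp: "0 \<le> d \<Longrightarrow> AE x in haar_borel d. x \<in> lattice_set d"
proof -
  assume "0 \<le> d"
  then have "d = 0 \<or> 0 < d" by auto
  then show ?thesis
  proof
    assume d: "0 < d"
    have "(\<integral>\<^sup>+x. indicator (- lattice_set d) x \<partial>haar_borel d)
        = ennreal d * (\<integral>\<^sup>+k. indicator (- lattice_set d) (d * of_int k) \<partial>count_space (UNIV :: int set))"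
      by (rule nn_integral_haar_borel_pos[OF d]) simp
    moreover have "d * of_int k \<in> lattice_set d" for k :: int using d by (simp add: lattice_set_pos)
    ultimately have "(\<integral>\<^sup>+x. indicator (- lattice_set d) x \<partial>haar_borel d) = 0" by simp
    then show ?thesis by (subst (asm) nn_integral_0_iff_AE) (auto simp: indicator_def elim!: eventually_mono split: if_splits)
  qed simp
qed

lemma bdd_finite_haar_borel:
  assumes "0 \<le> d"
  shows "bdd_finite (haar_borel d)"
  unfolding bdd_finite_def
proof (intro conjI allI)
  fix a b :: real
  show "emeasure (haar_borel d) {a..b} < top"
  proof (cases "d = 0")
    case True
    then show ?thesis by (simp add: haar_borel_0 emeasure_lborel_Icc_eq)
  next
    case False
    then have d: "0 < d" using assms by simp
    define K where "K = {k::int. a \<le> d * of_int k \<and> d * of_int k \<le> b}"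
    have "K \<subseteq> {\<lfloor>a / d\<rfloor>..\<lceil>b / d\<rceil>}"
    proof
      fix k assume "k \<in> K"
      then have "a / d \<le> of_int k" "of_int k \<le> b / d" using d by (auto simp: K_def field_simps)
      then show "k \<in> {\<lfloor>a / d\<rfloor>..\<lceil>b / d\<rceil>}" by (auto simp: floor_le_iff le_ceiling_iff)
    qed
    then have K: "finite K" by (rule finite_subset) simp
    have "emeasure (haar_borel d) {a..b} = (\<integral>\<^sup>+x. indicator {a..b} x \<partial>haar_borel d)" by simp
    also have "\<dots> = ennreal d * (\<integral>\<^sup>+k. indicator {a..b} (d * of_int k) \<partial>count_space (UNIV :: int set))"
      by (rule nn_integral_haar_borel_pos[OF d]) simp
    also have "(\<integral>\<^sup>+k. indicator {a..b} (d * of_int k) \<partial>count_space (UNIV :: int set))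
        = (\<integral>\<^sup>+k. indicator K k \<partial>count_space (UNIV :: int set))"
      by (rule nn_integral_cong) (simp add: K_def indicator_def)
    also have "ennreal d * (\<integral>\<^sup>+k. indicator K k \<partial>count_space (UNIV :: int set))
        = ennreal d * emeasure (count_space (UNIV :: int set)) K"
      by (subst nn_integral_indicator) simp_all
    also have "\<dots> = ennreal d * of_nat (card K)" using K by simp
    also have "\<dots> < top" by (simp add: ennreal_mult_less_top of_nat_less_top)
    finally show ?thesis .
  qed
qed simp


text \<open>Uniqueness of Haar measure by Fubini: f(x) times the indicator of y + x in
  \<open>C\<close> is integrated in both orders, and the shift is removed by translation invariance
  of one measure or the other. Only lattice shifts are allowed, hence the support conditions at each
  replacement.\<close>

lemma haar_unique:
  assumes d: "0 \<le> d" and M: "bdd_finite M" and supp: "AE x in M. x \<in> lattice_set d"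
    and inv: "\<And>h. h \<in> lattice_set d \<Longrightarrow> distr M borel (\<lambda>z. z + h) = M"
  shows "\<exists>c\<ge>0. \<forall>f\<in>BM. (\<integral>\<^sup>+x. f x \<partial>M) = ennreal c * (\<integral>\<^sup>+x. f x \<partial>haar_borel d)"
proof -
  let ?l = "haar_borel d"
  have sM [measurable_cong]: "sets M = sets borel" using M by (simp add: bdd_finite_def)
  interpret M: sigma_finite_measure M by (rule bdd_finite_sigma_finite[OF M])
  interpret L: sigma_finite_measure ?l by (rule bdd_finite_sigma_finite[OF bdd_finite_haar_borel[OF d]])
  interpret LM: pair_sigma_finite ?l M ..
  have invf: "(\<integral>\<^sup>+x. f (x + h) \<partial>M) = (\<integral>\<^sup>+x. f x \<partial>M)" if "h \<in> lattice_set d" "f \<in> BM" for f h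
  proof -
    have "(\<integral>\<^sup>+x. f x \<partial>distr M borel (\<lambda>z. z + h)) = (\<integral>\<^sup>+x. f (x + h) \<partial>M)"
      by (rule nn_integral_distr) (use that(2) in auto)
    then show ?thesis by (simp add: inv[OF that(1)])
  qed
  \<comment> \<open>A bounded set of positive Haar measure in both cases: it has positive length,
    and it contains the lattice point 0.\<close>
  define C where "C = {0..<max 1 d}"
  have C: "C \<in> sets borel" by (simp add: C_def)
  have Cl: "emeasure ?l C = ennreal (max 1 d) \<or> d > 0 \<and> emeasure ?l C \<noteq> 0"
  proof (cases "d = 0")
    case False
    then have d: "0 < d" using d by simp
    have "emeasure ?l C = ennreal d * (\<integral>\<^sup>+k. indicator C (d * of_int k) \<partial>count_space (UNIV :: int set))"
      using nn_integral_haar_borel_pos[OF d, of "indicator C"] C by simp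
    moreover have "(\<integral>\<^sup>+k. indicator {0::int} k \<partial>count_space UNIV) \<le> (\<integral>\<^sup>+k. indicator C (d * of_int k) \<partial>count_space (UNIV :: int set))"
      by (intro nn_integral_mono) (auto simp: C_def indicator_def)
    ultimately show ?thesis using d by (auto simp: ennreal_mult_eq_top_iff)
  qed (simp add: haar_borel_0 C_def)
  have fin: "emeasure ?l C < top" "emeasure M C < top"
  proof -
    have "C \<subseteq> {0..max 1 d}" by (auto simp: C_def)
    then have "emeasure ?l C \<le> emeasure ?l {0..max 1 d}" "emeasure M C \<le> emeasure M {0..max 1 d}"
      by (intro emeasure_mono; simp add: sM)+
    then show "emeasure ?l C < top" "emeasure M C < top"
      using M bdd_finite_haar_borel[OF d] by (auto simp: bdd_finite_def intro: le_less_trans)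
  qed
  have C_ne: "emeasure ?l C \<noteq> 0" using Cl by auto
  define c where "c = enn2real (emeasure M C) / enn2real (emeasure ?l C)"
  have "(\<integral>\<^sup>+x. f x \<partial>M) = ennreal c * (\<integral>\<^sup>+x. f x \<partial>?l)" if [measurable]: "f \<in> BM" for f
  proof -
    have [measurable]: "C \<in> sets borel" by (rule C)
    have "(\<integral>\<^sup>+x. f x \<partial>M) * emeasure ?l C = (\<integral>\<^sup>+x. f x * (\<integral>\<^sup>+y. indicator C y \<partial>?l) \<partial>M)"
      using C by (simp add: nn_integral_multc)
    also have "\<dots> = (\<integral>\<^sup>+x. (\<integral>\<^sup>+y. f x * indicator C (y + x) \<partial>?l) \<partial>M)"
    proof (rule nn_integral_cong_AE)
      show "AE x in M. f x * (\<integral>\<^sup>+y. indicator C y \<partial>?l) = (\<integral>\<^sup>+y. f x * indicator C (y + x) \<partial>?l)"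
        using supp
      proof eventually_elim
        case (elim x)
        have "(\<integral>\<^sup>+y. f x * indicator C (y + x) \<partial>?l) = f x * (\<integral>\<^sup>+y. indicator C (y + x) \<partial>?l)"
          by (rule nn_integral_cmult) measurable
        then show ?case using haar_borel_translate[OF d _ elim, of "indicator C"] C by simp
      qed
    qed
    also have "\<dots> = (\<integral>\<^sup>+y. (\<integral>\<^sup>+x. f x * indicator C (y + x) \<partial>M) \<partial>?l)"
      by (rule LM.Fubini') measurable
    also have "\<dots> = (\<integral>\<^sup>+y. (\<integral>\<^sup>+x. f (x + - y) * indicator C x \<partial>M) \<partial>?l)"
    proof (rule nn_integral_cong_AE)
      show "AE y in ?l. (\<integral>\<^sup>+x. f x * indicator C (y + x) \<partial>M) = (\<integral>\<^sup>+x. f (x + - y) * indicator C x \<partial>M)"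
        using haar_borel_supp[OF d]
      proof eventually_elim
        case (elim y)
        have "(\<integral>\<^sup>+x. f (x + - y) * indicator C (y + (x + - y)) \<partial>M) = (\<integral>\<^sup>+x. f x * indicator C (y + x) \<partial>M)"
          by (rule invf[of "- y" "\<lambda>x. f x * indicator C (y + x)"]) (use lattice_set_minus[OF elim] in auto)
        then show ?case by simp
      qed
    qed
    also have "\<dots> = (\<integral>\<^sup>+x. (\<integral>\<^sup>+y. f (x + - y) * indicator C x \<partial>?l) \<partial>M)"
      by (rule LM.Fubini'[symmetric]) measurable
    also have "\<dots> = (\<integral>\<^sup>+x. (\<integral>\<^sup>+y. f y \<partial>?l) * indicator C x \<partial>M)"
    proof (rule nn_integral_cong_AE)
      show "AE x in M. (\<integral>\<^sup>+y. f (x + - y) * indicator C x \<partial>?l) = (\<integral>\<^sup>+y. f y \<partial>?l) * indicator C x"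
        using supp
      proof eventually_elim
        case (elim x)
        have "(\<integral>\<^sup>+y. f (x + - y) * indicator C x \<partial>?l) = (\<integral>\<^sup>+y. f (x + - y) \<partial>?l) * indicator C x"
          by (rule nn_integral_multc) measurable
        also have "(\<integral>\<^sup>+y. f (x + - y) \<partial>?l) = (\<integral>\<^sup>+y. f (y + x) \<partial>?l)"
          using haar_borel_reflect[OF d, of "\<lambda>y. f (y + x)"] by (simp add: add.commute)
        also have "\<dots> = (\<integral>\<^sup>+y. f y \<partial>?l)" by (rule haar_borel_translate[OF d _ elim]) measurable
        finally show ?case .
      qed
    qed
    also have "\<dots> = (\<integral>\<^sup>+y. f y \<partial>?l) * emeasure M C"
      using C sM by (simp add: nn_integral_cmult)
    finally have eq: "(\<integral>\<^sup>+x. f x \<partial>M) * emeasure ?l C = (\<integral>\<^sup>+y. f y \<partial>?l) * emeasure M C" .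
    have "emeasure ?l C = ennreal (enn2real (emeasure ?l C))" "emeasure M C = ennreal (enn2real (emeasure M C))"
      using fin by simp_all
    moreover have pos: "0 < enn2real (emeasure ?l C)"
      using fin C_ne by (simp add: enn2real_positive_iff zero_less_iff_neq_zero)
    ultimately have "(\<integral>\<^sup>+x. f x \<partial>M) * ennreal (enn2real (emeasure ?l C)) * ennreal (1 / enn2real (emeasure ?l C))
        = (\<integral>\<^sup>+y. f y \<partial>?l) * ennreal (enn2real (emeasure M C)) * ennreal (1 / enn2real (emeasure ?l C))"
      using eq by simp
    then show ?thesis
      using pos by (simp add: mult.assoc ennreal_mult[symmetric] c_def) (simp add: mult.commute)
  qed
  then show ?thesis by (intro exI[of _ c]) (auto simp: c_def)
qed

text \<open>Multiples of small periods come arbitrarily close to \<open>t\<close> from below. The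
  translate of a compact interval by \<open>t\<close> lies in the translate of a slightly longer one
  by such a multiple, and continuity from above removes the excess. Using - t as well gives the
  reverse inequality.\<close>

lemma dense_periods:
  assumes M: "bdd_finite M"
    and dense: "\<And>\<epsilon>. 0 < \<epsilon> \<Longrightarrow> \<exists>h. 0 < h \<and> h < \<epsilon> \<and> distr M borel (\<lambda>z. z + h) = M \<and> distr M borel (\<lambda>z. z - h) = M"
  shows "distr M borel (\<lambda>z. z + t) = M"
proof -
  have sM [measurable_cong]: "sets M = sets borel" using M by (simp add: bdd_finite_def)
  have spM: "space M = UNIV" using sets_eq_imp_space_eq[OF sM] by simp
  define P where "P = {h. distr M borel (\<lambda>z. z + h) = M}"
  have shift: "emeasure (distr M borel (\<lambda>z. z + h)) {a..b} = emeasure M {a - h..b - h}" for h a b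
    by (subst emeasure_distr) (auto simp: spM intro!: arg_cong[of _ _ "emeasure M"])
  have P_shift: "emeasure M {a - h..b - h} = emeasure M {a..b}" if "h \<in> P" for h a b
    using shift[of h a b] that by (simp add: P_def)
  have P_add: "h + k \<in> P" if "h \<in> P" "k \<in> P" for h k
  proof -
    have "distr M borel (\<lambda>z. z + (h + k)) = distr (distr M borel (\<lambda>z. z + h)) borel (\<lambda>z. z + k)"
      by (subst distr_distr) (auto simp: comp_def add.assoc)
    then show ?thesis using that by (simp add: P_def)
  qed
  have P_mult: "real n * h \<in> P" if "h \<in> P" for h n
  proof (induction n)
    case 0
    show ?case using distr_id2[OF sM[symmetric]] by (simp add: P_def)
  next
    case (Suc n)
    then show ?case using P_add[OF that Suc] by (simp add: algebra_simps)
  qed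
  have P_near: "\<exists>h\<in>P. t - \<epsilon> < h \<and> h \<le> t" if \<epsilon>: "0 < \<epsilon>" for \<epsilon> t
  proof -
    obtain h where h: "0 < h" "h < \<epsilon>" "h \<in> P" "- h \<in> P" using dense[OF \<epsilon>] by (auto simp: P_def)
    define k where "k = \<lfloor>t / h\<rfloor>"
    have k: "of_int k \<le> t / h" "t / h < of_int k + 1" unfolding k_def by linarith+
    have "of_int k * h \<in> P"
      using P_mult[OF h(3), of "nat k"] P_mult[OF h(4), of "nat (- k)"] by (cases "0 \<le> k") auto
    moreover have "of_int k * h \<le> t" "t - h < of_int k * h" using k h(1) by (auto simp: field_simps)
    ultimately show ?thesis using h(2) by (intro bexI[of _ "of_int k * h"]) auto
  qed
  have le: "emeasure M {a + t..b + t} \<le> emeasure M {a..b}" for a b t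
  proof -
    have "emeasure M {a + t..b + t} \<le> emeasure M {a..b + 1 / Suc n}" for n
    proof -
      obtain h where h: "h \<in> P" "t - 1 / Suc n < h" "h \<le> t" using P_near[of "1 / Suc n" t] by auto
      have "emeasure M {a + t..b + t} \<le> emeasure M {a + h..b + 1 / Suc n + h}"
        using h by (intro emeasure_mono) (auto simp: sM)
      also have "\<dots> = emeasure M {a..b + 1 / Suc n}"
        using P_shift[OF h(1), of "a + h" "b + 1 / Suc n + h"] by simp
      finally show ?thesis .
    qed
    moreover have "(\<lambda>n. emeasure M {a..b + 1 / Suc n}) \<longlonglongrightarrow> emeasure M (\<Inter>n. {a..b + 1 / Suc n})"
    proof (rule Lim_emeasure_decseq)
      show "decseq (\<lambda>n. {a..b + 1 / Suc n})"
        unfolding decseq_def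
      proof (intro allI impI)
        fix m n :: nat assume "m \<le> n"
        then have "1 / real (Suc n) \<le> 1 / real (Suc m)" by (intro divide_left_mono) auto
        then show "{a..b + 1 / Suc n} \<subseteq> {a..b + 1 / Suc m}" by auto
      qed
    qed (use M in \<open>auto simp: sM bdd_finite_def less_top[symmetric]\<close>)
    moreover have "(\<Inter>n. {a..b + 1 / Suc n}) = {a..b}"
    proof (intro equalityI subsetI)
      fix x assume x: "x \<in> (\<Inter>n. {a..b + 1 / Suc n})"
      have "x \<le> b"
      proof (rule ccontr)
        assume "\<not> x \<le> b"
        then obtain n where "1 / Suc n < x - b" using nat_approx_posE[of "x - b"] by auto
        then show False using x by (auto dest!: spec[of _ n])
      qed
      then show "x \<in> {a..b}" using x by auto
    qed (auto intro: order_trans)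
    ultimately show ?thesis by (intro LIMSEQ_le_const) auto
  qed
  have eq: "emeasure M {a - t..b - t} = emeasure M {a..b}" for a b
    using le[of a "- t" b] le[of "a - t" t "b - t"] by (intro antisym) auto
  show ?thesis
  proof (rule measure_eqI_generator_eq[where \<Omega> = UNIV and E = "range (\<lambda>(a, b). {a..b::real})" and A = "\<lambda>n::nat. {- real n..real n}"])
    show "Int_stable (range (\<lambda>(a, b). {a..b::real}))"
    proof (rule Int_stableI_image)
      fix i j :: "real \<times> real"
      show "\<exists>k\<in>UNIV. (case i of (a, b) \<Rightarrow> {a..b}) \<inter> (case j of (a, b) \<Rightarrow> {a..b}) = (case k of (a, b) \<Rightarrow> {a..b})"
        by (intro bexI[of _ "(max (fst i) (fst j), min (snd i) (snd j))"]) (auto split: prod.splits)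
    qed
    show "emeasure (distr M borel (\<lambda>z. z + t)) X = emeasure M X" if "X \<in> range (\<lambda>(a, b). {a..b})" for X
      using that eq shift[of t] by auto
    have borel: "sigma_sets UNIV (range (\<lambda>(a, b). {a..b::real})) = sets borel"
      by (simp add: borel_eq_atLeastAtMost split_beta')
    show "sets (distr M borel (\<lambda>z. z + t)) = sigma_sets UNIV (range (\<lambda>(a, b). {a..b::real}))"
      "sets M = sigma_sets UNIV (range (\<lambda>(a, b). {a..b::real}))" using borel sM by auto
    show "range (\<lambda>n::nat. {- real n..real n}) \<subseteq> range (\<lambda>(a, b). {a..b::real})" by auto
    show "(\<Union>n::nat. {- real n..real n}) = UNIV"
    proof (rule UNIV_eq_I[symmetric])
      fix x :: real
      obtain n where "\<bar>x\<bar> \<le> real n" using real_arch_simple by blast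
      then show "x \<in> (\<Union>n::nat. {- real n..real n})" by (intro UN_I[of n]) auto
    qed
    show "emeasure (distr M borel (\<lambda>z. z + t)) {- real n..real n} \<noteq> \<infinity>" for n
      using eq M unfolding shift by (simp add: bdd_finite_def less_top[symmetric])
  qed simp
qed

section \<open>The density of the invariant measure\<close>

text \<open>\<open>backward p T h n\<close> is the Haar density of the measure \<open>h dx\<close> pushed through \<open>n\<close> steps of the walk with step law \<open>p\<close>
  killed outside \<open>T\<close>.\<close>

primrec backward :: "real measure \<Rightarrow> real set \<Rightarrow> (real \<Rightarrow> ennreal) \<Rightarrow> nat \<Rightarrow> real \<Rightarrow> ennreal" where
  "backward p T h 0 w = h w"
| "backward p T h (Suc n) w = indicator T w * (\<integral>\<^sup>+y. backward p T h n (w - y) \<partial>p)"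

lemma backward_measurable:
  assumes "prob_space p" "sets p = sets borel" "T \<in> sets borel" "h \<in> BM"
  shows "backward p T h n \<in> BM"
proof (induction n)
  case (Suc n)
  interpret prob_space p by fact
  note [measurable_cong] = assms(2) and [measurable] = Suc assms(3)
  have "(\<lambda>w. indicator T w * (\<integral>\<^sup>+y. backward p T h n (w - y) \<partial>p)) \<in> BM" by measurable
  then show ?case by (simp cong: measurable_cong)
qed (use assms(4) in \<open>simp cong: measurable_cong\<close>)

text \<open>The iterates decrease to a limit L that equals its own average over one step and does
  not increase when \<open>w\<close> is moved back along \<open>t\<close>. A mean of values at most
  L(w) equals L(w), so moving back by \<epsilon> loses nothing; iterating carries \<open>w\<close>
  to where \<open>h\<close>, hence L, is arbitrarily small.\<close>

lemma backward_tendsto_0: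
  fixes t :: real
  assumes p: "prob_space p" "sets p = sets borel" and t: "t = 1 \<or> t = - 1"
    and dir: "AE y in p. 0 \<le> t * y" and nontriv: "\<not> (AE y in p. y = 0)"
    and T: "T \<in> sets borel" "\<And>w u. w \<in> T \<Longrightarrow> 0 \<le> u \<Longrightarrow> w - t * u \<in> T"
    and h: "h \<in> BM" "\<And>w. h w \<le> 1"
    and anti: "\<And>w u. w \<in> T \<Longrightarrow> 0 \<le> u \<Longrightarrow> h (w - t * u) \<le> h w"
    and lim: "\<And>w. w \<in> T \<Longrightarrow> ((\<lambda>u. h (w - t * u)) \<longlongrightarrow> 0) at_top" and w: "w \<in> T"
  shows "(\<lambda>n. backward p T h n w) \<longlonglongrightarrow> 0" and "backward p T h n w \<le> h w"
proof -
  interpret prob_space p by fact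
  let ?b = "backward p T h"
  have mp: "f \<in> BM \<Longrightarrow> f \<in> borel_measurable p" for f :: "real \<Rightarrow> ennreal" by (rule measurable_borel_sets[OF p(2)])
  have b: "?b n \<in> BM" for n by (rule backward_measurable[OF p T(1) h(1)])
  have bk: "w - t * (t * y) = w - y" for w y using t by auto
  have back_T: "w - y \<in> T" if "w \<in> T" "0 \<le> t * y" for w y
    using T(2)[OF that] unfolding bk .
  have b_anti: "?b n (w - t * u) \<le> ?b n w" if "w \<in> T" "0 \<le> u" for n w u
    using that
  proof (induction n arbitrary: w)
    case (Suc n)
    have "(\<integral>\<^sup>+y. ?b n (w - t * u - y) \<partial>p) \<le> (\<integral>\<^sup>+y. ?b n (w - y) \<partial>p)"
    proof (rule nn_integral_mono_AE)
      show "AE y in p. ?b n (w - t * u - y) \<le> ?b n (w - y)"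
        using dir
      proof eventually_elim
        case (elim y)
        have "w - y \<in> T" by (rule back_T[OF Suc(2) elim])
        from Suc.IH[OF this Suc(3)] show ?case by (simp add: algebra_simps)
      qed
    qed
    then show ?case using Suc(2) T(2)[OF Suc(2,3)] by simp
  qed (simp add: anti)
  have b_dec1: "?b (Suc n) w \<le> ?b n w" if "w \<in> T" for n w
  proof -
    have "(\<integral>\<^sup>+y. ?b n (w - y) \<partial>p) \<le> (\<integral>\<^sup>+y. ?b n w \<partial>p)"
    proof (rule nn_integral_mono_AE)
      show "AE y in p. ?b n (w - y) \<le> ?b n w"
        using dir
      proof eventually_elim
        case (elim y)
        show ?case using b_anti[OF that elim, of n] unfolding bk .
      qed
    qed
    then show ?thesis using that by (simp add: emeasure_space_1)
  qed
  have b_le: "?b n w \<le> h w" if "w \<in> T" for n w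
  proof (induction n)
    case (Suc n)
    show ?case by (rule order_trans[OF b_dec1[OF that] Suc])
  qed simp
  show "?b n w \<le> h w" by (rule b_le[OF w])
  have b_dec: "decseq (\<lambda>n. ?b n w)" if "w \<in> T" for w
    by (rule decseq_SucI) (rule b_dec1[OF that])
  define L where "L w = (INF n. ?b n w)" for w
  have Lm: "L \<in> BM" unfolding L_def[abs_def] using b by (intro borel_measurable_INF) auto
  have L_lim: "(\<lambda>n. ?b n w) \<longlonglongrightarrow> L w" if "w \<in> T" for w
    unfolding L_def by (rule LIMSEQ_INF[OF b_dec[OF that]])
  have L_le: "L w \<le> h w" if "w \<in> T" for w
    unfolding L_def by (rule INF_lower2[of 0]) auto
  have L_anti: "L (w - t * u) \<le> L w" if "w \<in> T" "0 \<le> u" for w u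
    unfolding L_def by (rule INF_mono) (use b_anti[OF that] in blast)
  have AE_T: "AE y in p. w - y \<in> T" if "w \<in> T" for w
    using dir by eventually_elim (rule back_T[OF that])
  have L_eq: "L w = (\<integral>\<^sup>+y. L (w - y) \<partial>p)" if wT: "w \<in> T" for w
  proof -
    have "(\<lambda>n. \<integral>\<^sup>+y. ?b n (w - y) \<partial>p) \<longlonglongrightarrow> (\<integral>\<^sup>+y. L (w - y) \<partial>p)"
    proof (rule nn_integral_dominated_convergence[where w = "\<lambda>_. 1"])
      show "AE y in p. ?b n (w - y) \<le> 1" for n
        using AE_T[OF wT] by eventually_elim (rule order_trans[OF b_le h(2)])
      show "AE y in p. (\<lambda>n. ?b n (w - y)) \<longlonglongrightarrow> L (w - y)"
        using AE_T[OF wT] by eventually_elim (rule L_lim)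
    qed (use b Lm in \<open>auto intro!: mp simp: emeasure_space_1\<close>)
    moreover have "(\<lambda>n. ?b (Suc n) w) \<longlonglongrightarrow> L w" using L_lim[OF wT] by (rule LIMSEQ_Suc)
    then have "(\<lambda>n. \<integral>\<^sup>+y. ?b n (w - y) \<partial>p) \<longlonglongrightarrow> L w" using wT by simp
    ultimately show ?thesis by (rule LIMSEQ_unique[symmetric])
  qed
  obtain n0 :: nat where n0: "prob {y. 1 / Suc n0 \<le> t * y} \<noteq> 0"
  proof (rule ccontr)
    assume "\<not> thesis"
    then have "{y. 1 / Suc n \<le> t * y} \<in> null_sets p" for n :: nat
      using that p(2) by (auto simp: null_sets_def emeasure_eq_measure)
    then have "(\<Union>n::nat. {y. 1 / Suc n \<le> t * y}) \<in> null_sets p" by auto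
    then have "AE y in p. y \<notin> (\<Union>n::nat. {y. 1 / Suc n \<le> t * y})" by (rule AE_not_in)
    with dir have "AE y in p. y = 0"
    proof eventually_elim
      case (elim y)
      show ?case
      proof (rule ccontr)
        assume "y \<noteq> 0"
        then have "0 < t * y" using elim t by auto
        then obtain n where "1 / Suc n < t * y" using nat_approx_posE by blast
        then show False using elim(2) by (auto intro: less_imp_le)
      qed
    qed
    then show False using nontriv by simp
  qed
  define \<epsilon> :: real where "\<epsilon> = 1 / Suc n0"
  define A where "A = {y. \<epsilon> \<le> t * y}"
  define q where "q = prob A"
  have \<epsilon>: "0 < \<epsilon>" and A: "A \<in> sets p" and q: "0 < q" "q \<le> 1"
    using n0 p(2) by (auto simp: \<epsilon>_def A_def q_def zero_less_measure_iff)
  \<comment> \<open>With \<open>q\<close> the mass of steps of size at least \<epsilon>, L(w) \<le>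
    (1 - q) L(w) + q L(w - t \<epsilon>); the real values \<open>l\<close> and \<open>l'\<close>
    allow cancelling.\<close>
  have step: "L w \<le> L (w - t * \<epsilon>)" if wT: "w \<in> T" for w
  proof -
    have fin: "L w \<le> 1" "L (w - t * \<epsilon>) \<le> 1"
      using L_le[OF wT] L_anti[OF wT, of \<epsilon>] h(2)[of w] \<epsilon> by (auto intro: order_trans)
    define l l' where "l = enn2real (L w)" and "l' = enn2real (L (w - t * \<epsilon>))"
    have "L w < top" "L (w - t * \<epsilon>) < top" using fin by (auto intro: le_less_trans)
    then have l: "L w = ennreal l" "L (w - t * \<epsilon>) = ennreal l'" "0 \<le> l" "0 \<le> l'"
      by (auto simp: l_def l'_def)
    have "L w = (\<integral>\<^sup>+y. L (w - y) \<partial>p)" by (rule L_eq[OF wT])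
    also have "\<dots> \<le> (\<integral>\<^sup>+y. L w * indicator (space p - A) y + L (w - t * \<epsilon>) * indicator A y \<partial>p)"
    proof (rule nn_integral_mono_AE)
      show "AE y in p. L (w - y) \<le> L w * indicator (space p - A) y + L (w - t * \<epsilon>) * indicator A y"
        using dir AE_space
      proof eventually_elim
        case (elim y)
        show ?case
        proof (cases "y \<in> A")
          case True
          have "w - y = w - t * \<epsilon> - t * (t * y - \<epsilon>)" using t by (auto simp: algebra_simps)
          moreover have "L (w - t * \<epsilon> - t * (t * y - \<epsilon>)) \<le> L (w - t * \<epsilon>)"
            using True \<epsilon> by (intro L_anti T(2) wT) (auto simp: A_def)
          ultimately have "L (w - y) \<le> L (w - t * \<epsilon>)" by (simp only:)
          then show ?thesis using True by simp
        next
          case False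
          have "L (w - t * (t * y)) \<le> L w" by (rule L_anti[OF wT elim(1)])
          then have "L (w - y) \<le> L w" unfolding bk .
          then show ?thesis using False elim(2) by simp
        qed
      qed
    qed
    also have "\<dots> = L w * emeasure p (space p - A) + L (w - t * \<epsilon>) * emeasure p A"
      using A by (subst nn_integral_add) (auto simp: nn_integral_cmult_indicator)
    also have "\<dots> = ennreal (l * (1 - q) + l' * q)"
      using A q l prob_compl[OF A] by (simp add: emeasure_eq_measure q_def ennreal_mult)
    finally have "ennreal l \<le> ennreal (l * (1 - q) + l' * q)" using l(1) by (simp only:)
    moreover have "0 \<le> l * (1 - q) + l' * q" using l q by simp
    ultimately have "l \<le> l * (1 - q) + l' * q" using ennreal_le_iff by blast
    then have "q * l \<le> q * l'" by (simp add: algebra_simps)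
    then show ?thesis using q l by (simp add: ennreal_leI)
  qed
  have iter: "L w \<le> L (w - t * (real n * \<epsilon>))" for n
  proof (induction n)
    case (Suc n)
    have "w - t * (real n * \<epsilon>) \<in> T" using \<epsilon> by (intro T(2) w) simp
    from step[OF this] have "L (w - t * (real n * \<epsilon>)) \<le> L (w - t * (real (Suc n) * \<epsilon>))"
      by (simp add: algebra_simps)
    then show ?case using Suc by simp
  qed simp
  have "L w \<le> h (w - t * (real n * \<epsilon>))" for n
    using iter[of n] L_le[OF T(2)[OF w], of "real n * \<epsilon>"] \<epsilon> by (simp add: order_trans)
  moreover have "(\<lambda>n. h (w - t * (real n * \<epsilon>))) \<longlonglongrightarrow> 0"
  proof (rule filterlim_compose[OF lim[OF w]])
    show "filterlim (\<lambda>n. real n * \<epsilon>) at_top sequentially"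
      using \<epsilon> by (intro filterlim_at_top_mult_tendsto_pos[of _ \<epsilon>] tendsto_const filterlim_real_sequentially)
  qed
  ultimately have "L w \<le> 0" by (intro LIMSEQ_le_const[of _ 0]) auto
  then show "(\<lambda>n. ?b n w) \<longlonglongrightarrow> 0" using L_lim[OF w] by simp
qed

text \<open>By translation invariance, the adjoint of a walk step with respect to Haar measure is
  the reversed step; the constraint \<open>T\<close> then sits at the point \<open>w\<close> of
  arrival.\<close>

lemma taboo_dual:
  assumes d: "0 \<le> d" and p: "prob_space p" "sets p = sets borel" and Z: "AE y in p. y \<in> lattice_set d"
    and T: "T \<in> sets borel" and h: "h \<in> BM" and f: "f \<in> BM"
  shows "(\<integral>\<^sup>+x. h x * taboo (conv p) T f x \<partial>haar_borel d)
    = (\<integral>\<^sup>+w. indicator T w * (\<integral>\<^sup>+y. h (w - y) \<partial>p) * f w \<partial>haar_borel d)"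
proof -
  interpret p: prob_space p by fact
  interpret L: sigma_finite_measure "haar_borel d" by (rule bdd_finite_sigma_finite[OF bdd_finite_haar_borel[OF d]])
  interpret pL: pair_sigma_finite p "haar_borel d" ..
  note [measurable_cong] = p(2) and [measurable] = T h f
  have "(\<integral>\<^sup>+x. h x * taboo (conv p) T f x \<partial>haar_borel d)
      = (\<integral>\<^sup>+x. (\<integral>\<^sup>+y. h x * (f (x + y) * indicator T (x + y)) \<partial>p) \<partial>haar_borel d)"
    unfolding taboo_conv[OF p(2) f T] by (intro nn_integral_cong nn_integral_cmult[symmetric]) measurable
  also have "\<dots> = (\<integral>\<^sup>+y. (\<integral>\<^sup>+x. h x * (f (x + y) * indicator T (x + y)) \<partial>haar_borel d) \<partial>p)"
    by (rule pL.Fubini') measurable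
  also have "\<dots> = (\<integral>\<^sup>+y. (\<integral>\<^sup>+w. h (w - y) * (f w * indicator T w) \<partial>haar_borel d) \<partial>p)"
  proof (rule nn_integral_cong_AE)
    show "AE y in p. (\<integral>\<^sup>+x. h x * (f (x + y) * indicator T (x + y)) \<partial>haar_borel d)
        = (\<integral>\<^sup>+w. h (w - y) * (f w * indicator T w) \<partial>haar_borel d)"
      using Z
    proof eventually_elim
      case (elim y)
      have "(\<integral>\<^sup>+x. h (x + y - y) * (f (x + y) * indicator T (x + y)) \<partial>haar_borel d)
          = (\<integral>\<^sup>+w. h (w - y) * (f w * indicator T w) \<partial>haar_borel d)"
        by (rule haar_borel_translate[OF d _ elim]) measurable
      then show ?case by simp
    qed
  qed
  also have "\<dots> = (\<integral>\<^sup>+w. (\<integral>\<^sup>+y. h (w - y) * (f w * indicator T w) \<partial>p) \<partial>haar_borel d)"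
    by (rule pL.Fubini'[symmetric]) measurable
  also have "\<dots> = (\<integral>\<^sup>+w. indicator T w * (\<integral>\<^sup>+y. h (w - y) \<partial>p) * f w \<partial>haar_borel d)"
    by (intro nn_integral_cong, subst nn_integral_multc) (auto simp: ac_simps)
  finally show ?thesis .
qed

text \<open>With \<open>h = G + (h pushed by one killed step)\<close> and vanishing iterates, the potential of the measure \<open>G dx\<close>
  is \<open>h dx\<close>. The sign \<open>t\<close> is the direction of the steps.\<close>

lemma entrance_potential:
  fixes t :: real
  assumes d: "0 \<le> d" and p: "prob_space p" "sets p = sets borel" and Z: "AE y in p. y \<in> lattice_set d"
    and t: "t = 1 \<or> t = - 1" and dir: "AE y in p. 0 \<le> t * y" and nontriv: "\<not> (AE y in p. y = 0)"
    and T: "T \<in> sets borel" "\<And>w u. w \<in> T \<Longrightarrow> 0 \<le> u \<Longrightarrow> w - t * u \<in> T"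
    and h: "h \<in> BM" "\<And>w. h w \<le> 1" "\<And>w. w \<notin> T \<Longrightarrow> h w = 0"
    and anti: "\<And>w u. w \<in> T \<Longrightarrow> 0 \<le> u \<Longrightarrow> h (w - t * u) \<le> h w"
    and lim: "\<And>w. w \<in> T \<Longrightarrow> ((\<lambda>u. h (w - t * u)) \<longlongrightarrow> 0) at_top"
    and G: "G \<in> BM" "\<And>w. w \<notin> T \<Longrightarrow> G w = 0" "\<And>w. w \<in> T \<Longrightarrow> G w + (\<integral>\<^sup>+y. h (w - y) \<partial>p) = h w"
    and f: "f \<in> BM"
  shows "(\<integral>\<^sup>+x. G x * pot (conv p) T f x \<partial>haar_borel d) = (\<integral>\<^sup>+x. h x * f x \<partial>haar_borel d)"
proof -
  interpret p: prob_space p by fact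
  note k = kern_conv[OF p]
  note LP = linop_pot[OF k T(1)]
  have mh: "f \<in> BM \<Longrightarrow> f \<in> borel_measurable (haar_borel d)" for f by simp
  have b: "backward p T h n \<in> BM" for n by (rule backward_measurable[OF p T(1) h(1)])
  \<comment> \<open>The equation for \<open>h\<close> in integrated form: one killed step from h dx,
    together with the source G dx, reproduces h dx.\<close>
  have one: "(\<integral>\<^sup>+x. G x * g x \<partial>haar_borel d) + (\<integral>\<^sup>+x. h x * taboo (conv p) T g x \<partial>haar_borel d) = (\<integral>\<^sup>+x. h x * g x \<partial>haar_borel d)"
    if g: "g \<in> BM" for g
  proof -
    have m: "(\<lambda>w. indicator T w * (\<integral>\<^sup>+y. h (w - y) \<partial>p)) \<in> BM"
      using b[of "Suc 0"] by (simp cong: measurable_cong)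
    have "(\<integral>\<^sup>+x. G x * g x \<partial>haar_borel d) + (\<integral>\<^sup>+x. h x * taboo (conv p) T g x \<partial>haar_borel d)
        = (\<integral>\<^sup>+x. G x * g x + indicator T x * (\<integral>\<^sup>+y. h (x - y) \<partial>p) * g x \<partial>haar_borel d)"
      unfolding taboo_dual[OF d p Z T(1) h(1) g]
      by (rule nn_integral_add[symmetric]) (use G g m in auto)
    also have "\<dots> = (\<integral>\<^sup>+x. h x * g x \<partial>haar_borel d)"
    proof (rule nn_integral_cong)
      fix x show "G x * g x + indicator T x * (\<integral>\<^sup>+y. h (x - y) \<partial>p) * g x = h x * g x"
        using G(2,3)[of x] h(3)[of x] by (cases "x \<in> T") (auto simp: distrib_right[symmetric])
    qed
    finally show ?thesis .
  qed
  have dual_n: "(\<integral>\<^sup>+x. h x * (taboo (conv p) T ^^ n) g x \<partial>haar_borel d) = (\<integral>\<^sup>+x. backward p T h n x * g x \<partial>haar_borel d)"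
    if "g \<in> BM" for g n
    using that
  proof (induction n arbitrary: g)
    case (Suc n)
    have "(\<integral>\<^sup>+x. h x * (taboo (conv p) T ^^ Suc n) g x \<partial>haar_borel d)
        = (\<integral>\<^sup>+x. backward p T h n x * taboo (conv p) T g x \<partial>haar_borel d)"
      using Suc.IH[OF taboo_measurable[OF k T(1) Suc(2)]] by (simp add: funpow_swap1)
    also have "\<dots> = (\<integral>\<^sup>+x. backward p T h (Suc n) x * g x \<partial>haar_borel d)"
      using taboo_dual[OF d p Z T(1) b[of n] Suc(2)] by simp
    finally show ?case .
  qed simp
  \<comment> \<open>Iterated: the first \<open>N\<close> terms of the potential of G dx make up h dx
    except for the part of h dx that survives \<open>N\<close> killed steps, which has density
    \<open>backward p T h N\<close>.\<close>
  have tele: "(\<integral>\<^sup>+x. G x * psum (conv p) T N g x \<partial>haar_borel d) + (\<integral>\<^sup>+x. backward p T h N x * g x \<partial>haar_borel d)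
      = (\<integral>\<^sup>+x. h x * g x \<partial>haar_borel d)" if g: "g \<in> BM" for g N
  proof (induction N)
    case (Suc N)
    have gn: "(taboo (conv p) T ^^ N) g \<in> BM" by (rule taboo_funpow_measurable[OF k T(1) g])
    have "(\<integral>\<^sup>+x. G x * psum (conv p) T (Suc N) g x \<partial>haar_borel d)
        = (\<integral>\<^sup>+x. G x * psum (conv p) T N g x + G x * (taboo (conv p) T ^^ N) g x \<partial>haar_borel d)"
      by (simp add: psum_def distrib_left)
    also have "\<dots> = (\<integral>\<^sup>+x. G x * psum (conv p) T N g x \<partial>haar_borel d) + (\<integral>\<^sup>+x. G x * (taboo (conv p) T ^^ N) g x \<partial>haar_borel d)"
      by (rule nn_integral_add) (use G gn psum_measurable[OF k T(1) g] in auto)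
    also have "\<dots> + (\<integral>\<^sup>+x. backward p T h (Suc N) x * g x \<partial>haar_borel d)
        = (\<integral>\<^sup>+x. G x * psum (conv p) T N g x \<partial>haar_borel d) + (\<integral>\<^sup>+x. backward p T h N x * g x \<partial>haar_borel d)"
      using one[OF gn] dual_n[OF g, of N] dual_n[OF g, of "Suc N"] by (simp add: add.assoc)
    finally show ?case using Suc by simp
  qed (use h(1) that in simp)
  have LG: "linop (\<lambda>f x. G x * pot (conv p) T f x)" by (rule linop_mult[OF LP G(1)])
  have Lh: "linop (\<lambda>f x. h x * f x)" by (rule linop_mult[OF _ h(1)]) (simp add: linop_def)
  have "act (haar_borel d) (\<lambda>f x. G x * pot (conv p) T f x) = act (haar_borel d) (\<lambda>f x. h x * f x)"
  proof (rule measure_eqI_bounded_fun)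
    fix g :: "real \<Rightarrow> ennreal" and c :: real
    assume g: "g \<in> BM" "\<And>x. g x \<le> indicator {- c..c} x"
    \<comment> \<open>Dominated convergence is available because \<open>g\<close> has bounded
      support; equality of the two measures then covers all \<open>f\<close>.\<close>
    have lim0: "(\<lambda>N. \<integral>\<^sup>+x. backward p T h N x * g x \<partial>haar_borel d) \<longlonglongrightarrow> (\<integral>\<^sup>+x. 0 \<partial>haar_borel d)"
    proof (rule nn_integral_dominated_convergence[where w = "indicator {- c..c}"])
      have bb: "backward p T h N x \<le> indicator T x" for N x
      proof (cases "x \<in> T")
        case True
        then show ?thesis
          using backward_tendsto_0(2)[OF p t dir nontriv T h(1,2) anti lim True, of N] h(2)[of x] by simp
      next
        case False
        then show ?thesis using h(3)[OF False] by (cases N) auto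
      qed
      show "AE x in haar_borel d. backward p T h N x * g x \<le> indicator {- c..c} x" for N
      proof (rule AE_I2)
        fix x
        have "backward p T h N x \<le> 1" by (rule order_trans[OF bb]) (simp add: indicator_def)
        then have "backward p T h N x * g x \<le> 1 * indicator {- c..c} x" using g(2) by (rule mult_mono) auto
        then show "backward p T h N x * g x \<le> indicator {- c..c} x" by simp
      qed
      show "AE x in haar_borel d. (\<lambda>N. backward p T h N x * g x) \<longlonglongrightarrow> 0"
      proof (rule AE_I2)
        fix x
        have gx: "g x < top" using g(2)[of x] by (rule le_less_trans) (simp add: indicator_def)
        have "(\<lambda>N. backward p T h N x) \<longlonglongrightarrow> 0"
        proof (cases "x \<in> T")
          case True
          show ?thesis by (rule backward_tendsto_0(1)[OF p t dir nontriv T h(1,2) anti lim True])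
        next
          case False
          then have "backward p T h N x = 0" for N using bb[of N x] by simp
          then show ?thesis by simp
        qed
        then have "(\<lambda>N. backward p T h N x * g x) \<longlonglongrightarrow> 0 * g x"
          using gx by (intro tendsto_mult_ennreal tendsto_const) auto
        then show "(\<lambda>N. backward p T h N x * g x) \<longlonglongrightarrow> 0" by simp
      qed
      show "(\<integral>\<^sup>+x. indicator {- c..c} x \<partial>haar_borel d) < \<infinity>"
        using bdd_finite_haar_borel[OF d] by (simp add: bdd_finite_def)
    qed (use b g in auto)
    have limG: "(\<lambda>N. \<integral>\<^sup>+x. G x * psum (conv p) T N g x \<partial>haar_borel d) \<longlonglongrightarrow> (\<integral>\<^sup>+x. G x * pot (conv p) T g x \<partial>haar_borel d)"
    proof -
      have "(\<integral>\<^sup>+x. (SUP N. G x * psum (conv p) T N g x) \<partial>haar_borel d) = (SUP N. \<integral>\<^sup>+x. G x * psum (conv p) T N g x \<partial>haar_borel d)"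
      proof (rule nn_integral_monotone_convergence_SUP)
        show "incseq (\<lambda>N x. G x * psum (conv p) T N g x)"
        proof (rule incseq_SucI, rule le_funI)
          show "G x * psum (conv p) T N g x \<le> G x * psum (conv p) T (Suc N) g x" for N x
            by (intro mult_left_mono) (simp_all add: psum_def)
        qed
      qed (use G(1) psum_measurable[OF k T(1) g(1)] in simp)
      then have "(SUP N. \<integral>\<^sup>+x. G x * psum (conv p) T N g x \<partial>haar_borel d) = (\<integral>\<^sup>+x. (SUP N. G x * psum (conv p) T N g x) \<partial>haar_borel d)"
        by (rule sym)
      also have "\<dots> = (\<integral>\<^sup>+x. G x * pot (conv p) T g x \<partial>haar_borel d)"
        by (simp add: pot_SUP SUP_mult_left_ennreal)
      moreover have "(\<lambda>N. \<integral>\<^sup>+x. G x * psum (conv p) T N g x \<partial>haar_borel d) \<longlonglongrightarrow> (SUP N. \<integral>\<^sup>+x. G x * psum (conv p) T N g x \<partial>haar_borel d)"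
        by (rule LIMSEQ_SUP) (auto simp: incseq_def psum_def intro!: nn_integral_mono mult_left_mono sum_mono2)
      ultimately show ?thesis by simp
    qed
    from tendsto_add[OF limG lim0] have "(\<integral>\<^sup>+x. h x * g x \<partial>haar_borel d) = (\<integral>\<^sup>+x. G x * pot (conv p) T g x \<partial>haar_borel d)"
      unfolding tele[OF g(1)] by (simp add: LIMSEQ_const_iff)
    then show "(\<integral>\<^sup>+x. g x \<partial>act (haar_borel d) (\<lambda>f x. G x * pot (conv p) T f x)) = (\<integral>\<^sup>+x. g x \<partial>act (haar_borel d) (\<lambda>f x. h x * f x))"
      by (simp add: nn_integral_act[OF LG] nn_integral_act[OF Lh] g(1))
  qed simp_all
  then show ?thesis
    using nn_integral_act[OF LG _ f, of "haar_borel d"] nn_integral_act[OF Lh _ f, of "haar_borel d"] by simp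
qed

lemma distr_shift_0: "sets M = sets borel \<Longrightarrow> distr M borel (\<lambda>z::real. z + 0) = M"
  by (simp add: distr_id2)

lemma distr_shift_diff:
  assumes M: "sets M = sets (borel :: real measure)"
    and "distr M borel (\<lambda>z. z + h) = M" "distr M borel (\<lambda>z. z + k) = M"
  shows "distr M borel (\<lambda>z. z + (h - k)) = M"
proof -
  note [measurable_cong] = M
  have "distr M borel (\<lambda>z. z + - k) = distr (distr M borel (\<lambda>z. z + k)) borel (\<lambda>z. z + - k)"
    by (simp only: assms(3))
  also have "\<dots> = distr M borel (\<lambda>z. z)"
    by (subst distr_distr) (auto simp: comp_def)
  also have "\<dots> = M" using distr_id2[OF M[symmetric]] .
  finally have k: "distr M borel (\<lambda>z. z + - k) = M" .
  have "distr M borel (\<lambda>z. z + (h - k)) = distr (distr M borel (\<lambda>z. z + h)) borel (\<lambda>z. z + - k)"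
    by (subst distr_distr) (auto simp: comp_def algebra_simps)
  then show ?thesis by (simp only: assms(2) k)
qed

section \<open>Densities of the invariant and of the occupation measures\<close>

locale ladder_pair = two_sided +
  fixes d :: real
  assumes d: "0 \<le> d" and \<delta>_Z: "AE y in \<delta>. y \<in> lattice_set d" and \<alpha>_Z: "AE y in \<alpha>. y \<in> lattice_set d"
begin

text \<open>For independent D and A' with laws \<delta> and \<alpha>, \<open>mp\<close> is P(A' > w)
  and \<open>mm\<close> is P(D \<le> w), each on its half-line. \<open>Gp\<close> is P(A' > w, D +
  A' \<le> w) and \<open>Gm\<close> is P(D \<le> w < D + A'). As D \<le> 0 \<le> A', these are the
  two differences of probabilities in \<pi>, written without subtraction.\<close>

definition mp where "mp w = (\<integral>\<^sup>+z. (if 0 \<le> w \<and> w < z then 1 else 0 :: ennreal) \<partial>\<alpha>)"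
definition mm where "mm w = (\<integral>\<^sup>+y. (if w < 0 \<and> y \<le> w then 1 else 0 :: ennreal) \<partial>\<delta>)"
definition Gp where
  "Gp w = (\<integral>\<^sup>+y. (\<integral>\<^sup>+z. (if 0 \<le> w \<and> w < z \<and> y + z \<le> w then 1 else 0 :: ennreal) \<partial>\<alpha>) \<partial>\<delta>)"
definition Gm where
  "Gm w = (\<integral>\<^sup>+y. (\<integral>\<^sup>+z. (if w < 0 \<and> y \<le> w \<and> w < y + z then 1 else 0 :: ennreal) \<partial>\<alpha>) \<partial>\<delta>)"

lemma nn_integral_const_prob: "(\<integral>\<^sup>+y. c \<partial>\<delta>) = c" "(\<integral>\<^sup>+y. c \<partial>\<alpha>) = c"
  by (simp_all add: prob_space.emeasure_space_1 \<delta> \<alpha>)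

lemma densities_measurable: "mp \<in> BM" "mm \<in> BM" "Gp \<in> BM" "Gm \<in> BM"
proof -
  interpret D: prob_space \<delta> by (rule \<delta>)
  interpret A: prob_space \<alpha> by (rule \<alpha>)
  note [measurable_cong] = \<delta>(2) \<alpha>(2)
  show "mp \<in> BM" unfolding mp_def[abs_def] by measurable
  show "mm \<in> BM" unfolding mm_def[abs_def] by measurable
  show "Gp \<in> BM" unfolding Gp_def[abs_def] by measurable
  show "Gm \<in> BM" unfolding Gm_def[abs_def] by measurable
qed

lemma le_one: "mp w \<le> 1" "mm w \<le> 1" "Gp w \<le> 1" "Gm w \<le> 1"
proof -
  have i: "(\<integral>\<^sup>+y. f y \<partial>\<delta>) \<le> 1" "(\<integral>\<^sup>+y. f y \<partial>\<alpha>) \<le> 1" if "\<And>y. f y \<le> 1" for f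
    using nn_integral_mono[of \<delta> f "\<lambda>_. 1"] nn_integral_mono[of \<alpha> f "\<lambda>_. 1"] that nn_integral_const_prob[of 1] by auto
  show "mp w \<le> 1" "mm w \<le> 1" "Gp w \<le> 1" "Gm w \<le> 1"
    unfolding mp_def mm_def Gp_def Gm_def by (auto intro!: i)
qed

lemma densities_eq_0: "w \<notin> S \<Longrightarrow> mp w = 0" "w \<in> S \<Longrightarrow> mm w = 0" "w \<notin> S \<Longrightarrow> Gp w = 0" "w \<in> S \<Longrightarrow> Gm w = 0"
  by (simp_all add: mp_def mm_def Gp_def Gm_def)

lemma conv_mp: "(\<integral>\<^sup>+y. mp (w - y) \<partial>\<delta>) = (\<integral>\<^sup>+y. (\<integral>\<^sup>+z. (if 0 \<le> w - y \<and> w < y + z then 1 else 0) \<partial>\<alpha>) \<partial>\<delta>)"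
  unfolding mp_def by (intro nn_integral_cong) (auto simp: algebra_simps)

lemma conv_mm: "(\<integral>\<^sup>+z. mm (w - z) \<partial>\<alpha>) = (\<integral>\<^sup>+y. (\<integral>\<^sup>+z. (if w < z \<and> y + z \<le> w then 1 else 0) \<partial>\<alpha>) \<partial>\<delta>)"
proof -
  interpret D: prob_space \<delta> by (rule \<delta>)
  interpret A: prob_space \<alpha> by (rule \<alpha>)
  interpret AD: pair_sigma_finite \<alpha> \<delta> ..
  note [measurable_cong] = \<delta>(2) \<alpha>(2)
  have "(\<integral>\<^sup>+z. mm (w - z) \<partial>\<alpha>) = (\<integral>\<^sup>+z. (\<integral>\<^sup>+y. (if w < z \<and> y + z \<le> w then 1 else 0) \<partial>\<delta>) \<partial>\<alpha>)"
    unfolding mm_def by (intro nn_integral_cong) (auto simp: algebra_simps)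
  also have "\<dots> = (\<integral>\<^sup>+y. (\<integral>\<^sup>+z. (if w < z \<and> y + z \<le> w then 1 else 0) \<partial>\<alpha>) \<partial>\<delta>)"
    by (rule AD.Fubini'[symmetric]) measurable
  finally show ?thesis .
qed

text \<open>As D \<le> 0, the event w < A' splits into w < A', D + A' \<le> w and w < D + A'. The
  latter has the averaged \<open>mp\<close> as its probability, since the constraint 0 \<le> w - y
  is then automatic.\<close>

lemma Gp_eq:
  assumes "w \<in> S"
  shows "Gp w + (\<integral>\<^sup>+y. mp (w - y) \<partial>\<delta>) = mp w"
proof -
  interpret D: prob_space \<delta> by (rule \<delta>)
  interpret A: prob_space \<alpha> by (rule \<alpha>)
  note [measurable_cong] = \<delta>(2) \<alpha>(2)
  have "Gp w + (\<integral>\<^sup>+y. mp (w - y) \<partial>\<delta>)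
      = (\<integral>\<^sup>+y. (\<integral>\<^sup>+z. (if 0 \<le> w \<and> w < z \<and> y + z \<le> w then 1 else 0 :: ennreal) \<partial>\<alpha>)
          + (\<integral>\<^sup>+z. (if 0 \<le> w - y \<and> w < y + z then 1 else 0) \<partial>\<alpha>) \<partial>\<delta>)"
    unfolding conv_mp Gp_def by (rule nn_integral_add[symmetric]) measurable
  also have "\<dots> = (\<integral>\<^sup>+y. mp w \<partial>\<delta>)"
  proof (rule nn_integral_cong_AE)
    show "AE y in \<delta>. (\<integral>\<^sup>+z. (if 0 \<le> w \<and> w < z \<and> y + z \<le> w then 1 else 0 :: ennreal) \<partial>\<alpha>)
          + (\<integral>\<^sup>+z. (if 0 \<le> w - y \<and> w < y + z then 1 else 0) \<partial>\<alpha>) = mp w"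
      using \<delta>_le
    proof eventually_elim
      case (elim y)
      have "(\<integral>\<^sup>+z. (if 0 \<le> w \<and> w < z \<and> y + z \<le> w then 1 else 0 :: ennreal) \<partial>\<alpha>)
          + (\<integral>\<^sup>+z. (if 0 \<le> w - y \<and> w < y + z then 1 else 0) \<partial>\<alpha>)
        = (\<integral>\<^sup>+z. (if 0 \<le> w \<and> w < z \<and> y + z \<le> w then 1 else 0) + (if 0 \<le> w - y \<and> w < y + z then 1 else 0) \<partial>\<alpha>)"
        by (rule nn_integral_add[symmetric]) measurable
      also have "\<dots> = mp w"
        unfolding mp_def using assms elim by (intro nn_integral_cong) auto
      finally show ?case .
    qed
  qed
  finally show ?thesis unfolding nn_integral_const_prob .
qed

lemma Gm_eq:
  assumes "w \<notin> S"
  shows "Gm w + (\<integral>\<^sup>+z. mm (w - z) \<partial>\<alpha>) = mm w"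
proof -
  interpret D: prob_space \<delta> by (rule \<delta>)
  interpret A: prob_space \<alpha> by (rule \<alpha>)
  note [measurable_cong] = \<delta>(2) \<alpha>(2)
  have "Gm w + (\<integral>\<^sup>+z. mm (w - z) \<partial>\<alpha>)
      = (\<integral>\<^sup>+y. (\<integral>\<^sup>+z. (if w < 0 \<and> y \<le> w \<and> w < y + z then 1 else 0 :: ennreal) \<partial>\<alpha>)
          + (\<integral>\<^sup>+z. (if w < z \<and> y + z \<le> w then 1 else 0) \<partial>\<alpha>) \<partial>\<delta>)"
    unfolding conv_mm Gm_def by (rule nn_integral_add[symmetric]) measurable
  also have "\<dots> = (\<integral>\<^sup>+y. (if w < 0 \<and> y \<le> w then 1 else 0) \<partial>\<delta>)"
  proof (rule nn_integral_cong)
    fix y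
    have "(\<integral>\<^sup>+z. (if w < 0 \<and> y \<le> w \<and> w < y + z then 1 else 0 :: ennreal) \<partial>\<alpha>)
          + (\<integral>\<^sup>+z. (if w < z \<and> y + z \<le> w then 1 else 0) \<partial>\<alpha>)
        = (\<integral>\<^sup>+z. (if w < 0 \<and> y \<le> w \<and> w < y + z then 1 else 0) + (if w < z \<and> y + z \<le> w then 1 else 0) \<partial>\<alpha>)"
      by (rule nn_integral_add[symmetric]) measurable
    also have "\<dots> = (\<integral>\<^sup>+z. (if w < 0 \<and> y \<le> w then 1 else 0) \<partial>\<alpha>)"
    proof (rule nn_integral_cong_AE)
      show "AE z in \<alpha>. (if w < 0 \<and> y \<le> w \<and> w < y + z then 1 else 0) + (if w < z \<and> y + z \<le> w then 1 else 0)
          = (if w < 0 \<and> y \<le> w then 1 else 0 :: ennreal)"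
        using \<alpha>_ge by eventually_elim (use assms in auto)
    qed
    finally show "(\<integral>\<^sup>+z. (if w < 0 \<and> y \<le> w \<and> w < y + z then 1 else 0 :: ennreal) \<partial>\<alpha>)
          + (\<integral>\<^sup>+z. (if w < z \<and> y + z \<le> w then 1 else 0) \<partial>\<alpha>) = (if w < 0 \<and> y \<le> w then 1 else 0)"
      by (simp add: nn_integral_const_prob del: nn_integral_const)
  qed
  finally show ?thesis by (simp add: mm_def)
qed

text \<open>For w < 0 the average of \<open>mp (w - y)\<close> over \<delta> is P(D \<le> w, w < D +
  A'), because the constraint 0 \<le> w - D in \<open>mp\<close> becomes the first condition. The
  same computation with the roles exchanged gives \<open>flow_up\<close>.\<close>

lemma flow_down: "f \<in> BM \<Longrightarrow> (\<integral>\<^sup>+x. mp x * taboo (conv \<delta>) (- S) f x \<partial>haar_borel d) = (\<integral>\<^sup>+w. Gm w * f w \<partial>haar_borel d)"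
proof -
  assume f: "f \<in> BM"
  have "indicator (- S) w * (\<integral>\<^sup>+y. mp (w - y) \<partial>\<delta>) = Gm w" for w
    unfolding conv_mp Gm_def
    by (cases "w < 0") (auto intro!: nn_integral_cong)
  then show ?thesis using taboo_dual[OF d \<delta> \<delta>_Z half_line_sets(2) densities_measurable(1) f] by simp
qed

lemma flow_up: "f \<in> BM \<Longrightarrow> (\<integral>\<^sup>+x. mm x * taboo (conv \<alpha>) S f x \<partial>haar_borel d) = (\<integral>\<^sup>+w. Gp w * f w \<partial>haar_borel d)"
proof -
  assume f: "f \<in> BM"
  have "indicator S w * (\<integral>\<^sup>+y. mm (w - y) \<partial>\<alpha>) = Gp w" for w
    unfolding conv_mm Gp_def
    by (cases "0 \<le> w") (auto intro!: nn_integral_cong)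
  then show ?thesis using taboo_dual[OF d \<alpha> \<alpha>_Z half_line_sets(1) densities_measurable(2) f] by simp
qed

lemma mp_lim: "((\<lambda>u. mp (w + u)) \<longlongrightarrow> 0) at_top"
proof -
  interpret real_distribution \<alpha>
    using \<alpha> sets_eq_imp_space_eq[OF \<alpha>(2)] by (auto simp: real_distribution_def real_distribution_axioms_def)
  have le: "mp x \<le> ennreal (1 - cdf \<alpha> x)" for x
  proof -
    have "mp x \<le> (\<integral>\<^sup>+z. indicator (space \<alpha> - {..x}) z \<partial>\<alpha>)"
      unfolding mp_def by (intro nn_integral_mono) (auto simp: indicator_def)
    also have "\<dots> = emeasure \<alpha> (space \<alpha> - {..x})" by (rule nn_integral_indicator) auto
    also have "\<dots> = ennreal (1 - cdf \<alpha> x)"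
      using prob_compl[of "{..x}"] by (simp add: emeasure_eq_measure cdf_def del: space_eq_univ)
    finally show ?thesis .
  qed
  have "((\<lambda>u. cdf \<alpha> (w + u)) \<longlongrightarrow> 1) at_top"
    by (rule filterlim_compose[OF cdf_lim_at_top_prob filterlim_tendsto_add_at_top[OF tendsto_const filterlim_ident]])
  then have "((\<lambda>u. 1 - cdf \<alpha> (w + u)) \<longlongrightarrow> 1 - 1) at_top" by (intro tendsto_intros)
  then have L: "((\<lambda>u. ennreal (1 - cdf \<alpha> (w + u))) \<longlongrightarrow> 0) at_top"
    using tendsto_ennrealI[of "\<lambda>u. 1 - cdf \<alpha> (w + u)" 0] by simp
  show ?thesis
    by (rule tendsto_sandwich[OF _ _ tendsto_const[of 0] L]) (auto simp: le)
qed

lemma mm_lim: "((\<lambda>u. mm (w - u)) \<longlongrightarrow> 0) at_top"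
proof -
  interpret real_distribution \<delta>
    using \<delta> sets_eq_imp_space_eq[OF \<delta>(2)] by (auto simp: real_distribution_def real_distribution_axioms_def)
  have le: "mm x \<le> ennreal (cdf \<delta> x)" for x
  proof -
    have "mm x \<le> (\<integral>\<^sup>+z. indicator {..x} z \<partial>\<delta>)"
      unfolding mm_def by (intro nn_integral_mono) (auto simp: indicator_def)
    also have "\<dots> = ennreal (cdf \<delta> x)"
      by (simp add: emeasure_eq_measure cdf_def)
    finally show ?thesis .
  qed
  have "filterlim (\<lambda>u. w - u) at_bot at_top"
    using filterlim_tendsto_add_at_top[OF tendsto_const[of "- w"] filterlim_ident]
    unfolding filterlim_uminus_at_bot by simp
  from filterlim_compose[OF cdf_lim_at_bot this] have "((\<lambda>u. cdf \<delta> (w - u)) \<longlongrightarrow> 0) at_top" .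
  then have L: "((\<lambda>u. ennreal (cdf \<delta> (w - u))) \<longlongrightarrow> 0) at_top"
    using tendsto_ennrealI[of "\<lambda>u. cdf \<delta> (w - u)" 0] by simp
  show ?thesis
    by (rule tendsto_sandwich[OF _ _ tendsto_const[of 0] L]) (auto simp: le)
qed

lemma Gp_Up: "f \<in> BM \<Longrightarrow> (\<integral>\<^sup>+x. Gp x * Up f x \<partial>haar_borel d) = (\<integral>\<^sup>+x. mp x * f x \<partial>haar_borel d)"
proof (rule entrance_potential[OF d \<delta> \<delta>_Z _ dir_d \<delta>_nontriv half_line_sets(1) _ densities_measurable(1) le_one(1) densities_eq_0(1) _ _ densities_measurable(3) densities_eq_0(3) Gp_eq])
  show "mp (w - - 1 * u) \<le> mp w" if "w \<in> S" "0 \<le> u" for w u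
    unfolding mp_def using that by (intro nn_integral_mono) auto
  show "((\<lambda>u. mp (w - - 1 * u)) \<longlongrightarrow> 0) at_top" for w using mp_lim[of w] by simp
qed auto

lemma Gm_Um: "f \<in> BM \<Longrightarrow> (\<integral>\<^sup>+x. Gm x * Um f x \<partial>haar_borel d) = (\<integral>\<^sup>+x. mm x * f x \<partial>haar_borel d)"
proof (rule entrance_potential[OF d \<alpha> \<alpha>_Z _ dir_a \<alpha>_nontriv half_line_sets(2) _ densities_measurable(2) le_one(2) densities_eq_0(2) _ _ densities_measurable(4) densities_eq_0(4) Gm_eq])
  show "mm (w - 1 * u) \<le> mm w" if "w \<in> - S" "0 \<le> u" for w u
    unfolding mm_def using that by (intro nn_integral_mono) auto
  show "((\<lambda>u. mm (w - 1 * u)) \<longlongrightarrow> 0) at_top" for w using mm_lim[of w] by simp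
qed auto

lemma Gp_Kd: "f \<in> BM \<Longrightarrow> (\<integral>\<^sup>+x. Gp x * Kd f x \<partial>haar_borel d) = (\<integral>\<^sup>+w. Gm w * f w \<partial>haar_borel d)"
  unfolding exitop_def using Gp_Up[of "taboo (conv \<delta>) (- S) f"] flow_down[of f]
  by (simp add: taboo_measurable[OF kern_\<delta> half_line_sets(2)])

lemma Gm_Ku: "f \<in> BM \<Longrightarrow> (\<integral>\<^sup>+x. Gm x * Ku f x \<partial>haar_borel d) = (\<integral>\<^sup>+w. Gp w * f w \<partial>haar_borel d)"
  unfolding exitop_def using Gm_Um[of "taboo (conv \<alpha>) S f"] flow_up[of f]
  by (simp add: taboo_measurable[OF kern_\<alpha> half_line_sets(1)])

text \<open>If \<open>Gp\<close> vanished, so would the occupation density \<open>mp\<close>, by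
  \<open>Gp_Up\<close>. But \<alpha> charges some half-line beyond an \<epsilon> > 0, so
  \<open>mp\<close> is positive on [0, \<epsilon>), which Haar measure charges even on a lattice,
  through the point 0.\<close>

lemma Gp_nonzero: "(\<integral>\<^sup>+x. Gp x \<partial>haar_borel d) \<noteq> 0"
proof
  interpret A: prob_space \<alpha> by (rule \<alpha>)
  assume "(\<integral>\<^sup>+x. Gp x \<partial>haar_borel d) = 0"
  then have "AE x in haar_borel d. Gp x = 0" using densities_measurable(3) by (subst (asm) nn_integral_0_iff_AE) simp_all
  then have "(\<integral>\<^sup>+x. Gp x * Up (\<lambda>_. 1) x \<partial>haar_borel d) = (\<integral>\<^sup>+x. 0 \<partial>haar_borel d)"
    by (intro nn_integral_cong_AE) (auto elim!: eventually_mono)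
  then have "(\<integral>\<^sup>+x. mp x \<partial>haar_borel d) = 0" using Gp_Up[of "\<lambda>_. 1"] by simp
  then have mp0: "AE x in haar_borel d. mp x = 0" using densities_measurable(1) by (subst (asm) nn_integral_0_iff_AE) simp_all
  obtain n0 :: nat where n0: "A.prob {1 / Suc n0<..} \<noteq> 0"
  proof (rule ccontr)
    assume "\<not> thesis"
    then have "{1 / Suc n<..} \<in> null_sets \<alpha>" for n :: nat
      using that \<alpha>(2) by (auto simp: null_sets_def A.emeasure_eq_measure)
    then have "(\<Union>n::nat. {1 / real (Suc n)<..}) \<in> null_sets \<alpha>" by auto
    then have "AE y in \<alpha>. y \<notin> (\<Union>n::nat. {1 / real (Suc n)<..})" by (rule AE_not_in)
    with \<alpha>_ge have "AE y in \<alpha>. y = 0"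
    proof eventually_elim
      case (elim y)
      show ?case
      proof (rule ccontr)
        assume "y \<noteq> 0"
        then have "0 < y" using elim by auto
        then obtain n where "1 / Suc n < y" using nat_approx_posE by blast
        then show False using elim(2) by auto
      qed
    qed
    then show False using \<alpha>_nontriv by simp
  qed
  define \<epsilon> :: real where "\<epsilon> = 1 / Suc n0"
  have \<epsilon>: "0 < \<epsilon>" by (simp add: \<epsilon>_def)
  have mp_pos: "mp x \<noteq> 0" if "x \<in> {0..<\<epsilon>}" for x
  proof
    assume "mp x = 0"
    have "emeasure \<alpha> {\<epsilon><..} = (\<integral>\<^sup>+z. indicator {\<epsilon><..} z \<partial>\<alpha>)" using \<alpha>(2) by simp
    also have "\<dots> \<le> mp x"
      unfolding mp_def using that by (intro nn_integral_mono) (auto simp: indicator_def)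
    finally have "emeasure \<alpha> {\<epsilon><..} = 0" using \<open>mp x = 0\<close> by simp
    then show False using n0 by (simp add: \<epsilon>_def A.emeasure_eq_measure)
  qed
  from mp0 have "AE x in haar_borel d. x \<notin> {0..<\<epsilon>}" by eventually_elim (use mp_pos in blast)
  then have "emeasure (haar_borel d) {0..<\<epsilon>} = 0" by (subst (asm) AE_iff_null_sets[symmetric]) auto
  moreover have "emeasure (haar_borel d) {0..<\<epsilon>} \<noteq> 0"
  proof (cases "d = 0")
    case True
    then show ?thesis using \<epsilon> by (simp add: haar_borel_0)
  next
    case False
    then have d: "0 < d" using d by simp
    have "(\<integral>\<^sup>+k. indicator {0::int} k \<partial>count_space UNIV) \<le> (\<integral>\<^sup>+k. indicator {0..<\<epsilon>} (d * of_int k) \<partial>count_space (UNIV :: int set))"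
      using \<epsilon> by (intro nn_integral_mono) (auto simp: indicator_def)
    moreover have "emeasure (haar_borel d) {0..<\<epsilon>} = ennreal d * (\<integral>\<^sup>+k. indicator {0..<\<epsilon>} (d * of_int k) \<partial>count_space (UNIV :: int set))"
      using nn_integral_haar_borel_pos[OF d, of "indicator {0..<\<epsilon>}"] by simp
    ultimately show ?thesis using d by auto
  qed
  ultimately show False by simp
qed

end

section \<open>Uniqueness for the alternating renewal walks\<close>

locale ladder_pair_max = ladder_pair +
  assumes max: "\<And>g. 0 < g \<Longrightarrow> (AE y in \<delta>. y \<in> lattice_set g) \<Longrightarrow> (AE y in \<alpha>. y \<in> lattice_set g) \<Longrightarrow> g \<le> d"
begin

lemma invariant_unique:
  assumes \<nu>: "sets \<nu> = sets borel" "AE x in \<nu>. x \<in> S" "\<And>b. emeasure \<nu> {..b} < top"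
    and inv: "\<And>f. f \<in> BM \<Longrightarrow> (\<integral>\<^sup>+x. Kd (Ku f) x \<partial>\<nu>) = (\<integral>\<^sup>+x. f x \<partial>\<nu>)"
    and Z: "AE x in \<nu>. x \<in> lattice_set d"
  shows "\<exists>c\<ge>0. \<forall>f\<in>BM. (\<integral>\<^sup>+x. f x \<partial>\<nu>) = ennreal c * (\<integral>\<^sup>+x. Gp x * f x \<partial>haar_borel d)"
proof -
  interpret two_sided_inv \<delta> \<alpha> \<nu>
    by unfold_locales (use \<nu> inv in auto)
  have supp: "AE x in M. x \<in> lattice_set d"
  proof (rule M_supp)
    show "AE y in \<delta>. x + y \<in> lattice_set d" if "x \<in> lattice_set d" for x
      using \<delta>_Z by eventually_elim (rule lattice_set_add[OF that])
    show "AE y in \<alpha>. x + y \<in> lattice_set d" if "x \<in> lattice_set d" for x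
      using \<alpha>_Z by eventually_elim (rule lattice_set_add[OF that])
  qed (use Z in auto)
  \<comment> \<open>The periods of \<open>M\<close> inside the lattice form a subgroup that carries
    \<delta> and \<alpha> almost surely.\<close>
  define H where "H = {h \<in> lattice_set d. distr M borel (\<lambda>z. z + h) = M}"
  have H0: "0 \<in> H" using distr_shift_0[OF sets_M] by (simp add: H_def)
  have H_diff: "x - y \<in> H" if "x \<in> H" "y \<in> H" for x y
    using that distr_shift_diff[OF sets_M] lattice_set_diff by (auto simp: H_def)
  have H_d: "AE y in \<delta>. y \<in> H" and H_a: "AE y in \<alpha>. y \<in> H"
    using M_period_d \<delta>_Z M_period_a \<alpha>_Z by (auto simp: H_def)
  have "distr M borel (\<lambda>z. z + h) = M" if h: "h \<in> lattice_set d" for h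
  proof -
    consider "\<forall>\<epsilon>>0. \<exists>h\<in>H. 0 < h \<and> h < \<epsilon>" | "H = {0}" | g where "0 < g" "H = lattice_set g"
      using subgroup_real_cases[OF H0 H_diff] by blast
    then show ?thesis
    proof cases
      case 1
      show ?thesis
      proof (rule dense_periods[OF bdd_finite_M])
        fix \<epsilon> :: real assume "0 < \<epsilon>"
        then obtain h where h: "h \<in> H" "0 < h" "h < \<epsilon>" using 1 by blast
        then show "\<exists>h>0. h < \<epsilon> \<and> distr M borel (\<lambda>z. z + h) = M \<and> distr M borel (\<lambda>z. z - h) = M"
          using H_diff[OF H0 h(1)] by (intro exI[of _ h]) (auto simp: H_def)
      qed
    next
      case 2
      then show ?thesis using H_d \<delta>_nontriv by simp
    next
      case 3
      \<comment> \<open>Maximality gives g \<le> d, while g is a positive multiple of d as an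
        element of \<open>H\<close>; so the two agree.\<close>
      then have g: "g \<le> d" using max[OF 3(1)] H_d H_a by simp
      have "g \<in> lattice_set g" using 3(1) by (auto simp: lattice_set_pos intro!: image_eqI[of _ _ 1])
      then have "g \<in> lattice_set d" using 3(2) by (auto simp: H_def)
      then obtain k :: int where k: "g = d * of_int k" using g 3(1) by (auto simp: lattice_set_pos)
      have "0 < k" using k 3(1) d by (auto simp: zero_less_mult_iff)
      then have "d * 1 \<le> d * of_int k" using g 3(1) by (intro mult_left_mono) auto
      then have "g = d" using k g by simp
      then show ?thesis using 3(2) h by (auto simp: H_def)
    qed
  qed
  then obtain c where c: "0 \<le> c" "\<And>f. f \<in> BM \<Longrightarrow> (\<integral>\<^sup>+x. f x \<partial>M) = ennreal c * (\<integral>\<^sup>+x. f x \<partial>haar_borel d)"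
    using haar_unique[OF d bdd_finite_M supp] by blast
  have "(\<integral>\<^sup>+x. f x \<partial>\<nu>) = ennreal c * (\<integral>\<^sup>+x. Gp x * f x \<partial>haar_borel d)" if f: "f \<in> BM" for f
  proof -
    have m: "taboo (conv \<alpha>) S f \<in> BM" by (intro taboo_measurable kern_\<alpha> f) simp
    have m2: "(\<lambda>x. indicator S x * taboo (conv \<delta>) (- S) (taboo (conv \<alpha>) S f) x) \<in> BM"
      using taboo_measurable[OF kern_\<delta> half_line_sets(2) m] by simp
    \<comment> \<open>With \<open>M\<close> a multiple of Haar measure the flow in
      \<open>\<nu>_flow\<close> is explicit: density 1 on \<open>S\<close> becomes \<open>mm\<close>
      after the \<delta>-step down, and \<open>Gp\<close> after the \<alpha>-step up.\<close>
    have mm: "indicator (- S) w * (\<integral>\<^sup>+y. indicator S (w - y) \<partial>\<delta>) = mm w" for w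
      unfolding mm_def by (cases "w < 0") (auto intro!: nn_integral_cong simp: indicator_def)
    have "(\<integral>\<^sup>+x. f x \<partial>\<nu>) = ennreal c * (\<integral>\<^sup>+x. indicator S x * taboo (conv \<delta>) (- S) (taboo (conv \<alpha>) S f) x \<partial>haar_borel d)"
      unfolding \<nu>_flow[OF f] by (rule c(2)[OF m2])
    also have "(\<integral>\<^sup>+x. indicator S x * taboo (conv \<delta>) (- S) (taboo (conv \<alpha>) S f) x \<partial>haar_borel d)
        = (\<integral>\<^sup>+w. mm w * taboo (conv \<alpha>) S f w \<partial>haar_borel d)"
      using taboo_dual[OF d \<delta> \<delta>_Z half_line_sets(2) _ m, of "indicator S"] by (simp add: mm)
    also have "\<dots> = (\<integral>\<^sup>+w. Gp w * f w \<partial>haar_borel d)" by (rule flow_up[OF f])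
    finally show ?thesis .
  qed
  then show ?thesis using c(1) by blast
qed

end

section \<open>Ladder heights and overshoots of random walks\<close>

text \<open>The weight \<open>W\<close> depends on the first \<open>n\<close> increments and the
  next one is independent of them, so Fubini integrates it out. The injection \<open>e\<close>
  selects one walk from a jointly independent family; it will be \<open>Inl\<close> or
  \<open>Inr\<close> into the sum type indexing both walks.\<close>

lemma (in prob_space) walk_step:
  fixes Z :: "'i \<Rightarrow> 'a \<Rightarrow> real" and e :: "nat \<Rightarrow> 'i"
  assumes ind: "indep_vars (\<lambda>_. borel) Z I" and e: "inj e" "\<And>k. 1 \<le> k \<Longrightarrow> e k \<in> I"
    and law: "\<And>k. 1 \<le> k \<Longrightarrow> distr M borel (Z (e k)) = \<mu>"
    and W: "W \<in> borel_measurable (PiM (e ` {1..n}) (\<lambda>_. borel))"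
    and g: "g \<in> BM" and T: "T \<in> sets borel"
  shows "(\<integral>\<^sup>+\<omega>. W (\<lambda>i\<in>e ` {1..n}. Z i \<omega>) * (g (walk (\<lambda>k. Z (e k)) (Suc n) \<omega>) * indicator T (walk (\<lambda>k. Z (e k)) (Suc n) \<omega>)) \<partial>M)
    = (\<integral>\<^sup>+\<omega>. W (\<lambda>i\<in>e ` {1..n}. Z i \<omega>) * taboo (conv \<mu>) T g (walk (\<lambda>k. Z (e k)) n \<omega>) \<partial>M)"
proof -
  let ?A = "e ` {1..n}" and ?B = "{e (Suc n)}"
  let ?P = "PiM ?A (\<lambda>_. borel :: real measure)"
  define U where "U \<omega> = (\<lambda>i\<in>?A. Z i \<omega>)" for \<omega>
  define V where "V \<omega> = Z (e (Suc n)) \<omega>" for \<omega>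
  define s where "s u = (\<Sum>k=1..n. u (e k))" for u :: "'i \<Rightarrow> real"
  have [measurable]: "W \<in> borel_measurable ?P" "g \<in> BM" "T \<in> sets borel" by fact+
  have s [measurable]: "s \<in> borel_measurable ?P" unfolding s_def[abs_def]
    by (intro borel_measurable_sum measurable_component_singleton) auto
  have AB: "?A \<inter> ?B = {}" "?A \<subseteq> I" "?B \<subseteq> I" using e by (auto dest: injD)
  let ?Q = "PiM ?B (\<lambda>_. borel :: real measure)"
  define c where "c u = u (e (Suc n))" for u :: "'i \<Rightarrow> real"
  have c [measurable]: "c \<in> borel_measurable ?Q" unfolding c_def[abs_def]
    by (rule measurable_component_singleton) simp
  define R where "R \<omega> = (\<lambda>i\<in>?B. Z i \<omega>)" for \<omega>
  have "indep_var ?P U ?Q R"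
    unfolding U_def[abs_def] R_def[abs_def] by (rule indep_var_restrict[OF ind AB])
  then have UR: "U \<in> M \<rightarrow>\<^sub>M ?P" "R \<in> M \<rightarrow>\<^sub>M ?Q"
    and D: "distr M ?P U \<Otimes>\<^sub>M distr M ?Q R = distr M (?P \<Otimes>\<^sub>M ?Q) (\<lambda>\<omega>. (U \<omega>, R \<omega>))"
    unfolding indep_var_distribution_eq by auto
  note [measurable] = UR
  have V: "V \<omega> = c (R \<omega>)" for \<omega> by (simp add: V_def c_def R_def)
  have \<mu>: "distr (distr M ?Q R) borel c = \<mu>"
    using law[of "Suc n"] by (subst distr_distr) (auto simp: comp_def V[symmetric] V_def[abs_def])
  interpret R: prob_space "distr M ?Q R" by (rule prob_space_distr) measurable
  have p\<mu>: "prob_space \<mu>" unfolding \<mu>[symmetric] by (rule R.prob_space_distr) measurable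
  have s\<mu> [measurable_cong]: "sets \<mu> = sets borel" unfolding \<mu>[symmetric] by simp
  have walk1: "walk (\<lambda>k. Z (e k)) n \<omega> = s (U \<omega>)" and walk2: "walk (\<lambda>k. Z (e k)) (Suc n) \<omega> = s (U \<omega>) + c (R \<omega>)" for \<omega>
    by (auto simp: walk_def s_def U_def V[symmetric] V_def)
  have tb: "taboo (conv \<mu>) T g x = (\<integral>\<^sup>+r. g (x + c r) * indicator T (x + c r) \<partial>distr M ?Q R)" for x
  proof -
    have "taboo (conv \<mu>) T g x = (\<integral>\<^sup>+y. g (x + y) * indicator T (x + y) \<partial>distr (distr M ?Q R) borel c)"
      unfolding \<mu> by (rule taboo_conv[OF s\<mu>]) fact+
    then show ?thesis by (subst (asm) nn_integral_distr) auto
  qed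
  define h where "h u r = W u * (g (s u + c r) * indicator T (s u + c r))" for u r
  have hm: "(\<lambda>x. h (fst x) (snd x)) \<in> borel_measurable (?P \<Otimes>\<^sub>M ?Q)" unfolding h_def by measurable
  have "(\<integral>\<^sup>+\<omega>. h (U \<omega>) (R \<omega>) \<partial>M) = (\<integral>\<^sup>+x. h (fst x) (snd x) \<partial>distr M (?P \<Otimes>\<^sub>M ?Q) (\<lambda>\<omega>. (U \<omega>, R \<omega>)))"
    using nn_integral_distr[OF measurable_Pair[OF UR], unfolded measurable_distr_eq1, OF hm] by simp
  also have "\<dots> = (\<integral>\<^sup>+x. h (fst x) (snd x) \<partial>(distr M ?P U \<Otimes>\<^sub>M distr M ?Q R))"
    by (simp only: D)
  also have "\<dots> = (\<integral>\<^sup>+u. (\<integral>\<^sup>+r. h u r \<partial>distr M ?Q R) \<partial>distr M ?P U)"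
    using hm by (subst R.nn_integral_fst[symmetric]) (auto cong: measurable_cong_sets)
  also have "\<dots> = (\<integral>\<^sup>+u. W u * taboo (conv \<mu>) T g (s u) \<partial>distr M ?P U)"
    unfolding tb h_def by (intro nn_integral_cong nn_integral_cmult) measurable
  also have "\<dots> = (\<integral>\<^sup>+\<omega>. W (U \<omega>) * taboo (conv \<mu>) T g (s (U \<omega>)) \<partial>M)"
  proof -
    have [measurable]: "taboo (conv \<mu>) T g \<in> BM"
      by (rule taboo_measurable[OF kern_conv[OF p\<mu> s\<mu>]]) fact+
    have "(\<lambda>u. W u * taboo (conv \<mu>) T g (s u)) \<in> borel_measurable ?P" by measurable
    from nn_integral_distr[OF UR(1), unfolded measurable_distr_eq1, OF this] show ?thesis .
  qed
  finally show ?thesis by (simp add: walk1 walk2 U_def h_def)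
qed

lemma (in prob_space) walk_taboo:
  fixes Z :: "'i \<Rightarrow> 'a \<Rightarrow> real" and e :: "nat \<Rightarrow> 'i"
  assumes ind: "indep_vars (\<lambda>_. borel) Z I" and e: "inj e" "\<And>k. 1 \<le> k \<Longrightarrow> e k \<in> I"
    and law: "\<And>k. 1 \<le> k \<Longrightarrow> distr M borel (Z (e k)) = \<mu>"
    and S: "S \<in> sets borel" and g: "g \<in> BM"
  shows "(\<integral>\<^sup>+\<omega>. (\<Prod>i\<in>{1..n}. indicator S (walk (\<lambda>k. Z (e k)) i \<omega>)) * g (walk (\<lambda>k. Z (e k)) n \<omega>) \<partial>M)
    = (taboo (conv \<mu>) S ^^ n) g 0"
proof -
  have rv: "Z (e k) \<in> borel_measurable M" if "1 \<le> k" for k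
    using ind e(2)[OF that] by (auto simp: indep_vars_def)
  have \<mu>: "prob_space \<mu>" "sets \<mu> = sets borel"
    using law[of 1] prob_space_distr[OF rv[of 1]] by auto
  note k = kern_conv[OF \<mu>]
  define W where "W n v = (\<Prod>i\<in>{1..n}. indicator S (\<Sum>k=1..i. v (e k)) :: ennreal)" for n and v :: "'i \<Rightarrow> real"
  have Wm: "W n \<in> borel_measurable (PiM (e ` {1..n}) (\<lambda>_. borel))" for n
  proof -
    have "(\<lambda>v. indicator S (\<Sum>k=1..i. v (e k)) :: ennreal) \<in> borel_measurable (PiM (e ` {1..n}) (\<lambda>_. borel))"
      if "i \<in> {1..n}" for i
    proof -
      have "(\<lambda>v. \<Sum>k=1..i. v (e k)) \<in> borel_measurable (PiM (e ` {1..n}) (\<lambda>_. borel :: real measure))"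
        using that by (intro borel_measurable_sum measurable_component_singleton) auto
      then show ?thesis using S by measurable
    qed
    then show ?thesis unfolding W_def[abs_def] by (intro borel_measurable_prod_ennreal)
  qed
  have W_eq: "W n (\<lambda>i\<in>e ` {1..n}. Z i \<omega>) = (\<Prod>i\<in>{1..n}. indicator S (walk (\<lambda>k. Z (e k)) i \<omega>))" for n \<omega>
    unfolding W_def walk_def by (intro prod.cong refl arg_cong[of _ _ "indicator S"] sum.cong) auto
  show ?thesis
    using g
  proof (induction n arbitrary: g)
    case 0
    then show ?case by (simp add: walk_def emeasure_space_1)
  next
    case (Suc n)
    have "(\<integral>\<^sup>+\<omega>. (\<Prod>i\<in>{1..Suc n}. indicator S (walk (\<lambda>k. Z (e k)) i \<omega>)) * g (walk (\<lambda>k. Z (e k)) (Suc n) \<omega>) \<partial>M)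
      = (\<integral>\<^sup>+\<omega>. W n (\<lambda>i\<in>e ` {1..n}. Z i \<omega>) * (g (walk (\<lambda>k. Z (e k)) (Suc n) \<omega>) * indicator S (walk (\<lambda>k. Z (e k)) (Suc n) \<omega>)) \<partial>M)"
      unfolding W_eq by (intro nn_integral_cong) (simp add: prod.nat_ivl_Suc' ac_simps)
    also have "\<dots> = (\<integral>\<^sup>+\<omega>. W n (\<lambda>i\<in>e ` {1..n}. Z i \<omega>) * taboo (conv \<mu>) S g (walk (\<lambda>k. Z (e k)) n \<omega>) \<partial>M)"
      by (rule walk_step[OF ind e law Wm Suc(2) S])
    also have "\<dots> = (taboo (conv \<mu>) S ^^ n) (taboo (conv \<mu>) S g) 0"
      unfolding W_eq by (rule Suc.IH[OF taboo_measurable[OF k S Suc(2)]])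
    finally show ?case by (simp add: funpow_swap1)
  qed
qed

text \<open>Times start at 1, as for ladder times and for \<open>exitop\<close>. On paths that never
  leave \<open>S\<close> the value is 0, the infimum of the empty set of naturals.\<close>

definition first_exit :: "real set \<Rightarrow> (nat \<Rightarrow> real) \<Rightarrow> nat" where
  "first_exit S y = Inf {k. k \<ge> 1 \<and> y k \<notin> S}"

lemma first_exit_eq_iff:
  "k \<ge> 1 \<Longrightarrow> (\<exists>j. j \<ge> 1 \<and> y j \<notin> S) \<Longrightarrow> first_exit S y = k \<longleftrightarrow> (\<forall>i\<in>{1..<k}. y i \<in> S) \<and> y k \<notin> S"
proof -
  assume k: "k \<ge> 1" and ex: "\<exists>j. j \<ge> 1 \<and> y j \<notin> S"
  let ?X = "{k. k \<ge> 1 \<and> y k \<notin> S}"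
  have in_X: "Inf ?X \<in> ?X" using ex by (intro Inf_nat_def1) auto
  have le: "j \<in> ?X \<Longrightarrow> Inf ?X \<le> j" for j by (intro cInf_lower) auto
  show ?thesis
  proof
    assume "first_exit S y = k"
    then show "(\<forall>i\<in>{1..<k}. y i \<in> S) \<and> y k \<notin> S"
      using in_X le by (fastforce simp: first_exit_def not_le[symmetric])
  next
    assume *: "(\<forall>i\<in>{1..<k}. y i \<in> S) \<and> y k \<notin> S"
    then have "Inf ?X \<le> k" using k by (intro le) auto
    moreover have "\<not> Inf ?X < k" using * in_X by auto
    ultimately show "first_exit S y = k" by (simp add: first_exit_def)
  qed
qed

lemma exit_decomposition:
  fixes f :: "real \<Rightarrow> ennreal"
  assumes ex: "\<exists>j. j \<ge> 1 \<and> y j \<notin> S"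
  shows "f (y (first_exit S y))
    = (\<Sum>n. (\<Prod>i\<in>{1..n}. indicator S (y i)) * (f (y (Suc n)) * indicator (- S) (y (Suc n))))"
proof -
  define k where "k = first_exit S y"
  have "k \<in> {k. k \<ge> 1 \<and> y k \<notin> S}"
    unfolding k_def first_exit_def using ex by (intro Inf_nat_def1) auto
  then obtain n0 where n0: "k = Suc n0" by (cases k) auto
  have k_iff: "k = j \<longleftrightarrow> (\<forall>i\<in>{1..<j}. y i \<in> S) \<and> y j \<notin> S" if "j \<ge> 1" for j
    unfolding k_def by (rule first_exit_eq_iff[OF that ex])
  have prod: "(\<Prod>i\<in>{1..n}. indicator S (y i)) = (if \<forall>i\<in>{1..n}. y i \<in> S then 1 else 0 :: ennreal)" for n
    by (auto simp: indicator_def intro!: prod.neutral prod_zero)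
  have "(\<Prod>i\<in>{1..n}. indicator S (y i)) * (f (y (Suc n)) * indicator (- S) (y (Suc n)))
      = (if n = n0 then f (y k) else 0)" for n
    using k_iff[of "Suc n"] unfolding prod n0
    by (auto simp: indicator_def atLeastLessThanSuc_atLeastAtMost)
  then have "(\<Sum>n. (\<Prod>i\<in>{1..n}. indicator S (y i)) * (f (y (Suc n)) * indicator (- S) (y (Suc n))))
      = (\<Sum>n. if n = n0 then f (y k) else 0)" by simp
  also have "\<dots> = f (y k)" by (subst suminf_finite[of "{n0}"]) auto
  finally show ?thesis by (simp add: k_def)
qed

lemma first_exit_measurable:
  assumes [measurable]: "S \<in> sets borel" "\<And>k. 1 \<le> k \<Longrightarrow> (\<lambda>\<omega>. y \<omega> k) \<in> borel_measurable M"
  shows "(\<lambda>\<omega>. first_exit S (y \<omega>)) \<in> M \<rightarrow>\<^sub>M count_space UNIV"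
proof -
  have "Measurable.pred M (\<lambda>\<omega>. 1 \<le> k \<and> y \<omega> k \<notin> S)" for k
    by (cases "1 \<le> k") auto
  then show ?thesis unfolding first_exit_def Inf_nat_def by simp
qed

text \<open>Decomposition over the exit time. The almost sure exit matters: on other paths
  \<open>first_exit\<close> is 0 and the left side would pick up g(0), while \<open>exitop\<close>
  ignores such paths.\<close>

lemma (in prob_space) ladder_law:
  fixes Z :: "'i \<Rightarrow> 'a \<Rightarrow> real" and e :: "nat \<Rightarrow> 'i"
  assumes ind: "indep_vars (\<lambda>_. borel) Z I" and e: "inj e" "\<And>k. 1 \<le> k \<Longrightarrow> e k \<in> I"
    and law: "\<And>k. 1 \<le> k \<Longrightarrow> distr M borel (Z (e k)) = \<mu>"
    and S: "S \<in> sets borel" and g: "g \<in> BM"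
    and ex: "AE \<omega> in M. \<exists>k\<ge>1. walk (\<lambda>k. Z (e k)) k \<omega> \<notin> S"
  shows "(\<integral>\<^sup>+\<omega>. g (walk (\<lambda>k. Z (e k)) (first_exit S (\<lambda>k. walk (\<lambda>k. Z (e k)) k \<omega>)) \<omega>) \<partial>M) = exitop (conv \<mu>) S g 0"
proof -
  have rv: "Z (e k) \<in> borel_measurable M" if "1 \<le> k" for k
    using ind e(2)[OF that] by (auto simp: indep_vars_def)
  have w [measurable]: "(\<lambda>\<omega>. walk (\<lambda>k. Z (e k)) k \<omega>) \<in> borel_measurable M" for k
    unfolding walk_def using rv by (intro borel_measurable_sum) auto
  note [measurable] = S g
  have \<mu>: "prob_space \<mu>" "sets \<mu> = sets borel"
    using law[of 1] prob_space_distr[OF rv[of 1]] by auto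
  note k = kern_conv[OF \<mu>]
  define W where "W n v = (\<Prod>i\<in>{1..n}. indicator S (\<Sum>k=1..i. v (e k)) :: ennreal)" for n and v :: "'i \<Rightarrow> real"
  have Wm: "W n \<in> borel_measurable (PiM (e ` {1..n}) (\<lambda>_. borel))" for n
  proof -
    have "(\<lambda>v. indicator S (\<Sum>k=1..i. v (e k)) :: ennreal) \<in> borel_measurable (PiM (e ` {1..n}) (\<lambda>_. borel))"
      if "i \<in> {1..n}" for i
    proof -
      have "(\<lambda>v. \<Sum>k=1..i. v (e k)) \<in> borel_measurable (PiM (e ` {1..n}) (\<lambda>_. borel :: real measure))"
        using that by (intro borel_measurable_sum measurable_component_singleton) auto
      then show ?thesis using S by measurable
    qed
    then show ?thesis unfolding W_def[abs_def] by (intro borel_measurable_prod_ennreal)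
  qed
  have W_eq: "W n (\<lambda>i\<in>e ` {1..n}. Z i \<omega>) = (\<Prod>i\<in>{1..n}. indicator S (walk (\<lambda>k. Z (e k)) i \<omega>))" for n \<omega>
    unfolding W_def walk_def by (intro prod.cong refl arg_cong[of _ _ "indicator S"] sum.cong) auto
  have "(\<integral>\<^sup>+\<omega>. g (walk (\<lambda>k. Z (e k)) (first_exit S (\<lambda>k. walk (\<lambda>k. Z (e k)) k \<omega>)) \<omega>) \<partial>M)
      = (\<integral>\<^sup>+\<omega>. (\<Sum>n. (\<Prod>i\<in>{1..n}. indicator S (walk (\<lambda>k. Z (e k)) i \<omega>))
          * (g (walk (\<lambda>k. Z (e k)) (Suc n) \<omega>) * indicator (- S) (walk (\<lambda>k. Z (e k)) (Suc n) \<omega>))) \<partial>M)"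
  proof (rule nn_integral_cong_AE)
    show "AE \<omega> in M. g (walk (\<lambda>k. Z (e k)) (first_exit S (\<lambda>k. walk (\<lambda>k. Z (e k)) k \<omega>)) \<omega>)
      = (\<Sum>n. (\<Prod>i\<in>{1..n}. indicator S (walk (\<lambda>k. Z (e k)) i \<omega>))
          * (g (walk (\<lambda>k. Z (e k)) (Suc n) \<omega>) * indicator (- S) (walk (\<lambda>k. Z (e k)) (Suc n) \<omega>)))"
      using ex
    proof eventually_elim
      case (elim \<omega>)
      show ?case using exit_decomposition[of "\<lambda>k. walk (\<lambda>k. Z (e k)) k \<omega>" S g] elim by blast
    qed
  qed
  also have "\<dots> = (\<Sum>n. \<integral>\<^sup>+\<omega>. (\<Prod>i\<in>{1..n}. indicator S (walk (\<lambda>k. Z (e k)) i \<omega>))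
          * (g (walk (\<lambda>k. Z (e k)) (Suc n) \<omega>) * indicator (- S) (walk (\<lambda>k. Z (e k)) (Suc n) \<omega>)) \<partial>M)"
    by (rule nn_integral_suminf) measurable
  also have "\<dots> = (\<Sum>n. \<integral>\<^sup>+\<omega>. (\<Prod>i\<in>{1..n}. indicator S (walk (\<lambda>k. Z (e k)) i \<omega>))
          * taboo (conv \<mu>) (- S) g (walk (\<lambda>k. Z (e k)) n \<omega>) \<partial>M)"
  proof -
    have "(\<integral>\<^sup>+\<omega>. (\<Prod>i\<in>{1..n}. indicator S (walk (\<lambda>k. Z (e k)) i \<omega>))
          * (g (walk (\<lambda>k. Z (e k)) (Suc n) \<omega>) * indicator (- S) (walk (\<lambda>k. Z (e k)) (Suc n) \<omega>)) \<partial>M)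
      = (\<integral>\<^sup>+\<omega>. (\<Prod>i\<in>{1..n}. indicator S (walk (\<lambda>k. Z (e k)) i \<omega>))
          * taboo (conv \<mu>) (- S) g (walk (\<lambda>k. Z (e k)) n \<omega>) \<partial>M)" for n
      unfolding W_eq[symmetric] by (rule walk_step[OF ind e law Wm g]) (use S in auto)
    then show ?thesis by (simp only:)
  qed
  also have "\<dots> = (\<Sum>n. (taboo (conv \<mu>) S ^^ n) (taboo (conv \<mu>) (- S) g) 0)"
    using walk_taboo[OF ind e law S taboo_measurable[OF k _ g]] by simp
  finally show ?thesis by (simp add: exitop_def pot_def)
qed

lemma (in prob_space) ladder_indep:
  fixes Z :: "'i \<Rightarrow> 'a \<Rightarrow> real"
  assumes ind: "indep_vars (\<lambda>_. borel) Z I"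
    and sub: "e1 ` {1..} \<subseteq> I" "e2 ` {1..} \<subseteq> I" "e1 ` {1..} \<inter> e2 ` {1..} = {}"
    and S: "S1 \<in> sets borel" "S2 \<in> sets borel"
  shows "indep_var borel (\<lambda>\<omega>. walk (\<lambda>k. Z (e1 k)) (first_exit S1 (\<lambda>k. walk (\<lambda>k. Z (e1 k)) k \<omega>)) \<omega>)
    borel (\<lambda>\<omega>. walk (\<lambda>k. Z (e2 k)) (first_exit S2 (\<lambda>k. walk (\<lambda>k. Z (e2 k)) k \<omega>)) \<omega>)"
proof -
  define F where "F e S v = walk (\<lambda>k v. v (e k)) (first_exit S (\<lambda>k. walk (\<lambda>k v. v (e k)) k v)) v"
    for e :: "nat \<Rightarrow> 'i" and S and v :: "'i \<Rightarrow> real"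
  have Fm: "F e S \<in> borel_measurable (PiM (e ` {1..}) (\<lambda>_. borel))" if "S \<in> sets borel" for e :: "nat \<Rightarrow> 'i" and S
  proof -
    have w: "(\<lambda>v. walk (\<lambda>k v. v (e k)) k v) \<in> borel_measurable (PiM (e ` {1..}) (\<lambda>_. borel :: real measure))" for k
      unfolding walk_def by (intro borel_measurable_sum measurable_component_singleton) auto
    show ?thesis
      unfolding F_def[abs_def]
      by (rule measurable_compose_countable[OF w first_exit_measurable[OF that w]])
  qed
  have "indep_var borel (F e1 S1 \<circ> (\<lambda>\<omega>. restrict (\<lambda>i. Z i \<omega>) (e1 ` {1..}))) borel (F e2 S2 \<circ> (\<lambda>\<omega>. restrict (\<lambda>i. Z i \<omega>) (e2 ` {1..})))"
    by (rule indep_var_compose[OF indep_var_restrict[OF ind sub(3,1,2)] Fm[OF S(1)] Fm[OF S(2)]])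
  moreover have "F e S \<circ> (\<lambda>\<omega>. restrict (\<lambda>i. Z i \<omega>) (e ` {1..}))
      = (\<lambda>\<omega>. walk (\<lambda>k. Z (e k)) (first_exit S (\<lambda>k. walk (\<lambda>k. Z (e k)) k \<omega>)) \<omega>)" for e S
  proof -
    have "walk (\<lambda>k v. v (e k)) k (restrict (\<lambda>i. Z i \<omega>) (e ` {1..})) = walk (\<lambda>k. Z (e k)) k \<omega>" for k \<omega>
      unfolding walk_def by (intro sum.cong) auto
    then show ?thesis by (auto simp: F_def fun_eq_iff)
  qed
  ultimately show ?thesis by simp
qed

section \<open>Crossing times of paths\<close>

definition first_time :: "((nat \<Rightarrow> real) \<Rightarrow> nat \<Rightarrow> bool) \<Rightarrow> (nat \<Rightarrow> real) \<Rightarrow> nat \<Rightarrow> bool" where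
  "first_time C y k \<longleftrightarrow> C y k \<and> (\<forall>j<k. \<not> C y j)"

lemma overshoot_iff_first_time:
  "(\<exists>k. C y k) \<and> overshoot C y 1 \<in> B \<longleftrightarrow> (\<exists>k. first_time C y k \<and> y k \<in> B)"
proof -
  have L: "overshoot C y 1 = y (LEAST k. C y k)"
    by (simp add: overshoot_def enumerate.simps)
  have "first_time C y k \<longleftrightarrow> (\<exists>k. C y k) \<and> k = (LEAST k. C y k)" for k
  proof
    assume k: "first_time C y k"
    have "(LEAST k. C y k) = k"
      by (rule Least_equality) (use k in \<open>auto simp: first_time_def not_less[symmetric]\<close>)
    then show "(\<exists>k. C y k) \<and> k = (LEAST k. C y k)" using k by (auto simp: first_time_def)
  next
    assume "(\<exists>k. C y k) \<and> k = (LEAST k. C y k)"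
    then show "first_time C y k"
      unfolding first_time_def by (auto intro: LeastI dest: not_less_Least)
  qed
  then show ?thesis unfolding L by auto
qed

text \<open>\<open>T\<close> is the half-line containing the starting point: while the path is in
  \<open>T\<close>, a crossing of type \<open>C\<close> is the same as leaving \<open>T\<close>, so
  the first crossing is the first exit.\<close>

lemma first_time_Suc_iff:
  assumes "y 0 \<in> T" and C: "\<And>k. y k \<in> T \<Longrightarrow> C y (Suc k) \<longleftrightarrow> y (Suc k) \<notin> T" and C0: "\<not> C y 0"
  shows "first_time C y (Suc n) \<longleftrightarrow> (\<forall>i\<in>{1..n}. y i \<in> T) \<and> y (Suc n) \<notin> T"
proof -
  have *: "(\<forall>j<Suc n. \<not> C y j) \<longleftrightarrow> (\<forall>i\<in>{1..n}. y i \<in> T)" for n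
  proof (induction n)
    case (Suc n)
    have "y n \<in> T" if "\<forall>i\<in>{1..n}. y i \<in> T" using that assms(1) by (cases n) auto
    then show ?case using Suc C[of n] by (auto simp: less_Suc_eq atLeastAtMostSuc_conv)
  qed (use C0 in auto)
  have "y n \<in> T" if "\<forall>i\<in>{1..n}. y i \<in> T" using that assms(1) by (cases n) auto
  then show ?thesis using *[of n] C[of n] by (auto simp: first_time_def)
qed

lemma prod_indicator:
  "finite I \<Longrightarrow> (\<Prod>i\<in>I. indicator (T i) (y i)) = (if \<forall>i\<in>I. y i \<in> T i then 1 else 0 :: ennreal)"
  by (auto simp: indicator_def intro!: prod.neutral prod_zero)

lemma first_time_sum:
  assumes y0: "y 0 \<in> T" and C: "\<And>k. y k \<in> T \<Longrightarrow> C y (Suc k) \<longleftrightarrow> y (Suc k) \<notin> T" and C0: "\<not> C y 0"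
  shows "(if (\<exists>k. first_time C y k \<and> y k \<in> B) then 1 else 0 :: ennreal)
    = (\<Sum>n. (\<Prod>i\<in>{1..n}. indicator T (y i)) * (indicator B (y (Suc n)) * indicator (- T) (y (Suc n))))"
proof -
  have un: "first_time C y k \<Longrightarrow> first_time C y l \<Longrightarrow> k = l" for k l
    unfolding first_time_def by (meson linorder_neqE_nat)
  have trm: "(\<Prod>i\<in>{1..n}. indicator T (y i)) * (indicator B (y (Suc n)) * indicator (- T) (y (Suc n)))
      = (if first_time C y (Suc n) \<and> y (Suc n) \<in> B then 1 else 0 :: ennreal)" for n
  proof -
    have "first_time C y (Suc n) \<longleftrightarrow> (\<forall>i\<in>{1..n}. y i \<in> T) \<and> y (Suc n) \<notin> T"
      by (rule first_time_Suc_iff[where T = T]) (use y0 C C0 in auto)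
    then show ?thesis by (subst prod_indicator) (auto simp: indicator_def)
  qed
  show ?thesis
  proof (cases "\<exists>k. first_time C y k \<and> y k \<in> B")
    case True
    then obtain k where k: "first_time C y k" "y k \<in> B" by blast
    then obtain n0 where n0: "k = Suc n0" using C0 by (cases k) (auto simp: first_time_def)
    have "(if first_time C y (Suc n) \<and> y (Suc n) \<in> B then 1 else 0 :: ennreal) = (if n = n0 then 1 else 0)" for n
    proof (cases "n = n0")
      case False
      then have "\<not> first_time C y (Suc n)" using un[OF k(1), of "Suc n"] n0 by blast
      then show ?thesis using False by simp
    qed (use k n0 in simp)
    then have "(\<Sum>n. (\<Prod>i\<in>{1..n}. indicator T (y i)) * (indicator B (y (Suc n)) * indicator (- T) (y (Suc n))))
        = (\<Sum>n. if n = n0 then 1 else 0 :: ennreal)"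
      unfolding trm by simp
    also have "\<dots> = 1" by (subst suminf_finite[of "{n0}"]) auto
    finally show ?thesis using True by simp
  next
    case False
    then have "(if first_time C y (Suc n) \<and> y (Suc n) \<in> B then 1 else 0 :: ennreal) = 0" for n by auto
    then show ?thesis using False unfolding trm by simp
  qed
qed

text \<open>A path that is nonnegative up to time n has no up-crossing up to time n + 1, so the
  search may restart there.\<close>

lemma up_crossing_shift:
  assumes "\<And>i. i \<le> n \<Longrightarrow> 0 \<le> y i"
  shows "(\<exists>k. first_time up_crossing y k \<and> y k \<in> B)
    \<longleftrightarrow> (\<exists>k. first_time up_crossing (\<lambda>j. y (Suc n + j)) k \<and> y (Suc n + k) \<in> B)"
proof -
  have no: "\<not> up_crossing y k" if "k \<le> Suc n" for k
  proof -
    have "0 \<le> y (k - 1)" using that by (intro assms) simp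
    then show ?thesis by (simp add: up_crossing_def)
  qed
  have eq: "up_crossing y (Suc n + k) \<longleftrightarrow> up_crossing (\<lambda>j. y (Suc n + j)) k" if "0 < k" for k
    using that by (auto simp: up_crossing_def)
  have no': "\<not> up_crossing z 0" for z by (simp add: up_crossing_def)
  have "first_time up_crossing y (Suc n + k) \<longleftrightarrow> first_time up_crossing (\<lambda>j. y (Suc n + j)) k" for k
  proof (cases "k = 0")
    case True
    then show ?thesis using no[of "Suc n"] no' by (auto simp: first_time_def)
  next
    case False
    have "(\<forall>j<Suc n + k. \<not> up_crossing y j) \<longleftrightarrow> (\<forall>j<k. \<not> up_crossing (\<lambda>j. y (Suc n + j)) j)"
    proof (intro iffI allI impI)
      fix j assume "\<forall>j<Suc n + k. \<not> up_crossing y j" "j < k"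
      then show "\<not> up_crossing (\<lambda>j. y (Suc n + j)) j" using eq[of j] no' by (cases "j = 0") auto
    next
      fix j assume *: "\<forall>j<k. \<not> up_crossing (\<lambda>j. y (Suc n + j)) j" "j < Suc n + k"
      show "\<not> up_crossing y j"
      proof (cases "j \<le> Suc n")
        case False
        then have "j = Suc n + (j - Suc n)" "0 < j - Suc n" "j - Suc n < k" using *(2) by auto
        then show ?thesis using eq[of "j - Suc n"] *(1) by metis
      qed (rule no)
    qed
    then show ?thesis using eq[of k] False by (simp add: first_time_def)
  qed
  moreover have "\<exists>l. k = Suc n + l" if "first_time up_crossing y k" for k
  proof -
    have "\<not> k \<le> Suc n" using that no[of k] unfolding first_time_def by blast
    then show ?thesis by (intro exI[of _ "k - Suc n"]) simp
  qed
  ultimately show ?thesis by metis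
qed

text \<open>From above zero, the first up-crossing ends the first negative excursion: the path
  becomes negative at n + 1, stays so for \<open>m\<close> more steps and is nonnegative at n + m +
  2. At most one pair (n, m) contributes.\<close>

lemma up_crossing_sum:
  assumes y0: "0 \<le> y 0"
  shows "(if (\<exists>k. first_time up_crossing y k \<and> y k \<in> B) then 1 else 0 :: ennreal)
    = (\<Sum>n. \<Sum>m. (\<Prod>i\<in>{1..n}. indicator Hp (y i)) * (indicator (- Hp) (y (Suc n)) *
        ((\<Prod>j\<in>{1..m}. indicator (- Hp) (y (Suc n + j))) *
         (indicator B (y (Suc n + Suc m)) * indicator Hp (y (Suc n + Suc m))))))"
proof -
  define ev where "ev y B = (if (\<exists>k. first_time up_crossing y k \<and> y k \<in> B) then 1 else 0 :: ennreal)"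
    for y B
  define a where "a n = (\<Prod>i\<in>{1..n}. indicator Hp (y i)) * (indicator (- Hp) (y (Suc n)) :: ennreal)" for n
  define z where "z n j = y (Suc n + j)" for n j
  have a_eq: "a n = (if (\<forall>i\<in>{1..n}. y i \<in> Hp) \<and> y (Suc n) \<notin> Hp then 1 else 0)" for n
    unfolding a_def by (subst prod_indicator) (auto simp: indicator_def)
  have inner: "ev (z n) B = (\<Sum>m. (\<Prod>j\<in>{1..m}. indicator (- Hp) (z n j)) * (indicator B (z n (Suc m)) * indicator Hp (z n (Suc m))))"
    if "a n \<noteq> 0" for n
  proof -
    have "z n 0 \<in> - Hp" using that by (auto simp: a_eq z_def split: if_splits)
    then show ?thesis
      unfolding ev_def by (subst first_time_sum[of "z n" "- Hp" up_crossing B]) (auto simp: up_crossing_def)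
  qed
  have ev_shift: "ev y B = ev (z n) B" if "a n \<noteq> 0" for n
  proof -
    have "0 \<le> y i" if "i \<le> n" for i
      using y0 \<open>a n \<noteq> 0\<close> that by (cases i) (auto simp: a_eq split: if_splits)
    moreover have "z n = (\<lambda>j. y (Suc n + j))" by (simp add: z_def fun_eq_iff)
    ultimately show ?thesis using up_crossing_shift[of n y B] unfolding ev_def by simp
  qed
  have "ev y B = (\<Sum>n. a n * ev (z n) B)"
  proof (cases "\<exists>j. j \<ge> 1 \<and> y j \<notin> Hp")
    case True
    have "(\<Sum>n. a n * ev (z n) B) = (\<Sum>n. a n * ev y B)"
      by (rule suminf_cong) (metis ev_shift mult_zero_left)
    also have "\<dots> = (\<Sum>n. a n) * ev y B" by simp
    also have "(\<Sum>n. a n) = 1"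
      using exit_decomposition[OF True, of "\<lambda>_. 1"] by (simp add: a_def)
    finally show ?thesis by simp
  next
    case False
    then have "a n = 0" for n by (auto simp: a_eq)
    moreover have "\<not> up_crossing y k" for k
    proof
      assume "up_crossing y k"
      then have "y (k - 1) < 0" by (simp add: up_crossing_def)
      moreover have "0 \<le> y (k - 1)"
        using False y0 by (cases "k - 1 = 0") (simp, metis Hp_iff One_nat_def Suc_leI not_gr_zero)
      ultimately show False by simp
    qed
    ultimately show ?thesis by (simp add: ev_def first_time_def)
  qed
  also have "\<dots> = (\<Sum>n. a n * (\<Sum>m. (\<Prod>j\<in>{1..m}. indicator (- Hp) (z n j)) * (indicator B (z n (Suc m)) * indicator Hp (z n (Suc m)))))"
  proof (rule suminf_cong)
    fix n
    show "a n * ev (z n) B = a n * (\<Sum>m. (\<Prod>j\<in>{1..m}. indicator (- Hp) (z n j)) * (indicator B (z n (Suc m)) * indicator Hp (z n (Suc m))))"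
    proof (cases "a n = 0")
      case False
      show ?thesis unfolding inner[OF False] ..
    qed simp
  qed
  finally show ?thesis by (simp add: ev_def a_def z_def mult.assoc)
qed

text \<open>Killed steps with a constraint that varies in time, \<open>T i\<close> being imposed at
  time \<open>i\<close> from 1 to n: a first crossing prescribes different half-lines before and
  after it.\<close>

primrec seqop :: "(real \<Rightarrow> real measure) \<Rightarrow> (nat \<Rightarrow> real set) \<Rightarrow> nat \<Rightarrow> (real \<Rightarrow> ennreal) \<Rightarrow> real \<Rightarrow> ennreal" where
  "seqop \<kappa> T 0 g = g"
| "seqop \<kappa> T (Suc n) g = seqop \<kappa> T n (taboo \<kappa> (T (Suc n)) g)"

lemma seqop_const: "(\<And>i. i \<in> {1..n} \<Longrightarrow> T i = S) \<Longrightarrow> seqop \<kappa> T n g = (taboo \<kappa> S ^^ n) g"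
  by (induction n arbitrary: g) (auto simp: funpow_swap1)

lemma seqop_add: "seqop \<kappa> T (n + m) g = seqop \<kappa> T n (seqop \<kappa> (\<lambda>i. T (n + i)) m g)"
  by (induction m arbitrary: g) auto

text \<open>The definition of the chain provides real conditional probabilities of single sets,
  almost surely. To pass to functions, both sides are read as integrals of \<open>g\<close> against
  measures on the line, which agree on Borel sets; the event \<open>F\<close> of the past enters as
  a density.\<close>

lemma markov_step:
  assumes Y: "markov_chain_from x \<kappa> N Y" and \<kappa>: "prob_kern \<kappa>"
    and F: "F \<in> sets (natural_filtration N Y n)" and g: "g \<in> BM"
  shows "(\<integral>\<^sup>+\<omega>. indicator F \<omega> * g (Y (Suc n) \<omega>) \<partial>N) = (\<integral>\<^sup>+\<omega>. indicator F \<omega> * taboo \<kappa> UNIV g (Y n \<omega>) \<partial>N)"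
proof -
  interpret prob_space N using Y by (simp add: markov_chain_from_def)
  have Ym [measurable]: "Y n \<in> borel_measurable N" for n using Y by (simp add: markov_chain_from_def)
  have k: "kern \<kappa>" and pk: "\<And>x. prob_space (\<kappa> x)" using \<kappa> by (auto simp: prob_kern_def)
  let ?G = "natural_filtration N Y n"
  have gen: "(\<Union>i\<in>{..n}. {Y i -` B \<inter> space N | B. B \<in> sets borel}) \<subseteq> Pow (space N)" by auto
  have sub: "subalgebra N ?G"
    unfolding subalgebra_def
  proof
    show "space ?G = space N" by (simp add: natural_filtration_def space_measure_of_conv)
    have "(\<Union>i\<in>{..n}. {Y i -` B \<inter> space N | B. B \<in> sets borel}) \<subseteq> sets N"
      using Ym by (auto intro: measurable_sets)
    then show "sets ?G \<subseteq> sets N"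
      unfolding natural_filtration_def sets_measure_of[OF gen] by (rule sets.sigma_sets_subset)
  qed
  interpret sigma_finite_subalgebra N ?G
    by (rule finite_measure_subalgebra_is_sigma_finite)
       (simp add: finite_measure_subalgebra_def finite_measure_axioms finite_measure_subalgebra_axioms_def sub)
  have FN [measurable]: "F \<in> sets N" using F sub by (auto simp: subalgebra_def)
  define D where "D = density N (indicator F)"
  have [measurable_cong]: "sets D = sets N" by (simp add: D_def)
  have L: "linop (taboo \<kappa> UNIV)" by (rule linop_taboo[OF k]) simp
  have eq: "distr D borel (Y (Suc n)) = act (distr D borel (Y n)) (taboo \<kappa> UNIV)"
  proof (rule measure_eqI)
    fix B assume "B \<in> sets (distr D borel (Y (Suc n)))"
    then have B [measurable]: "B \<in> sets borel" by simp
    have tb: "taboo \<kappa> UNIV (indicator B) y = ennreal (measure (\<kappa> y) B)" for y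
    proof -
      interpret ky: prob_space "\<kappa> y" by (rule pk)
      show ?thesis using B kern_sets[OF k, of y] by (simp add: taboo_def ky.emeasure_eq_measure)
    qed
    have tm: "(\<lambda>y. measure (\<kappa> y) B) \<in> borel_measurable borel"
    proof -
      have "(\<lambda>y. enn2real (taboo \<kappa> UNIV (indicator B) y)) \<in> borel_measurable borel"
        using linop_measurable[OF L, of "indicator B"] by measurable
      then show ?thesis by (simp add: tb)
    qed
    let ?E = "{\<omega> \<in> space N. Y (Suc n) \<omega> \<in> B}"
    have E [measurable]: "?E \<in> sets N" by measurable
    have cond: "AE \<omega> in N. real_cond_exp N ?G (indicator ?E) \<omega> = measure (\<kappa> (Y n \<omega>)) B"
      using Y B by (simp add: markov_chain_from_def)
    have "emeasure (distr D borel (Y (Suc n))) B = (\<integral>\<^sup>+\<omega>. indicator F \<omega> * indicator ?E \<omega> \<partial>N)"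
    proof -
      have "emeasure (distr D borel (Y (Suc n))) B = emeasure D (Y (Suc n) -` B \<inter> space N)"
        by (subst emeasure_distr) (auto simp: D_def)
      also have "\<dots> = (\<integral>\<^sup>+\<omega>. indicator F \<omega> * indicator (Y (Suc n) -` B \<inter> space N) \<omega> \<partial>N)"
        unfolding D_def by (subst emeasure_density) auto
      also have "\<dots> = (\<integral>\<^sup>+\<omega>. indicator F \<omega> * indicator ?E \<omega> \<partial>N)"
        by (rule nn_integral_cong) (auto simp: indicator_def)
      finally show ?thesis .
    qed
    also have "\<dots> = (\<integral>\<^sup>+\<omega>. ennreal (indicator F \<omega> * indicator ?E \<omega>) \<partial>N)"
      by (intro nn_integral_cong) (simp add: ennreal_mult ennreal_indicator)
    also have "\<dots> = ennreal (\<integral>\<omega>. indicator F \<omega> * indicator ?E \<omega> \<partial>N)"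
    proof (rule nn_integral_eq_integral)
      show "integrable N (\<lambda>\<omega>. indicator F \<omega> * indicator ?E \<omega> :: real)"
        by (rule integrable_const_bound[where B = 1]) (auto simp: indicator_def)
    qed simp
    also have "(\<integral>\<omega>. indicator F \<omega> * indicator ?E \<omega> \<partial>N) = (\<integral>\<omega>. indicator F \<omega> * measure (\<kappa> (Y n \<omega>)) B \<partial>N)"
    proof -
      have "integrable N (indicator ?E :: _ \<Rightarrow> real)"
        by (rule integrable_const_bound[where B = 1]) (auto simp: indicator_def)
      from real_cond_exp_intA[OF this F]
      have "(\<integral>\<omega>. indicator F \<omega> * indicator ?E \<omega> \<partial>N) = (\<integral>\<omega>. indicator F \<omega> * real_cond_exp N ?G (indicator ?E) \<omega> \<partial>N)"
        by (simp add: set_lebesgue_integral_def)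
      also have "\<dots> = (\<integral>\<omega>. indicator F \<omega> * measure (\<kappa> (Y n \<omega>)) B \<partial>N)"
      proof (rule integral_cong_AE)
        show "AE \<omega> in N. indicator F \<omega> * real_cond_exp N ?G (indicator ?E) \<omega> = indicator F \<omega> * measure (\<kappa> (Y n \<omega>)) B"
          using cond by eventually_elim simp
      qed (use tm in measurable)
      finally show ?thesis .
    qed
    also have "ennreal (\<integral>\<omega>. indicator F \<omega> * measure (\<kappa> (Y n \<omega>)) B \<partial>N) = (\<integral>\<^sup>+\<omega>. ennreal (indicator F \<omega> * measure (\<kappa> (Y n \<omega>)) B) \<partial>N)"
    proof (rule nn_integral_eq_integral[symmetric])
      show "integrable N (\<lambda>\<omega>. indicator F \<omega> * measure (\<kappa> (Y n \<omega>)) B)"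
        by (rule integrable_const_bound[where B = 1])
           (use tm in \<open>auto simp: indicator_def prob_space.prob_le_1[OF pk]\<close>)
    qed auto
    also have "\<dots> = (\<integral>\<^sup>+\<omega>. indicator F \<omega> * taboo \<kappa> UNIV (indicator B) (Y n \<omega>) \<partial>N)"
      by (intro nn_integral_cong) (auto simp: tb ennreal_mult ennreal_indicator)
    also have "\<dots> = (\<integral>\<^sup>+\<omega>. taboo \<kappa> UNIV (indicator B) (Y n \<omega>) \<partial>D)"
      unfolding D_def using linop_measurable[OF L, of "indicator B"]
      by (subst nn_integral_density) auto
    also have "\<dots> = (\<integral>\<^sup>+y. taboo \<kappa> UNIV (indicator B) y \<partial>distr D borel (Y n))"
      using linop_measurable[OF L, of "indicator B"] by (subst nn_integral_distr) auto
    also have "\<dots> = emeasure (act (distr D borel (Y n)) (taboo \<kappa> UNIV)) B"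
      by (rule emeasure_act[OF L _ B, symmetric]) simp
    finally show "emeasure (distr D borel (Y (Suc n))) B = emeasure (act (distr D borel (Y n)) (taboo \<kappa> UNIV)) B" .
  qed simp
  have "(\<integral>\<^sup>+\<omega>. indicator F \<omega> * g (Y (Suc n) \<omega>) \<partial>N) = (\<integral>\<^sup>+y. g y \<partial>distr D borel (Y (Suc n)))"
    using g by (subst nn_integral_distr) (auto simp: D_def nn_integral_density)
  also have "\<dots> = (\<integral>\<^sup>+y. taboo \<kappa> UNIV g y \<partial>distr D borel (Y n))"
    unfolding eq by (rule nn_integral_act[OF L _ g]) simp
  also have "\<dots> = (\<integral>\<^sup>+\<omega>. indicator F \<omega> * taboo \<kappa> UNIV g (Y n \<omega>) \<partial>N)"
    using linop_measurable[OF L g] by (subst nn_integral_distr) (auto simp: D_def nn_integral_density)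
  finally show ?thesis .
qed

lemma markov_seqop:
  assumes Y: "markov_chain_from x \<kappa> N Y" and \<kappa>: "prob_kern \<kappa>"
    and T: "\<And>i. T i \<in> sets borel" and g: "g \<in> BM"
  shows "(\<integral>\<^sup>+\<omega>. (\<Prod>i\<in>{1..n}. indicator (T i) (Y i \<omega>)) * g (Y n \<omega>) \<partial>N) = seqop \<kappa> T n g x"
  using g
proof (induction n arbitrary: g)
  case 0
  interpret prob_space N using Y by (simp add: markov_chain_from_def)
  have "AE \<omega> in N. Y 0 \<omega> = x" using Y by (simp add: markov_chain_from_def)
  then have "(\<integral>\<^sup>+\<omega>. g (Y 0 \<omega>) \<partial>N) = (\<integral>\<^sup>+\<omega>. g x \<partial>N)"
    by (intro nn_integral_cong_AE) (auto elim!: eventually_mono)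
  then show ?case by (simp add: emeasure_space_1)
next
  case (Suc n)
  have k: "kern \<kappa>" using \<kappa> by (simp add: prob_kern_def)
  define F where "F = {\<omega> \<in> space N. \<forall>i\<in>{1..n}. Y i \<omega> \<in> T i}"
  have gen: "(\<Union>i\<in>{..n}. {Y i -` B \<inter> space N | B. B \<in> sets borel}) \<subseteq> Pow (space N)" by auto
  have F: "F \<in> sets (natural_filtration N Y n)"
  proof -
    have sp: "space (natural_filtration N Y n) = space N"
      by (simp add: natural_filtration_def space_measure_of_conv)
    have "Y i -` T i \<inter> space N \<in> sets (natural_filtration N Y n)" if "i \<in> {1..n}" for i
      unfolding natural_filtration_def sets_measure_of[OF gen]
      using that T by (intro sigma_sets.Basic) auto
    moreover have "{\<omega> \<in> space (natural_filtration N Y n). Y i \<omega> \<in> T i} = Y i -` T i \<inter> space N" for i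
      by (auto simp: sp)
    ultimately have "{\<omega> \<in> space (natural_filtration N Y n). \<forall>i\<in>{1..n}. Y i \<omega> \<in> T i} \<in> sets (natural_filtration N Y n)"
      by (intro sets.sets_Collect_finite_All) auto
    then show ?thesis by (simp add: F_def sp)
  qed
  have ind: "(\<Prod>i\<in>{1..n}. indicator (T i) (Y i \<omega>)) = (indicator F \<omega> :: ennreal)" if "\<omega> \<in> space N" for \<omega>
    using that by (subst prod_indicator) (auto simp: F_def indicator_def)
  define h where "h y = g y * indicator (T (Suc n)) y" for y
  have h: "h \<in> BM" unfolding h_def using Suc(2) T by measurable
  have "(\<integral>\<^sup>+\<omega>. (\<Prod>i\<in>{1..Suc n}. indicator (T i) (Y i \<omega>)) * g (Y (Suc n) \<omega>) \<partial>N)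
      = (\<integral>\<^sup>+\<omega>. indicator F \<omega> * h (Y (Suc n) \<omega>) \<partial>N)"
  proof (rule nn_integral_cong)
    fix \<omega> assume \<omega>: "\<omega> \<in> space N"
    have "(\<Prod>i\<in>{1..Suc n}. indicator (T i) (Y i \<omega>)) = (\<Prod>i\<in>{1..n}. indicator (T i) (Y i \<omega>)) * (indicator (T (Suc n)) (Y (Suc n) \<omega>) :: ennreal)"
      by simp
    then show "(\<Prod>i\<in>{1..Suc n}. indicator (T i) (Y i \<omega>)) * g (Y (Suc n) \<omega>) = indicator F \<omega> * h (Y (Suc n) \<omega>)"
      unfolding ind[OF \<omega>] h_def by (simp only: ac_simps)
  qed
  also have "\<dots> = (\<integral>\<^sup>+\<omega>. indicator F \<omega> * taboo \<kappa> UNIV h (Y n \<omega>) \<partial>N)"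
    by (rule markov_step[OF Y \<kappa> F h])
  also have "taboo \<kappa> UNIV h = taboo \<kappa> (T (Suc n)) g"
    by (simp add: taboo_def h_def fun_eq_iff)
  also have "(\<integral>\<^sup>+\<omega>. indicator F \<omega> * taboo \<kappa> (T (Suc n)) g (Y n \<omega>) \<partial>N)
      = (\<integral>\<^sup>+\<omega>. (\<Prod>i\<in>{1..n}. indicator (T i) (Y i \<omega>)) * taboo \<kappa> (T (Suc n)) g (Y n \<omega>) \<partial>N)"
    by (rule nn_integral_cong) (simp only: ind)
  also have "\<dots> = seqop \<kappa> T n (taboo \<kappa> (T (Suc n)) g) x"
    by (rule Suc.IH[OF taboo_measurable[OF k T Suc(2)]])
  finally show ?case by simp
qed

lemma prod_Suc_Icc: "(\<Prod>i\<in>{1..Suc n}. f i) = (\<Prod>i\<in>{1..n}. f i) * (f (Suc n) :: ennreal)"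
  by simp

lemma overshoot_event_measurable:
  assumes Y: "\<And>n. Y n \<in> borel_measurable N" and B: "B \<in> sets borel"
    and C: "\<And>k. Measurable.pred N (\<lambda>\<omega>. C (\<lambda>n. Y n \<omega>) k)"
  shows "{\<omega> \<in> space N. (\<exists>k. C (\<lambda>n. Y n \<omega>) k) \<and> overshoot C (\<lambda>n. Y n \<omega>) 1 \<in> B} \<in> sets N"
proof -
  note [measurable] = Y B C
  have "Measurable.pred N (\<lambda>\<omega>. \<exists>k. first_time C (\<lambda>n. Y n \<omega>) k \<and> Y k \<omega> \<in> B)"
    unfolding first_time_def by measurable
  then show ?thesis unfolding overshoot_iff_first_time by (simp add: pred_def)
qed

lemma overshoot_kernel_eq:
  assumes "{\<omega> \<in> space (Pr x). (\<exists>k. C (\<lambda>n. Y n \<omega>) k) \<and> overshoot C (\<lambda>n. Y n \<omega>) 1 \<in> B} \<in> sets (Pr x)"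
  shows "overshoot_kernel C Pr Y x B
    = (\<integral>\<^sup>+\<omega>. (if (\<exists>k. first_time C (\<lambda>n. Y n \<omega>) k \<and> Y k \<omega> \<in> B) then 1 else 0) \<partial>Pr x)"
proof -
  have "overshoot_kernel C Pr Y x B = (\<integral>\<^sup>+\<omega>. indicator {\<omega> \<in> space (Pr x). (\<exists>k. C (\<lambda>n. Y n \<omega>) k) \<and> overshoot C (\<lambda>n. Y n \<omega>) 1 \<in> B} \<omega> \<partial>Pr x)"
    unfolding overshoot_kernel_def using assms by (rule nn_integral_indicator[symmetric])
  also have "\<dots> = (\<integral>\<^sup>+\<omega>. (if (\<exists>k. first_time C (\<lambda>n. Y n \<omega>) k \<and> Y k \<omega> \<in> B) then 1 else 0) \<partial>Pr x)"
    unfolding overshoot_iff_first_time by (intro nn_integral_cong) (auto simp: indicator_def)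
  finally show ?thesis .
qed

text \<open>Covers zero-crossings from either side and up-crossings from below, where the first
  crossing is the first exit from the half-line \<open>T\<close> of the start. Summing over the exit
  time gives the exit operator.\<close>

lemma overshoot_kernel_exit:
  assumes Y: "markov_chain_from x \<kappa> (Pr x) Y" and \<kappa>: "prob_kern \<kappa>"
    and x: "x \<in> T" and T: "T \<in> sets borel" and B: "B \<in> sets borel"
    and C: "\<And>y k. y k \<in> T \<Longrightarrow> C y (Suc k) \<longleftrightarrow> y (Suc k) \<notin> T" and C0: "\<And>y. \<not> C y 0"
    and Cm: "\<And>k. Measurable.pred (Pr x) (\<lambda>\<omega>. C (\<lambda>n. Y n \<omega>) k)"
  shows "overshoot_kernel C Pr Y x B = exitop \<kappa> T (indicator B) x"
proof -
  let ?N = "Pr x"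
  have Ym [measurable]: "Y n \<in> borel_measurable ?N" for n using Y by (simp add: markov_chain_from_def)
  have Y0: "AE \<omega> in ?N. Y 0 \<omega> = x" using Y by (simp add: markov_chain_from_def)
  note [measurable] = T B
  have "overshoot_kernel C Pr Y x B
      = (\<integral>\<^sup>+\<omega>. (if (\<exists>k. first_time C (\<lambda>n. Y n \<omega>) k \<and> Y k \<omega> \<in> B) then 1 else 0) \<partial>?N)"
    by (rule overshoot_kernel_eq[where Pr = Pr and x = x, OF overshoot_event_measurable[where C = C, OF Ym B Cm]])
  also have "\<dots> = (\<integral>\<^sup>+\<omega>. (\<Sum>n. (\<Prod>i\<in>{1..n}. indicator T (Y i \<omega>)) * (indicator B (Y (Suc n) \<omega>) * indicator (- T) (Y (Suc n) \<omega>))) \<partial>?N)"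
  proof (rule nn_integral_cong_AE)
    show "AE \<omega> in ?N. (if (\<exists>k. first_time C (\<lambda>n. Y n \<omega>) k \<and> Y k \<omega> \<in> B) then 1 else 0 :: ennreal)
        = (\<Sum>n. (\<Prod>i\<in>{1..n}. indicator T (Y i \<omega>)) * (indicator B (Y (Suc n) \<omega>) * indicator (- T) (Y (Suc n) \<omega>)))"
      using Y0
    proof eventually_elim
      case (elim \<omega>)
      show ?case by (rule first_time_sum) (use elim x C C0 in auto)
    qed
  qed
  also have "\<dots> = (\<Sum>n. \<integral>\<^sup>+\<omega>. (\<Prod>i\<in>{1..n}. indicator T (Y i \<omega>)) * (indicator B (Y (Suc n) \<omega>) * indicator (- T) (Y (Suc n) \<omega>)) \<partial>?N)"
    by (rule nn_integral_suminf) measurable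
  also have "\<dots> = (\<Sum>n. (taboo \<kappa> T ^^ n) (taboo \<kappa> (- T) (indicator B)) x)"
  proof (rule suminf_cong)
    fix n :: nat
    \<comment> \<open>Inside \<open>T\<close> up to time n, outside at the exit time n + 1.\<close>
    define T' where "T' i = (if i \<le> n then T else - T)" for i
    have "(\<integral>\<^sup>+\<omega>. (\<Prod>i\<in>{1..n}. indicator T (Y i \<omega>)) * (indicator B (Y (Suc n) \<omega>) * indicator (- T) (Y (Suc n) \<omega>)) \<partial>?N)
        = (\<integral>\<^sup>+\<omega>. (\<Prod>i\<in>{1..Suc n}. indicator (T' i) (Y i \<omega>)) * indicator B (Y (Suc n) \<omega>) \<partial>?N)"
    proof (rule nn_integral_cong)
      fix \<omega>
      have "(\<Prod>i\<in>{1..n}. indicator (T' i) (Y i \<omega>)) = (\<Prod>i\<in>{1..n}. indicator T (Y i \<omega>) :: ennreal)"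
        by (intro prod.cong) (auto simp: T'_def)
      then show "(\<Prod>i\<in>{1..n}. indicator T (Y i \<omega>)) * (indicator B (Y (Suc n) \<omega>) * indicator (- T) (Y (Suc n) \<omega>))
          = (\<Prod>i\<in>{1..Suc n}. indicator (T' i) (Y i \<omega>)) * (indicator B (Y (Suc n) \<omega>) :: ennreal)"
        unfolding prod_Suc_Icc by (simp add: T'_def ac_simps)
    qed
    also have "\<dots> = seqop \<kappa> T' (Suc n) (indicator B) x"
      by (rule markov_seqop[OF Y \<kappa>]) (auto simp: T'_def)
    also have "\<dots> = (taboo \<kappa> T ^^ n) (taboo \<kappa> (- T) (indicator B)) x"
    proof -
      have "seqop \<kappa> T' n (taboo \<kappa> (- T) (indicator B)) = (taboo \<kappa> T ^^ n) (taboo \<kappa> (- T) (indicator B))"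
        by (rule seqop_const) (auto simp: T'_def)
      then show ?thesis by (simp add: T'_def)
    qed
    finally show "(\<integral>\<^sup>+\<omega>. (\<Prod>i\<in>{1..n}. indicator T (Y i \<omega>)) * (indicator B (Y (Suc n) \<omega>) * indicator (- T) (Y (Suc n) \<omega>)) \<partial>?N)
        = (taboo \<kappa> T ^^ n) (taboo \<kappa> (- T) (indicator B)) x" .
  qed
  finally show ?thesis by (simp add: exitop_def pot_def)
qed

lemma crossing_measurable:
  assumes Y [measurable]: "\<And>n. Y n \<in> borel_measurable N"
  shows "Measurable.pred N (\<lambda>\<omega>. up_crossing (\<lambda>n. Y n \<omega>) k)" "Measurable.pred N (\<lambda>\<omega>. zero_crossing (\<lambda>n. Y n \<omega>) k)"
  unfolding up_crossing_def zero_crossing_def down_crossing_def by measurable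

lemma overshoot_kernel_zero_crossing_nonneg:
  assumes Y: "markov_chain_from x \<kappa> (Pr x) Y" and \<kappa>: "prob_kern \<kappa>" and x: "0 \<le> x" and B: "B \<in> sets borel"
  shows "overshoot_kernel zero_crossing Pr Y x B = exitop \<kappa> Hp (indicator B) x"
proof (rule overshoot_kernel_exit[where Pr = Pr and x = x, OF Y \<kappa> _ Hp_sets B])
  have "Y n \<in> borel_measurable (Pr x)" for n using Y by (simp add: markov_chain_from_def)
  then show "Measurable.pred (Pr x) (\<lambda>\<omega>. zero_crossing (\<lambda>n. Y n \<omega>) k)" for k by (rule crossing_measurable)
qed (use x in \<open>auto simp: zero_crossing_def up_crossing_def down_crossing_def\<close>)

lemma overshoot_kernel_zero_crossing_neg:
  assumes Y: "markov_chain_from x \<kappa> (Pr x) Y" and \<kappa>: "prob_kern \<kappa>" and x: "x < 0" and B: "B \<in> sets borel"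
  shows "overshoot_kernel zero_crossing Pr Y x B = exitop \<kappa> (- Hp) (indicator B) x"
proof (rule overshoot_kernel_exit[where Pr = Pr and x = x, OF Y \<kappa> _ _ B])
  have "Y n \<in> borel_measurable (Pr x)" for n using Y by (simp add: markov_chain_from_def)
  then show "Measurable.pred (Pr x) (\<lambda>\<omega>. zero_crossing (\<lambda>n. Y n \<omega>) k)" for k by (rule crossing_measurable)
qed (use x in \<open>auto simp: zero_crossing_def up_crossing_def down_crossing_def\<close>)

lemma overshoot_kernel_up_crossing_neg:
  assumes Y: "markov_chain_from x \<kappa> (Pr x) Y" and \<kappa>: "prob_kern \<kappa>" and x: "x < 0" and B: "B \<in> sets borel"
  shows "overshoot_kernel up_crossing Pr Y x B = exitop \<kappa> (- Hp) (indicator B) x"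
proof (rule overshoot_kernel_exit[where Pr = Pr and x = x, OF Y \<kappa> _ _ B])
  have "Y n \<in> borel_measurable (Pr x)" for n using Y by (simp add: markov_chain_from_def)
  then show "Measurable.pred (Pr x) (\<lambda>\<omega>. up_crossing (\<lambda>n. Y n \<omega>) k)" for k by (rule crossing_measurable)
qed (use x in \<open>auto simp: up_crossing_def\<close>)

text \<open>From above zero an up-crossing must be preceded by a down-crossing, so two exit
  operators are composed; \<open>seqop\<close> turns each term of the double sum over the two
  durations into a product of powers.\<close>

lemma overshoot_kernel_up_crossing_nonneg:
  assumes Y: "markov_chain_from x \<kappa> (Pr x) Y" and \<kappa>: "prob_kern \<kappa>" and x: "0 \<le> x" and B: "B \<in> sets borel"
  shows "overshoot_kernel up_crossing Pr Y x B = exitop \<kappa> Hp (exitop \<kappa> (- Hp) (indicator B)) x"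
proof -
  let ?N = "Pr x"
  have Ym [measurable]: "Y n \<in> borel_measurable ?N" for n using Y by (simp add: markov_chain_from_def)
  have Y0: "AE \<omega> in ?N. Y 0 \<omega> = x" using Y by (simp add: markov_chain_from_def)
  have k: "kern \<kappa>" using \<kappa> by (simp add: prob_kern_def)
  note [measurable] = B
  define t where "t n m \<omega> = (\<Prod>i\<in>{1..n}. indicator Hp (Y i \<omega>)) * (indicator (- Hp) (Y (Suc n) \<omega>) *
        ((\<Prod>j\<in>{1..m}. indicator (- Hp) (Y (Suc n + j) \<omega>)) *
         (indicator B (Y (Suc n + Suc m) \<omega>) * indicator Hp (Y (Suc n + Suc m) \<omega>)) :: ennreal))" for n m \<omega>
  have tm [measurable]: "t n m \<in> borel_measurable ?N" for n m unfolding t_def[abs_def] by measurable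
  have "overshoot_kernel up_crossing Pr Y x B
      = (\<integral>\<^sup>+\<omega>. (if (\<exists>k. first_time up_crossing (\<lambda>n. Y n \<omega>) k \<and> Y k \<omega> \<in> B) then 1 else 0) \<partial>?N)"
    by (rule overshoot_kernel_eq[where Pr = Pr and x = x, OF overshoot_event_measurable[where C = up_crossing, OF Ym B crossing_measurable(1)[OF Ym]]])
  also have "\<dots> = (\<integral>\<^sup>+\<omega>. (\<Sum>n. \<Sum>m. t n m \<omega>) \<partial>?N)"
  proof (rule nn_integral_cong_AE)
    show "AE \<omega> in ?N. (if (\<exists>k. first_time up_crossing (\<lambda>n. Y n \<omega>) k \<and> Y k \<omega> \<in> B) then 1 else 0 :: ennreal) = (\<Sum>n. \<Sum>m. t n m \<omega>)"
      using Y0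
    proof eventually_elim
      case (elim \<omega>)
      show ?case unfolding t_def by (rule up_crossing_sum) (use elim x in simp)
    qed
  qed
  also have "\<dots> = (\<Sum>n. \<integral>\<^sup>+\<omega>. (\<Sum>m. t n m \<omega>) \<partial>?N)" by (rule nn_integral_suminf) measurable
  also have "\<dots> = (\<Sum>n. \<Sum>m. \<integral>\<^sup>+\<omega>. t n m \<omega> \<partial>?N)" by (intro suminf_cong nn_integral_suminf) measurable
  also have "\<dots> = (\<Sum>n. \<Sum>m. (taboo \<kappa> Hp ^^ n) (taboo \<kappa> (- Hp) ((taboo \<kappa> (- Hp) ^^ m) (taboo \<kappa> Hp (indicator B)))) x)"
  proof (intro suminf_cong)
    fix n m :: nat
    \<comment> \<open>Nonnegative up to n, negative from n + 1 to n + 1 + m, nonnegative at the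
      final time n + m + 2.\<close>
    define T where "T i = (if i \<le> n then Hp else if i \<le> Suc n + m then - Hp else Hp)" for i
    have T1: "(\<Prod>i\<in>{1..Suc n + Suc m}. indicator (T i) (y i)) = (\<Prod>i\<in>{1..n}. indicator Hp (y i)) *
        (indicator (- Hp) (y (Suc n)) * ((\<Prod>j\<in>{1..m}. indicator (- Hp) (y (Suc n + j))) * indicator Hp (y (Suc n + Suc m)) :: ennreal))" for y
    proof -
      have "(\<Prod>i\<in>{1..Suc n + l}. indicator (T i) (y i)) = (\<Prod>i\<in>{1..n}. indicator Hp (y i)) *
          (indicator (- Hp) (y (Suc n)) * (\<Prod>j\<in>{1..l}. indicator (- Hp) (y (Suc n + j)) :: ennreal))" if "l \<le> m" for l
        using that
      proof (induction l)
        case 0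
        have "(\<Prod>i\<in>{1..n}. indicator (T i) (y i)) = (\<Prod>i\<in>{1..n}. indicator Hp (y i) :: ennreal)"
          by (intro prod.cong) (auto simp: T_def)
        then show ?case unfolding add_0_right prod_Suc_Icc by (simp add: T_def)
      next
        case (Suc l)
        then have IH: "(\<Prod>i\<in>{1..Suc n + l}. indicator (T i) (y i)) = (\<Prod>i\<in>{1..n}. indicator Hp (y i)) *
          (indicator (- Hp) (y (Suc n)) * (\<Prod>j\<in>{1..l}. indicator (- Hp) (y (Suc n + j)) :: ennreal))" by simp
        have "T (Suc (Suc n + l)) = - Hp" using Suc(2) by (simp add: T_def)
        then show ?case unfolding add_Suc_right prod_Suc_Icc IH by (simp only: ac_simps)
      qed
      from this[of m] have E: "(\<Prod>i\<in>{1..Suc n + m}. indicator (T i) (y i)) = (\<Prod>i\<in>{1..n}. indicator Hp (y i)) *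
          (indicator (- Hp) (y (Suc n)) * (\<Prod>j\<in>{1..m}. indicator (- Hp) (y (Suc n + j)) :: ennreal))" by simp
      have "T (Suc (Suc n + m)) = Hp" by (simp add: T_def)
      then show ?thesis unfolding add_Suc_right prod_Suc_Icc E by (simp only: ac_simps)
    qed
    have "(\<integral>\<^sup>+\<omega>. t n m \<omega> \<partial>?N)
        = (\<integral>\<^sup>+\<omega>. (\<Prod>i\<in>{1..Suc n + Suc m}. indicator (T i) (Y i \<omega>)) * indicator B (Y (Suc n + Suc m) \<omega>) \<partial>?N)"
      unfolding T1 t_def by (rule nn_integral_cong) (simp only: ac_simps)
    also have "\<dots> = seqop \<kappa> T (Suc n + Suc m) (indicator B) x"
      by (rule markov_seqop[OF Y \<kappa>]) (auto simp: T_def)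
    also have "\<dots> = seqop \<kappa> T (Suc n) (seqop \<kappa> (\<lambda>i. T (Suc n + i)) (Suc m) (indicator B)) x"
      by (simp only: seqop_add)
    also have "seqop \<kappa> (\<lambda>i. T (Suc n + i)) (Suc m) (indicator B) = (taboo \<kappa> (- Hp) ^^ m) (taboo \<kappa> Hp (indicator B))"
    proof -
      have "T (Suc n + Suc m) = Hp" by (simp add: T_def)
      moreover have "seqop \<kappa> (\<lambda>i. T (Suc n + i)) m (taboo \<kappa> Hp (indicator B)) = (taboo \<kappa> (- Hp) ^^ m) (taboo \<kappa> Hp (indicator B))"
        by (rule seqop_const) (auto simp: T_def)
      ultimately show ?thesis by (simp only: seqop.simps)
    qed
    also have "seqop \<kappa> T (Suc n) ((taboo \<kappa> (- Hp) ^^ m) (taboo \<kappa> Hp (indicator B))) x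
        = (taboo \<kappa> Hp ^^ n) (taboo \<kappa> (- Hp) ((taboo \<kappa> (- Hp) ^^ m) (taboo \<kappa> Hp (indicator B)))) x"
    proof -
      let ?g = "taboo \<kappa> (- Hp) ((taboo \<kappa> (- Hp) ^^ m) (taboo \<kappa> Hp (indicator B)))"
      have "seqop \<kappa> T n ?g = (taboo \<kappa> Hp ^^ n) ?g"
        by (rule seqop_const) (auto simp: T_def)
      then show ?thesis by (simp add: T_def)
    qed
    finally show "(\<integral>\<^sup>+\<omega>. t n m \<omega> \<partial>?N) = (taboo \<kappa> Hp ^^ n) (taboo \<kappa> (- Hp) ((taboo \<kappa> (- Hp) ^^ m) (taboo \<kappa> Hp (indicator B)))) x" .
  qed
  also have "\<dots> = (\<Sum>n. (taboo \<kappa> Hp ^^ n) (taboo \<kappa> (- Hp) (exitop \<kappa> (- Hp) (indicator B))) x)"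
  proof (rule suminf_cong)
    fix n :: nat
    have L: "linop (\<lambda>f. (taboo \<kappa> Hp ^^ n) (taboo \<kappa> (- Hp) f))"
      by (rule linop_comp[OF linop_funpow[OF linop_taboo[OF k]] linop_taboo[OF k]]) auto
    have m: "taboo \<kappa> Hp (indicator B) \<in> BM" by (rule taboo_measurable[OF k]) auto
    have "exitop \<kappa> (- Hp) (indicator B) = (\<lambda>y. \<Sum>m. (taboo \<kappa> (- Hp) ^^ m) (taboo \<kappa> Hp (indicator B)) y)"
      by (simp add: exitop_def pot_def fun_eq_iff)
    moreover have "(taboo \<kappa> (- Hp) ^^ j) (taboo \<kappa> Hp (indicator B)) \<in> BM" for j
      by (rule taboo_funpow_measurable[OF k _ m]) simp
    from linop_suminf[OF L this, of "\<lambda>j. j" x]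
    have "(taboo \<kappa> Hp ^^ n) (taboo \<kappa> (- Hp) (\<lambda>y. \<Sum>m. (taboo \<kappa> (- Hp) ^^ m) (taboo \<kappa> Hp (indicator B)) y)) x
        = (\<Sum>m. (taboo \<kappa> Hp ^^ n) (taboo \<kappa> (- Hp) ((taboo \<kappa> (- Hp) ^^ m) (taboo \<kappa> Hp (indicator B)))) x)" .
    ultimately show "(\<Sum>m. (taboo \<kappa> Hp ^^ n) (taboo \<kappa> (- Hp) ((taboo \<kappa> (- Hp) ^^ m) (taboo \<kappa> Hp (indicator B)))) x)
        = (taboo \<kappa> Hp ^^ n) (taboo \<kappa> (- Hp) (exitop \<kappa> (- Hp) (indicator B))) x"
      by simp
  qed
  finally show ?thesis by (simp add: exitop_def[of \<kappa> Hp] pot_def)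
qed

section \<open>Uniqueness on the state space\<close>

text \<open>As \<open>Z\<close> is closed, a bounded part of it lies in a compact subset of
  \<open>Z\<close>, which finitely many neighbourhoods of finite measure cover.\<close>

lemma locally_finite_bounded:
  assumes \<nu>: "locally_finite_borel_measure_on Z \<nu>" and Z: "closed Z" and B: "B \<in> sets borel" "bounded B"
  shows "emeasure \<nu> (B \<inter> Z) < top"
proof -
  have sets: "sets \<nu> = sets (restrict_space borel Z)"
    and loc: "\<And>x. x \<in> Z \<Longrightarrow> \<exists>U. openin (top_of_set Z) U \<and> x \<in> U \<and> emeasure \<nu> U < top"
    using \<nu> by (auto simp: locally_finite_borel_measure_on_def)
  obtain b a where a: "B \<subseteq> cball b a" using iffD1[OF bounded_subset_cball B(2)] by auto
  have comp: "compact (cball b a \<inter> Z)" using Z by (intro compact_Int_closed) auto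
  define U where "U x = (SOME U. openin (top_of_set Z) U \<and> x \<in> U \<and> emeasure \<nu> U < top)" for x
  have U: "openin (top_of_set Z) (U x) \<and> x \<in> U x \<and> emeasure \<nu> (U x) < top" if "x \<in> Z" for x
    unfolding U_def by (rule someI_ex[OF loc[OF that]])
  define V where "V x = (SOME V. open V \<and> U x = Z \<inter> V)" for x
  have V: "open (V x) \<and> U x = Z \<inter> V x" if "x \<in> Z" for x
    unfolding V_def using U[OF that] by (intro someI_ex[of "\<lambda>V. open V \<and> U x = Z \<inter> V"]) (auto simp: openin_open)
  have cov: "cball b a \<inter> Z \<subseteq> (\<Union>x\<in>Z. V x)"
  proof
    fix x assume "x \<in> cball b a \<inter> Z"
    then have x: "x \<in> Z" by simp
    then have "x \<in> V x" using U[OF x] V[OF x] by simp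
    then show "x \<in> (\<Union>x\<in>Z. V x)" using x by (rule UN_I[rotated])
  qed
  have opV: "open (V x)" if "x \<in> Z" for x using V[OF that] by simp
  obtain F where F: "F \<subseteq> Z" "finite F" "cball b a \<inter> Z \<subseteq> (\<Union>x\<in>F. V x)"
    by (rule compactE_image[OF comp opV cov])
  have m: "U x \<in> sets \<nu>" if "x \<in> Z" for x
    using V[OF that] Z unfolding sets by (auto simp: sets_restrict_space)
  have "emeasure \<nu> (B \<inter> Z) \<le> emeasure \<nu> (\<Union>x\<in>F. U x)"
  proof (rule emeasure_mono)
    show "B \<inter> Z \<subseteq> (\<Union>x\<in>F. U x)"
    proof
      fix x assume x: "x \<in> B \<inter> Z"
      then have "x \<in> (\<Union>x\<in>F. V x)" using a F(3) by auto
      then obtain z where z: "z \<in> F" "x \<in> V z" by (rule UN_E)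
      then have "x \<in> U z" using V[of z] F(1) x by auto
      then show "x \<in> (\<Union>x\<in>F. U x)" using z(1) by (rule UN_I[rotated])
    qed
    show "(\<Union>x\<in>F. U x) \<in> sets \<nu>" using F m by (intro sets.finite_UN) auto
  qed
  also have "\<dots> \<le> (\<Sum>x\<in>F. emeasure \<nu> (U x))"
    using F m by (intro emeasure_subadditive_finite) auto
  also have "\<dots> < top"
  proof -
    have "emeasure \<nu> (U x) < top" if "x \<in> F" for x using U[of x] F(1) that by auto
    then show ?thesis using F(2) by (simp add: less_top)
  qed
  finally show ?thesis .
qed

lemma closed_lattice_set: "closed (lattice_set d)"
proof (cases "d = 0")
  case False
  show ?thesis
    unfolding closed_sequential_limits
  proof (intro allI impI)
    fix x l assume *: "(\<forall>n. x n \<in> lattice_set d) \<and> x \<longlonglongrightarrow> l"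
    then have "Cauchy x" by (intro LIMSEQ_imp_Cauchy) auto
    then have "\<exists>N. \<forall>m\<ge>N. \<forall>n\<ge>N. dist (x m) (x n) < \<bar>d\<bar>"
      using False unfolding Cauchy_def by simp
    then obtain N where N: "\<And>m n. N \<le> m \<Longrightarrow> N \<le> n \<Longrightarrow> dist (x m) (x n) < \<bar>d\<bar>" by auto
    have "x n = x N" if n: "N \<le> n" for n
    proof -
      obtain k m :: int where kl: "x n = d * of_int k" "x N = d * of_int m"
      proof -
        have "x n \<in> lattice_set d" "x N \<in> lattice_set d" using * by auto
        then show thesis using False that by (auto simp: lattice_set_def)
      qed
      have "dist (x n) (x N) < \<bar>d\<bar>" using N n by simp
      then have "\<bar>d * of_int k - d * of_int m\<bar> < \<bar>d\<bar>"
        unfolding kl dist_real_def .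
      moreover have "d * of_int k - d * of_int m = d * of_int (k - m)" by (simp add: right_diff_distrib)
      ultimately have *: "\<bar>d\<bar> * \<bar>real_of_int (k - m)\<bar> < \<bar>d\<bar> * 1" by (simp only: abs_mult mult_1_right)
      have "\<bar>real_of_int (k - m)\<bar> < 1" using False by (intro mult_left_less_imp_less[OF *]) simp
      then have "\<bar>k - m\<bar> < 1" by (simp only: of_int_abs[symmetric] of_int_less_1_iff)
      then have "k = m" by linarith
      then show ?thesis using kl by simp
    qed
    then have "\<forall>n\<ge>N. x n = x N" by blast
    then have "eventually (\<lambda>n. x n = x N) sequentially" unfolding eventually_sequentially by (rule exI)
    then have "x \<longlonglongrightarrow> x N" by (rule tendsto_eventually)
    then have "l = x N" using * by (intro LIMSEQ_unique[of x]) auto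
    then show "l \<in> lattice_set d" using * by simp
  qed
qed (simp add: lattice_set_def)

text \<open>Measures in the theorem live on the trace \<sigma>-algebra of the state space; the
  operators need measures on all Borel sets of the line.\<close>

definition to_borel :: "real measure \<Rightarrow> real measure" where
  "to_borel \<nu> = distr \<nu> borel (\<lambda>x. x)"

lemma sets_to_borel [simp, measurable_cong]: "sets (to_borel \<nu>) = sets borel"
  by (simp add: to_borel_def)

context
  fixes Z :: "real set" and \<nu> :: "real measure"
  assumes Z: "Z \<in> sets borel" and \<nu>: "sets \<nu> = sets (restrict_space borel Z)"
begin

lemma space_\<nu>: "space \<nu> = Z"
  using sets_eq_imp_space_eq[OF \<nu>] by (simp add: space_restrict_space)

lemma sets_\<nu>_iff: "B \<in> sets \<nu> \<longleftrightarrow> B \<in> sets borel \<and> B \<subseteq> Z"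
  unfolding \<nu> using Z by (subst sets_restrict_space_iff) auto

lemma id_\<nu>: "(\<lambda>x. x) \<in> \<nu> \<rightarrow>\<^sub>M borel"
proof -
  have "(\<lambda>x. x) \<in> restrict_space borel Z \<rightarrow>\<^sub>M borel" by (rule measurable_restrict_space1) simp
  then show ?thesis using \<nu> by (simp cong: measurable_cong_sets)
qed

lemma nn_integral_to_borel: "f \<in> BM \<Longrightarrow> (\<integral>\<^sup>+x. f x \<partial>to_borel \<nu>) = (\<integral>\<^sup>+x. f x \<partial>\<nu>)"
  unfolding to_borel_def by (rule nn_integral_distr[OF id_\<nu>]) simp

lemma emeasure_to_borel: "B \<in> sets borel \<Longrightarrow> emeasure (to_borel \<nu>) B = emeasure \<nu> (B \<inter> Z)"
  unfolding to_borel_def by (subst emeasure_distr[OF id_\<nu>]) (auto simp: space_\<nu>)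

lemma AE_to_borel: "AE x in to_borel \<nu>. x \<in> Z"
  unfolding to_borel_def using Z by (subst AE_distr_iff[OF id_\<nu>]) (auto simp: space_\<nu> intro: AE_I2)

end

context ladder_pair_max
begin

abbreviation "Zd \<equiv> lattice_set d"

lemma conv_\<delta>_lattice: "x \<in> Zd \<Longrightarrow> AE y in conv \<delta> x. y \<in> Zd"
  using \<delta>_Z by (subst AE_conv[OF \<delta>(2)]) (auto elim!: eventually_mono intro: lattice_set_add)

lemma conv_\<alpha>_lattice: "x \<in> Zd \<Longrightarrow> AE y in conv \<alpha> x. y \<in> Zd"
  using \<alpha>_Z by (subst AE_conv[OF \<alpha>(2)]) (auto elim!: eventually_mono intro: lattice_set_add)

lemma Ku_neg: "(\<And>y. 0 \<le> y \<Longrightarrow> f y = 0) \<Longrightarrow> Ku f x = 0"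
proof -
  assume "\<And>y. 0 \<le> y \<Longrightarrow> f y = 0"
  then have "Ku f = Ku (\<lambda>_. 0)" by (intro exitop_cong) auto
  then show ?thesis using linop_zero[OF operators_linop(6)] by simp
qed

lemma Kd_nonneg: "(\<And>y. y < 0 \<Longrightarrow> f y = 0) \<Longrightarrow> Kd f x = 0"
proof -
  assume "\<And>y. y < 0 \<Longrightarrow> f y = 0"
  then have "Kd f = Kd (\<lambda>_. 0)" by (intro exitop_cong) auto
  then show ?thesis using linop_zero[OF operators_linop(5)] by simp
qed

definition Psi where "Psi f x = indicator S x * Kd f x + indicator (- S) x * Ku f x"

lemma linop_Psi: "linop Psi"
proof -
  have "linop (\<lambda>f x. indicator S x * Kd f x + indicator (- S) x * Ku f x)"
    by (intro linop_plus linop_mult operators_linop) simp_all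
  then show ?thesis by (simp add: Psi_def[abs_def])
qed

text \<open>A start below zero needs only the upward passage. Such starts are included because the
  up-crossing kernel is considered on the whole state space.\<close>

definition Psi_up where "Psi_up f x = indicator S x * Kd (Ku f) x + indicator (- S) x * Ku f x"

lemma linop_Psi_up: "linop Psi_up"
proof -
  have "linop (\<lambda>f x. indicator S x * Kd (Ku f) x + indicator (- S) x * Ku f x)"
    by (intro linop_plus linop_mult linop_comp[OF operators_linop(5,6)] operators_linop) simp_all
  then show ?thesis by (simp add: Psi_up_def[abs_def])
qed

lemma Ku_Z: "x \<in> Zd \<Longrightarrow> (\<And>y. y \<in> Zd \<Longrightarrow> f y = g y) \<Longrightarrow> Ku f x = Ku g x"
  by (rule exitop_cong_on[where Z = Zd, OF conv_\<alpha>_lattice])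

lemma Kd_Z: "x \<in> Zd \<Longrightarrow> (\<And>y. y \<in> Zd \<Longrightarrow> f y = g y) \<Longrightarrow> Kd f x = Kd g x"
  by (rule exitop_cong_on[where Z = Zd, OF conv_\<delta>_lattice])

lemma Psi_Z: "x \<in> Zd \<Longrightarrow> (\<And>y. y \<in> Zd \<Longrightarrow> f y = g y) \<Longrightarrow> Psi f x = Psi g x"
  unfolding Psi_def using Ku_Z[of x f g] Kd_Z[of x f g] by auto

lemma Psi_up_Z: "x \<in> Zd \<Longrightarrow> (\<And>y. y \<in> Zd \<Longrightarrow> f y = g y) \<Longrightarrow> Psi_up f x = Psi_up g x"
  unfolding Psi_up_def using Ku_Z[of x f g] Kd_Z[of x "Ku f" "Ku g"] Ku_Z[of _ f g] by auto

text \<open>Invariance is given for subsets of the state space only. By \<open>\<Psi>_Z\<close>,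
  seen from the state space \<Psi> does not distinguish a Borel set from its trace, so invariance
  extends to all Borel functions of the line.\<close>

lemma invariant_to_borel:
  assumes \<nu>: "sets \<nu> = sets (restrict_space borel Zd)" and inv: "invariant_measure K \<nu>"
    and L: "linop \<Psi>" and K: "\<And>x B. x \<in> Zd \<Longrightarrow> B \<in> sets borel \<Longrightarrow> K x B = \<Psi> (indicator B) x"
    and \<Psi>_Z: "\<And>x f g. x \<in> Zd \<Longrightarrow> (\<And>y. y \<in> Zd \<Longrightarrow> f y = g y) \<Longrightarrow> \<Psi> f x = \<Psi> g x" and f: "f \<in> BM"
  shows "(\<integral>\<^sup>+x. \<Psi> f x \<partial>to_borel \<nu>) = (\<integral>\<^sup>+x. f x \<partial>to_borel \<nu>)"
proof -
  note Zb = lattice_sets_borel[of d]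
  have "act (to_borel \<nu>) \<Psi> = to_borel \<nu>"
  proof (rule measure_eqI)
    fix B assume "B \<in> sets (act (to_borel \<nu>) \<Psi>)"
    then have B: "B \<in> sets borel" by simp
    have BZ: "B \<inter> Zd \<in> sets borel" using B Zb by auto
    have "emeasure (act (to_borel \<nu>) \<Psi>) B = (\<integral>\<^sup>+x. \<Psi> (indicator B) x \<partial>to_borel \<nu>)"
      by (rule emeasure_act[OF L _ B]) simp
    also have "\<dots> = (\<integral>\<^sup>+x. \<Psi> (indicator B) x \<partial>\<nu>)"
      by (rule nn_integral_to_borel[OF Zb \<nu> linop_measurable[OF L]]) (use B in simp)
    also have "\<dots> = (\<integral>\<^sup>+x. K x (B \<inter> Zd) \<partial>\<nu>)"
    proof (rule nn_integral_cong)
      fix x assume "x \<in> space \<nu>"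
      then have x: "x \<in> Zd" by (simp add: space_\<nu>[OF Zb \<nu>])
      show "\<Psi> (indicator B) x = K x (B \<inter> Zd)"
        unfolding K[OF x BZ] by (rule \<Psi>_Z[OF x]) (simp add: indicator_def)
    qed
    also have "\<dots> = emeasure \<nu> (B \<inter> Zd)"
      using inv BZ sets_\<nu>_iff[OF Zb \<nu>] by (simp add: invariant_measure_def)
    also have "\<dots> = emeasure (to_borel \<nu>) B" by (rule emeasure_to_borel[OF Zb \<nu> B, symmetric])
    finally show "emeasure (act (to_borel \<nu>) \<Psi>) B = emeasure (to_borel \<nu>) B" .
  qed simp
  then show ?thesis using nn_integral_act[OF L _ f, of "to_borel \<nu>"] by simp
qed

text \<open>Common frame for both chains, leaving the operator statements \<open>\<Psi>_inv\<close>
  and \<open>uniq\<close> to be supplied. The bound G \<le> 1 yields local finiteness, and Gp \<le>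
  G a nonzero measure.\<close>

lemma unique_of_density:
  assumes \<pi>: "sets \<pi> = sets (restrict_space borel Zd)"
    and G: "G \<in> BM" "\<And>x. G x \<le> 1" "\<And>x. Gp x \<le> G x" and \<pi>_int: "\<And>f. f \<in> BM \<Longrightarrow> (\<integral>\<^sup>+x. f x \<partial>\<pi>) = (\<integral>\<^sup>+x. G x * f x \<partial>haar_borel d)"
    and L: "linop \<Psi>" and K: "\<And>x B. x \<in> Zd \<Longrightarrow> B \<in> sets borel \<Longrightarrow> K x B = \<Psi> (indicator B) x"
    and \<Psi>_inv: "\<And>f. f \<in> BM \<Longrightarrow> (\<integral>\<^sup>+x. G x * \<Psi> f x \<partial>haar_borel d) = (\<integral>\<^sup>+x. G x * f x \<partial>haar_borel d)"
    and uniq: "\<And>\<nu>. sets \<nu> = sets borel \<Longrightarrow> AE x in \<nu>. x \<in> Zd \<Longrightarrow> (\<And>a b. emeasure \<nu> {a..b} < top) \<Longrightarrow>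
      (\<And>f. f \<in> BM \<Longrightarrow> (\<integral>\<^sup>+x. \<Psi> f x \<partial>\<nu>) = (\<integral>\<^sup>+x. f x \<partial>\<nu>)) \<Longrightarrow>
      \<exists>c\<ge>0. \<forall>f\<in>BM. (\<integral>\<^sup>+x. f x \<partial>\<nu>) = ennreal c * (\<integral>\<^sup>+x. G x * f x \<partial>haar_borel d)"
    and \<Psi>_Z: "\<And>x f g. x \<in> Zd \<Longrightarrow> (\<And>y. y \<in> Zd \<Longrightarrow> f y = g y) \<Longrightarrow> \<Psi> f x = \<Psi> g x"
  shows "unique_locally_finite_invariant_measure Zd K \<pi>"
proof -
  note Zb = lattice_sets_borel[of d]
  have em: "emeasure \<pi> B = (\<integral>\<^sup>+x. G x * indicator B x \<partial>haar_borel d)" if "B \<in> sets \<pi>" for B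
  proof -
    have B: "B \<in> sets borel" using that sets_\<nu>_iff[OF Zb \<pi>] by simp
    have "emeasure \<pi> B = (\<integral>\<^sup>+x. indicator B x \<partial>\<pi>)" using that by simp
    also have "\<dots> = (\<integral>\<^sup>+x. G x * indicator B x \<partial>haar_borel d)" by (rule \<pi>_int) (use B in simp)
    finally show ?thesis .
  qed
  have "locally_finite_borel_measure_on Zd \<pi>"
    unfolding locally_finite_borel_measure_on_def
  proof (intro conjI ballI)
    fix x assume x: "x \<in> Zd"
    let ?U = "Zd \<inter> ball x 1"
    have "?U \<in> sets \<pi>" using sets_\<nu>_iff[OF Zb \<pi>] Zb by auto
    then have "emeasure \<pi> ?U = (\<integral>\<^sup>+y. G y * indicator ?U y \<partial>haar_borel d)" by (rule em)
    also have "\<dots> \<le> (\<integral>\<^sup>+y. indicator {x - 1..x + 1} y \<partial>haar_borel d)"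
    proof (rule nn_integral_mono)
      fix y
      have "G y * indicator ?U y \<le> 1 * indicator {x - 1..x + 1} y"
        using G(2)[of y] by (intro mult_mono) (auto simp: indicator_def dist_real_def)
      then show "G y * indicator ?U y \<le> indicator {x - 1..x + 1} y" by simp
    qed
    also have "\<dots> = emeasure (haar_borel d) {x - 1..x + 1}" by simp
    also have "\<dots> < top" using bdd_finite_haar_borel[OF d] by (simp add: bdd_finite_def)
    finally have "emeasure \<pi> ?U < \<infinity>" by simp
    moreover have "openin (top_of_set Zd) ?U" by (auto simp: openin_open)
    ultimately show "\<exists>U. openin (top_of_set Zd) U \<and> x \<in> U \<and> emeasure \<pi> U < \<infinity>"
      using x by (intro exI[of _ ?U]) auto
  qed (rule \<pi>)
  moreover have "invariant_measure K \<pi>"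
    unfolding invariant_measure_def
  proof
    fix B assume B': "B \<in> sets \<pi>"
    then have B: "B \<in> sets borel" using sets_\<nu>_iff[OF Zb \<pi>] by simp
    have iB: "(indicator B :: real \<Rightarrow> ennreal) \<in> BM" using B by simp
    have "(\<integral>\<^sup>+x. K x B \<partial>\<pi>) = (\<integral>\<^sup>+x. \<Psi> (indicator B) x \<partial>\<pi>)"
      by (rule nn_integral_cong) (simp add: space_\<nu>[OF Zb \<pi>] K B)
    also have "\<dots> = (\<integral>\<^sup>+x. G x * indicator B x \<partial>haar_borel d)"
      by (simp add: \<pi>_int linop_measurable[OF L iB] \<Psi>_inv[OF iB])
    finally show "emeasure \<pi> B = (\<integral>\<^sup>+x. K x B \<partial>\<pi>)" by (simp add: em[OF B'])
  qed
  moreover have "emeasure \<pi> (space \<pi>) \<noteq> 0"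
  proof
    assume "emeasure \<pi> (space \<pi>) = 0"
    then have "(\<integral>\<^sup>+x. 1 \<partial>\<pi>) = 0" by simp
    then have "(\<integral>\<^sup>+x. G x \<partial>haar_borel d) = 0" using \<pi>_int[of "\<lambda>_. 1"] by simp
    moreover have "(\<integral>\<^sup>+x. Gp x \<partial>haar_borel d) \<le> (\<integral>\<^sup>+x. G x \<partial>haar_borel d)" by (rule nn_integral_mono) (rule G)
    ultimately show False using Gp_nonzero by simp
  qed
  moreover have "\<exists>c\<ge>0. \<nu> = scale_measure (ennreal c) \<pi>"
    if \<nu>: "locally_finite_borel_measure_on Zd \<nu>" "invariant_measure K \<nu>" for \<nu>
  proof -
    have s\<nu>: "sets \<nu> = sets (restrict_space borel Zd)" using \<nu>(1) by (simp add: locally_finite_borel_measure_on_def)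
    have "\<exists>c\<ge>0. \<forall>f\<in>BM. (\<integral>\<^sup>+x. f x \<partial>to_borel \<nu>) = ennreal c * (\<integral>\<^sup>+x. G x * f x \<partial>haar_borel d)"
    proof (rule uniq)
      show "AE x in to_borel \<nu>. x \<in> Zd" by (rule AE_to_borel[OF Zb s\<nu>])
      show "emeasure (to_borel \<nu>) {a..b} < top" for a b
        using locally_finite_bounded[OF \<nu>(1) closed_lattice_set, of "{a..b}"]
        by (subst emeasure_to_borel[OF Zb s\<nu>]) auto
      show "(\<integral>\<^sup>+x. \<Psi> f x \<partial>to_borel \<nu>) = (\<integral>\<^sup>+x. f x \<partial>to_borel \<nu>)" if "f \<in> BM" for f
        by (rule invariant_to_borel[OF s\<nu> \<nu>(2) L K \<Psi>_Z that])
    qed simp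
    then obtain c where c: "0 \<le> c" "\<And>f. f \<in> BM \<Longrightarrow> (\<integral>\<^sup>+x. f x \<partial>to_borel \<nu>) = ennreal c * (\<integral>\<^sup>+x. G x * f x \<partial>haar_borel d)"
      by blast
    have "\<nu> = scale_measure (ennreal c) \<pi>"
    proof (rule measure_eqI)
      show "sets \<nu> = sets (scale_measure (ennreal c) \<pi>)" by (simp add: s\<nu> \<pi>)
      fix B assume B': "B \<in> sets \<nu>"
      then have B: "B \<in> sets borel" and B\<pi>: "B \<in> sets \<pi>" using sets_\<nu>_iff[OF Zb s\<nu>] by (auto simp: s\<nu> \<pi>)
      have "emeasure \<nu> B = (\<integral>\<^sup>+x. indicator B x \<partial>\<nu>)" using B' by simp
      also have "\<dots> = (\<integral>\<^sup>+x. indicator B x \<partial>to_borel \<nu>)" using B by (intro nn_integral_to_borel[OF Zb s\<nu>, symmetric]) simp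
      also have "\<dots> = ennreal c * (\<integral>\<^sup>+x. G x * indicator B x \<partial>haar_borel d)" using B by (intro c(2)) simp
      also have "\<dots> = emeasure (scale_measure (ennreal c) \<pi>) B" using em[OF B\<pi>] by simp
      finally show "emeasure \<nu> B = emeasure (scale_measure (ennreal c) \<pi>) B" .
    qed
    then show ?thesis using c(1) by blast
  qed
  ultimately show ?thesis unfolding unique_locally_finite_invariant_measure_def by blast
qed

text \<open>After one transition the chain is nonnegative, so an invariant measure puts no mass on
  the negative half-line and \<open>invariant_unique\<close> applies directly.\<close>

lemma unique_up:
  assumes \<pi>: "sets \<pi> = sets (restrict_space borel Zd)"
    and \<pi>_int: "\<And>f. f \<in> BM \<Longrightarrow> (\<integral>\<^sup>+x. f x \<partial>\<pi>) = (\<integral>\<^sup>+x. Gp x * f x \<partial>haar_borel d)"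
    and K: "\<And>x B. x \<in> Zd \<Longrightarrow> B \<in> sets borel \<Longrightarrow> K x B = Psi_up (indicator B) x"
  shows "unique_locally_finite_invariant_measure Zd K \<pi>"
proof (rule unique_of_density[OF \<pi> densities_measurable(3) le_one(3) order_refl \<pi>_int linop_Psi_up K _ _ Psi_up_Z])
  fix f assume f: "f \<in> BM"
  have "(\<integral>\<^sup>+x. Gp x * Psi_up f x \<partial>haar_borel d) = (\<integral>\<^sup>+x. Gp x * Kd (Ku f) x \<partial>haar_borel d)"
    by (rule nn_integral_cong) (use densities_eq_0(3) in \<open>auto simp: Psi_up_def indicator_def\<close>)
  also have "\<dots> = (\<integral>\<^sup>+x. Gp x * f x \<partial>haar_borel d)"
    by (simp add: Gp_Kd Gm_Ku operators_measurable f)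
  finally show "(\<integral>\<^sup>+x. Gp x * Psi_up f x \<partial>haar_borel d) = (\<integral>\<^sup>+x. Gp x * f x \<partial>haar_borel d)" .
next
  fix \<nu> :: "real measure"
  assume s\<nu>: "sets \<nu> = sets borel" and Z: "AE x in \<nu>. x \<in> Zd" and fin: "\<And>a b. emeasure \<nu> {a..b} < top"
    and inv: "\<And>f. f \<in> BM \<Longrightarrow> (\<integral>\<^sup>+x. Psi_up f x \<partial>\<nu>) = (\<integral>\<^sup>+x. f x \<partial>\<nu>)"
  have "(\<integral>\<^sup>+x. indicator (- S) x \<partial>\<nu>) = (\<integral>\<^sup>+x. Psi_up (indicator (- S)) x \<partial>\<nu>)"
    by (rule inv[symmetric]) simp
  also have "\<dots> = 0"
  proof -
    have "Ku (indicator (- S)) y = 0" for y by (rule Ku_neg) simp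
    then have "Psi_up (indicator (- S)) x = 0" for x
      unfolding Psi_up_def by (simp add: Kd_nonneg)
    then show ?thesis by simp
  qed
  finally have pos: "AE x in \<nu>. x \<in> S"
    using s\<nu> by (subst (asm) nn_integral_0_iff_AE) (auto simp: indicator_def elim!: eventually_mono split: if_splits cong: measurable_cong_sets)
  show "\<exists>c\<ge>0. \<forall>f\<in>BM. (\<integral>\<^sup>+x. f x \<partial>\<nu>) = ennreal c * (\<integral>\<^sup>+x. Gp x * f x \<partial>haar_borel d)"
  proof (rule invariant_unique[OF s\<nu> pos _ _ Z])
    show "emeasure \<nu> {..b} < top" for b
    proof -
      have "emeasure \<nu> {..b} = emeasure \<nu> {0..b}"
        by (rule emeasure_eq_AE) (use pos s\<nu> in \<open>auto elim!: eventually_mono\<close>)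
      then show ?thesis using fin by simp
    qed
    fix f assume f: "f \<in> BM"
    have "(\<integral>\<^sup>+x. Kd (Ku f) x \<partial>\<nu>) = (\<integral>\<^sup>+x. Psi_up f x \<partial>\<nu>)"
      by (rule nn_integral_cong_AE) (use pos in \<open>auto simp: Psi_up_def elim!: eventually_mono\<close>)
    then show "(\<integral>\<^sup>+x. Kd (Ku f) x \<partial>\<nu>) = (\<integral>\<^sup>+x. f x \<partial>\<nu>)" by (simp add: inv f)
  qed
qed

text \<open>The chain alternates between the half-lines, so invariance says that each half of \<nu>
  is the image of the other. Hence the upper half is invariant under a crossing down followed by one
  up and is a multiple of \<open>Gp\<close>; its image under \<open>Kd\<close> is the same multiple
  of \<open>Gm\<close>.\<close>

lemma unique_zero:
  assumes \<pi>: "sets \<pi> = sets (restrict_space borel Zd)"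
    and \<pi>_int: "\<And>f. f \<in> BM \<Longrightarrow> (\<integral>\<^sup>+x. f x \<partial>\<pi>) = (\<integral>\<^sup>+x. (Gp x + Gm x) * f x \<partial>haar_borel d)"
    and K: "\<And>x B. x \<in> Zd \<Longrightarrow> B \<in> sets borel \<Longrightarrow> K x B = Psi (indicator B) x"
  shows "unique_locally_finite_invariant_measure Zd K \<pi>"
proof (rule unique_of_density[OF \<pi> _ _ _ \<pi>_int linop_Psi K _ _ Psi_Z])
  show "(\<lambda>x. Gp x + Gm x) \<in> BM" using densities_measurable by simp
  show "Gp x + Gm x \<le> 1" for x
    using densities_eq_0(3,4)[of x] le_one(3,4)[of x] by (cases "x \<in> S") auto
  show "Gp x \<le> Gp x + Gm x" for x by simp
  have split: "(\<integral>\<^sup>+x. (Gp x + Gm x) * g x \<partial>haar_borel d) = (\<integral>\<^sup>+x. Gp x * g x \<partial>haar_borel d) + (\<integral>\<^sup>+x. Gm x * g x \<partial>haar_borel d)"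
    if "g \<in> BM" for g
    unfolding distrib_right by (rule nn_integral_add) (use densities_measurable that in simp_all)
  fix f assume f: "f \<in> BM"
  have "(\<integral>\<^sup>+x. (Gp x + Gm x) * Psi f x \<partial>haar_borel d) = (\<integral>\<^sup>+x. Gp x * Psi f x \<partial>haar_borel d) + (\<integral>\<^sup>+x. Gm x * Psi f x \<partial>haar_borel d)"
    by (rule split[OF linop_measurable[OF linop_Psi f]])
  also have "(\<integral>\<^sup>+x. Gp x * Psi f x \<partial>haar_borel d) = (\<integral>\<^sup>+x. Gp x * Kd f x \<partial>haar_borel d)"
    by (rule nn_integral_cong) (use densities_eq_0(3) in \<open>auto simp: Psi_def indicator_def\<close>)
  also have "(\<integral>\<^sup>+x. Gm x * Psi f x \<partial>haar_borel d) = (\<integral>\<^sup>+x. Gm x * Ku f x \<partial>haar_borel d)"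
    by (rule nn_integral_cong) (use densities_eq_0(4) in \<open>auto simp: Psi_def indicator_def\<close>)
  finally have E: "(\<integral>\<^sup>+x. (Gp x + Gm x) * Psi f x \<partial>haar_borel d) = (\<integral>\<^sup>+x. Gm x * f x \<partial>haar_borel d) + (\<integral>\<^sup>+x. Gp x * f x \<partial>haar_borel d)"
    unfolding Gp_Kd[OF f] Gm_Ku[OF f] .
  show "(\<integral>\<^sup>+x. (Gp x + Gm x) * Psi f x \<partial>haar_borel d) = (\<integral>\<^sup>+x. (Gp x + Gm x) * f x \<partial>haar_borel d)"
    unfolding E split[OF f] by (rule add.commute)
next
  fix \<nu> :: "real measure"
  assume s\<nu>: "sets \<nu> = sets borel" and Z: "AE x in \<nu>. x \<in> Zd" and fin: "\<And>a b. emeasure \<nu> {a..b} < top"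
    and inv: "\<And>f. f \<in> BM \<Longrightarrow> (\<integral>\<^sup>+x. Psi f x \<partial>\<nu>) = (\<integral>\<^sup>+x. f x \<partial>\<nu>)"
  define \<nu>p where "\<nu>p = density \<nu> (indicator S)"
  have \<nu>p: "(\<integral>\<^sup>+x. f x \<partial>\<nu>p) = (\<integral>\<^sup>+x. indicator S x * f x \<partial>\<nu>)" if "f \<in> BM" for f
    unfolding \<nu>p_def using that s\<nu> by (intro nn_integral_density) (auto cong: measurable_cong_sets)
  have neg: "(\<integral>\<^sup>+x. indicator (- S) x * f x \<partial>\<nu>) = (\<integral>\<^sup>+x. indicator S x * Kd f x \<partial>\<nu>)" if f: "f \<in> BM" for f
  proof -
    have "Kd (\<lambda>x. indicator (- S) x * f x) = Kd f" by (rule exitop_cong) simp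
    moreover have "Ku (\<lambda>x. indicator (- S) x * f x) x = 0" for x by (rule Ku_neg) simp
    ultimately have "Psi (\<lambda>x. indicator (- S) x * f x) x = indicator S x * Kd f x" for x
      by (simp add: Psi_def)
    then show ?thesis using inv[of "\<lambda>x. indicator (- S) x * f x"] f by (simp add: borel_measurable_times_ennreal)
  qed
  have pos: "(\<integral>\<^sup>+x. indicator S x * f x \<partial>\<nu>) = (\<integral>\<^sup>+x. indicator (- S) x * Ku f x \<partial>\<nu>)" if f: "f \<in> BM" for f
  proof -
    have "Ku (\<lambda>x. indicator S x * f x) = Ku f" by (rule exitop_cong) simp
    moreover have "Kd (\<lambda>x. indicator S x * f x) x = 0" for x by (rule Kd_nonneg) simp
    ultimately have "Psi (\<lambda>x. indicator S x * f x) x = indicator (- S) x * Ku f x" for x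
      by (simp add: Psi_def)
    then show ?thesis using inv[of "\<lambda>x. indicator S x * f x"] f by (simp add: borel_measurable_times_ennreal)
  qed
  have "\<exists>c\<ge>0. \<forall>f\<in>BM. (\<integral>\<^sup>+x. f x \<partial>\<nu>p) = ennreal c * (\<integral>\<^sup>+x. Gp x * f x \<partial>haar_borel d)"
  proof (rule invariant_unique)
    show "sets \<nu>p = sets borel" by (simp add: \<nu>p_def s\<nu>)
    show "AE x in \<nu>p. x \<in> S" unfolding \<nu>p_def using s\<nu>
      by (subst AE_density) (auto simp: indicator_def cong: measurable_cong_sets)
    show "AE x in \<nu>p. x \<in> Zd" unfolding \<nu>p_def using s\<nu> Z
      by (subst AE_density) (auto cong: measurable_cong_sets elim!: eventually_mono)
    show "emeasure \<nu>p {..b} < top" for b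
    proof -
      have "emeasure \<nu>p {..b} = (\<integral>\<^sup>+x. indicator {..b} x \<partial>\<nu>p)"
        by (rule nn_integral_indicator[symmetric]) (simp add: \<nu>p_def s\<nu>)
      also have "\<dots> = (\<integral>\<^sup>+x. indicator S x * indicator {..b} x \<partial>\<nu>)"
        by (rule \<nu>p) simp
      also have "\<dots> = (\<integral>\<^sup>+x. indicator {0..b} x \<partial>\<nu>)" by (rule nn_integral_cong) (auto split: split_indicator)
      also have "\<dots> < top" using fin s\<nu> by simp
      finally show ?thesis .
    qed
    fix f assume f: "f \<in> BM"
    show "(\<integral>\<^sup>+x. Kd (Ku f) x \<partial>\<nu>p) = (\<integral>\<^sup>+x. f x \<partial>\<nu>p)"
      by (simp add: \<nu>p operators_measurable f pos neg[OF operators_measurable(6)[OF f]])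
  qed
  then obtain c where c: "0 \<le> c" "\<And>f. f \<in> BM \<Longrightarrow> (\<integral>\<^sup>+x. indicator S x * f x \<partial>\<nu>) = ennreal c * (\<integral>\<^sup>+x. Gp x * f x \<partial>haar_borel d)"
    using \<nu>p by auto
  have "(\<integral>\<^sup>+x. f x \<partial>\<nu>) = ennreal c * (\<integral>\<^sup>+x. (Gp x + Gm x) * f x \<partial>haar_borel d)" if f: "f \<in> BM" for f
  proof -
    have "(\<integral>\<^sup>+x. f x \<partial>\<nu>) = (\<integral>\<^sup>+x. indicator S x * f x + indicator (- S) x * f x \<partial>\<nu>)"
      by (rule nn_integral_cong) (auto simp: indicator_def)
    also have "\<dots> = (\<integral>\<^sup>+x. indicator S x * f x \<partial>\<nu>) + (\<integral>\<^sup>+x. indicator (- S) x * f x \<partial>\<nu>)"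
    proof (rule nn_integral_add)
      have *: "BM = borel_measurable \<nu>" using s\<nu> by (intro measurable_cong_sets) simp_all
      have "(\<lambda>x. indicator S x * f x) \<in> BM" "(\<lambda>x. indicator (- S) x * f x) \<in> BM" using f by simp_all
      then show "(\<lambda>x. indicator S x * f x) \<in> borel_measurable \<nu>" "(\<lambda>x. indicator (- S) x * f x) \<in> borel_measurable \<nu>"
        unfolding * by this
    qed
    also have "\<dots> = ennreal c * (\<integral>\<^sup>+x. Gp x * f x \<partial>haar_borel d) + ennreal c * (\<integral>\<^sup>+x. Gm x * f x \<partial>haar_borel d)"
      by (simp add: neg[OF f] c(2) f operators_measurable Gp_Kd)
    also have "\<dots> = ennreal c * (\<integral>\<^sup>+x. (Gp x + Gm x) * f x \<partial>haar_borel d)"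
    proof -
      have "(\<integral>\<^sup>+x. (Gp x + Gm x) * f x \<partial>haar_borel d) = (\<integral>\<^sup>+x. Gp x * f x \<partial>haar_borel d) + (\<integral>\<^sup>+x. Gm x * f x \<partial>haar_borel d)"
        unfolding distrib_right by (rule nn_integral_add) (use densities_measurable f in simp_all)
      then show ?thesis by (simp add: distrib_left)
    qed
    finally show ?thesis .
  qed
  then show "\<exists>c\<ge>0. \<forall>f\<in>BM. (\<integral>\<^sup>+x. f x \<partial>\<nu>) = ennreal c * (\<integral>\<^sup>+x. (Gp x + Gm x) * f x \<partial>haar_borel d)"
    using c(1) by blast
qed

end

section \<open>Overshoots at zero of the switching walk\<close>

lemma first_exit_props:
  assumes "\<exists>j. j \<ge> 1 \<and> y j \<notin> S"
  shows "1 \<le> first_exit S y" "y (first_exit S y) \<notin> S"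
proof -
  have "first_exit S y \<in> {k. k \<ge> 1 \<and> y k \<notin> S}"
    unfolding first_exit_def using assms by (intro Inf_nat_def1) auto
  then show "1 \<le> first_exit S y" "y (first_exit S y) \<notin> S" by auto
qed

lemma liminf_minus_infty_neg:
  assumes "liminf (\<lambda>n. ereal (y n)) = -\<infinity>" shows "\<exists>k\<ge>1. y k < 0"
proof (rule ccontr)
  assume "\<not> ?thesis"
  then have "\<forall>n\<ge>1. 0 \<le> ereal (y n)" by (auto simp: not_less)
  then have "eventually (\<lambda>n. 0 \<le> ereal (y n)) sequentially" unfolding eventually_sequentially by blast
  then have "0 \<le> liminf (\<lambda>n. ereal (y n))" by (rule Liminf_bounded)
  then show False using assms by simp
qed

lemma limsup_infty_pos:
  assumes "limsup (\<lambda>n. ereal (y n)) = \<infinity>" shows "\<exists>k\<ge>1. 0 < y k"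
proof (rule ccontr)
  assume "\<not> ?thesis"
  then have "\<forall>n\<ge>1. ereal (y n) \<le> 0" by (auto simp: not_less)
  then have "eventually (\<lambda>n. ereal (y n) \<le> 0) sequentially" unfolding eventually_sequentially by blast
  then have "limsup (\<lambda>n. ereal (y n)) \<le> 0" by (rule Limsup_bounded)
  then show False using assms by simp
qed

text \<open>The sign \<open>s\<close> is \<open>1\<close> for descending and \<open>-1\<close> for ascending ladder heights.\<close>

lemma (in prob_space) ladder_height:
  fixes Z :: "'i \<Rightarrow> 'a \<Rightarrow> real" and e :: "nat \<Rightarrow> 'i" and s :: real
  assumes ind: "indep_vars (\<lambda>_. borel) Z I" and inj: "inj e" and mem: "\<forall>k\<ge>1. e k \<in> I"
    and laws: "\<forall>k\<ge>1. distr M borel (Z (e k)) = \<mu>"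
    and ex: "AE \<omega> in M. \<exists>k\<ge>1. s * walk (\<lambda>k. Z (e k)) k \<omega> < 0"
    and S: "S = {x. 0 < s * x}"
    and D: "D = (\<lambda>\<omega>. walk (\<lambda>k. Z (e k)) (first_exit S (\<lambda>k. walk (\<lambda>k. Z (e k)) k \<omega>)) \<omega>)"
  shows "D \<in> borel_measurable M"
    and "\<And>g. g \<in> BM \<Longrightarrow> (\<integral>\<^sup>+y. g y \<partial>distr M borel D) = exitop (conv \<mu>) S g 0"
    and "AE \<omega> in M. s * D \<omega> \<le> 0"
    and "measure \<mu> {z. s * z < 0} \<noteq> 0"
    and "\<not> (AE y in distr M borel D. y = 0)"
proof -
  have e: "inj e" "\<And>k. 1 \<le> k \<Longrightarrow> e k \<in> I" and law: "\<And>k. 1 \<le> k \<Longrightarrow> distr M borel (Z (e k)) = \<mu>"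
    using inj mem laws by auto
  have rv: "Z (e k) \<in> borel_measurable M" if "1 \<le> k" for k
    using ind e(2)[OF that] by (auto simp: indep_vars_def)
  have w: "(\<lambda>\<omega>. walk (\<lambda>k. Z (e k)) k \<omega>) \<in> borel_measurable M" for k
    unfolding walk_def using rv by (intro borel_measurable_sum) auto
  have Sb: "S \<in> sets borel" unfolding S by measurable
  have \<mu>: "prob_space \<mu>" "sets \<mu> = sets borel"
    using law[of 1] prob_space_distr[OF rv[of 1]] by auto
  note kc = kern_conv[OF \<mu>]
  have ex': "AE \<omega> in M. \<exists>k\<ge>1. walk (\<lambda>k. Z (e k)) k \<omega> \<notin> S"
    using ex by eventually_elim (auto simp: S not_less intro: less_imp_le)
  show Dm: "D \<in> borel_measurable M"
    unfolding D by (rule measurable_compose_countable[OF w first_exit_measurable[OF Sb w]])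
  show int: "(\<integral>\<^sup>+y. g y \<partial>distr M borel D) = exitop (conv \<mu>) S g 0" if g: "g \<in> BM" for g
  proof -
    have "(\<integral>\<^sup>+y. g y \<partial>distr M borel D) = (\<integral>\<^sup>+\<omega>. g (D \<omega>) \<partial>M)"
      by (rule nn_integral_distr[OF Dm]) (use g in simp)
    also have "\<dots> = exitop (conv \<mu>) S g 0"
      unfolding D by (rule ladder_law[OF ind e law Sb g ex'])
    finally show ?thesis .
  qed
  show "AE \<omega> in M. s * D \<omega> \<le> 0"
    using ex'
  proof eventually_elim
    case (elim \<omega>)
    then have "walk (\<lambda>k. Z (e k)) (first_exit S (\<lambda>k. walk (\<lambda>k. Z (e k)) k \<omega>)) \<omega> \<notin> S"
      by (intro first_exit_props(2)) auto
    then show ?case by (simp add: D S)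
  qed
  have neg_sets: "{z. s * z < 0} \<in> sets borel" by measurable
  show neg: "measure \<mu> {z. s * z < 0} \<noteq> 0"
  proof
    \<comment> \<open>Otherwise s times every partial sum would be nonnegative almost surely,
      against \<open>ex\<close>.\<close>
    assume *: "measure \<mu> {z. s * z < 0} = 0"
    interpret \<mu>: prob_space \<mu> by fact
    have "AE z in \<mu>. \<not> s * z < 0"
    proof (rule AE_I)
      show "emeasure \<mu> {z. s * z < 0} = 0" using * by (simp add: \<mu>.emeasure_eq_measure)
    qed (use neg_sets \<mu> in auto)
    then have "AE \<omega> in M. \<not> s * Z (e k) \<omega> < 0" if k: "1 \<le> k" for k
      unfolding law[OF k, symmetric] by (subst (asm) AE_distr_iff[OF rv[OF k]]) auto
    then have "AE \<omega> in M. \<forall>k. 1 \<le> k \<longrightarrow> \<not> s * Z (e k) \<omega> < 0" by (simp add: AE_all_countable)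
    then have "AE \<omega> in M. False"
      using ex
    proof eventually_elim
      case (elim \<omega>)
      obtain n where "s * walk (\<lambda>k. Z (e k)) n \<omega> < 0" using elim(2) by blast
      moreover have "0 \<le> (\<Sum>k=1..n. s * Z (e k) \<omega>)"
        using elim(1) by (intro sum_nonneg) (auto simp: not_less)
      ultimately show ?case by (simp add: walk_def sum_distrib_left)
    qed
    then show False by simp
  qed
  show "\<not> (AE y in distr M borel D. y = 0)"
  proof
    \<comment> \<open>A first step with s z < 0 is itself the ladder height, so a degenerate ladder
      height would give such steps probability 0.\<close>
    assume "AE y in distr M borel D. y = 0"
    then have "AE y in distr M borel D. indicator {z. s * z < 0} y = (0 :: ennreal)"
      by eventually_elim simp
    then have "(\<integral>\<^sup>+y. indicator {z. s * z < 0} y \<partial>distr M borel D) = (\<integral>\<^sup>+y. 0 \<partial>distr M borel D)"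
      by (rule nn_integral_cong_AE)
    then have "exitop (conv \<mu>) S (indicator {z. s * z < 0}) 0 = 0"
      using neg_sets by (simp add: int[symmetric])
    then have "taboo (conv \<mu>) (- S) (indicator {z. s * z < 0}) 0 = 0"
      by (subst (asm) exitop_unfold[OF kc Sb]) (use neg_sets in auto)
    moreover have "taboo (conv \<mu>) (- S) (indicator {z. s * z < 0}) 0 = emeasure \<mu> {z. s * z < 0}"
    proof -
      have "taboo (conv \<mu>) (- S) (indicator {z. s * z < 0}) 0
        = (\<integral>\<^sup>+y. indicator {z. s * z < 0} (0 + y) * indicator (- S) (0 + y) \<partial>\<mu>)"
        by (rule taboo_conv[OF \<mu>(2)]) (use Sb neg_sets in auto)
      also have "\<dots> = (\<integral>\<^sup>+y. indicator {z. s * z < 0} y \<partial>\<mu>)"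
        by (rule nn_integral_cong) (auto simp: S indicator_def)
      also have "\<dots> = emeasure \<mu> {z. s * z < 0}" using neg_sets \<mu>(2) by simp
      finally show ?thesis .
    qed
    ultimately show False using neg by (simp add: measure_def)
  qed
qed

lemma (in prob_space) lattice_prob_iff:
  assumes [measurable]: "U \<in> borel_measurable M" "U' \<in> borel_measurable M"
  shows "prob {\<omega> \<in> space M. U \<omega> \<in> lattice_set u} * prob {\<omega> \<in> space M. U' \<omega> \<in> lattice_set u} = 1
    \<longleftrightarrow> (AE \<omega> in M. U \<omega> \<in> lattice_set u) \<and> (AE \<omega> in M. U' \<omega> \<in> lattice_set u)" (is "?p * ?q = 1 \<longleftrightarrow> _")
proof -
  have "?p = 1 \<longleftrightarrow> (AE \<omega> in M. U \<omega> \<in> lattice_set u)" "?q = 1 \<longleftrightarrow> (AE \<omega> in M. U' \<omega> \<in> lattice_set u)"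
    by (rule prob_Collect_eq_1, measurable)+
  moreover have "?p * ?q = 1 \<longleftrightarrow> ?p = 1 \<and> ?q = 1"
  proof
    assume *: "?p * ?q = 1"
    have "?p * ?q \<le> ?p * 1" "?p * ?q \<le> 1 * ?q"
      by (intro mult_mono prob_le_1 order_refl measure_nonneg zero_le_one)+
    then have "1 \<le> ?p" "1 \<le> ?q" unfolding * by simp_all
    then show "?p = 1 \<and> ?q = 1" by (intro conjI antisym prob_le_1)
  qed simp
  ultimately show ?thesis by simp
qed

text \<open>Existence of the maximum. If some u > 0 is admissible, then \<open>U\<close>, not being
  0 almost surely, has an atom x0 \<noteq> 0 on a countable lattice. Every admissible u > 0 divides
  x0, that is u = |x0| / (n + 1), and the least such n gives the maximum. Otherwise the maximum is
  0.\<close>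

lemma (in prob_space) lattice_span_props:
  assumes U: "U \<in> borel_measurable M" "U' \<in> borel_measurable M" and nz: "\<not> (AE \<omega> in M. U \<omega> = 0)"
  shows "0 \<le> lattice_span M U U'"
    and "AE \<omega> in M. U \<omega> \<in> lattice_set (lattice_span M U U')"
    and "AE \<omega> in M. U' \<omega> \<in> lattice_set (lattice_span M U U')"
    and "\<And>u. 0 < u \<Longrightarrow> (AE \<omega> in M. U \<omega> \<in> lattice_set u) \<Longrightarrow> (AE \<omega> in M. U' \<omega> \<in> lattice_set u) \<Longrightarrow> u \<le> lattice_span M U U'"
proof -
  define Q where "Q u \<longleftrightarrow> 0 \<le> u \<and> (AE \<omega> in M. U \<omega> \<in> lattice_set u) \<and> (AE \<omega> in M. U' \<omega> \<in> lattice_set u)" for u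
  have span: "lattice_span M U U' = (GREATEST u. Q u)"
    unfolding lattice_span_def Q_def lattice_prob_iff[OF U] by simp
  have "\<exists>d. Q d \<and> (\<forall>u. Q u \<longrightarrow> u \<le> d)"
  proof (cases "\<exists>u>0. Q u")
    case False
    then have "\<forall>u. Q u \<longrightarrow> u \<le> 0" by (meson not_less)
    moreover have "Q 0" by (simp add: Q_def)
    ultimately show ?thesis by blast
  next
    case True
    then obtain u0 where u0: "0 < u0" "Q u0" by blast
    have "\<exists>x0\<in>lattice_set u0. x0 \<noteq> 0 \<and> \<not> (AE \<omega> in M. U \<omega> \<noteq> x0)"
    proof (rule ccontr)
      assume "\<not> ?thesis"
      then have "\<forall>x\<in>lattice_set u0 - {0}. AE \<omega> in M. U \<omega> \<noteq> x" by blast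
      then have "AE \<omega> in M. \<forall>x\<in>lattice_set u0 - {0}. U \<omega> \<noteq> x"
        using countable_lattice[of u0] u0(1) by (subst AE_ball_countable) auto
      moreover have "AE \<omega> in M. U \<omega> \<in> lattice_set u0" using u0(2) by (simp add: Q_def)
      ultimately have "AE \<omega> in M. U \<omega> = 0" by eventually_elim auto
      then show False using nz by simp
    qed
    then obtain x0 where x0: "x0 \<noteq> 0" "\<not> (AE \<omega> in M. U \<omega> \<noteq> x0)" by blast
    have div: "\<exists>n. u = \<bar>x0\<bar> / real (Suc n)" if Qu: "Q u" and pos: "0 < u" for u
    proof -
      have "x0 \<in> lattice_set u"
      proof (rule ccontr)
        assume *: "x0 \<notin> lattice_set u"
        have "AE \<omega> in M. U \<omega> \<in> lattice_set u" using Qu by (simp add: Q_def)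
        then have "AE \<omega> in M. U \<omega> \<noteq> x0" by eventually_elim (use * in auto)
        then show False using x0 by simp
      qed
      then obtain j :: int where j: "x0 = u * of_int j" using pos by (auto simp: lattice_set_pos)
      then have "j \<noteq> 0" using x0 by auto
      then obtain n where "nat \<bar>j\<bar> = Suc n" by (cases "nat \<bar>j\<bar>") auto
      then have n: "\<bar>real_of_int j\<bar> = real (Suc n)" by linarith
      have "\<bar>x0\<bar> = u * real (Suc n)" using pos by (simp only: j abs_mult n abs_of_pos)
      then show ?thesis by (intro exI[of _ n]) simp
    qed
    define n where "n = (LEAST n. Q (\<bar>x0\<bar> / real (Suc n)))"
    have "\<exists>n. Q (\<bar>x0\<bar> / real (Suc n))" using div[OF u0(2,1)] u0(2) by auto
    then have Qn: "Q (\<bar>x0\<bar> / real (Suc n))" unfolding n_def by (rule LeastI_ex)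
    have "u \<le> \<bar>x0\<bar> / real (Suc n)" if u: "Q u" for u
    proof (cases "0 < u")
      case True
      obtain m where m: "u = \<bar>x0\<bar> / real (Suc m)" using div[OF u True] by blast
      then have "n \<le> m" unfolding n_def using u by (intro Least_le) simp
      then show ?thesis unfolding m by (intro divide_left_mono) auto
    next
      case False
      then have "u \<le> 0" by simp
      also have "0 \<le> \<bar>x0\<bar> / real (Suc n)" by (intro divide_nonneg_nonneg) simp_all
      finally show ?thesis .
    qed
    then show ?thesis using Qn by blast
  qed
  then obtain d where d: "Q d" "\<And>u. Q u \<Longrightarrow> u \<le> d" by blast
  have "lattice_span M U U' = d" unfolding span using d by (intro Greatest_equality) auto
  then show "0 \<le> lattice_span M U U'"
    and "AE \<omega> in M. U \<omega> \<in> lattice_set (lattice_span M U U')"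
    and "AE \<omega> in M. U' \<omega> \<in> lattice_set (lattice_span M U U')"
    and "\<And>u. 0 < u \<Longrightarrow> (AE \<omega> in M. U \<omega> \<in> lattice_set u) \<Longrightarrow> (AE \<omega> in M. U' \<omega> \<in> lattice_set u) \<Longrightarrow> u \<le> lattice_span M U U'"
    using d by (auto simp: Q_def)
qed

lemma ladder_supported_on_lattice:
  assumes q: "sets q = sets borel" and p: "prob_space p" "sets p = sets borel"
    and law: "\<And>g. g \<in> BM \<Longrightarrow> (\<integral>\<^sup>+y. g y \<partial>q) = exitop (conv p) S g 0" and pZ: "AE y in p. y \<in> lattice_set d"
  shows "AE y in q. y \<in> lattice_set d"
proof -
  have i: "(indicator (- lattice_set d) :: real \<Rightarrow> ennreal) \<in> BM" by simp
  have step: "AE y in conv p x. y \<in> lattice_set d" if "x \<in> lattice_set d" for x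
    using pZ by (subst AE_conv[OF p(2)]) (auto elim!: eventually_mono intro: lattice_set_add that)
  have "(\<integral>\<^sup>+y. indicator (- lattice_set d) y \<partial>q) = exitop (conv p) S (indicator (- lattice_set d)) 0"
    by (rule law[OF i])
  also have "\<dots> = exitop (conv p) S (\<lambda>_. 0) 0"
    by (rule exitop_cong_on[where Z = "lattice_set d", OF step]) auto
  also have "\<dots> = (\<integral>\<^sup>+y. 0 \<partial>q)" by (rule law[symmetric]) simp
  finally have "(\<integral>\<^sup>+y. indicator (- lattice_set d) y \<partial>q) = 0" by simp
  then have "emeasure q (- lattice_set d) = 0" using q by simp
  then show ?thesis using q by (intro AE_I[of _ _ "- lattice_set d"]) auto
qed

lemma increments_supported_on_lattice:
  fixes s :: real
  assumes q: "sets q = sets borel" and p: "prob_space p" "sets p = sets borel"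
    and law: "\<And>g. g \<in> BM \<Longrightarrow> (\<integral>\<^sup>+y. g y \<partial>q) = exitop (conv p) {x. 0 < s * x} g 0"
    and neg: "measure p {z. s * z < 0} \<noteq> 0" and qZ: "AE y in q. y \<in> lattice_set g"
  shows "AE y in p. y \<in> lattice_set g"
proof (rule ladder_lattice[OF p neg])
  have "exitop (conv p) {x. 0 < s * x} (indicator (- lattice_set g)) 0 = (\<integral>\<^sup>+y. indicator (- lattice_set g) y \<partial>q)"
    by (rule law[symmetric]) simp
  also have "\<dots> = (\<integral>\<^sup>+y. 0 \<partial>q)"
    by (rule nn_integral_cong_AE) (use qZ in \<open>auto elim!: eventually_mono\<close>)
  finally show "exitop (conv p) {x. 0 < s * x} (indicator (- lattice_set g)) 0 = 0" by simp
qed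

lemma (in prob_space) nn_integral_indep_pair:
  fixes D A :: "'a \<Rightarrow> real"
  assumes ind: "indep_var borel D borel A" and h: "case_prod h \<in> borel_measurable (borel \<Otimes>\<^sub>M borel)"
  shows "(\<integral>\<^sup>+y. (\<integral>\<^sup>+z. h y z \<partial>distr M borel A) \<partial>distr M borel D) = (\<integral>\<^sup>+\<omega>. h (D \<omega>) (A \<omega>) \<partial>M)"
proof -
  have DA: "D \<in> borel_measurable M" "A \<in> borel_measurable M"
    and eq: "distr M borel D \<Otimes>\<^sub>M distr M borel A = distr M (borel \<Otimes>\<^sub>M borel) (\<lambda>\<omega>. (D \<omega>, A \<omega>))"
    using ind unfolding indep_var_distribution_eq by auto
  interpret A: prob_space "distr M borel A" by (rule prob_space_distr[OF DA(2)])
  have "(\<integral>\<^sup>+y. (\<integral>\<^sup>+z. case_prod h (y, z) \<partial>distr M borel A) \<partial>distr M borel D)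
      = (\<integral>\<^sup>+x. case_prod h x \<partial>(distr M borel D \<Otimes>\<^sub>M distr M borel A))"
    by (rule A.nn_integral_fst) (use h in \<open>simp cong: measurable_cong_sets add: sets_pair_measure_cong[of "distr M borel D" borel "distr M borel A" borel]\<close>)
  also have "\<dots> = (\<integral>\<^sup>+\<omega>. case_prod h (D \<omega>, A \<omega>) \<partial>M)"
    unfolding eq by (rule nn_integral_distr) (use DA h in simp_all)
  finally show ?thesis by simp
qed

lemma sets_haar: "sets (haar d) = sets (restrict_space borel (lattice_set d))"
proof (cases "d = 0")
  case False
  have B: "B \<in> sets borel" if "B \<subseteq> lattice_set d" for B
    by (rule sets.countable[OF _ countable_subset[OF that countable_lattice[OF False]]]) simp
  have "sets (restrict_space borel (lattice_set d)) = Pow (lattice_set d)"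
  proof (rule set_eqI)
    fix B
    have "B \<in> sets (restrict_space borel (lattice_set d)) \<longleftrightarrow> B \<subseteq> lattice_set d \<and> B \<in> sets borel"
      by (rule sets_restrict_space_iff) simp
    then show "B \<in> sets (restrict_space borel (lattice_set d)) \<longleftrightarrow> B \<in> Pow (lattice_set d)"
      using B by blast
  qed
  then show ?thesis using False by (simp only: haar_def if_False sets_scale_measure sets_count_space)
next
  case True
  then show ?thesis by (simp add: haar_def sets_restrict_space)
qed

text \<open>Since D \<le> 0 \<le> A, in each difference one event contains the other almost surely;
  so the differences are themselves probabilities and \<open>ennreal\<close> truncates nothing. For
  each w one of the two summands is 0.\<close>

lemma (in prob_space) overshoot_density_eq:
  assumes [measurable]: "D \<in> borel_measurable M" "A \<in> borel_measurable M"
    and D: "AE \<omega> in M. D \<omega> \<le> 0" and A: "AE \<omega> in M. 0 \<le> A \<omega>"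
  shows "ennreal (overshoot_density M D A w)
    = (\<integral>\<^sup>+\<omega>. (if 0 \<le> w \<and> w < A \<omega> \<and> D \<omega> + A \<omega> \<le> w then 1 else 0) \<partial>M)
    + (\<integral>\<^sup>+\<omega>. (if w < 0 \<and> D \<omega> \<le> w \<and> w < D \<omega> + A \<omega> then 1 else 0) \<partial>M)"
proof -
  have em: "(\<integral>\<^sup>+\<omega>. (if P \<omega> then 1 else 0) \<partial>M) = ennreal (prob {\<omega> \<in> space M. P \<omega>})"
    if "Measurable.pred M P" for P
  proof -
    have "(\<integral>\<^sup>+\<omega>. (if P \<omega> then 1 else 0) \<partial>M) = (\<integral>\<^sup>+\<omega>. indicator {\<omega> \<in> space M. P \<omega>} \<omega> \<partial>M)"
      by (rule nn_integral_cong) (auto simp: indicator_def)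
    also have "\<dots> = ennreal (prob {\<omega> \<in> space M. P \<omega>})"
      using that by (simp add: emeasure_eq_measure pred_def)
    finally show ?thesis .
  qed
  have diff: "prob {\<omega> \<in> space M. P \<omega>} - prob {\<omega> \<in> space M. Q \<omega>} = prob {\<omega> \<in> space M. P \<omega> \<and> \<not> Q \<omega>}"
    if P: "Measurable.pred M P" and Q: "Measurable.pred M Q" and QP: "AE \<omega> in M. Q \<omega> \<longrightarrow> P \<omega>" for P Q
  proof -
    note [measurable] = P Q
    have "prob {\<omega> \<in> space M. P \<omega>} = prob ({\<omega> \<in> space M. P \<omega> \<and> Q \<omega>} \<union> {\<omega> \<in> space M. P \<omega> \<and> \<not> Q \<omega>})"
      by (rule arg_cong[of _ _ prob]) auto
    also have "\<dots> = prob {\<omega> \<in> space M. P \<omega> \<and> Q \<omega>} + prob {\<omega> \<in> space M. P \<omega> \<and> \<not> Q \<omega>}"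
      by (rule finite_measure_Union) auto
    also have "prob {\<omega> \<in> space M. P \<omega> \<and> Q \<omega>} = prob {\<omega> \<in> space M. Q \<omega>}"
      by (rule finite_measure_eq_AE) (use QP in \<open>auto elim!: eventually_mono\<close>)
    finally show ?thesis by simp
  qed
  show ?thesis
  proof (cases "0 \<le> w")
    case True
    have "prob {\<omega> \<in> space M. w < A \<omega>} - prob {\<omega> \<in> space M. w < D \<omega> + A \<omega>}
        = prob {\<omega> \<in> space M. w < A \<omega> \<and> \<not> w < D \<omega> + A \<omega>}"
      by (rule diff) (use D in \<open>auto elim!: eventually_mono\<close>)
    then show ?thesis using True by (simp add: overshoot_density_def em not_less)
  next
    case False
    have "prob {\<omega> \<in> space M. D \<omega> \<le> w} - prob {\<omega> \<in> space M. D \<omega> + A \<omega> \<le> w}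
        = prob {\<omega> \<in> space M. D \<omega> \<le> w \<and> \<not> D \<omega> + A \<omega> \<le> w}"
      by (rule diff) (use A in \<open>auto elim!: eventually_mono\<close>)
    then show ?thesis using False by (simp add: overshoot_density_def em not_le)
  qed
qed

context ladder_pair_max
begin

context
  fixes \<kappa> :: "real \<Rightarrow> real measure" and \<mu> \<mu>' :: "real measure"
    and Pr :: "real \<Rightarrow> 'b measure" and Y :: "nat \<Rightarrow> 'b \<Rightarrow> real" and \<phi> :: "real \<Rightarrow> ennreal"
  assumes \<mu>: "prob_space \<mu>" "sets \<mu> = sets borel" and \<mu>': "prob_space \<mu>'" "sets \<mu>' = sets borel"
    and \<delta>_law: "\<And>g. g \<in> BM \<Longrightarrow> (\<integral>\<^sup>+y. g y \<partial>\<delta>) = exitop (conv \<mu>) {x. 0 < 1 * x} g 0"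
    and \<alpha>_law: "\<And>g. g \<in> BM \<Longrightarrow> (\<integral>\<^sup>+y. g y \<partial>\<alpha>) = exitop (conv \<mu>') {x. 0 < -1 * x} g 0"
    and \<kappa>: "\<And>x. \<kappa> x = (if 0 \<le> x then conv \<mu> x else conv \<mu>' x)"
    and Y: "\<And>x. x \<in> Zd \<Longrightarrow> markov_chain_from x \<kappa> (Pr x) Y"
    and \<phi>: "\<And>w. \<phi> w = Gp w + Gm w"
begin

lemma prob_kern_switching: "prob_kern \<kappa>"
proof -
  have pk: "prob_kern (conv \<mu>)" "prob_kern (conv \<mu>')" using prob_kern_conv \<mu> \<mu>' by auto
  have "(\<lambda>x. \<integral>\<^sup>+y. f y \<partial>\<kappa> x) \<in> BM" if f: "f \<in> BM" for f
  proof -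
    have [measurable]: "(\<lambda>x. \<integral>\<^sup>+y. f y \<partial>conv \<mu> x) \<in> BM" "(\<lambda>x. \<integral>\<^sup>+y. f y \<partial>conv \<mu>' x) \<in> BM"
      using pk f by (auto simp: prob_kern_def kern_def)
    have "(\<lambda>x. \<integral>\<^sup>+y. f y \<partial>\<kappa> x) = (\<lambda>x. if 0 \<le> x then \<integral>\<^sup>+y. f y \<partial>conv \<mu> x else \<integral>\<^sup>+y. f y \<partial>conv \<mu>' x)"
      by (auto simp: \<kappa>)
    then show ?thesis by simp
  qed
  then show ?thesis using pk by (auto simp: prob_kern_def kern_def \<kappa>)
qed

text \<open>Before leaving \<open>S\<close> the switching walk uses only the step law \<mu>. In
  \<open>exitop_ladder\<close> the excursion strictly above a point x \<ge> 0 stays within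
  \<open>S\<close>, so only ladder epochs can lead out.\<close>

lemma exitop_switching_nonneg:
  assumes f: "f \<in> BM" and x: "x \<in> S"
  shows "exitop \<kappa> S f x = Kd f x"
proof -
  have "exitop \<kappa> S f x = exitop (conv \<mu>) S f x" by (rule exitop_kern_cong) (use x in \<open>auto simp: \<kappa>\<close>)
  also have "\<dots> = Kd f x"
    by (rule exitop_ladder[OF \<mu> \<delta>(1,2) _ Hp_sets \<delta>_law _ f x]) auto
  finally show ?thesis .
qed

lemma exitop_switching_neg:
  assumes f: "f \<in> BM" and x: "x \<notin> S"
  shows "exitop \<kappa> (- S) f x = Ku f x"
proof -
  have "exitop \<kappa> (- S) f x = exitop (conv \<mu>') (- S) f x" by (rule exitop_kern_cong) (use x in \<open>auto simp: \<kappa>\<close>)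
  also have "\<dots> = Ku f x"
    by (rule exitop_ladder[OF \<mu>' \<alpha>(1,2) _ _ \<alpha>_law _ f]) (use x in auto)
  finally show ?thesis .
qed

lemma zero_crossing_kernel:
  assumes x: "x \<in> Zd" and B: "B \<in> sets borel"
  shows "overshoot_kernel zero_crossing Pr Y x B = Psi (indicator B) x"
proof -
  note Y' = Y[OF x] prob_kern_switching
  have iB: "(indicator B :: real \<Rightarrow> ennreal) \<in> BM" using B by simp
  show ?thesis
  proof (cases "0 \<le> x")
    case True
    then have xS: "x \<in> S" by simp
    then show ?thesis
      unfolding overshoot_kernel_zero_crossing_nonneg[where Pr = Pr, OF Y' True B] exitop_switching_nonneg[OF iB xS]
      by (simp add: Psi_def)
  next
    case False
    then have xS: "x \<notin> S" and "x < 0" by simp_all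
    then show ?thesis
      unfolding overshoot_kernel_zero_crossing_neg[where Pr = Pr, OF Y' \<open>x < 0\<close> B] exitop_switching_neg[OF iB xS]
      by (simp add: Psi_def)
  qed
qed

lemma up_crossing_kernel:
  assumes x: "x \<in> Zd" and B: "B \<in> sets borel"
  shows "overshoot_kernel up_crossing Pr Y x B = Psi_up (indicator B) x"
proof -
  note Y' = Y[OF x] prob_kern_switching
  have iB: "(indicator B :: real \<Rightarrow> ennreal) \<in> BM" using B by simp
  show ?thesis
  proof (cases "0 \<le> x")
    case True
    then have xS: "x \<in> S" by simp
    have "exitop \<kappa> S (exitop \<kappa> (- S) (indicator B)) = exitop \<kappa> S (Ku (indicator B))"
      by (rule exitop_cong) (rule exitop_switching_neg[OF iB])
    then show ?thesis
      unfolding overshoot_kernel_up_crossing_nonneg[where Pr = Pr, OF Y' True B]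
      using xS by (simp add: Psi_up_def exitop_switching_nonneg[OF operators_measurable(6)[OF iB]])
  next
    case False
    then have xS: "x \<notin> S" and "x < 0" by simp_all
    then show ?thesis
      unfolding overshoot_kernel_up_crossing_neg[where Pr = Pr, OF Y' \<open>x < 0\<close> B] exitop_switching_neg[OF iB xS]
      by (simp add: Psi_up_def)
  qed
qed

lemma overshoot_chains_unique:
  shows "unique_locally_finite_invariant_measure Zd (overshoot_kernel zero_crossing Pr Y) (density (haar d) \<phi>)"
    and "unique_locally_finite_invariant_measure Zd (overshoot_kernel up_crossing Pr Y)
      (density (density (haar d) \<phi>) (indicator {0..}))"
proof -
  have \<phi>_eq: "\<phi> = (\<lambda>w. Gp w + Gm w)" using \<phi> by (rule ext)
  have \<phi>m: "\<phi> \<in> BM" unfolding \<phi>_eq using densities_measurable by simp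
  have int: "(\<integral>\<^sup>+x. f x \<partial>density (haar d) \<phi>) = (\<integral>\<^sup>+x. \<phi> x * f x \<partial>haar_borel d)" if f: "f \<in> BM" for f
  proof -
    have "(\<integral>\<^sup>+x. f x \<partial>density (haar d) \<phi>) = (\<integral>\<^sup>+x. \<phi> x * f x \<partial>haar d)"
      by (rule nn_integral_density) (use \<phi>m f haar_measurable in auto)
    also have "\<dots> = (\<integral>\<^sup>+x. \<phi> x * f x \<partial>haar_borel d)" by (rule nn_integral_haar_borel[symmetric]) (use \<phi>m f in simp)
    finally show ?thesis .
  qed
  have int': "(\<integral>\<^sup>+x. f x \<partial>density (density (haar d) \<phi>) (indicator {0..})) = (\<integral>\<^sup>+x. Gp x * f x \<partial>haar_borel d)" if f: "f \<in> BM" for f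
  proof -
    have m: "g \<in> borel_measurable (density (haar d) \<phi>)" if "g \<in> BM" for g :: "real \<Rightarrow> ennreal"
      unfolding measurable_density_eq1 by (rule haar_measurable[OF that])
    have "(\<integral>\<^sup>+x. f x \<partial>density (density (haar d) \<phi>) (indicator {0..}))
        = (\<integral>\<^sup>+x. indicator {0..} x * f x \<partial>density (haar d) \<phi>)"
      by (rule nn_integral_density) (rule m, use f in simp)+
    also have "\<dots> = (\<integral>\<^sup>+x. \<phi> x * (indicator {0..} x * f x) \<partial>haar_borel d)" by (rule int) (use f in simp)
    also have "\<dots> = (\<integral>\<^sup>+x. Gp x * f x \<partial>haar_borel d)"
      by (rule nn_integral_cong) (use densities_eq_0(3,4) in \<open>auto simp: \<phi> indicator_def\<close>)
    finally show ?thesis .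
  qed
  show "unique_locally_finite_invariant_measure Zd (overshoot_kernel zero_crossing Pr Y) (density (haar d) \<phi>)"
    by (rule unique_zero[OF _ _ zero_crossing_kernel]) (simp_all add: sets_haar int \<phi>)
  show "unique_locally_finite_invariant_measure Zd (overshoot_kernel up_crossing Pr Y)
      (density (density (haar d) \<phi>) (indicator {0..}))"
    by (rule unique_up[OF _ _ up_crossing_kernel]) (simp_all add: sets_haar int')
qed

end

end

theorem theorem4:
  fixes M :: "'a measure" and X X' :: "nat \<Rightarrow> 'a \<Rightarrow> real"
    and Pr :: "real \<Rightarrow> 'b measure" and Y :: "nat \<Rightarrow> 'b \<Rightarrow> real"
  assumes "prob_space M"
    and "prob_space.indep_vars M (\<lambda>_. borel) (case_sum X X') ({1..} <+> {1..})"
    and "\<And>n. n \<ge> 1 \<Longrightarrow> distr M borel (X n) = distr M borel (X 1)"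
    and "\<And>n. n \<ge> 1 \<Longrightarrow> distr M borel (X' n) = distr M borel (X' 1)"
    and "\<not> (AE \<omega> in M. X 1 \<omega> = 0)"
    and "\<not> (AE \<omega> in M. X' 1 \<omega> = 0)"
    and "AE \<omega> in M. liminf (\<lambda>n. ereal (walk X n \<omega>)) = -\<infinity>"
    and "AE \<omega> in M. limsup (\<lambda>n. ereal (walk X' n \<omega>)) = \<infinity>"
    and "\<And>x. x \<in> lattice_set (lattice_span M (X 1) (X' 1)) \<Longrightarrow>
           markov_chain_from x (switching_kernel M (X 1) (X' 1)) (Pr x) Y"
  shows "unique_locally_finite_invariant_measure
           (lattice_set (lattice_span M (X 1) (X' 1)))
           (overshoot_kernel zero_crossing Pr Y)
           (overshoot_measure M X X')
       \<and> unique_locally_finite_invariant_measure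
           (lattice_set (lattice_span M (X 1) (X' 1)))
           (overshoot_kernel up_crossing Pr Y)
           (density (overshoot_measure M X X') (indicator {0..}))"
proof -
  interpret prob_space M by fact
  let ?Z = "case_sum X X'" and ?I = "{1..} <+> {1..} :: (nat + nat) set"
  \<comment> \<open>A weak ladder epoch is the first exit from an open half-line, hence the strict
    inequalities. The factors 1 and -1 match the sign \<open>s\<close> in
    \<open>ladder_height\<close>.\<close>
  let ?S = "{x. 0 < 1 * x} :: real set" and ?S' = "{x. 0 < -1 * x} :: real set"
  define D where "D = weak_descending_ladder_height X"
  define A where "A = weak_ascending_ladder_height X'"
  define \<mu> where "\<mu> = distr M borel (X 1)"
  define \<mu>' where "\<mu>' = distr M borel (X' 1)"
  define \<delta> where "\<delta> = distr M borel D"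
  define \<alpha> where "\<alpha> = distr M borel A"
  define d where "d = lattice_span M (X 1) (X' 1)"
  note ind = assms(2)
  have X: "X 1 \<in> borel_measurable M" and X': "X' 1 \<in> borel_measurable M"
    using ind unfolding indep_vars_def by (force dest!: conjunct1)+
  have \<mu>: "prob_space \<mu>" "sets \<mu> = sets borel" and \<mu>': "prob_space \<mu>'" "sets \<mu>' = sets borel"
    unfolding \<mu>_def \<mu>'_def using prob_space_distr X X' by auto
  have D: "D = (\<lambda>\<omega>. walk (\<lambda>k. ?Z (Inl k)) (first_exit ?S (\<lambda>k. walk (\<lambda>k. ?Z (Inl k)) k \<omega>)) \<omega>)"
    by (rule ext) (simp add: D_def weak_descending_ladder_height_def first_exit_def not_less)
  have A: "A = (\<lambda>\<omega>. walk (\<lambda>k. ?Z (Inr k)) (first_exit ?S' (\<lambda>k. walk (\<lambda>k. ?Z (Inr k)) k \<omega>)) \<omega>)"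
    by (rule ext) (simp add: A_def weak_ascending_ladder_height_def first_exit_def not_less)
  \<comment> \<open>The hypothesis yields a strictly negative value; besides a finite ladder time
    this gives nondegeneracy of the ladder height.\<close>
  have ex: "AE \<omega> in M. \<exists>k\<ge>1. 1 * walk (\<lambda>k. ?Z (Inl k)) k \<omega> < 0"
    using assms(7) by eventually_elim (drule liminf_minus_infty_neg, simp)
  have ex': "AE \<omega> in M. \<exists>k\<ge>1. -1 * walk (\<lambda>k. ?Z (Inr k)) k \<omega> < 0"
    using assms(8) by eventually_elim (drule limsup_infty_pos, simp)
  have inj: "inj (Inl :: nat \<Rightarrow> nat + nat)" "inj (Inr :: nat \<Rightarrow> nat + nat)" by simp_all
  have mem: "\<forall>k\<ge>1. Inl k \<in> ?I" "\<forall>k\<ge>1. Inr k \<in> ?I" by auto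
  have law: "\<forall>k\<ge>1. distr M borel (?Z (Inl k)) = \<mu>" "\<forall>k\<ge>1. distr M borel (?Z (Inr k)) = \<mu>'"
    unfolding \<mu>_def \<mu>'_def by (simp_all only: sum.case) (intro allI impI assms(3,4), assumption)+
  note LD = ladder_height[OF ind inj(1) mem(1) law(1) ex refl D, folded \<delta>_def]
  note LA = ladder_height[OF ind inj(2) mem(2) law(2) ex' refl A, folded \<alpha>_def]
  have \<delta>: "prob_space \<delta>" "sets \<delta> = sets borel" and \<alpha>: "prob_space \<alpha>" "sets \<alpha> = sets borel"
    unfolding \<delta>_def \<alpha>_def using prob_space_distr LD(1) LA(1) by auto
  have D0: "AE \<omega> in M. D \<omega> \<le> 0" and A0: "AE \<omega> in M. 0 \<le> A \<omega>" using LD(3) LA(3) by simp_all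
  note sp = lattice_span_props[OF X X' assms(5), folded d_def]
  have to_X: "(AE y in \<mu>. y \<in> lattice_set u) \<longleftrightarrow> (AE \<omega> in M. X 1 \<omega> \<in> lattice_set u)"
    "(AE y in \<mu>'. y \<in> lattice_set u) \<longleftrightarrow> (AE \<omega> in M. X' 1 \<omega> \<in> lattice_set u)" for u
    unfolding \<mu>_def \<mu>'_def by (simp_all add: AE_distr_iff[OF X] AE_distr_iff[OF X'])
  interpret ladder_pair_max \<delta> \<alpha> d
  proof (intro ladder_pair_max.intro ladder_pair.intro two_sided.intro ladder_pair_axioms.intro ladder_pair_max_axioms.intro)
    show "AE y in \<delta>. y \<le> 0" unfolding \<delta>_def using D0 by (subst AE_distr_iff[OF LD(1)]) auto
    show "AE y in \<alpha>. 0 \<le> y" unfolding \<alpha>_def using A0 by (subst AE_distr_iff[OF LA(1)]) auto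
    show "AE y in \<delta>. y \<in> lattice_set d"
      by (rule ladder_supported_on_lattice[OF \<delta>(2) \<mu> LD(2)]) (use sp(2) to_X in auto)
    show "AE y in \<alpha>. y \<in> lattice_set d"
      by (rule ladder_supported_on_lattice[OF \<alpha>(2) \<mu>' LA(2)]) (use sp(3) to_X in auto)
    fix g :: real
    \<comment> \<open>A lattice that carries the ladder laws carries the increments too, so
      maximality of the span applies to it.\<close>
    assume g: "0 < g" "AE y in \<delta>. y \<in> lattice_set g" "AE y in \<alpha>. y \<in> lattice_set g"
    have "AE y in \<mu>. y \<in> lattice_set g" by (rule increments_supported_on_lattice[OF \<delta>(2) \<mu> LD(2) LD(4) g(2)])
    moreover have "AE y in \<mu>'. y \<in> lattice_set g" by (rule increments_supported_on_lattice[OF \<alpha>(2) \<mu>' LA(2) LA(4) g(3)])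
    ultimately show "g \<le> d" using sp(4)[OF g(1)] to_X by simp
  qed (rule \<delta> \<alpha> LD(5) LA(5) sp(1))+
  note [measurable] = LD(1) LA(1)
  have indDA: "indep_var borel D borel A"
    unfolding D A by (rule ladder_indep[OF ind]) auto
  \<comment> \<open>Independence of the two ladder heights turns the iterated integrals in
    \<open>Gp\<close> and \<open>Gm\<close> into probabilities of joint events.\<close>
  have \<phi>: "ennreal (overshoot_density M D A w) = Gp w + Gm w" for w
  proof -
    have "Gp w = (\<integral>\<^sup>+\<omega>. (if 0 \<le> w \<and> w < A \<omega> \<and> D \<omega> + A \<omega> \<le> w then 1 else 0) \<partial>M)"
      unfolding Gp_def unfolding \<delta>_def \<alpha>_def by (rule nn_integral_indep_pair[OF indDA]) measurable
    moreover have "Gm w = (\<integral>\<^sup>+\<omega>. (if w < 0 \<and> D \<omega> \<le> w \<and> w < D \<omega> + A \<omega> then 1 else 0) \<partial>M)"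
      unfolding Gm_def unfolding \<delta>_def \<alpha>_def by (rule nn_integral_indep_pair[OF indDA]) measurable
    ultimately show ?thesis using overshoot_density_eq[OF LD(1) LA(1) D0 A0, of w] by (simp only:)
  qed
  have \<kappa>: "switching_kernel M (X 1) (X' 1) x = (if 0 \<le> x then conv \<mu> x else conv \<mu>' x)" for x
    using X X' by (simp add: switching_kernel_def conv_def \<mu>_def \<mu>'_def distr_distr comp_def)
  have \<pi>: "overshoot_measure M X X' = density (haar d) (\<lambda>w. ennreal (overshoot_density M D A w))"
    by (simp add: overshoot_measure_def d_def D_def A_def)
  show ?thesis
    unfolding \<pi> d_def[symmetric]
    by (intro conjI overshoot_chains_unique[OF \<mu> \<mu>' LD(2) LA(2) \<kappa> assms(9)[folded d_def] \<phi>])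
qed

end
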